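(* Let $g\in\mathbb N_{\ge1}$ and $n\in g\mathbb Z$. 1) The Verma module $M^{h,h'}(n,g)$ of $U_{h,h'}(\mathfrak{sl}_2,g)$ is a deformation along $h'$ of the Verma module $M^h(n)$ of $U_h(\mathfrak{sl}_2)$: $\lim_{h'\to0}M^{h,h'}(n,g)=M^h(n)$. 2) The specialization $M^{\varepsilon,h'}(n,g)$ at $Q=\varepsilon$ of $M^{h,h'}(n,g)$ is a weight $U_{\varepsilon,h'}(\mathfrak{sl}_2,g)$-module. 3) $M^{\varepsilon,h'}(n,g)$ contains the representation ${}^L\!M^{h'}(n,g)$ of $U_{gh'}(\mathfrak{sl}_2)$, Langlands $g$-dual of $M^h(n)$, as the sum of the weight spaces whose weight is divisible by $g$. 4) If $g$ is even, ${}^L\!M^{h'}(n,g)\simeq M^{gh'}\!\left(\frac ng\right)\oplus M^{gh'}\!\left(\frac ng-1\right)$. 5) If $g$ is odd, ${}^L\!M^{h'}(n,g)\simeq M^{gh'}\!\left(\frac ng\right)$.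
   Context: $\mathbb N=\{0,1,2,\dots\}$. For a vector space $V$, $V[[\bar h]]$ is the space of formal power series in the parameters $\bar h$ with coefficients in $V$. The $\mathbb C[[\bar h]]$-algebra topologically generated by a set $X$ with relations $\mathcal R$ is $\mathbb C\langle X\rangle[[\bar h]]$ modulo the $\bar h$-adic closure of the two-sided ideal generated by $\mathcal R$. Definition of $U_{h,h'}(\mathfrak{sl}_2,g)$. Let $\varepsilon=\exp(i\pi/g)$, $Q=\exp(h)$, $T=\exp(h')$, $$P(u)=\tfrac12\left(u^{g-1}+u^{1-g}\right)\prod_{k=1}^{g-1}\frac{\varepsilon^k u-\varepsilon^{-k}u^{-1}}{\varepsilon^k-\varepsilon^{-k}}.$$ $U_{h,h'}(\mathfrak{sl}_2,g)$ is the $\mathbb C[[h,h']]$-algebra topologically generated by $X^+,X^-,H,C$ with relations $[C,X^\pm]=[C,H]=0$, $[H,X^\pm]=\pm2X^\pm$, $$X^\pm X^\mp=\prod_{e=1,-1}\frac{\left(Q\,T^{\{H_e^\pm\}_Q}\right)^{H_e^\pm}-\left(Q\,T^{\{H_e^\pm\}_Q}\right)^{-H_e^\pm}}{Q\,T^{\{H_e^\pm\}_Q}-Q^{-1}T^{-\{H_e^\pm\}_Q}},$$ where $H_e^\pm=\frac12(\sqrt C+eH\mp e)$, $\{H_e^\pm\}_Q=P(Q^{H_e^\pm})$. Numerator and denominator are series in $\mathbb C[H,\sqrt C][[h,h']]$, each divided by $h+h'\{H_e^\pm\}_Q$ before the quotient is taken; the product over $e$ is invariant under $\sqrt C\mapsto-\sqrt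 C$, and $(\sqrt C)^2$ is replaced by $C$. Similarly $Q^{\sqrt C}+Q^{-\sqrt C}$ is an element of the algebra. $U_h(\mathfrak{sl}_2)$ is the $\mathbb C[[h]]$-algebra topologically generated by $\tilde X^\pm,\tilde H$ with $[\tilde H,\tilde X^\pm]=\pm2\tilde X^\pm$, $[\tilde X^+,\tilde X^-]=\sinh(h\tilde H)/\sinh(h)$. $U_{gh'}(\mathfrak{sl}_2)$ is the $\mathbb C[[h']]$-algebra topologically generated by $\tilde X^\pm,\tilde H$ with $[\tilde H,\tilde X^\pm]=\pm2\tilde X^\pm$, $[\tilde X^+,\tilde X^-]=\sinh(gh'\tilde H)/\sinh(gh')$. One has $U_{h,h'}(\mathfrak{sl}_2,g)/(h'=0)\simeq U_h(\mathfrak{sl}_2)$ via $X^\pm\leftrightarrow\tilde X^\pm$, $H\leftrightarrow\tilde H$. Representations. A representation of one of these algebras over $\mathbb C[[\bar h]]$ is an action by $\mathbb C[[\bar h]]$-linear operators on $V[[\bar h]]$ for a vector space $V$. A representation of $U_{h,h'}(\mathfrak{sl}_2,g)$ on $V[[h,h']]$ is a deformation along $h'$ of the representation of $U_h(\mathfrak{sl}_2)$ on $V[[h]]$ that it induces modulo $h'$; the latter is its limit $\lim_{h'\to0}$. Put $[a]_q=\frac{q^a-q^{-a}}{q-q^{-1}}$ and $\{a\}=P(Q^a)$ for $a\in\mathbb Z$. Verma modules ($n\in\mathbb Z$). With $U^{h,h'}=U_{h,h'}(\mathfrak{sl}_2,g)$, $M^{h,h'}(n,g)=U^{h,h'}/\big(U^{h,h'}X^++U^{h,h'}(H-n1)\big)$;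 with $m_j$ the class of $(X^-)^j$ it is $\big(\bigoplus_{j\in\mathbb N}\mathbb C m_j\big)[[h,h']]$ with $Hm_j=(n-2j)m_j$, $Cm_j=(n+1)^2m_j$, $X^-m_j=m_{j+1}$, $X^+m_j=[j]_{QT^{\{j\}}}[n-j+1]_{QT^{\{n-j+1\}}}m_{j-1}$ ($m_{-1}=0$). With $U^h=U_h(\mathfrak{sl}_2)$, $M^h(n)=U^h/\big(U^h\tilde X^++U^h(\tilde H-n1)\big)=\big(\bigoplus_{j\in\mathbb N}\mathbb C m_j\big)[[h]]$ with $\tilde Hm_j=(n-2j)m_j$, $\tilde X^-m_j=m_{j+1}$, $\tilde X^+m_j=[j]_Q[n-j+1]_Qm_{j-1}$. $M^{gh'}(n)$ is the representation of $U_{gh'}(\mathfrak{sl}_2)$ given by the same formulas with $h$ replaced by $gh'$ (i.e. $Q$ replaced by $T^g$). Specialization. $\mathcal A=\mathbb C[Q^{\pm1}]\subset\mathbb C[[h]]$. $U_{\mathcal A,h'}(\mathfrak{sl}_2,g)$ is the sub-$\mathcal A[[h']]$-algebra of $U_{h,h'}(\mathfrak{sl}_2,g)$ topologically generated ($h'$-adically) by $C,H,X^\pm,Q^{\pm H},Q^{\sqrt C}+Q^{-\sqrt C}$, and $U_{\varepsilon,h'}(\mathfrak{sl}_2,g)=U_{\mathcal A,h'}(\mathfrak{sl}_2,g)/\overline{(Q=\varepsilon)}^{\,h'}$ (closure in the $h'$-adic topology). $M^{\mathcal A,h'}(n,g)=\big(\bigoplus_{j\in\mathbb N}\mathcal A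 m_j\big)[[h']]\subset M^{h,h'}(n,g)$ is stable under $U_{\mathcal A,h'}(\mathfrak{sl}_2,g)$, and $M^{\varepsilon,h'}(n,g)=M^{\mathcal A,h'}(n,g)/\overline{(Q-\varepsilon)M^{\mathcal A,h'}(n,g)}^{\,h'}\simeq\big(\bigoplus_{j\in\mathbb N}\mathbb C m_j\big)[[h']]$, a $U_{\varepsilon,h'}(\mathfrak{sl}_2,g)$-module. A $U_{\varepsilon,h'}(\mathfrak{sl}_2,g)$-module $V$ is a weight module if it is the direct sum of its weight spaces $V_m=\{f:Hf=mf\}$, $m\in\mathbb Z$. Direct sums and sums of infinitely many weight spaces are understood $h'$-adically completed. Langlands $g$-dual. For $n\in g\mathbb Z$, ${}^L\!M^{h'}(n,g)$ is the sum of the weight spaces of $M^{\varepsilon,h'}(n,g)$ whose weight is divisible by $g$; explicitly it is $\big(\bigoplus_{j\in\mathbb N}\mathbb C m_{g'j}\big)[[h']]$ with $g'=g/2$ if $g$ is even and $g'=g$ if $g$ is odd. It is regarded as a representation of $U_{gh'}(\mathfrak{sl}_2)$ by letting $\tilde X^\pm,\tilde H$ act as ${}^L\!X^\pm,{}^L\!H$ (operators on its localization at $h'$ which preserve it), where $${}^L\!X^+=([g-1]^!_\varepsilon)^{-2}(\varepsilon T-\varepsilon^{-1}T^{-1})^2(T^g-T^{-g})^{-2}(X^+)^g,\quad {}^L\!X^-=(X^-)^g,\quad {}^L\!H=H/g,$$ and $[g-1]^!_\varepsilon=\prod_{k=1}^{g-1}\frac{\varepsilon^k-\varepsilon^{-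k}}{\varepsilon-\varepsilon^{-1}}$.
   Formalization: The operator ^L X^+ carries an extra factor (-1)^{n+g}. It is 1 if g is even or n/g is odd; for g odd and n/g even the uncorrected operators violate the relation of U_{gh'}(sl_2) (e.g. g=1, n=0), so 3) and 5) fail as literally stated. *)

theory Defs
  imports
    Complex_Main
    "HOL-Library.Poly_Mapping"
    "HOL-Computational_Algebra.Formal_Laurent_Series"
    "HOL-Computational_Algebra.Polynomial"
    "HOL-Algebra.Module"
    "HOL-Algebra.QuotRing"
    "HOL-Algebra.Generated_Rings"
begin

section \<open>Complex algebras, free algebras, power series\<close>

text \<open>Unital complex algebras; \<open>cst\<close> is the structure map.\<close>

class complex_alg = ring_1 +
  fixes cst :: "complex \<Rightarrow> 'a"
  assumes cst_one: "cst 1 = 1"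
    and cst_add: "cst (a + b) = cst a + cst b"
    and cst_mult: "cst (a * b) = cst a * cst b"
    and cst_central: "cst a * x = x * cst a"

instantiation complex :: complex_alg
begin
definition cst_complex :: "complex \<Rightarrow> complex" where "cst_complex c = c"
instance by standard (auto simp: cst_complex_def)
end

instantiation poly :: ("{comm_ring_1,complex_alg}") complex_alg
begin
definition cst_poly :: "complex \<Rightarrow> 'a poly" where "cst_poly c = [:cst c:]"
instance by standard (auto simp: cst_poly_def cst_one cst_add cst_mult mult.commute)
end

instantiation fps :: (complex_alg) complex_alg
begin
definition cst_fps :: "complex \<Rightarrow> 'a fps" where "cst_fps c = fps_const (cst c)"
instance
proof
  fix a b :: complex and x :: "'a fps"
  show "cst a * x = x * cst a"
    by (simp add: cst_fps_def fps_eq_iff cst_central)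
qed (simp_all add: cst_fps_def cst_one cst_add cst_mult)
end

text \<open>Words form a monoid under concatenation, so that \<open>'x list \<Rightarrow>\<^sub>0 complex\<close> is the free
  unital complex algebra on the generators \<open>'x\<close>.\<close>

instantiation list :: (type) monoid_add
begin
definition zero_list :: "'a list" where "zero_list = []"
definition plus_list :: "'a list \<Rightarrow> 'a list \<Rightarrow> 'a list" where "plus_list = (@)"
instance by standard (auto simp: zero_list_def plus_list_def)
end

type_synonym 'x free = "'x list \<Rightarrow>\<^sub>0 complex"

instantiation poly_mapping :: (monoid_add, complex_alg) complex_alg
begin
definition cst_poly_mapping :: "complex \<Rightarrow> ('a \<Rightarrow>\<^sub>0 'b)"
  where "cst_poly_mapping c = Poly_Mapping.single 0 (cst c)"
instance
proof
  fix a b :: complex and x :: "'a \<Rightarrow>\<^sub>0 'b"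
  show "cst a * x = x * cst a"
  proof (induction x rule: update_induct)
    case (update f k v)
    have "Poly_Mapping.update k v f = f + Poly_Mapping.single k v"
      using update.hyps(1)
      by (intro poly_mapping_eqI)
        (auto simp: Poly_Mapping.lookup_update lookup_add lookup_single when_def in_keys_iff)
    then show ?case
      using update.IH
      by (simp add: cst_poly_mapping_def distrib_left distrib_right mult_single cst_central)
  qed simp
qed (simp_all add: cst_poly_mapping_def cst_one cst_add cst_mult single_add mult_single)
end

definition gen :: "'x \<Rightarrow> 'x free"
  where "gen x = Poly_Mapping.single [x] 1"

text \<open>A series in two parameters is an element of \<open>'a fps fps\<close>: the outer variable is \<open>h'\<close>, the
  inner variable is \<open>h\<close>.\<close>

definition map_fps :: "('a::zero \<Rightarrow> 'b::zero) \<Rightarrow> 'a fps \<Rightarrow> 'b fps"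
  where "map_fps f a = Abs_fps (\<lambda>k. f (fps_nth a k))"

text \<open>\<open>fexp x\<close> is \<open>exp (t * x)\<close>, with \<open>t\<close> the (outer) variable.\<close>

definition fexp :: "'a::complex_alg \<Rightarrow> 'a fps"
  where "fexp x = Abs_fps (\<lambda>k. cst (1 / fact k) * x ^ k)"

definition exact_quot :: "'a::idom \<Rightarrow> 'a \<Rightarrow> 'a"
  where "exact_quot a b = (THE c. a = c * b)"

section \<open>Rings, left modules, adic topologies\<close>

definition type_ring :: "'a::ring_1 ring"
  where "type_ring = \<lparr>carrier = UNIV, mult = (*), one = 1, zero = 0, add = (+)\<rparr>"

text \<open>Left modules over a not necessarily commutative ring. The ring operations that the record
  \<open>module\<close> inherits for \<open>M\<close> (\<open>mult\<close> and \<open>one\<close>) play no role.\<close>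

locale left_module = R?: ring R + M?: abelian_group M
  for R :: "('a, 'c) ring_scheme" (structure) and M :: "('a, 'b, 'd) module_scheme" (structure) +
  assumes smult_closed:
      "\<lbrakk>a \<in> carrier R; x \<in> carrier M\<rbrakk> \<Longrightarrow> a \<odot>\<^bsub>M\<^esub> x \<in> carrier M"
    and smult_l_distr:
      "\<lbrakk>a \<in> carrier R; b \<in> carrier R; x \<in> carrier M\<rbrakk> \<Longrightarrow>
       (a \<oplus>\<^bsub>R\<^esub> b) \<odot>\<^bsub>M\<^esub> x = a \<odot>\<^bsub>M\<^esub> x \<oplus>\<^bsub>M\<^esub> b \<odot>\<^bsub>M\<^esub> x"
    and smult_r_distr:
      "\<lbrakk>a \<in> carrier R; x \<in> carrier M; y \<in> carrier M\<rbrakk> \<Longrightarrow>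
       a \<odot>\<^bsub>M\<^esub> (x \<oplus>\<^bsub>M\<^esub> y) = a \<odot>\<^bsub>M\<^esub> x \<oplus>\<^bsub>M\<^esub> a \<odot>\<^bsub>M\<^esub> y"
    and smult_assoc:
      "\<lbrakk>a \<in> carrier R; b \<in> carrier R; x \<in> carrier M\<rbrakk> \<Longrightarrow>
       (a \<otimes>\<^bsub>R\<^esub> b) \<odot>\<^bsub>M\<^esub> x = a \<odot>\<^bsub>M\<^esub> (b \<odot>\<^bsub>M\<^esub> x)"
    and smult_one:
      "x \<in> carrier M \<Longrightarrow> \<one>\<^bsub>R\<^esub> \<odot>\<^bsub>M\<^esub> x = x"

definition regular_module :: "('a, 'c) ring_scheme \<Rightarrow> ('a, 'a) module"
  where "regular_module R = \<lparr>carrier = carrier R, mult = mult R, one = one R,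
    zero = zero R, add = add R, smult = mult R\<rparr>"

definition quot_module :: "('a, 'b, 'c) module_scheme \<Rightarrow> 'b set \<Rightarrow> ('a, 'b set) module"
  where "quot_module M N = \<lparr>carrier = a_rcosets\<^bsub>M\<^esub> N, mult = (\<lambda>X Y. N), one = N,
    zero = N, add = set_add M, smult = (\<lambda>a X. \<Union>x\<in>X. N +>\<^bsub>M\<^esub> (a \<odot>\<^bsub>M\<^esub> x))\<rparr>"

definition with_smult :: "('r \<Rightarrow> 'b \<Rightarrow> 'b) \<Rightarrow> ('a, 'b, 'c) module_scheme \<Rightarrow> ('r, 'b) module"
  where "with_smult act M = \<lparr>carrier = carrier M, mult = mult M, one = one M,
    zero = zero M, add = add M, smult = act\<rparr>"

definition direct_sum_module ::
    "('a, 'b, 'c) module_scheme \<Rightarrow> ('a, 'd, 'e) module_scheme \<Rightarrow> ('a, 'b \<times> 'd) module"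
  where "direct_sum_module M N = \<lparr>carrier = carrier M \<times> carrier N,
    mult = (\<lambda>(x, y) (x', y'). (x \<otimes>\<^bsub>M\<^esub> x', y \<otimes>\<^bsub>N\<^esub> y')), one = (\<one>\<^bsub>M\<^esub>, \<one>\<^bsub>N\<^esub>), zero = (\<zero>\<^bsub>M\<^esub>, \<zero>\<^bsub>N\<^esub>),
    add = (\<lambda>(x, y) (x', y'). (x \<oplus>\<^bsub>M\<^esub> x', y \<oplus>\<^bsub>N\<^esub> y')),
    smult = (\<lambda>a (x, y). (a \<odot>\<^bsub>M\<^esub> x, a \<odot>\<^bsub>N\<^esub> y))\<rparr>"

definition module_iso ::
    "('a, 'c) ring_scheme \<Rightarrow> ('a, 'b, 'd) module_scheme \<Rightarrow> ('a, 'e, 'f) module_scheme \<Rightarrow> bool"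
  where "module_iso R M N \<longleftrightarrow> (\<exists>\<phi>. bij_betw \<phi> (carrier M) (carrier N) \<and>
    (\<forall>x\<in>carrier M. \<forall>y\<in>carrier M. \<phi> (x \<oplus>\<^bsub>M\<^esub> y) = \<phi> x \<oplus>\<^bsub>N\<^esub> \<phi> y) \<and>
    (\<forall>a\<in>carrier R. \<forall>x\<in>carrier M. \<phi> (a \<odot>\<^bsub>M\<^esub> x) = a \<odot>\<^bsub>N\<^esub> \<phi> x))"

text \<open>Closure of \<open>S\<close> in the \<open>t\<close>-adic topology of the \<open>R\<close>-module \<open>M\<close>.\<close>

definition adic_closure ::
    "('a, 'c) ring_scheme \<Rightarrow> 'a \<Rightarrow> ('a, 'b, 'd) module_scheme \<Rightarrow> 'b set \<Rightarrow> 'b set"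
  where "adic_closure R t M S = {x \<in> carrier M. \<forall>N::nat. \<exists>s\<in>S. \<exists>y\<in>carrier M.
    x = s \<oplus>\<^bsub>M\<^esub> (t [^]\<^bsub>R\<^esub> N) \<odot>\<^bsub>M\<^esub> y}"

text \<open>Convergence of a family of vectors indexed by the weights, in the \<open>t\<close>-adic topology.\<close>

definition adic_sums ::
    "('a, 'c) ring_scheme \<Rightarrow> 'a \<Rightarrow> ('a, 'b, 'd) module_scheme \<Rightarrow> (int \<Rightarrow> 'b) \<Rightarrow> 'b \<Rightarrow> bool"
  where "adic_sums R t M f x \<longleftrightarrow> (\<forall>N::nat. \<exists>F. finite F \<and> (\<forall>F'. finite F' \<and> F \<subseteq> F' \<longrightarrow>
    (\<exists>y\<in>carrier M. x = finsum M f F' \<oplus>\<^bsub>M\<^esub> (t [^]\<^bsub>R\<^esub> N) \<odot>\<^bsub>M\<^esub> y)))"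

definition adic_null ::
    "('a, 'c) ring_scheme \<Rightarrow> 'a \<Rightarrow> ('a, 'b, 'd) module_scheme \<Rightarrow> (int \<Rightarrow> 'b) \<Rightarrow> bool"
  where "adic_null R t M f \<longleftrightarrow>
    (\<forall>N::nat. finite {m. f m \<notin> (\<lambda>y. (t [^]\<^bsub>R\<^esub> N) \<odot>\<^bsub>M\<^esub> y) ` carrier M})"

definition weight_space :: "'a \<Rightarrow> ('a, 'b, 'd) module_scheme \<Rightarrow> int \<Rightarrow> 'b set"
  where "weight_space H M m = {x \<in> carrier M. H \<odot>\<^bsub>M\<^esub> x = [m] \<cdot>\<^bsub>M\<^esub> x}"

text \<open>\<open>M\<close> is the \<open>t\<close>-adically completed direct sum of its weight spaces.\<close>

definition weight_module ::
    "('a, 'c) ring_scheme \<Rightarrow> 'a \<Rightarrow> 'a \<Rightarrow> ('a, 'b, 'd) module_scheme \<Rightarrow> bool"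
  where "weight_module R t H M \<longleftrightarrow> left_module R M \<and>
    (\<forall>x\<in>carrier M. \<exists>!f. (\<forall>m. f m \<in> weight_space H M m) \<and> adic_null R t M f \<and> adic_sums R t M f x) \<and>
    (\<forall>f. (\<forall>m. f m \<in> weight_space H M m) \<and> adic_null R t M f \<longrightarrow>
       (\<exists>!x. x \<in> carrier M \<and> adic_sums R t M f x))"

definition weight_sum ::
    "('a, 'c) ring_scheme \<Rightarrow> 'a \<Rightarrow> 'a \<Rightarrow> ('a, 'b, 'd) module_scheme \<Rightarrow> int set \<Rightarrow> 'b set"
  where "weight_sum R t H M I = {x \<in> carrier M. \<exists>f.
    (\<forall>m\<in>I. f m \<in> weight_space H M m) \<and> (\<forall>m. m \<notin> I \<longrightarrow> f m = \<zero>\<^bsub>M\<^esub>) \<and>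
    adic_null R t M f \<and> adic_sums R t M f x}"

text \<open>Equality \<open>a x = y\<close> in the localization \<open>M[1/t]\<close>, for a Laurent series \<open>a\<close> in \<open>t\<close> and
  \<open>x, y \<in> M\<close>; \<open>\<iota>\<close> maps power series in \<open>t\<close> to scalars. With \<open>p = t\<^sup>k a\<close> a power series, it says that
  the fractions \<open>p x / t\<^sup>k\<close> and \<open>y / 1\<close> agree.\<close>

definition loc_eq ::
    "(complex fps \<Rightarrow> 'a) \<Rightarrow> ('a, 'b, 'd) module_scheme \<Rightarrow> complex fls \<Rightarrow> 'b \<Rightarrow> 'b \<Rightarrow> bool"
  where "loc_eq \<iota> M a x y \<longleftrightarrow> (\<exists>k N p. fls_X ^ k * a = fps_to_fls p \<and>
    \<iota> (fps_X ^ N) \<odot>\<^bsub>M\<^esub> (\<iota> p \<odot>\<^bsub>M\<^esub> x) = \<iota> (fps_X ^ (N + k)) \<odot>\<^bsub>M\<^esub> y)"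

section \<open>Representations over rings of formal power series\<close>

text \<open>Extension of a scalar multiplication from \<open>V\<close> over \<open>K\<close> to \<open>V[[h]]\<close> over \<open>K[[h]]\<close>.\<close>

definition fps_scale ::
    "('k \<Rightarrow> 'v \<Rightarrow> 'v) \<Rightarrow> 'k fps \<Rightarrow> 'v::comm_monoid_add fps \<Rightarrow> 'v fps"
  where "fps_scale s c v = Abs_fps (\<lambda>k. \<Sum>i\<le>k. s (fps_nth c i) (fps_nth v (k - i)))"

text \<open>\<open>M\<close> is an \<open>R\<close>-module whose underlying module over the power series ring \<open>K\<close> (acting through
  \<open>\<iota>\<close>) is, up to isomorphism, the type \<open>'w\<close> of power series with scalar multiplication \<open>sc\<close>.\<close>

definition rep_on ::
    "('a, 'c) ring_scheme \<Rightarrow> ('k \<Rightarrow> 'a) \<Rightarrow> ('k \<Rightarrow> 'w::ab_group_add \<Rightarrow> 'w) \<Rightarrow>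
     ('a, 'b, 'd) module_scheme \<Rightarrow> bool"
  where "rep_on R \<iota> sc M \<longleftrightarrow> left_module R M \<and>
    (\<exists>\<phi>. bij_betw \<phi> (carrier M) (UNIV :: 'w set) \<and>
      (\<forall>x\<in>carrier M. \<forall>y\<in>carrier M. \<phi> (x \<oplus>\<^bsub>M\<^esub> y) = \<phi> x + \<phi> y) \<and>
      (\<forall>c. \<forall>x\<in>carrier M. \<phi> (\<iota> c \<odot>\<^bsub>M\<^esub> x) = sc c (\<phi> x)))"

text \<open>The vector space \<open>\<Oplus>\<^sub>j \<complex> m\<^sub>j\<close>, \<open>j \<in> \<nat>\<close>, is the type \<open>nat \<Rightarrow>\<^sub>0 complex\<close>.\<close>

definition scale_sum :: "complex \<Rightarrow> (nat \<Rightarrow>\<^sub>0 complex) \<Rightarrow> (nat \<Rightarrow>\<^sub>0 complex)"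
  where "scale_sum c = Poly_Mapping.map ((*) c)"

definition verma :: "('a, 'c) ring_scheme \<Rightarrow> 'a \<Rightarrow> 'a \<Rightarrow> ('a, 'a set) module"
  where "verma R x y = quot_module (regular_module R)
    {u \<otimes>\<^bsub>R\<^esub> x \<oplus>\<^bsub>R\<^esub> v \<otimes>\<^bsub>R\<^esub> y | u v. u \<in> carrier R \<and> v \<in> carrier R}"

section \<open>The algebras \<open>U\<^sub>c\<^sub>h(sl\<^sub>2)\<close>\<close>

datatype sl2_gen = Xp | Xm | Hg

definition gen1 :: "'x \<Rightarrow> 'x free fps"
  where "gen1 x = fps_const (gen x)"

definition subst_H :: "complex poly \<Rightarrow> sl2_gen free"
  where "subst_H p = (\<Sum>i\<le>Polynomial.degree p. cst (Polynomial.coeff p i) * gen Hg ^ i)"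

definition formal_sinh :: "'a::complex_alg \<Rightarrow> 'a fps"
  where "formal_sinh x = cst (1 / 2) * (fexp x - fexp (- x))"

text \<open>\<open>sinh (c h H) / sinh (c h)\<close>, first as a series with coefficients in \<open>\<complex>[H]\<close>.\<close>

definition sinh_quot :: "nat \<Rightarrow> sl2_gen free fps"
  where "sinh_quot c = map_fps subst_H
    (exact_quot (formal_sinh (of_nat c * [:0, 1:])) (formal_sinh (of_nat c)))"

definition Uq_rels :: "nat \<Rightarrow> sl2_gen free fps set"
  where "Uq_rels c =
    {gen1 Hg * gen1 Xp - gen1 Xp * gen1 Hg - 2 * gen1 Xp,
     gen1 Hg * gen1 Xm - gen1 Xm * gen1 Hg + 2 * gen1 Xm,
     gen1 Xp * gen1 Xm - gen1 Xm * gen1 Xp - sinh_quot c}"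

definition Uq_ideal :: "nat \<Rightarrow> sl2_gen free fps set"
  where "Uq_ideal c = adic_closure type_ring fps_X (regular_module type_ring)
    (Idl\<^bsub>type_ring\<^esub> (Uq_rels c))"

text \<open>\<open>Uq 1\<close> is \<open>U\<^sub>h(sl\<^sub>2)\<close>; \<open>Uq g\<close> is \<open>U\<^sub>g\<^sub>h\<^sub>'(sl\<^sub>2)\<close>, with \<open>h'\<close> the variable.\<close>

definition Uq :: "nat \<Rightarrow> sl2_gen free fps set ring"
  where "Uq c = type_ring Quot (Uq_ideal c)"

definition Uq_cls :: "nat \<Rightarrow> sl2_gen free fps \<Rightarrow> sl2_gen free fps set"
  where "Uq_cls c f = Uq_ideal c +>\<^bsub>type_ring\<^esub> f"

definition Uq_scal :: "nat \<Rightarrow> complex fps \<Rightarrow> sl2_gen free fps set"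
  where "Uq_scal c a = Uq_cls c (map_fps cst a)"

text \<open>\<open>Mq 1 n\<close> is \<open>M\<^sup>h(n)\<close>; \<open>Mq g n\<close> is \<open>M\<^sup>g\<^sup>h\<^sup>'(n)\<close>.\<close>

definition Mq :: "nat \<Rightarrow> int \<Rightarrow> (sl2_gen free fps set, sl2_gen free fps set set) module"
  where "Mq c n = verma (Uq c) (Uq_cls c (gen1 Xp)) (Uq_cls c (gen1 Hg - of_int n))"

section \<open>The algebra \<open>U\<^sub>h\<^sub>,\<^sub>h\<^sub>'(sl\<^sub>2, g)\<close>\<close>

definition root_eps :: "nat \<Rightarrow> complex"
  where "root_eps g = exp (\<i> * of_real pi / of_nat g)"

text \<open>\<open>P_fun g u v\<close> is \<open>P(u)\<close>, with \<open>v\<close> the inverse of \<open>u\<close>.\<close>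

definition P_fun :: "nat \<Rightarrow> 'a::{comm_ring_1,complex_alg} \<Rightarrow> 'a \<Rightarrow> 'a"
  where "P_fun g u v = cst (1 / 2) * (u ^ (g - 1) + v ^ (g - 1)) *
    (\<Prod>k = 1..g - 1. let \<epsilon> = root_eps g in
       cst (inverse (\<epsilon> ^ k - inverse \<epsilon> ^ k)) * (cst (\<epsilon> ^ k) * u - cst (inverse \<epsilon> ^ k) * v))"

text \<open>The ring \<open>\<complex>[H, \<surd>C]\<close>: the outer polynomial variable is \<open>\<surd>C\<close>, the inner one is \<open>H\<close>.\<close>

type_synonym HC = "complex poly poly"

definition brace_Q :: "nat \<Rightarrow> HC \<Rightarrow> HC fps"
  where "brace_Q g y = P_fun g (fexp y) (fexp (- y))"

text \<open>\<open>QT_pow x y\<close> is \<open>(Q T\<^sup>x)\<^sup>y = exp(h y) exp(h' x y)\<close>.\<close>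

definition QT_pow :: "HC fps \<Rightarrow> HC \<Rightarrow> HC fps fps"
  where "QT_pow x y = fps_const (fexp y) * fexp (x * fps_const y)"

definition QT_number :: "nat \<Rightarrow> HC \<Rightarrow> HC fps fps"
  where "QT_number g y = (let x = brace_Q g y; w = fps_const fps_X + fps_X * fps_const x in
    exact_quot (exact_quot (QT_pow x y - QT_pow x (- y)) w)
               (exact_quot (QT_pow x 1 - QT_pow x (- 1)) w))"

text \<open>\<open>H_half \<sigma> e\<close> is \<open>H\<^sub>e\<^sup>\<sigma> = (\<surd>C + e H - \<sigma> e) / 2\<close>, where \<open>\<sigma> = 1\<close> stands for \<open>+\<close> and \<open>\<sigma> = -1\<close> for \<open>-\<close>.\<close>

definition H_half :: "int \<Rightarrow> int \<Rightarrow> HC"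
  where "H_half \<sigma> e = cst (1 / 2) * ([:0, 1:] + of_int e * [:[:0, 1:]:] - of_int (\<sigma> * e))"

text \<open>The right-hand side of the relation for \<open>X\<^sup>\<sigma> X\<^sup>-\<^sup>\<sigma>\<close> as a series with coefficients in
  \<open>\<complex>[H, C]\<close> (outer polynomial variable \<open>C\<close>): the series that gives back the product when
  \<open>(\<surd>C)\<^sup>2\<close> is put for \<open>C\<close>.\<close>

definition XX_series :: "nat \<Rightarrow> int \<Rightarrow> HC fps fps"
  where "XX_series g \<sigma> = (THE G. map_fps (map_fps (\<lambda>p. p \<circ>\<^sub>p [:0, 0, 1:])) G =
    (\<Prod>e\<in>{1, -1}. QT_number g (H_half \<sigma> e)))"

datatype int_gen = Sl2 sl2_gen | Cas

definition gen2 :: "int_gen \<Rightarrow> int_gen free fps fps"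
  where "gen2 x = fps_const (fps_const (gen x))"

definition subst_HC :: "HC \<Rightarrow> int_gen free"
  where "subst_HC p = (\<Sum>j\<le>Polynomial.degree p. \<Sum>i\<le>Polynomial.degree (Polynomial.coeff p j).
    cst (Polynomial.coeff (Polynomial.coeff p j) i) * gen Cas ^ j * gen (Sl2 Hg) ^ i)"

definition Uhh_rels :: "nat \<Rightarrow> int_gen free fps fps set"
  where "Uhh_rels g = (let xp = gen2 (Sl2 Xp); xm = gen2 (Sl2 Xm); H = gen2 (Sl2 Hg); C = gen2 Cas in
    {C * xp - xp * C, C * xm - xm * C, C * H - H * C,
     H * xp - xp * H - 2 * xp, H * xm - xm * H + 2 * xm,
     xp * xm - map_fps (map_fps subst_HC) (XX_series g 1),
     xm * xp - map_fps (map_fps subst_HC) (XX_series g (- 1))})"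

text \<open>Closure in the \<open>(h, h')\<close>-adic topology.\<close>

definition closure_hh :: "'a fps fps set \<Rightarrow> 'a::zero fps fps set"
  where "closure_hh S = {x. \<forall>N::nat. \<exists>s\<in>S. \<forall>i k. i + k < N \<longrightarrow>
    fps_nth (fps_nth x k) i = fps_nth (fps_nth s k) i}"

definition Uhh_ideal :: "nat \<Rightarrow> int_gen free fps fps set"
  where "Uhh_ideal g = closure_hh (Idl\<^bsub>type_ring\<^esub> (Uhh_rels g))"

definition Uhh :: "nat \<Rightarrow> int_gen free fps fps set ring"
  where "Uhh g = type_ring Quot (Uhh_ideal g)"

definition Uhh_cls :: "nat \<Rightarrow> int_gen free fps fps \<Rightarrow> int_gen free fps fps set"
  where "Uhh_cls g f = Uhh_ideal g +>\<^bsub>type_ring\<^esub> f"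

definition Uhh_scal :: "nat \<Rightarrow> complex fps fps \<Rightarrow> int_gen free fps fps set"
  where "Uhh_scal g c = Uhh_cls g (map_fps (map_fps cst) c)"

definition Mhh :: "nat \<Rightarrow> int \<Rightarrow> (int_gen free fps fps set, int_gen free fps fps set set) module"
  where "Mhh g n = verma (Uhh g) (Uhh_cls g (gen2 (Sl2 Xp))) (Uhh_cls g (gen2 (Sl2 Hg) - of_int n))"

section \<open>Deformations along \<open>h'\<close>\<close>

definition embed_free :: "sl2_gen free \<Rightarrow> int_gen free"
  where "embed_free p = (\<Sum>w\<in>Poly_Mapping.keys p.
    Poly_Mapping.single (map Sl2 w) (Poly_Mapping.lookup p w))"

text \<open>The limit \<open>M/h'M\<close>, on which \<open>U\<^sub>h(sl\<^sub>2)\<close> acts by way of \<open>U\<^sub>h(sl\<^sub>2) \<simeq> U\<^sub>h\<^sub>,\<^sub>h\<^sub>'(sl\<^sub>2, g)/(h' = 0)\<close>: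
  the class of a series \<open>f\<close> in the generators of \<open>U\<^sub>h(sl\<^sub>2)\<close> acts as the same series in the
  corresponding generators of \<open>U\<^sub>h\<^sub>,\<^sub>h\<^sub>'(sl\<^sub>2, g)\<close>.\<close>

definition limit_h' :: "nat \<Rightarrow> (int_gen free fps fps set, 'b, 'd) module_scheme \<Rightarrow>
    (sl2_gen free fps set, 'b set) module"
  where "limit_h' g M =
    (let M0 = quot_module M ((\<lambda>x. Uhh_scal g fps_X \<odot>\<^bsub>M\<^esub> x) ` carrier M)
     in with_smult (\<lambda>u x. \<Union>f\<in>u. Uhh_cls g (fps_const (map_fps embed_free f)) \<odot>\<^bsub>M0\<^esub> x) M0)"

text \<open>\<open>M\<close> is a representation on \<open>V[[h,h']]\<close> (for the vector space \<open>V\<close> with scalar multiplication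
  \<open>s\<close>), \<open>N\<close> is a representation on \<open>V[[h]]\<close>, and \<open>N\<close> is the limit of \<open>M\<close>.\<close>

definition deformation_along_h' :: "(complex \<Rightarrow> 'v::ab_group_add \<Rightarrow> 'v) \<Rightarrow> nat \<Rightarrow>
    (int_gen free fps fps set, 'b, 'd) module_scheme \<Rightarrow> (sl2_gen free fps set, 'c, 'e) module_scheme \<Rightarrow> bool"
  where "deformation_along_h' s g M N \<longleftrightarrow>
    rep_on (Uhh g) (Uhh_scal g) (fps_scale (fps_scale s)) M \<and>
    rep_on (Uq 1) (Uq_scal 1) (fps_scale s) N \<and>
    rep_on (Uq 1) (Uq_scal 1) (fps_scale s) (limit_h' g M) \<and>
    module_iso (Uq 1) (limit_h' g M) N"

section \<open>Specialization at \<open>Q = \<epsilon>\<close>\<close>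

text \<open>The subring \<open>\<A> = \<complex>[Q, Q\<^sup>-\<^sup>1]\<close> of \<open>\<complex>[[h]]\<close>; here \<open>fexp (of_int i) = Q\<^sup>i\<close>.\<close>

definition ring_A :: "complex fps set"
  where "ring_A = {\<Sum>i\<in>I. cst (c i) * fexp (of_int i) | (I :: int set) c. finite I}"

text \<open>Representatives of \<open>Q\<^sup>\<plusminus>\<^sup>H\<close> and \<open>Q\<^bsup>\<surd>C\<^esup> + Q\<^bsup>-\<surd>C\<^esup>\<close>; the latter is
  \<open>\<Sum>\<^sub>k 2 h\<^sup>2\<^sup>k C\<^sup>k / (2k)!\<close>.\<close>

definition Q_H :: "int \<Rightarrow> int_gen free fps fps"
  where "Q_H e = fps_const (fexp (of_int e * gen (Sl2 Hg)))"

definition Q_sqrtC :: "int_gen free fps fps"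
  where "Q_sqrtC = fps_const (Abs_fps (\<lambda>k.
    if even k then cst (2 / fact k) * gen Cas ^ (k div 2) else 0))"

definition UA :: "nat \<Rightarrow> int_gen free fps fps set ring"
  where "UA g = (Uhh g)\<lparr>carrier :=
    adic_closure (Uhh g) (Uhh_scal g fps_X) (regular_module (Uhh g))
      (generate_ring (Uhh g)
        (Uhh_cls g ` (range gen2 \<union> {Q_H 1, Q_H (- 1), Q_sqrtC}) \<union>
         Uhh_scal g ` {c. \<forall>k. fps_nth c k \<in> ring_A}))\<rparr>"

text \<open>\<open>Q - \<epsilon>\<close> as a scalar.\<close>

definition Q_minus_eps :: "nat \<Rightarrow> int_gen free fps fps set"
  where "Q_minus_eps g = Uhh_scal g (fps_const (fexp 1 - cst (root_eps g)))"

definition Ueps_ideal :: "nat \<Rightarrow> int_gen free fps fps set set"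
  where "Ueps_ideal g = adic_closure (UA g) (Uhh_scal g fps_X) (regular_module (UA g))
    (Idl\<^bsub>UA g\<^esub> {Q_minus_eps g})"

definition Ueps :: "nat \<Rightarrow> int_gen free fps fps set set ring"
  where "Ueps g = UA g Quot Ueps_ideal g"

definition Ueps_cls :: "nat \<Rightarrow> int_gen free fps fps \<Rightarrow> int_gen free fps fps set set"
  where "Ueps_cls g f = Ueps_ideal g +>\<^bsub>UA g\<^esub> Uhh_cls g f"

text \<open>Power series in \<open>h'\<close> as scalars.\<close>

definition Ueps_scal :: "nat \<Rightarrow> complex fps \<Rightarrow> int_gen free fps fps set set"
  where "Ueps_scal g a = Ueps_cls g (map_fps cst a)"

text \<open>\<open>(\<Oplus>\<^sub>j \<A> m\<^sub>j)[[h']]\<close> inside \<open>Mhh g n\<close>, with \<open>m\<^sub>j\<close> the class of \<open>(X\<^sup>-)\<^sup>j\<close>.\<close>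

definition Mhh_cls :: "nat \<Rightarrow> int \<Rightarrow> int_gen free fps fps \<Rightarrow> int_gen free fps fps set set"
  where "Mhh_cls g n f = \<zero>\<^bsub>Mhh g n\<^esub> +>\<^bsub>Uhh g\<^esub> Uhh_cls g f"

definition MA_carrier :: "nat \<Rightarrow> int \<Rightarrow> int_gen free fps fps set set set"
  where "MA_carrier g n =
    {Mhh_cls g n (Abs_fps (\<lambda>k. \<Sum>j\<in>Poly_Mapping.keys (a k).
        map_fps cst (Poly_Mapping.lookup (a k) j) * fps_const (gen (Sl2 Xm) ^ j)))
     | a :: nat \<Rightarrow> nat \<Rightarrow>\<^sub>0 complex fps. \<forall>k j. Poly_Mapping.lookup (a k) j \<in> ring_A}"

definition MA :: "nat \<Rightarrow> int \<Rightarrow> (int_gen free fps fps set, int_gen free fps fps set set) module"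
  where "MA g n = (Mhh g n)\<lparr>carrier := MA_carrier g n\<rparr>"

definition Meps ::
    "nat \<Rightarrow> int \<Rightarrow> (int_gen free fps fps set set, int_gen free fps fps set set set) module"
  where "Meps g n =
    (let M0 = quot_module (MA g n) (adic_closure (UA g) (Uhh_scal g fps_X) (MA g n)
                ((\<lambda>x. Q_minus_eps g \<odot>\<^bsub>MA g n\<^esub> x) ` carrier (MA g n)))
     in with_smult (\<lambda>Y X. \<Union>u\<in>Y. u \<odot>\<^bsub>M0\<^esub> X) M0)"

section \<open>The Langlands \<open>g\<close>-dual\<close>

definition eps_fact :: "nat \<Rightarrow> complex"
  where "eps_fact g = (let \<epsilon> = root_eps g in
    \<Prod>k = 1..g - 1. (\<epsilon> ^ k - inverse \<epsilon> ^ k) / (\<epsilon> - inverse \<epsilon>))"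

text \<open>The scalar in the definition of \<open>\<^sup>LX\<^sup>+\<close>, a Laurent series in \<open>h'\<close>; here \<open>fexp a = T\<^sup>a\<close>.

  The factor \<open>(-1)\<^sup>n\<^sup>+\<^sup>g\<close> is a correction. It is \<open>1\<close> if \<open>g\<close> is even or \<open>n/g\<close> is odd. If \<open>g\<close> is odd
  and \<open>n/g\<close> is even, then without it the operators satisfy
  \<open>[\<^sup>LX\<^sup>+, \<^sup>LX\<^sup>-] = - sinh(gh' \<^sup>LH) / sinh(gh')\<close>, which is not the relation of \<open>U\<^sub>g\<^sub>h\<^sub>'(sl\<^sub>2)\<close>.
  (For \<open>g = 1\<close>, \<open>n = 0\<close>: \<open>\<^sup>LX\<^sup>+ = X\<^sup>+\<close> maps \<open>m\<^sub>1\<close> to \<open>0\<close> and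
  \<open>m\<^sub>2\<close> to \<open>(T + T\<^sup>-\<^sup>1) m\<^sub>1\<close>, while \<open>m\<^sub>1\<close> has weight \<open>-2\<close>.)\<close>

definition LX_coeff :: "nat \<Rightarrow> int \<Rightarrow> complex fls"
  where "LX_coeff g n = (let \<epsilon> = root_eps g in
    fls_const ((- 1) powi (n + int g)) *
    (inverse (fls_const (eps_fact g)))\<^sup>2 *
    (fps_to_fls (cst \<epsilon> * fexp 1 - cst (inverse \<epsilon>) * fexp (- 1)))\<^sup>2 *
    (inverse (fps_to_fls (fexp (of_nat g) - fexp (- of_nat g))))\<^sup>2)"

text \<open>\<open>L\<close> is the sum of the weight spaces of \<open>Meps g n\<close> of weights divisible by \<open>g\<close>, regarded as a
  representation of \<open>U\<^sub>g\<^sub>h\<^sub>'(sl\<^sub>2)\<close>, where the generators act as \<open>\<^sup>LX\<^sup>+\<close>, \<open>\<^sup>LX\<^sup>-\<close>, \<open>\<^sup>LH\<close>. The action is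
  determined by these conditions: on modules \<open>V[[h']]\<close>, power series in the generators act by
  \<open>h'\<close>-adically convergent sums.\<close>

definition langlands_dual :: "nat \<Rightarrow> int \<Rightarrow>
    (sl2_gen free fps set, int_gen free fps fps set set set) module \<Rightarrow> bool"
  where "langlands_dual g n L \<longleftrightarrow> (let M = Meps g n; xp = Ueps_cls g (gen2 (Sl2 Xp));
      xm = Ueps_cls g (gen2 (Sl2 Xm)); H = Ueps_cls g (gen2 (Sl2 Hg)) in
    carrier L = weight_sum (Ueps g) (Ueps_scal g fps_X) H M {m. int g dvd m} \<and>
    zero L = zero M \<and>
    (\<forall>x\<in>carrier L. \<forall>y\<in>carrier L. x \<oplus>\<^bsub>L\<^esub> y = x \<oplus>\<^bsub>M\<^esub> y) \<and>
    rep_on (Uq g) (Uq_scal g) (fps_scale scale_sum) L \<and>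
    (\<forall>x\<in>carrier L.
      (\<forall>c. Uq_scal g c \<odot>\<^bsub>L\<^esub> x = Ueps_scal g c \<odot>\<^bsub>M\<^esub> x) \<and>
      loc_eq (Ueps_scal g) M (LX_coeff g n) ((xp [^]\<^bsub>Ueps g\<^esub> g) \<odot>\<^bsub>M\<^esub> x) (Uq_cls g (gen1 Xp) \<odot>\<^bsub>L\<^esub> x) \<and>
      Uq_cls g (gen1 Xm) \<odot>\<^bsub>L\<^esub> x = (xm [^]\<^bsub>Ueps g\<^esub> g) \<odot>\<^bsub>M\<^esub> x \<and>
      Uq_cls g (gen1 Hg) \<odot>\<^bsub>L\<^esub> x = Ueps_scal g (cst (1 / of_nat g)) \<odot>\<^bsub>M\<^esub> (H \<odot>\<^bsub>M\<^esub> x)))"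

end

theory Submission
  imports Defs "HOL-Library.Product_Plus"
begin

text \<open>Verma modules are compared through coordinates with respect to the \<open>m\<^sub>j\<close>.

  The formulas for the generators on the \<open>m\<^sub>j\<close> define operators on series with coefficients in
  \<open>\<Oplus> \<complex> m\<^sub>j\<close>. They satisfy the relations: on \<open>m\<^sub>j\<close> the right-hand side for \<open>X\<^sup>+X\<^sup>-\<close> is the product of the
  deformed numbers of \<open>j + 1\<close> and \<open>n - j\<close>, the values of \<open>H\<^sub>e\<^sup>+\<close> at \<open>\<surd>C = n + 1\<close>, \<open>H = n - 2j\<close>
  (\<open>rep2_rels\<close>; \<open>rep1_rels\<close> for one parameter). So the algebra acts, and the Verma module maps onto this
  space. The map is injective, because modulo the left ideal every series is a convergent
  combination of the \<open>(X\<^sup>-)\<^sup>j\<close> (\<open>span1\<close>, \<open>span2\<close>). With two parameters, the central element \<open>C\<close> has to be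
  eliminated as well: at \<open>H = n\<close> the relation for \<open>X\<^sup>-X\<^sup>+\<close> reads \<open>C - (n + 1)\<^sup>2\<close> times a unit
  (\<open>XX_series_minus_unit\<close>). At \<open>h' = 0\<close> the deformed numbers become the quantum numbers for \<open>Q\<close>,
  which gives the limit.

  For integers \<open>a\<close> the deformed number of \<open>a\<close> has coefficients in \<open>\<A>\<close>, so the lattice over \<open>\<A>[[h']]\<close> is
  stable and the specialization is evaluation at \<open>Q = \<epsilon>\<close> in each coordinate; nothing more is divided out
  because the kernel of this evaluation on \<open>\<A>\<close> is generated by \<open>Q - \<epsilon>\<close> (\<open>evA_kernel\<close>, \<open>kernel_tau\<close>). In these
  coordinates \<open>H\<close> is diagonal with distinct eigenvalues, hence the weight decomposition.

  The duality comes from \<open>P(\<epsilon>\<^sup>a) = 1\<close> if \<open>g\<close> divides \<open>a\<close> and \<open>P(\<epsilon>\<^sup>a) = 0\<close> otherwise (\<open>P_fun_root\<close>). At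
  \<open>Q = \<epsilon>\<close> the deformed number of \<open>a\<close> is therefore the constant \<open>[a]\<^sub>\<epsilon>\<close> unless \<open>g\<close> divides \<open>a\<close>. Of \<open>g\<close>
  consecutive integers exactly one is divisible by \<open>g\<close>, and its number is, up to a common factor, a
  quantum number for \<open>T\<^sup>g\<close>. So \<open>(X\<^sup>+)\<^sup>g\<close>, rescaled, has the coefficients of \<open>X\<^sup>+\<close> on a Verma module of
  \<open>U\<^sub>g\<^sub>h\<^sub>'(sl\<^sub>2)\<close> (\<open>LX_coeff_numE\<close>). The weight \<open>n - 2j\<close> is divisible by \<open>g\<close> if \<open>j\<close> is congruent to \<open>0\<close> or, for
  even \<open>g\<close>, to \<open>g/2\<close> modulo \<open>g\<close>; each of these residues carries one Verma module, of highest
  weight \<open>n/g\<close> and \<open>n/g - 1\<close>. This proves existence of the dual and its decomposition; that the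
  operators of the generators determine the whole action is \<open>langlands_models\<close>.\<close>

section \<open>Modules presented by a bijection onto a set of vectors\<close>

text \<open>Every module below is known through an additive bijection \<open>\<phi>\<close> onto a set \<open>T\<close> of power series with
  coefficients in \<open>\<Oplus> \<complex> m\<^sub>j\<close>, under which the ring acts by explicit operators. Two modules with the
  same \<open>T\<close> and the same operators are isomorphic (\<open>models_iso\<close>); this is how all isomorphisms of the
  theorem arise.\<close>

definition models ::
    "('a, 'c) ring_scheme \<Rightarrow> ('a, 'b, 'd) module_scheme \<Rightarrow> ('b \<Rightarrow> 'w::ab_group_add) \<Rightarrow> 'w set \<Rightarrow>
     ('a \<Rightarrow> 'w \<Rightarrow> 'w) \<Rightarrow> bool"
  where "models R M \<phi> T act \<longleftrightarrow> left_module R M \<and> bij_betw \<phi> (carrier M) T \<and>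
    (\<forall>x\<in>carrier M. \<forall>y\<in>carrier M. \<phi> (x \<oplus>\<^bsub>M\<^esub> y) = \<phi> x + \<phi> y) \<and>
    (\<forall>a\<in>carrier R. \<forall>x\<in>carrier M. \<phi> (a \<odot>\<^bsub>M\<^esub> x) = act a (\<phi> x))"

lemma modelsD:
  assumes "models R M \<phi> T act"
  shows "left_module R M" "bij_betw \<phi> (carrier M) T" "inj_on \<phi> (carrier M)" "\<phi> ` carrier M = T"
    "x \<in> carrier M \<Longrightarrow> \<phi> x \<in> T"
    "x \<in> carrier M \<Longrightarrow> y \<in> carrier M \<Longrightarrow> \<phi> (x \<oplus>\<^bsub>M\<^esub> y) = \<phi> x + \<phi> y"
    "a \<in> carrier R \<Longrightarrow> x \<in> carrier M \<Longrightarrow> \<phi> (a \<odot>\<^bsub>M\<^esub> x) = act a (\<phi> x)"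
  using assms by (auto simp: models_def bij_betw_def)

lemma left_module_closed:
  assumes "left_module R M"
  shows "x \<in> carrier M \<Longrightarrow> y \<in> carrier M \<Longrightarrow> x \<oplus>\<^bsub>M\<^esub> y \<in> carrier M"
    "a \<in> carrier R \<Longrightarrow> x \<in> carrier M \<Longrightarrow> a \<odot>\<^bsub>M\<^esub> x \<in> carrier M"
    "\<zero>\<^bsub>M\<^esub> \<in> carrier M" "x \<in> carrier M \<Longrightarrow> \<ominus>\<^bsub>M\<^esub> x \<in> carrier M" "ring R" "abelian_group M"
proof -
  interpret left_module R M by fact
  show "x \<in> carrier M \<Longrightarrow> y \<in> carrier M \<Longrightarrow> x \<oplus>\<^bsub>M\<^esub> y \<in> carrier M"
    "a \<in> carrier R \<Longrightarrow> x \<in> carrier M \<Longrightarrow> a \<odot>\<^bsub>M\<^esub> x \<in> carrier M"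
    "\<zero>\<^bsub>M\<^esub> \<in> carrier M" "x \<in> carrier M \<Longrightarrow> \<ominus>\<^bsub>M\<^esub> x \<in> carrier M" "ring R" "abelian_group M"
    by (auto intro: smult_closed R.ring_axioms M.abelian_group_axioms)
qed

lemma additive_zero_neg:
  fixes \<tau> :: "'b \<Rightarrow> 'w::ab_group_add"
  assumes "abelian_group M"
    and add: "\<And>x y. x \<in> carrier M \<Longrightarrow> y \<in> carrier M \<Longrightarrow> \<tau> (x \<oplus>\<^bsub>M\<^esub> y) = \<tau> x + \<tau> y"
  shows "\<tau> \<zero>\<^bsub>M\<^esub> = 0" "x \<in> carrier M \<Longrightarrow> \<tau> (\<ominus>\<^bsub>M\<^esub> x) = - \<tau> x"
proof -
  interpret abelian_group M by fact
  have "\<tau> \<zero>\<^bsub>M\<^esub> = \<tau> \<zero>\<^bsub>M\<^esub> + \<tau> \<zero>\<^bsub>M\<^esub>"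
    using add[of "\<zero>\<^bsub>M\<^esub>" "\<zero>\<^bsub>M\<^esub>"] by simp
  then show z: "\<tau> \<zero>\<^bsub>M\<^esub> = 0" by simp
  show "x \<in> carrier M \<Longrightarrow> \<tau> (\<ominus>\<^bsub>M\<^esub> x) = - \<tau> x"
    using add[of x "\<ominus>\<^bsub>M\<^esub> x"] z by (simp add: r_neg eq_neg_iff_add_eq_0 add.commute)
qed

lemma additive_finsum:
  fixes \<tau> :: "'b \<Rightarrow> 'w::ab_group_add"
  assumes "abelian_group M" "finite F" "\<And>m. f m \<in> carrier M"
    and add: "\<And>x y. x \<in> carrier M \<Longrightarrow> y \<in> carrier M \<Longrightarrow> \<tau> (x \<oplus>\<^bsub>M\<^esub> y) = \<tau> x + \<tau> y"
  shows "\<tau> (finsum M f F) = (\<Sum>m\<in>F. \<tau> (f m))"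
proof -
  interpret abelian_group M by fact
  have z: "\<tau> \<zero>\<^bsub>M\<^esub> = 0" by (rule additive_zero_neg(1)[OF assms(1) add])
  show ?thesis
    using assms(2) by (induction F rule: finite_induct)
      (use assms(3) z in \<open>auto simp: add finsum_insert\<close>)
qed

lemma additive_int_pow:
  fixes \<tau> :: "'b \<Rightarrow> 'w::ring_1" and m :: int
  assumes "abelian_group M" and x: "x \<in> carrier M"
    and add: "\<And>x y. x \<in> carrier M \<Longrightarrow> y \<in> carrier M \<Longrightarrow> \<tau> (x \<oplus>\<^bsub>M\<^esub> y) = \<tau> x + \<tau> y"
  shows "\<tau> ([m] \<cdot>\<^bsub>M\<^esub> x) = of_int m * \<tau> x"
proof -
  interpret abelian_group M by fact
  note zn = additive_zero_neg[where \<tau>=\<tau>, OF assms(1) add]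
  have nat: "\<tau> ([k] \<cdot>\<^bsub>M\<^esub> x) = of_nat k * \<tau> x" for k :: nat
    by (induction k) (use x zn(1) in \<open>auto simp: add algebra_simps\<close>)
  show ?thesis
  proof (cases "m \<ge> 0")
    case True
    then obtain k where "m = int k" using nonneg_int_cases by blast
    then show ?thesis using nat[of k] by (simp add: add_pow_int_ge)
  next
    case False
    then obtain k where m: "m = - int k" "k > 0"
      by (metis neg_int_cases linorder_not_le)
    then have "[m] \<cdot>\<^bsub>M\<^esub> x = \<ominus>\<^bsub>M\<^esub> ([k] \<cdot>\<^bsub>M\<^esub> x)"
      by (simp add: add_pow_int_lt)
    then show ?thesis using nat[of k] zn(2) x m by simp
  qed
qed

lemma abelian_group_model:
  fixes \<phi> :: "'b \<Rightarrow> 'w::ab_group_add"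
  assumes bij: "bij_betw \<phi> (carrier M) T"
    and neg: "\<And>t. t \<in> T \<Longrightarrow> - t \<in> T"
    and zero: "\<zero>\<^bsub>M\<^esub> \<in> carrier M" "\<phi> \<zero>\<^bsub>M\<^esub> = 0"
    and closed: "\<And>x y. x \<in> carrier M \<Longrightarrow> y \<in> carrier M \<Longrightarrow> x \<oplus>\<^bsub>M\<^esub> y \<in> carrier M"
    and add: "\<And>x y. x \<in> carrier M \<Longrightarrow> y \<in> carrier M \<Longrightarrow> \<phi> (x \<oplus>\<^bsub>M\<^esub> y) = \<phi> x + \<phi> y"
  shows "abelian_group M"
proof -
  have inj: "x = y" if "\<phi> x = \<phi> y" "x \<in> carrier M" "y \<in> carrier M" for x y
    using that bij by (auto simp: bij_betw_def inj_on_def)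
  show ?thesis
  proof (rule abelian_groupI)
    fix x assume x: "x \<in> carrier M"
    then have "- \<phi> x \<in> \<phi> ` carrier M"
      using neg bij by (auto simp: bij_betw_def)
    then obtain y where y: "y \<in> carrier M" "\<phi> y = - \<phi> x" by auto
    have "y \<oplus>\<^bsub>M\<^esub> x = \<zero>\<^bsub>M\<^esub>"
      by (rule inj) (use x y zero closed add in auto)
    then show "\<exists>y\<in>carrier M. y \<oplus>\<^bsub>M\<^esub> x = \<zero>\<^bsub>M\<^esub>" using y by auto
  qed (use zero closed add in \<open>auto intro!: inj simp: algebra_simps\<close>)
qed

lemma models_intro:
  fixes \<phi> :: "'b \<Rightarrow> 'w::ab_group_add"
  assumes "ring R" "abelian_group M"
    and bij: "bij_betw \<phi> (carrier M) T"
    and add: "\<And>x y. x \<in> carrier M \<Longrightarrow> y \<in> carrier M \<Longrightarrow> \<phi> (x \<oplus>\<^bsub>M\<^esub> y) = \<phi> x + \<phi> y"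
    and closed: "\<And>a x. a \<in> carrier R \<Longrightarrow> x \<in> carrier M \<Longrightarrow> a \<odot>\<^bsub>M\<^esub> x \<in> carrier M"
    and act: "\<And>a x. a \<in> carrier R \<Longrightarrow> x \<in> carrier M \<Longrightarrow> \<phi> (a \<odot>\<^bsub>M\<^esub> x) = act a (\<phi> x)"
    and l_distr: "\<And>a b t. a \<in> carrier R \<Longrightarrow> b \<in> carrier R \<Longrightarrow> t \<in> T \<Longrightarrow> act (a \<oplus>\<^bsub>R\<^esub> b) t = act a t + act b t"
    and r_distr: "\<And>a s t. a \<in> carrier R \<Longrightarrow> s \<in> T \<Longrightarrow> t \<in> T \<Longrightarrow> act a (s + t) = act a s + act a t"
    and assoc: "\<And>a b t. a \<in> carrier R \<Longrightarrow> b \<in> carrier R \<Longrightarrow> t \<in> T \<Longrightarrow> act (a \<otimes>\<^bsub>R\<^esub> b) t = act a (act b t)"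
    and one: "\<And>t. t \<in> T \<Longrightarrow> act \<one>\<^bsub>R\<^esub> t = t"
  shows "models R M \<phi> T act"
proof -
  interpret R: ring R by fact
  interpret M: abelian_group M by fact
  have inj: "x = y" if "\<phi> x = \<phi> y" "x \<in> carrier M" "y \<in> carrier M" for x y
    using that bij by (auto simp: bij_betw_def inj_on_def)
  have T: "\<phi> x \<in> T" if "x \<in> carrier M" for x using that bij by (auto simp: bij_betw_def)
  have "left_module R M"
    by (intro left_module.intro left_module_axioms.intro assms(1,2))
      (auto intro!: inj simp: closed add act T l_distr r_distr assoc one)
  then show ?thesis using bij add act by (auto simp: models_def)
qed

lemma models_iso:
  assumes M: "models R M \<phi> T act" and N: "models R N \<psi> T act"
  shows "module_iso R M N"
proof -
  define \<beta> where "\<beta> x = inv_into (carrier N) \<psi> (\<phi> x)" for x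
  note M' = modelsD[OF M] and N' = modelsD[OF N]
  have \<beta>: "\<beta> x \<in> carrier N" "\<psi> (\<beta> x) = \<phi> x" if "x \<in> carrier M" for x
    using M'(5)[OF that] N'(4) unfolding \<beta>_def by (auto intro: inv_into_into f_inv_into_f)
  have inj: "x = y" if "\<psi> x = \<psi> y" "x \<in> carrier N" "y \<in> carrier N" for x y
    using that N'(3) by (auto simp: inj_on_def)
  have "bij_betw \<beta> (carrier M) (carrier N)"
    using bij_betw_trans[OF M'(2) bij_betw_inv_into[OF N'(2)]]
    by (rule bij_betw_cong[THEN iffD1, rotated]) (simp add: \<beta>_def)
  moreover have "\<beta> (x \<oplus>\<^bsub>M\<^esub> y) = \<beta> x \<oplus>\<^bsub>N\<^esub> \<beta> y" if "x \<in> carrier M" "y \<in> carrier M" for x y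
    by (rule inj) (simp_all add: that \<beta> M'(6) N'(6) left_module_closed(1)[OF M'(1)] left_module_closed(1)[OF N'(1)])
  moreover have "\<beta> (a \<odot>\<^bsub>M\<^esub> x) = a \<odot>\<^bsub>N\<^esub> \<beta> x" if "x \<in> carrier M" "a \<in> carrier R" for a x
    by (rule inj) (simp_all add: that \<beta> M'(7) N'(7) left_module_closed(2)[OF M'(1)] left_module_closed(2)[OF N'(1)])
  ultimately show ?thesis
    unfolding module_iso_def by blast
qed

text \<open>The bijection that a map \<open>\<tau>\<close>, constant on the cosets of its kernel, induces on them.\<close>

definition coset_map :: "('b \<Rightarrow> 'w) \<Rightarrow> 'b set \<Rightarrow> 'w"
  where "coset_map \<tau> X = \<tau> (SOME x. x \<in> X)"

lemma models_quot:
  fixes \<tau> :: "'b \<Rightarrow> 'w::ab_group_add"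
  assumes M: "left_module R M"
    and add: "\<And>x y. x \<in> carrier M \<Longrightarrow> y \<in> carrier M \<Longrightarrow> \<tau> (x \<oplus>\<^bsub>M\<^esub> y) = \<tau> x + \<tau> y"
    and act: "\<And>a x. a \<in> carrier R \<Longrightarrow> x \<in> carrier M \<Longrightarrow> \<tau> (a \<odot>\<^bsub>M\<^esub> x) = act a (\<tau> x)"
    and N: "N = {x \<in> carrier M. \<tau> x = 0}"
  shows "models R (quot_module M N) (coset_map \<tau>) (\<tau> ` carrier M) act"
    and "\<And>x. x \<in> carrier M \<Longrightarrow> coset_map \<tau> (N +>\<^bsub>M\<^esub> x) = \<tau> x"
    and "carrier (quot_module M N) = (\<lambda>x. N +>\<^bsub>M\<^esub> x) ` carrier M"
proof -
  interpret left_module R M by fact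
  note clo = left_module_closed[OF M]
  note zn = additive_zero_neg[where \<tau>=\<tau>, OF clo(6) add]
  define fib where "fib c = {z \<in> carrier M. \<tau> z = c}" for c
  have diff: "\<exists>n\<in>carrier M. \<tau> n = \<tau> z - \<tau> x \<and> n \<oplus>\<^bsub>M\<^esub> x = z \<and> x \<oplus>\<^bsub>M\<^esub> n = z"
    if "x \<in> carrier M" "z \<in> carrier M" for x z
    using that by (intro bexI[of _ "z \<oplus>\<^bsub>M\<^esub> (\<ominus>\<^bsub>M\<^esub> x)"])
      (auto simp: add zn(2) M.a_assoc M.l_neg M.r_neg M.a_lcomm[of x])
  have coset: "N +>\<^bsub>M\<^esub> x = fib (\<tau> x)" if "x \<in> carrier M" for x
  proof (rule Set.set_eqI)
    fix z show "z \<in> N +>\<^bsub>M\<^esub> x \<longleftrightarrow> z \<in> fib (\<tau> x)"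
      using diff[of x z] that by (auto simp: a_r_coset_def' N fib_def add)
  qed
  have fib_map: "coset_map \<tau> (fib (\<tau> x)) = \<tau> x" if "x \<in> carrier M" for x
    using someI[of "\<lambda>z. z \<in> fib (\<tau> x)" x] that by (auto simp: coset_map_def fib_def)
  show map: "coset_map \<tau> (N +>\<^bsub>M\<^esub> x) = \<tau> x" if "x \<in> carrier M" for x
    using that by (simp add: coset fib_map)
  have car: "carrier (quot_module M N) = (\<lambda>x. fib (\<tau> x)) ` carrier M"
    by (auto simp: quot_module_def A_RCOSETS_def' coset)
  then show "carrier (quot_module M N) = (\<lambda>x. N +>\<^bsub>M\<^esub> x) ` carrier M"
    by (auto simp: coset)
  have qadd: "fib (\<tau> x) \<oplus>\<^bsub>quot_module M N\<^esub> fib (\<tau> y) = fib (\<tau> (x \<oplus>\<^bsub>M\<^esub> y))"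
    if "x \<in> carrier M" "y \<in> carrier M" for x y
  proof (rule Set.set_eqI)
    fix z
    show "z \<in> fib (\<tau> x) \<oplus>\<^bsub>quot_module M N\<^esub> fib (\<tau> y) \<longleftrightarrow> z \<in> fib (\<tau> (x \<oplus>\<^bsub>M\<^esub> y))"
      using diff[of x z] that by (force simp: quot_module_def set_add_def' fib_def add)
  qed
  have qsm: "a \<odot>\<^bsub>quot_module M N\<^esub> fib (\<tau> x) = fib (\<tau> (a \<odot>\<^bsub>M\<^esub> x))"
    if "x \<in> carrier M" "a \<in> carrier R" for x a
    using that by (auto simp: quot_module_def coset clo fib_def act)
  have qz: "\<zero>\<^bsub>quot_module M N\<^esub> = fib (\<tau> \<zero>\<^bsub>M\<^esub>)"
    by (auto simp: quot_module_def fib_def N zn(1))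
  have bij: "bij_betw (coset_map \<tau>) (carrier (quot_module M N)) (\<tau> ` carrier M)"
    unfolding car by (rule bij_betw_imageI) (auto simp: inj_on_def fib_map image_image)
  define T where "T = \<tau> ` carrier M"
  have T: "\<tau> x \<in> T" if "x \<in> carrier M" for x using that by (auto simp: T_def)
  have T_add: "s + t \<in> T" if "s \<in> T" "t \<in> T" for s t
    using that T[OF clo(1)] by (force simp: T_def simp flip: add)
  have T_zero: "0 \<in> T" using T[OF clo(3)] zn(1) by simp
  have fibT: "coset_map \<tau> (fib t) = t" if "t \<in> T" for t using that fib_map by (auto simp: T_def)
  have carT: "carrier (quot_module M N) = fib ` T" unfolding car by (auto simp: T_def)
  have ab: "abelian_group (quot_module M N)"
  proof (rule abelian_group_model[OF bij])
    fix t assume "t \<in> \<tau> ` carrier M"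
    then obtain x where "t = \<tau> x" "x \<in> carrier M" by auto
    then show "- t \<in> \<tau> ` carrier M" using zn(2)[of x] imageI[OF clo(4)[of x], of \<tau>] by simp
  next
    fix X Y assume "X \<in> carrier (quot_module M N)" "Y \<in> carrier (quot_module M N)"
    then obtain x y where X: "x \<in> carrier M" "y \<in> carrier M" "X = fib (\<tau> x)" "Y = fib (\<tau> y)"
      unfolding car by auto
    have q: "X \<oplus>\<^bsub>quot_module M N\<^esub> Y = fib (\<tau> x + \<tau> y)" using X by (simp add: qadd add)
    show "X \<oplus>\<^bsub>quot_module M N\<^esub> Y \<in> carrier (quot_module M N)"
      unfolding q carT using X T T_add by blast
    show "coset_map \<tau> (X \<oplus>\<^bsub>quot_module M N\<^esub> Y) = coset_map \<tau> X + coset_map \<tau> Y"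
      unfolding q using X T T_add fibT by simp
  qed (use T_zero in \<open>simp_all add: carT qz zn(1) fibT\<close>)
  show "models R (quot_module M N) (coset_map \<tau>) (\<tau> ` carrier M) act"
  proof (rule models_intro[OF clo(5) ab bij])
    fix a b t assume a: "a \<in> carrier R" and b: "b \<in> carrier R" and "t \<in> \<tau> ` carrier M"
    then obtain x where x: "t = \<tau> x" "x \<in> carrier M" by auto
    show "act (a \<oplus>\<^bsub>R\<^esub> b) t = act a t + act b t"
      using act[of "a \<oplus>\<^bsub>R\<^esub> b" x] a b x by (simp add: smult_l_distr clo add act)
    show "act (a \<otimes>\<^bsub>R\<^esub> b) t = act a (act b t)"
      using act[of "a \<otimes>\<^bsub>R\<^esub> b" x] act[of a "b \<odot>\<^bsub>M\<^esub> x"] a b x by (simp add: smult_assoc clo act)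
  next
    fix a s t assume a: "a \<in> carrier R" and "s \<in> \<tau> ` carrier M" "t \<in> \<tau> ` carrier M"
    then obtain x y where x: "t = \<tau> x" "x \<in> carrier M" "s = \<tau> y" "y \<in> carrier M" by auto
    show "act a (s + t) = act a s + act a t"
      using act[of a "y \<oplus>\<^bsub>M\<^esub> x"] a x by (simp add: smult_r_distr clo add act)
  next
    fix t assume "t \<in> \<tau> ` carrier M"
    then obtain x where x: "t = \<tau> x" "x \<in> carrier M" by auto
    show "act \<one>\<^bsub>R\<^esub> t = t"
      using act[of "\<one>\<^bsub>R\<^esub>" x] x by (simp add: smult_one)
  next
    fix a X assume a: "a \<in> carrier R" and "X \<in> carrier (quot_module M N)"
    then obtain x where X: "x \<in> carrier M" "X = fib (\<tau> x)" unfolding car by auto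
    have q: "a \<odot>\<^bsub>quot_module M N\<^esub> X = fib (\<tau> (a \<odot>\<^bsub>M\<^esub> x))" using X a by (simp add: qsm)
    show "a \<odot>\<^bsub>quot_module M N\<^esub> X \<in> carrier (quot_module M N)"
      unfolding q car using clo(2)[OF a X(1)] by blast
    show "coset_map \<tau> (a \<odot>\<^bsub>quot_module M N\<^esub> X) = act a (coset_map \<tau> X)"
      unfolding q using fib_map[OF clo(2)[OF a X(1)]] X a by (simp add: act fib_map)
  next
    fix X Y assume "X \<in> carrier (quot_module M N)" "Y \<in> carrier (quot_module M N)"
    then obtain x y where X: "x \<in> carrier M" "y \<in> carrier M" "X = fib (\<tau> x)" "Y = fib (\<tau> y)"
      unfolding car by auto
    then show "coset_map \<tau> (X \<oplus>\<^bsub>quot_module M N\<^esub> Y) = coset_map \<tau> X + coset_map \<tau> Y"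
      using fib_map[OF clo(1)[OF X(1,2)]] by (simp add: qadd fib_map add)
  qed
qed

text \<open>The definitions of the limit and of the specialization replace the ring of a quotient module by
  another one that acts through representatives.\<close>

lemma models_with_smult:
  assumes M: "models R M \<phi> T act0" and S: "ring S"
    and closed: "\<And>a x. a \<in> carrier S \<Longrightarrow> x \<in> carrier M \<Longrightarrow> sm a x \<in> carrier M"
    and act: "\<And>a x. a \<in> carrier S \<Longrightarrow> x \<in> carrier M \<Longrightarrow> \<phi> (sm a x) = act a (\<phi> x)"
    and l_distr: "\<And>a b t. a \<in> carrier S \<Longrightarrow> b \<in> carrier S \<Longrightarrow> t \<in> T \<Longrightarrow> act (a \<oplus>\<^bsub>S\<^esub> b) t = act a t + act b t"
    and r_distr: "\<And>a s t. a \<in> carrier S \<Longrightarrow> s \<in> T \<Longrightarrow> t \<in> T \<Longrightarrow> act a (s + t) = act a s + act a t"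
    and assoc: "\<And>a b t. a \<in> carrier S \<Longrightarrow> b \<in> carrier S \<Longrightarrow> t \<in> T \<Longrightarrow> act (a \<otimes>\<^bsub>S\<^esub> b) t = act a (act b t)"
    and one: "\<And>t. t \<in> T \<Longrightarrow> act \<one>\<^bsub>S\<^esub> t = t"
  shows "models S (with_smult sm M) \<phi> T act"
proof -
  note M' = modelsD[OF M]
  interpret M: abelian_group M using left_module_closed[OF M'(1)] by blast
  have "abelian_group (with_smult sm M)"
    by (rule abelian_groupI)
      (auto simp: with_smult_def M.a_assoc M.a_comm M.a_lcomm intro: M.l_neg)
  then show ?thesis
    by (rule models_intro[OF S])
      (use assms M' in \<open>auto simp: with_smult_def left_module_closed[OF M'(1)]\<close>)
qed

section \<open>The ring of a type and its quotients\<close>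

lemma type_ring_simps [simp]:
  "carrier type_ring = UNIV" "x \<otimes>\<^bsub>type_ring\<^esub> y = x * y" "\<one>\<^bsub>type_ring\<^esub> = 1"
  "\<zero>\<^bsub>type_ring\<^esub> = 0" "x \<oplus>\<^bsub>type_ring\<^esub> y = x + y"
  by (simp_all add: type_ring_def)

lemma ring_type_ring: "ring (type_ring :: 'a::ring_1 ring)"
  by (rule ringI, rule abelian_groupI)
    (auto simp: algebra_simps intro: monoidI exI[of _ "- _"] add.left_inverse)

lemma type_ring_minus [simp]: "\<ominus>\<^bsub>type_ring\<^esub> x = - (x::'a::ring_1)"
proof -
  interpret ring "type_ring :: 'a ring" by (rule ring_type_ring)
  show ?thesis by (rule minus_equality) auto
qed

lemma type_ring_pow [simp]: "x [^]\<^bsub>type_ring\<^esub> (N::nat) = (x::'a::ring_1) ^ N"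
proof -
  interpret ring "type_ring :: 'a ring" by (rule ring_type_ring)
  show ?thesis by (induction N) (auto simp: power_commutes)
qed

lemma ideal_type_ring_iff:
  "ideal I (type_ring :: 'a::ring_1 ring) \<longleftrightarrow>
    0 \<in> I \<and> (\<forall>x\<in>I. \<forall>y\<in>I. x + y \<in> I) \<and> (\<forall>a. \<forall>x\<in>I. a * x \<in> I \<and> x * a \<in> I)"
proof
  assume "ideal I (type_ring :: 'a ring)"
  then interpret ideal I "type_ring :: 'a ring" .
  show "0 \<in> I \<and> (\<forall>x\<in>I. \<forall>y\<in>I. x + y \<in> I) \<and> (\<forall>a. \<forall>x\<in>I. a * x \<in> I \<and> x * a \<in> I)"
  proof (intro conjI ballI allI)
    show "0 \<in> I" using additive_subgroup.zero_closed[OF additive_subgroup_axioms] by simp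
    show "x + y \<in> I" if "x \<in> I" "y \<in> I" for x y using additive_subgroup.a_closed[OF additive_subgroup_axioms that] by simp
    show "a * x \<in> I" "x * a \<in> I" if "x \<in> I" for a x
      using I_l_closed[OF that, of a] I_r_closed[OF that, of a] by simp_all
  qed
next
  assume I: "0 \<in> I \<and> (\<forall>x\<in>I. \<forall>y\<in>I. x + y \<in> I) \<and> (\<forall>a. \<forall>x\<in>I. a * x \<in> I \<and> x * a \<in> I)"
  interpret ring "type_ring :: 'a ring" by (rule ring_type_ring)
  have neg: "- x \<in> I" if "x \<in> I" for x
    using I that by (metis mult_minus1)
  show "ideal I (type_ring :: 'a ring)"
  proof (rule idealI[OF ring_type_ring])
    show "subgroup I (add_monoid (type_ring :: 'a ring))"
      using I neg by (intro add.subgroupI) (auto simp flip: a_inv_def)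
  qed (use I in auto)
qed

lemma type_ring_coset: "I +>\<^bsub>type_ring\<^esub> f = {i + f |i. i \<in> I}"
  by (auto simp: a_r_coset_def')

section \<open>Homomorphisms of complex algebras\<close>

definition ahom :: "('a::complex_alg \<Rightarrow> 'b::complex_alg) \<Rightarrow> bool"
  where "ahom f \<longleftrightarrow> (\<forall>c. f (cst c) = cst c) \<and> (\<forall>x y. f (x + y) = f x + f y) \<and> (\<forall>x y. f (x * y) = f x * f y)"

lemma cst_zero [simp]: "cst 0 = (0 :: 'a::complex_alg)"
  using cst_add[of 0 0] by (metis add_cancel_right_right)

lemma cst_one' [simp]: "cst 1 = (1 :: 'a::complex_alg)"
  by (rule cst_one)

lemma cst_minus: "cst (- c) = - (cst c :: 'a::complex_alg)"
  using cst_add[of c "- c", where 'a='a] by (simp add: eq_neg_iff_add_eq_0 add.commute)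

lemma cst_diff: "cst (c - d) = (cst c - cst d :: 'a::complex_alg)"
  using cst_add[of c "- d", where 'a='a] by (simp add: cst_minus)

lemma cst_of_nat: "cst (of_nat n) = (of_nat n :: 'a::complex_alg)"
  by (induction n) (auto simp: cst_add)

lemma cst_numeral: "cst (numeral w) = (numeral w :: 'a::complex_alg)"
  using cst_of_nat[of "numeral w", where 'a='a] by simp

lemma cst_of_int: "cst (of_int n) = (of_int n :: 'a::complex_alg)"
  by (cases n) (auto simp: cst_of_nat cst_minus cst_diff)

lemma cst_power: "cst (c ^ n) = (cst c ^ n :: 'a::complex_alg)"
  by (induction n) (auto simp: cst_mult)

lemma cst_id [simp]: "cst = (\<lambda>c::complex. c)"
  by (auto simp: cst_complex_def)

lemma ahomD:
  assumes "ahom f"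
  shows "f (cst c) = cst c" "f (x + y) = f x + f y" "f (x * y) = f x * f y"
    "f 0 = 0" "f 1 = 1" "f (- x) = - f x" "f (x - y) = f x - f y" "f (x ^ n) = f x ^ n"
    "f (sum a S) = (\<Sum>i\<in>S. f (a i))" "f (of_int m) = of_int m" "f (of_nat n) = of_nat n"
    "f (numeral w) = numeral w"
proof -
  show c: "f (cst c) = cst c" and add: "f (x + y) = f x + f y" and mult: "f (x * y) = f x * f y" for c x y
    using assms by (auto simp: ahom_def)
  show z: "f 0 = 0" and o: "f 1 = 1" using c[of 0] c[of 1] by simp_all
  show neg: "f (- x) = - f x" for x
    using add[of x "- x"] z by (simp add: eq_neg_iff_add_eq_0 add.commute)
  show "f (x - y) = f x - f y" using add[of x "- y"] neg by simp
  show "f (x ^ n) = f x ^ n" by (induction n) (auto simp: o mult)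
  show "f (sum a S) = (\<Sum>i\<in>S. f (a i))"
    by (induction S rule: infinite_finite_induct) (auto simp: z add)
  show "f (of_int m) = of_int m" using c[of "of_int m"] by (simp add: cst_of_int)
  show "f (of_nat n) = of_nat n" using c[of "of_nat n"] by (simp add: cst_of_nat)
  show "f (numeral w) = numeral w" using c[of "numeral w"] by (simp add: cst_numeral)
qed

lemma ahom_prod:
  fixes f :: "'a::{complex_alg,comm_ring_1} \<Rightarrow> 'b::{complex_alg,comm_ring_1}"
  assumes "ahom f" shows "f (prod a S) = (\<Prod>i\<in>S. f (a i))"
  by (induction S rule: infinite_finite_induct) (auto simp: ahomD[OF assms])

lemma map_fps_nth [simp]: "fps_nth (map_fps f a) n = f (fps_nth a n)"
  by (simp add: map_fps_def)

lemma ahom_map_fps: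
  assumes "ahom f" shows "ahom (map_fps f)"
  unfolding ahom_def by (auto simp: fps_eq_iff cst_fps_def fps_mult_nth ahomD[OF assms])

lemma ahom_fps_const: "ahom fps_const"
  by (auto simp: ahom_def cst_fps_def)

lemma ahom_cst: "ahom cst"
  by (auto simp: ahom_def cst_add cst_mult)

lemma ahom_compose: "ahom f \<Longrightarrow> ahom g \<Longrightarrow> ahom (\<lambda>x. f (g x))"
  by (simp add: ahom_def)

subsection \<open>Monoid algebras\<close>

lemma poly_mapping_single_induct [case_names zero single add]:
  assumes "P 0" "\<And>k v. P (Poly_Mapping.single k v)" "\<And>f g. P f \<Longrightarrow> P g \<Longrightarrow> P (f + g)"
  shows "P (f :: 'a \<Rightarrow>\<^sub>0 'b::monoid_add)"
proof (induction f rule: update_induct)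
  case (update f k v)
  have "Poly_Mapping.update k v f = f + Poly_Mapping.single k v"
    using update.hyps(1)
    by (intro poly_mapping_eqI)
      (auto simp: Poly_Mapping.lookup_update lookup_add lookup_single when_def in_keys_iff)
  then show ?case using assms update by simp
qed (use assms in auto)

text \<open>The linear extension of \<open>\<chi>\<close> from a monoid to its monoid algebra. Words give homomorphisms out of free
  algebras, integers give evaluations of Laurent polynomials.\<close>

definition mono_lift :: "('m \<Rightarrow> 'b::complex_alg) \<Rightarrow> ('m \<Rightarrow>\<^sub>0 complex) \<Rightarrow> 'b"
  where "mono_lift \<chi> p = (\<Sum>k\<in>Poly_Mapping.keys p. cst (Poly_Mapping.lookup p k) * \<chi> k)"

lemma mono_lift_superset:
  assumes "finite S" "Poly_Mapping.keys p \<subseteq> S"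
  shows "mono_lift \<chi> p = (\<Sum>k\<in>S. cst (Poly_Mapping.lookup p k) * \<chi> k)"
  unfolding mono_lift_def using assms
  by (intro sum.mono_neutral_left) (auto simp: in_keys_iff)

lemma mono_lift_zero [simp]: "mono_lift \<chi> 0 = 0"
  by (simp add: mono_lift_def)

lemma mono_lift_add: "mono_lift \<chi> (p + q) = mono_lift \<chi> p + mono_lift \<chi> q"
proof -
  let ?S = "Poly_Mapping.keys p \<union> Poly_Mapping.keys q"
  have "mono_lift \<chi> (p + q) = (\<Sum>k\<in>?S. cst (Poly_Mapping.lookup (p + q) k) * \<chi> k)"
    by (rule mono_lift_superset) (auto simp: in_keys_iff lookup_add)
  also have "\<dots> = (\<Sum>k\<in>?S. cst (Poly_Mapping.lookup p k) * \<chi> k) + (\<Sum>k\<in>?S. cst (Poly_Mapping.lookup q k) * \<chi> k)"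
    by (simp add: lookup_add cst_add algebra_simps sum.distrib)
  also have "\<dots> = mono_lift \<chi> p + mono_lift \<chi> q"
    by (simp add: mono_lift_superset[of ?S])
  finally show ?thesis .
qed

lemma mono_lift_single [simp]: "mono_lift \<chi> (Poly_Mapping.single k a) = cst a * \<chi> k"
  by (simp add: mono_lift_def)

lemma ahom_mono_lift:
  assumes zero: "\<chi> 0 = 1" and add: "\<And>k l. \<chi> (k + l) = \<chi> k * \<chi> l"
  shows "ahom (mono_lift \<chi>)"
proof -
  have 1: "mono_lift \<chi> (Poly_Mapping.single k a * q) = cst a * \<chi> k * mono_lift \<chi> q" for k a q
  proof (induction q rule: poly_mapping_single_induct)
    case (single l b)
    have "cst a * cst b * (\<chi> k * \<chi> l) = cst a * (cst b * \<chi> k) * \<chi> l" by (simp add: mult.assoc)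
    also have "\<dots> = cst a * \<chi> k * (cst b * \<chi> l)" by (subst cst_central) (simp add: mult.assoc)
    finally show ?case by (simp add: mult_single add cst_mult)
  qed (simp_all add: mono_lift_add algebra_simps)
  have "mono_lift \<chi> (p * q) = mono_lift \<chi> p * mono_lift \<chi> q" for p q
    by (induction p rule: poly_mapping_single_induct)
      (simp_all add: 1 mono_lift_add algebra_simps)
  then show ?thesis
    by (auto simp: ahom_def mono_lift_add cst_poly_mapping_def zero)
qed

definition free_lift :: "('x \<Rightarrow> 'b::complex_alg) \<Rightarrow> 'x free \<Rightarrow> 'b"
  where "free_lift a = mono_lift (\<lambda>w. prod_list (map a w))"

lemma ahom_free_lift: "ahom (free_lift a)"
  unfolding free_lift_def by (rule ahom_mono_lift) (auto simp: zero_list_def plus_list_def)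

lemma free_lift_gen [simp]: "free_lift a (gen x) = a x"
  by (simp add: free_lift_def gen_def)

lemma free_single_Cons: "Poly_Mapping.single (x # w) c = gen x * Poly_Mapping.single w (c::complex)"
  by (simp add: gen_def mult_single plus_list_def)

text \<open>A left-stable subspace containing \<open>1\<close> is everything: words are built by left multiplication.\<close>

lemma free_left_induct [case_names cst add gen]:
  assumes "\<And>c. P (cst c)" "\<And>f g. P f \<Longrightarrow> P g \<Longrightarrow> P (f + g)" "\<And>x f. P f \<Longrightarrow> P (gen x * f)"
  shows "P (f :: 'x free)"
proof (induction f rule: poly_mapping_single_induct)
  case zero then show ?case using assms(1)[of 0] by simp
next
  case (single w c)
  show ?case
  proof (induction w)
    case Nil
    then show ?case using assms(1)[of c] by (simp add: cst_poly_mapping_def zero_list_def)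
  qed (simp add: free_single_Cons assms(3))
qed (use assms in auto)

lemma ahom_free_eqI:
  assumes "ahom f" "ahom g" "\<And>x. f (gen x) = g (gen x)"
  shows "f (p :: 'x free) = g p"
  by (induction p rule: free_left_induct) (simp_all add: ahomD[OF assms(1)] ahomD[OF assms(2)] assms(3))

section \<open>Rings of power series in one or two central parameters\<close>

text \<open>Series in one and in two parameters need the same arguments about convergence and closures, so they
  are treated at once: \<open>mon i * con p\<close> is the monomial with coefficient \<open>p\<close>, and \<open>deg\<close> measures the
  distance to \<open>0\<close>.\<close>

locale series_ring =
  fixes con :: "'p::complex_alg \<Rightarrow> 'f::complex_alg"
    and mon :: "'i::comm_monoid_add \<Rightarrow> 'f"
    and coef :: "'f \<Rightarrow> 'i \<Rightarrow> 'p"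
    and ser :: "('i \<Rightarrow> 'p) \<Rightarrow> 'f"
    and deg :: "'i \<Rightarrow> nat"
  assumes coef_ser [simp]: "coef (ser c) = c"
    and ser_coef [simp]: "ser (coef f) = f"
    and coef_add: "coef (f + g) i = coef f i + coef g i"
    and fin_deg: "finite {i. deg i < N}"
    and mon_zero: "mon 0 = 1" and mon_add: "mon (i + j) = mon i * mon j"
    and mon_central: "mon i * f = f * mon i"
    and ahom_con: "ahom con"
    and coef_mon_con: "coef (mon i * con p) j = (if j = i then p else 0)"
    and coef_mult_eq_0: "(\<And>i. deg i < N \<Longrightarrow> coef f i = 0) \<Longrightarrow> deg j < N \<Longrightarrow> coef (g * f) j = 0"
      "(\<And>i. deg i < N \<Longrightarrow> coef f i = 0) \<Longrightarrow> deg j < N \<Longrightarrow> coef (f * g) j = 0"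
    and coef_mon_mult_eq_0: "deg j < deg i \<Longrightarrow> coef (mon i * f) j = 0"
begin

lemma coef_inject: "coef f = coef g \<Longrightarrow> f = g"
  by (metis ser_coef)

lemma coef_zero [simp]: "coef 0 i = 0"
  using coef_add[of 0 0 i] by simp

lemma coef_minus: "coef (- f) i = - coef f i"
  using coef_add[of f "- f" i] by (simp add: eq_neg_iff_add_eq_0 add.commute)

lemma coef_diff: "coef (f - g) i = coef f i - coef g i"
  using coef_add[of f "- g" i] by (simp add: coef_minus)

lemma coef_sum: "coef (sum F S) i = (\<Sum>s\<in>S. coef (F s) i)"
  by (induction S rule: infinite_finite_induct) (auto simp: coef_add)

definition eqv :: "nat \<Rightarrow> 'f \<Rightarrow> 'f \<Rightarrow> bool"
  where "eqv N f g \<longleftrightarrow> (\<forall>i. deg i < N \<longrightarrow> coef f i = coef g i)"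

lemma eqv_refl [simp]: "eqv N f f"
  and eqv_sym: "eqv N f g \<Longrightarrow> eqv N g f"
  and eqv_trans: "eqv N f g \<Longrightarrow> eqv N g k \<Longrightarrow> eqv N f k"
  and eqv_add: "eqv N f g \<Longrightarrow> eqv N f' g' \<Longrightarrow> eqv N (f + f') (g + g')"
  by (auto simp: eqv_def coef_add)

lemma eqv_diff_0: "eqv N f g \<longleftrightarrow> eqv N (f - g) 0"
  by (auto simp: eqv_def coef_diff)

lemma eqv_mult:
  assumes "eqv N f g" "eqv N f' g'"
  shows "eqv N (f * f') (g * g')"
proof -
  have "coef ((f - g) * f') i = 0" if "deg i < N" for i
    using assms by (intro coef_mult_eq_0(2)[OF _ that]) (auto simp: coef_diff eqv_def)
  moreover have "coef (g * (f' - g')) i = 0" if "deg i < N" for i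
    using assms by (intro coef_mult_eq_0(1)[OF _ that]) (auto simp: coef_diff eqv_def)
  ultimately have "eqv N ((f - g) * f') 0" "eqv N (g * (f' - g')) 0" by (auto simp: eqv_def)
  then have "eqv N ((f - g) * f' + g * (f' - g')) (0 + 0)" by (rule eqv_add)
  then show ?thesis by (simp add: eqv_diff_0[of N "f * f'"] algebra_simps)
qed

lemma eqv_all: "(\<And>N. eqv N f g) \<Longrightarrow> f = g"
  by (rule coef_inject) (auto simp: eqv_def)

lemma eqv_mon: "N \<le> deg i \<Longrightarrow> eqv N (mon i * f) 0"
  by (auto simp: eqv_def coef_mon_mult_eq_0)

lemma eqv_expand: "eqv N f (\<Sum>i | deg i < N. mon i * con (coef f i))"
  by (auto simp: eqv_def coef_sum coef_mon_con fin_deg)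

text \<open>The convergent sum \<open>\<Sum>\<^sub>i mon i * b i\<close>: only the terms with \<open>deg i \<le> deg n\<close> contribute to the
  coefficient with index \<open>n\<close>.\<close>

definition join :: "('i \<Rightarrow> 'f) \<Rightarrow> 'f"
  where "join b = ser (\<lambda>n. coef (\<Sum>i | deg i \<le> deg n. mon i * b i) n)"

lemma fin_deg': "finite {i. deg i \<le> N}"
  using fin_deg[of "Suc N"] by (simp add: less_Suc_eq_le)

lemma join_eqv: "eqv N (join b) (\<Sum>i | deg i < N. mon i * b i)"
  unfolding eqv_def join_def coef_ser
proof (intro allI impI)
  fix n assume n: "deg n < N"
  have "(\<Sum>i | deg i < N. coef (mon i * b i) n) = (\<Sum>i | deg i \<le> deg n. coef (mon i * b i) n)"
    using n by (intro sum.mono_neutral_right fin_deg) (auto intro: coef_mon_mult_eq_0)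
  then show "coef (\<Sum>i | deg i \<le> deg n. mon i * b i) n = coef (\<Sum>i | deg i < N. mon i * b i) n"
    by (simp add: coef_sum)
qed

lemma join_unique: "(\<And>N. eqv N f (\<Sum>i | deg i < N. mon i * b i)) \<Longrightarrow> f = join b"
  by (rule eqv_all, rule eqv_trans[OF _ eqv_sym[OF join_eqv]])

lemma join_con: "join (\<lambda>i. con (c i)) = ser c"
  by (rule sym, rule join_unique) (use eqv_expand[of _ "ser c"] in simp)

lemma join_coef: "f = join (\<lambda>i. con (coef f i))"
  by (simp add: join_con)

lemma join_add: "join b + join c = join (\<lambda>i. b i + c i)"
  by (rule join_unique) (use eqv_add[OF join_eqv join_eqv] in \<open>auto simp: distrib_left sum.distrib\<close>)

lemma join_mult_left: "a * join b = join (\<lambda>i. a * b i)"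
proof (rule join_unique)
  fix N
  have "mon i * (a * b i) = a * (mon i * b i)" for i by (metis mon_central mult.assoc)
  then show "eqv N (a * join b) (\<Sum>i | deg i < N. mon i * (a * b i))"
    using eqv_mult[OF eqv_refl join_eqv, of N a b] by (simp add: sum_distrib_left)
qed

lemma join_mult_right: "join b * a = join (\<lambda>i. b i * a)"
proof (rule join_unique)
  fix N
  show "eqv N (join b * a) (\<Sum>i | deg i < N. mon i * (b i * a))"
    using eqv_mult[OF join_eqv eqv_refl, of N b a] by (simp add: sum_distrib_right mult.assoc)
qed

definition clos :: "'f set \<Rightarrow> 'f set"
  where "clos S = {x. \<forall>N. \<exists>s\<in>S. eqv N x s}"

lemma subset_clos: "S \<subseteq> clos S"
  by (auto simp: clos_def intro: eqv_refl)

lemma ideal_clos: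
  assumes "ideal I (type_ring :: 'f ring)"
  shows "ideal (clos I) (type_ring :: 'f ring)"
proof -
  have I: "0 \<in> I" "\<And>x y. x \<in> I \<Longrightarrow> y \<in> I \<Longrightarrow> x + y \<in> I" "\<And>a x. x \<in> I \<Longrightarrow> a * x \<in> I" "\<And>a x. x \<in> I \<Longrightarrow> x * a \<in> I"
    using assms unfolding ideal_type_ring_iff by blast+
  have "x + y \<in> clos I" if xy: "x \<in> clos I" "y \<in> clos I" for x y
    unfolding clos_def
  proof (intro CollectI allI)
    fix N
    obtain s t where "s \<in> I" "t \<in> I" "eqv N x s" "eqv N y t"
      using xy unfolding clos_def by blast
    then show "\<exists>s\<in>I. eqv N (x + y) s" using I(2) eqv_add by blast
  qed
  moreover have "a * x \<in> clos I" "x * a \<in> clos I" if x: "x \<in> clos I" for a x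
  proof -
    have "\<exists>s\<in>I. eqv N (a * x) s" "\<exists>s\<in>I. eqv N (x * a) s" for N
    proof -
      obtain s where "s \<in> I" "eqv N x s" using x unfolding clos_def by blast
      then show "\<exists>s\<in>I. eqv N (a * x) s" "\<exists>s\<in>I. eqv N (x * a) s"
        using I(3)[of s a] I(4)[of s a] eqv_mult[OF eqv_refl[of N a]] eqv_mult[OF _ eqv_refl[of N a]] by blast+
    qed
    then show "a * x \<in> clos I" "x * a \<in> clos I" by (auto simp: clos_def)
  qed
  moreover have "0 \<in> clos I" using I(1) subset_clos by blast
  ultimately show ?thesis unfolding ideal_type_ring_iff by blast
qed

text \<open>An element of the closure is an element of \<open>I\<close> up to any given order, and up to that order the sum
  is finite.\<close>

lemma join_clos:
  assumes "ideal I (type_ring :: 'f ring)" and b: "\<And>i. b i \<in> clos I"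
  shows "join b \<in> clos I"
  unfolding clos_def
proof (intro CollectI allI)
  fix N
  have cl: "0 \<in> clos I" "\<And>x y. x \<in> clos I \<Longrightarrow> y \<in> clos I \<Longrightarrow> x + y \<in> clos I" "\<And>a x. x \<in> clos I \<Longrightarrow> a * x \<in> clos I"
    using ideal_clos[OF assms(1)] unfolding ideal_type_ring_iff by blast+
  have "(\<Sum>i\<in>S. mon i * b i) \<in> clos I" for S
    by (induction S rule: infinite_finite_induct) (auto intro: cl b)
  then obtain s where "s \<in> I" "eqv N (\<Sum>i | deg i < N. mon i * b i) s" by (auto simp: clos_def)
  then show "\<exists>s\<in>I. eqv N (join b) s" using join_eqv eqv_trans by blast
qed

end

text \<open>A homomorphism defined on coefficients extends to series, continuously and compatibly with the
  parameters.\<close>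

locale series_ext =
  A: series_ring conA monA coefA serA deg + B: series_ring conB monB coefB serB deg
  for conA :: "'p::complex_alg \<Rightarrow> 'f::complex_alg" and monA :: "'i::comm_monoid_add \<Rightarrow> 'f" and coefA serA
    and conB :: "'q::complex_alg \<Rightarrow> 'g::complex_alg" and monB coefB serB and deg :: "'i \<Rightarrow> nat" +
  fixes r :: "'p \<Rightarrow> 'g"
  assumes ahom_r: "ahom r"
begin

definition ext :: "'f \<Rightarrow> 'g"
  where "ext f = B.join (\<lambda>i. r (coefA f i))"

lemma ext_add: "ext (f + g) = ext f + ext g"
  by (simp add: ext_def B.join_add A.coef_add ahomD[OF ahom_r])

lemma ext_zero: "ext 0 = 0"
  using ext_add[of 0 0] by simp

lemma ext_sum: "ext (sum F S) = (\<Sum>s\<in>S. ext (F s))"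
  by (induction S rule: infinite_finite_induct) (auto simp: ext_add ext_zero)

lemma ext_eqv: "A.eqv N f g \<Longrightarrow> B.eqv N (ext f) (ext g)"
  using B.join_eqv[of N "\<lambda>i. r (coefA f i)"] B.join_eqv[of N "\<lambda>i. r (coefA g i)"]
  by (auto simp: B.eqv_def A.eqv_def ext_def B.coef_sum)

lemma ext_mon_con: "ext (monA i * conA p) = monB i * r p"
proof (rule B.eqv_all)
  fix N
  have *: "(\<Sum>j | deg j < N. monB j * r (coefA (monA i * conA p) j)) = (if deg i < N then monB i * r p else 0)"
    using A.fin_deg[of N]
    by (simp add: A.coef_mon_con if_distrib[of r] if_distrib[of "(*) (monB _)"] ahomD[OF ahom_r] cong: if_cong)
  show "B.eqv N (ext (monA i * conA p)) (monB i * r p)"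
    using B.join_eqv[of N "\<lambda>j. r (coefA (monA i * conA p) j)"] B.eqv_mon[of N i "r p"]
    unfolding * ext_def by (cases "deg i < N") (auto intro: B.eqv_trans B.eqv_sym)
qed

lemma ext_con: "ext (conA p) = r p"
  using ext_mon_con[of 0 p] by (simp add: A.mon_zero B.mon_zero)

lemma ext_mult: "ext (f * g) = ext f * ext g"
proof (rule B.eqv_all)
  fix N
  let ?S = "{i. deg i < N}"
  let ?t = "\<lambda>f. \<Sum>i\<in>?S. monA i * conA (coefA f i)"
  have t: "ext (?t f) = (\<Sum>i\<in>?S. monB i * r (coefA f i))" for f
    by (simp add: ext_sum ext_mon_con)
  have m: "monA i * conA p * (monA j * conA q) = monA (i + j) * conA (p * q)" for i j p q
  proof -
    have "conA p * (monA j * conA q) = monA j * (conA p * conA q)"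
      by (simp add: mult.assoc[symmetric] A.mon_central[of j "conA p", symmetric])
    then show ?thesis by (simp add: A.mon_add ahomD(3)[OF A.ahom_con] mult.assoc)
  qed
  have m': "monB (i + j) * r (p * q) = monB i * r p * (monB j * r q)" for i j p q
  proof -
    have "r p * (monB j * r q) = monB j * (r p * r q)"
      by (simp add: mult.assoc[symmetric] B.mon_central[of j "r p", symmetric])
    then show ?thesis by (simp add: B.mon_add ahomD(3)[OF ahom_r] mult.assoc)
  qed
  have "B.eqv N (ext (f * g)) (ext (?t f * ?t g))"
    by (intro ext_eqv A.eqv_mult A.eqv_expand)
  also have "ext (?t f * ?t g) = ext (?t f) * ext (?t g)"
    unfolding t by (simp add: sum_product ext_sum m m' ext_mon_con)
  finally have "B.eqv N (ext (f * g)) (ext (?t f) * ext (?t g))" .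
  moreover have "B.eqv N (ext (?t f) * ext (?t g)) (ext f * ext g)"
    by (intro B.eqv_mult ext_eqv A.eqv_sym[OF A.eqv_expand])
  ultimately show "B.eqv N (ext (f * g)) (ext f * ext g)" by (rule B.eqv_trans)
qed

lemma ahom_ext: "ahom ext"
proof -
  have "ext (cst c) = cst c" for c
    using ext_con[of "cst c"] by (simp add: ahomD[OF A.ahom_con] ahomD[OF ahom_r])
  then show ?thesis by (auto simp: ahom_def ext_add ext_mult)
qed

lemma ext_ser:
  assumes "\<And>i. r (coefA f i) = conB (e i)"
  shows "ext f = serB e"
  by (simp add: ext_def assms B.join_con)

lemma ext_clos:
  assumes "\<And>s. s \<in> S \<Longrightarrow> ext s = 0" "f \<in> A.clos S"
  shows "ext f = 0"
proof (rule B.eqv_all)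
  fix N
  obtain s where "s \<in> S" "A.eqv N f s" using assms(2) by (auto simp: A.clos_def)
  then show "B.eqv N (ext f) 0" using ext_eqv[of N f s] assms(1) by simp
qed

end

interpretation fps1: series_ring fps_const "\<lambda>n. fps_X ^ n" fps_nth Abs_fps "\<lambda>n. n"
proof
  fix i j :: nat and f g :: "'a::complex_alg fps" and N :: nat
  show "fps_X ^ (i + j) = fps_X ^ i * (fps_X ^ j :: 'a fps)" by (rule power_add)
  show "fps_X ^ i * f = f * fps_X ^ i" by (metis fps_mult_fps_X_power_commute)
  show "j < i \<Longrightarrow> fps_nth (fps_X ^ i * f) j = 0" by (simp add: fps_X_power_mult_nth)
  show "(\<And>i. i < N \<Longrightarrow> fps_nth f i = 0) \<Longrightarrow> j < N \<Longrightarrow> fps_nth (g * f) j = 0"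
    "(\<And>i. i < N \<Longrightarrow> fps_nth f i = 0) \<Longrightarrow> j < N \<Longrightarrow> fps_nth (f * g) j = 0"
    by (auto simp: fps_mult_nth intro!: sum.neutral)
  show "fps_nth (Abs_fps c) = c" for c :: "nat \<Rightarrow> 'a" by (simp add: fun_eq_iff)
  show "Abs_fps (fps_nth f) = f" by (simp add: fps_eq_iff)
  show "finite {i. i < N}" by simp
  show "fps_nth (f + g) i = fps_nth f i + fps_nth g i" by simp
  show "fps_X ^ 0 = (1 :: 'a fps)" by simp
  show "ahom (fps_const :: 'a \<Rightarrow> 'a fps)" by (rule ahom_fps_const)
  show "fps_nth (fps_X ^ i * fps_const p) j = (if j = i then p else 0)" for p :: 'a
    by (auto simp: fps_X_power_mult_nth)
qed

interpretation fps2: series_ring "\<lambda>p. fps_const (fps_const p)" "\<lambda>(k, i). fps_X ^ k * fps_const (fps_X ^ i)"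
    "\<lambda>f (k, i). fps_nth (fps_nth f k) i" "\<lambda>c. Abs_fps (\<lambda>k. Abs_fps (\<lambda>i. c (k, i)))" "\<lambda>(k, i). k + i"
proof
  fix i j :: "nat \<times> nat" and f g :: "'a::complex_alg fps fps" and N :: nat
  let ?mon = "\<lambda>(k, i). fps_X ^ k * fps_const (fps_X ^ i :: 'a fps)"
  have X: "fps_const (fps_X ^ n) * f = f * fps_const (fps_X ^ n)" for n and f :: "'a fps fps"
    by (simp add: fps_eq_iff fps_mult_fps_X_power_commute)
  have X': "fps_X ^ n * f = f * fps_X ^ n" for n and f :: "'a fps fps"
    by (metis fps_mult_fps_X_power_commute)
  show "?mon i * f = f * ?mon i"
    by (cases i) (metis (mono_tags, lifting) X X' case_prod_conv mult.assoc)
  show "?mon (i + j) = ?mon i * ?mon j"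
  proof (cases i; cases j)
    fix a b c d assume "i = (a, b)" "j = (c, d)"
    moreover have "fps_const (fps_X ^ b) * (fps_X ^ c * fps_const (fps_X ^ d)) =
        fps_X ^ c * (fps_const (fps_X ^ b :: 'a fps) * fps_const (fps_X ^ d))"
      by (simp only: mult.assoc[symmetric] X[of b "fps_X ^ c"])
    ultimately show ?thesis by (simp add: power_add mult.assoc)
  qed
  have "{i. (case i of (k::nat, i) \<Rightarrow> k + i) < N} \<subseteq> {..<N} \<times> {..<N}" by auto
  then show "finite {i. (case i of (k, i) \<Rightarrow> k + i) < N}"
    by (rule finite_subset) auto
  show "(case j of (k, l) \<Rightarrow> fps_nth (fps_nth (?mon i * fps_const (fps_const p)) k) l) = (if j = i then p else 0)" for p
    by (cases i; cases j) (auto simp: fps_X_power_mult_nth mult.assoc fps_const_mult simp del: fps_const_mult[symmetric])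
  show "(case j of (k, l) \<Rightarrow> k + l) < (case i of (k, l) \<Rightarrow> k + l) \<Longrightarrow>
      (case j of (k, l) \<Rightarrow> fps_nth (fps_nth (?mon i * f) k) l) = 0"
    by (cases i; cases j) (auto simp: fps_X_power_mult_nth mult.assoc)
  show "(case j of (k, l) \<Rightarrow> fps_nth (fps_nth (g * f) k) l) = 0"
    "(case j of (k, l) \<Rightarrow> fps_nth (fps_nth (f * g) k) l) = 0"
    if f: "\<And>i. (case i of (k, l) \<Rightarrow> k + l) < N \<Longrightarrow> (case i of (k, l) \<Rightarrow> fps_nth (fps_nth f k) l) = 0"
      and j: "(case j of (k, l) \<Rightarrow> k + l) < N"
  proof -
    obtain a b where ab: "j = (a, b)" by (cases j)
    have "fps_nth (fps_nth f k) l = 0" if "k + l < N" for k l using f[of "(k, l)"] that by simp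
    then show "(case j of (k, l) \<Rightarrow> fps_nth (fps_nth (g * f) k) l) = 0"
      "(case j of (k, l) \<Rightarrow> fps_nth (fps_nth (f * g) k) l) = 0"
      using j by (simp_all add: ab fps_mult_nth fps_sum_nth)
  qed
  show "ahom (\<lambda>p. fps_const (fps_const p :: 'a fps))"
    by (rule ahom_compose[OF ahom_fps_const ahom_fps_const])
  show "(\<lambda>(k, i). fps_nth (fps_nth (Abs_fps (\<lambda>k. Abs_fps (\<lambda>i. c (k, i)))) k) i) = c" for c :: "nat \<times> nat \<Rightarrow> 'a"
    by (simp add: fun_eq_iff)
  show "Abs_fps (\<lambda>k. Abs_fps (\<lambda>i. case (k, i) of (k, i) \<Rightarrow> fps_nth (fps_nth f k) i)) = f"
    by (simp add: fps_eq_iff)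
  show "(case i of (k, l) \<Rightarrow> fps_nth (fps_nth (f + g) k) l) =
      (case i of (k, l) \<Rightarrow> fps_nth (fps_nth f k) l) + (case i of (k, l) \<Rightarrow> fps_nth (fps_nth g k) l)"
    by (cases i) simp
  show "(case 0 of (k, i) \<Rightarrow> fps_X ^ k * fps_const (fps_X ^ i)) = (1 :: 'a fps fps)"
    by (simp add: zero_prod_def)
qed

section \<open>Linear operators on the space with basis \<open>m\<^sub>j\<close>\<close>

definition is_rep :: "('k::ring_1 \<Rightarrow> 'v::ab_group_add \<Rightarrow> 'v) \<Rightarrow> bool"
  where "is_rep A \<longleftrightarrow> (\<forall>e f v. A (e + f) v = A e v + A f v) \<and> (\<forall>e v w. A e (v + w) = A e v + A e w) \<and>
    (\<forall>e f v. A (e * f) v = A e (A f v)) \<and> (\<forall>v. A 1 v = v)"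

lemma is_repD:
  assumes "is_rep A"
  shows "A (e + f) v = A e v + A f v" "A e (v + w) = A e v + A e w" "A (e * f) v = A e (A f v)" "A 1 v = v"
    "A 0 v = 0" "A e 0 = 0" "A (- e) v = - A e v" "A (e - f) v = A e v - A f v" "A e (- v) = - A e v"
    "A e (v - w) = A e v - A e w"
    "A (sum a S) v = (\<Sum>i\<in>S. A (a i) v)" "A e (sum b S) = (\<Sum>i\<in>S. A e (b i))"
proof -
  show add: "A (e + f) v = A e v + A f v" and add': "A e (v + w) = A e v + A e w"
    and "A (e * f) v = A e (A f v)" "A 1 v = v" for e f v w
    using assms by (auto simp: is_rep_def)
  show z: "A 0 v = 0" "A e 0 = 0" for e v using add[of 0 0 v] add'[of e 0 0] by auto
  show n: "A (- e) v = - A e v" "A e (- v) = - A e v" for e v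
    using add[of e "- e" v] add'[of e v "- v"] z by (auto simp: eq_neg_iff_add_eq_0 add.commute)
  show "A (e - f) v = A e v - A f v" "A e (v - w) = A e v - A e w"
    using add[of e "- f" v] add'[of e v "- w"] n by auto
  show "A (sum a S) v = (\<Sum>i\<in>S. A (a i) v)" "A e (sum b S) = (\<Sum>i\<in>S. A e (b i))"
    by (induction S rule: infinite_finite_induct) (auto simp: z add add')
qed

lemma fps_scale_nth: "fps_nth (fps_scale s c v) n = (\<Sum>i\<le>n. s (fps_nth c i) (fps_nth v (n - i)))"
  by (simp add: fps_scale_def)

lemma is_rep_fps_scale:
  assumes s: "is_rep s" shows "is_rep (fps_scale s)"
  unfolding is_rep_def
proof (intro conjI allI)
  note S = is_repD[OF s]
  show "fps_scale s (e + f) v = fps_scale s e v + fps_scale s f v"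
    "fps_scale s e (v + w) = fps_scale s e v + fps_scale s e w" for e f v w
    by (simp_all add: fps_eq_iff fps_scale_nth S sum.distrib)
  show "fps_scale s 1 v = v" for v
  proof (rule fps_ext)
    fix n
    have "(\<Sum>i\<le>n. s (fps_nth 1 i) (fps_nth v (n - i))) = (\<Sum>i\<le>n. if i = 0 then fps_nth v n else 0)"
      by (intro sum.cong) (auto simp: S)
    then show "fps_nth (fps_scale s 1 v) n = fps_nth v n" by (simp add: fps_scale_nth)
  qed
  show "fps_scale s (e * f) v = fps_scale s e (fps_scale s f v)" for e f v
  proof (rule fps_ext)
    fix n
    have "fps_nth (fps_scale s (e * f) v) n =
        (\<Sum>j=0..n. \<Sum>i=0..j. s (fps_nth e i) (s (fps_nth f (j - i)) (fps_nth v (n - j))))"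
      by (simp add: fps_scale_nth fps_mult_nth S atMost_atLeast0)
    also have "\<dots> = (\<Sum>j=0..n. \<Sum>i=0..n - j. s (fps_nth e j) (s (fps_nth f i) (fps_nth v (n - j - i))))"
      by (rule fps_mult_assoc_lemma[of "\<lambda>i j k. s (fps_nth e i) (s (fps_nth f j) (fps_nth v k))"])
    also have "\<dots> = fps_nth (fps_scale s e (fps_scale s f v)) n"
      by (simp add: fps_scale_nth S atMost_atLeast0)
    finally show "fps_nth (fps_scale s (e * f) v) n = fps_nth (fps_scale s e (fps_scale s f v)) n" .
  qed
qed

lemma fps_scale_const:
  assumes "\<And>v. s 0 v = 0"
  shows "fps_nth (fps_scale s (fps_const c) v) n = s c (fps_nth v n)"
proof -
  have "(\<Sum>i\<le>n. s (fps_nth (fps_const c) i) (fps_nth v (n - i))) = (\<Sum>i\<le>n. if i = 0 then s c (fps_nth v n) else 0)"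
    by (intro sum.cong) (auto simp: assms)
  then show ?thesis by (simp add: fps_scale_nth)
qed

type_synonym basis_space = "nat \<Rightarrow>\<^sub>0 complex"

lemma lookup_scale_sum [simp]: "Poly_Mapping.lookup (scale_sum c x) j = c * Poly_Mapping.lookup x j"
  by (simp add: scale_sum_def Poly_Mapping.map.rep_eq when_def)

text \<open>The linear endomorphisms form an algebra, so that homomorphisms from free algebras into it are
  available; as a type they can be coefficients of power series.\<close>

typedef endo = "{f :: basis_space \<Rightarrow> basis_space. (\<forall>x y. f (x + y) = f x + f y) \<and>
    (\<forall>c x. f (scale_sum c x) = scale_sum c (f x))}"
  morphisms app Endo
  by (rule exI[of _ "\<lambda>x. x"]) simp

setup_lifting type_definition_endo

lemma app_add: "app e (x + y) = app e x + app e y"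
  using app[of e] by auto

lemma endo_eqI: "(\<And>x. app e x = app f x) \<Longrightarrow> e = f"
  by (simp add: app_inject[symmetric] fun_eq_iff)

lemma scale_sum_simps:
  "scale_sum c (x + y) = scale_sum c x + scale_sum c y" "scale_sum c (- x) = - scale_sum c x"
  "scale_sum c (x - y) = scale_sum c x - scale_sum c y" "scale_sum c 0 = 0"
  "scale_sum (a + b) x = scale_sum a x + scale_sum b x" "scale_sum (a * b) x = scale_sum a (scale_sum b x)"
  "scale_sum 1 x = x"
  by (auto intro!: poly_mapping_eqI simp: lookup_add lookup_minus algebra_simps)

lemma scale_sum_commute: "scale_sum a (scale_sum b x) = scale_sum b (scale_sum a x)"
  by (auto intro!: poly_mapping_eqI)

instantiation endo :: complex_alg
begin
lift_definition zero_endo :: endo is "\<lambda>x. 0" by (simp add: scale_sum_simps)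
lift_definition one_endo :: endo is "\<lambda>x. x" by simp
lift_definition plus_endo :: "endo \<Rightarrow> endo \<Rightarrow> endo" is "\<lambda>f g x. f x + g x"
  by (simp add: scale_sum_simps algebra_simps)
lift_definition minus_endo :: "endo \<Rightarrow> endo \<Rightarrow> endo" is "\<lambda>f g x. f x - g x"
  by (simp add: scale_sum_simps algebra_simps)
lift_definition uminus_endo :: "endo \<Rightarrow> endo" is "\<lambda>f x. - f x"
  by (simp add: scale_sum_simps algebra_simps)
lift_definition times_endo :: "endo \<Rightarrow> endo \<Rightarrow> endo" is "\<lambda>f g x. f (g x)"
  by simp
lift_definition cst_endo :: "complex \<Rightarrow> endo" is "\<lambda>c x. scale_sum c x"
  by (simp add: scale_sum_simps scale_sum_commute)
instance
proof
  fix a b c :: endo and z w :: complex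
  show "a + b + c = a + (b + c)" "a + b = b + a" "0 + a = a" "- a + a = 0" "a - b = a + - b"
    "a * b * c = a * (b * c)" "1 * a = a" "a * 1 = a" "(a + b) * c = a * c + b * c"
    "cst 1 = (1::endo)" "cst (z + w) = (cst z + cst w :: endo)" "cst (z * w) = (cst z * cst w :: endo)"
    by (transfer; simp add: fun_eq_iff algebra_simps scale_sum_simps)+
  show "a * (b + c) = a * b + a * c" "cst z * a = a * cst z"
    by (transfer; simp add: fun_eq_iff)+
  show "(0::endo) \<noteq> 1"
  proof
    assume "(0::endo) = 1"
    then have "app 0 (Poly_Mapping.single 0 1) = app 1 (Poly_Mapping.single 0 1)" by simp
    then have "(0::basis_space) = Poly_Mapping.single 0 1" by (simp add: zero_endo.rep_eq one_endo.rep_eq)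
    then show False by (metis lookup_single_eq lookup_zero zero_neq_one)
  qed
qed
end

lemma is_rep_app: "is_rep app"
  by (simp add: is_rep_def plus_endo.rep_eq times_endo.rep_eq one_endo.rep_eq app_add)

lemma app_cst: "app (cst c) = scale_sum c"
  by (simp add: cst_endo.rep_eq fun_eq_iff)

lift_definition mul_seq :: "(nat \<Rightarrow> complex) \<Rightarrow> basis_space \<Rightarrow> basis_space" is "\<lambda>d f j. d j * f j"
  by (rule finite_subset[rotated], assumption) auto

lift_definition shift_up :: "basis_space \<Rightarrow> basis_space" is "\<lambda>f j. if j = 0 then 0 else f (j - 1)"
proof -
  fix f :: "nat \<Rightarrow> complex" assume "finite {j. f j \<noteq> 0}"
  then show "finite {j. (if j = 0 then 0 else f (j - 1)) \<noteq> 0}"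
    by (rule finite_subset[rotated, OF finite_imageI[of _ Suc]]) (auto simp: image_iff gr0_conv_Suc)
qed

lift_definition shift_down :: "basis_space \<Rightarrow> basis_space" is "\<lambda>f j. f (Suc j)"
proof -
  fix f :: "nat \<Rightarrow> complex" assume "finite {j. f j \<noteq> 0}"
  then have "finite (Suc -` {j. f j \<noteq> 0})" by (rule finite_vimageI) simp
  then show "finite {j. f (Suc j) \<noteq> 0}" by (simp add: vimage_def)
qed

lift_definition diag :: "(nat \<Rightarrow> complex) \<Rightarrow> endo" is mul_seq
  by (auto intro!: poly_mapping_eqI simp: mul_seq.rep_eq lookup_add algebra_simps)
lift_definition up :: endo is shift_up
  by (auto intro!: poly_mapping_eqI simp: shift_up.rep_eq lookup_add algebra_simps)
lift_definition down :: endo is shift_down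
  by (auto intro!: poly_mapping_eqI simp: shift_down.rep_eq lookup_add algebra_simps)

lemma lookup_app [simp]:
  "Poly_Mapping.lookup (app (diag d) x) j = d j * Poly_Mapping.lookup x j"
  "Poly_Mapping.lookup (app up x) j = (if j = 0 then 0 else Poly_Mapping.lookup x (j - 1))"
  "Poly_Mapping.lookup (app down x) j = Poly_Mapping.lookup x (Suc j)"
  by (simp_all add: diag.rep_eq up.rep_eq down.rep_eq mul_seq.rep_eq shift_up.rep_eq shift_down.rep_eq)

subsection \<open>Components of vectors\<close>

text \<open>The coordinates with respect to the \<open>m\<^sub>j\<close>. All operators of the proof act on coordinates by shifts
  and scalars, and identities between them are checked coordinate by coordinate.\<close>

definition comp1 :: "nat \<Rightarrow> basis_space fps \<Rightarrow> complex fps"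
  where "comp1 j = map_fps (\<lambda>x. Poly_Mapping.lookup x j)"

definition comp2 :: "nat \<Rightarrow> basis_space fps fps \<Rightarrow> complex fps fps"
  where "comp2 j = map_fps (comp1 j)"

lemma comp1_nth: "fps_nth (comp1 j v) k = Poly_Mapping.lookup (fps_nth v k) j"
  by (simp add: comp1_def)

lemma comp2_nth: "fps_nth (comp2 j v) k = comp1 j (fps_nth v k)"
  by (simp add: comp2_def)

lemma comp1_eqI: "(\<And>j. comp1 j v = comp1 j w) \<Longrightarrow> v = w"
  by (auto simp: fps_eq_iff comp1_nth intro: poly_mapping_eqI)

lemma comp2_eqI: "(\<And>j. comp2 j v = comp2 j w) \<Longrightarrow> v = w"
  by (rule fps_ext, rule comp1_eqI) (metis comp2_nth)

lemma comp1_simps: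
  "comp1 j (v + w) = comp1 j v + comp1 j w" "comp1 j (v - w) = comp1 j v - comp1 j w"
  "comp1 j (- v) = - comp1 j v" "comp1 j 0 = 0"
  by (simp_all add: fps_eq_iff comp1_nth lookup_add lookup_minus)

lemma comp1_sum: "comp1 j (sum f S) = (\<Sum>i\<in>S. comp1 j (f i))"
  by (induction S rule: infinite_finite_induct) (auto simp: comp1_simps)

lemma comp2_simps:
  "comp2 j (v + w) = comp2 j v + comp2 j w" "comp2 j (v - w) = comp2 j v - comp2 j w"
  "comp2 j (- v) = - comp2 j v" "comp2 j 0 = 0"
  by (simp_all add: fps_eq_iff[of "comp2 j _"] comp2_nth comp1_simps)

lemma finite_comp1: "finite {j. fps_nth (comp1 j v) k \<noteq> 0}"
  by (simp add: comp1_nth)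

lemma comp1_scale: "comp1 j (fps_scale scale_sum c v) = c * comp1 j v"
  by (simp add: fps_eq_iff comp1_nth fps_scale_nth fps_mult_nth lookup_sum atMost_atLeast0)

lemma comp2_scale: "comp2 j (fps_scale (fps_scale scale_sum) c v) = c * comp2 j v"
  by (rule fps_ext) (simp add: comp2_nth fps_scale_nth fps_mult_nth comp1_sum comp1_scale atMost_atLeast0)

text \<open>A family of series is the coordinate family of a vector if in each degree only finitely many of them
  contribute; for other families the value is unspecified.\<close>

definition assemble1 :: "(nat \<Rightarrow> complex fps) \<Rightarrow> basis_space fps"
  where "assemble1 f = Abs_fps (\<lambda>k. Abs_poly_mapping (\<lambda>j. fps_nth (f j) k))"

definition assemble2 :: "(nat \<Rightarrow> complex fps fps) \<Rightarrow> basis_space fps fps"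
  where "assemble2 f = Abs_fps (\<lambda>k. assemble1 (\<lambda>j. fps_nth (f j) k))"

lemma comp1_assemble1: "(\<And>k. finite {j. fps_nth (f j) k \<noteq> 0}) \<Longrightarrow> comp1 j (assemble1 f) = f j"
  by (simp add: fps_eq_iff comp1_nth assemble1_def)

lemma comp2_assemble2:
  "(\<And>k i. finite {j. fps_nth (fps_nth (f j) k) i \<noteq> 0}) \<Longrightarrow> comp2 j (assemble2 f) = f j"
  by (rule fps_ext) (simp add: comp2_nth assemble2_def comp1_assemble1)

abbreviation act1 :: "endo fps \<Rightarrow> basis_space fps \<Rightarrow> basis_space fps"
  where "act1 \<equiv> fps_scale app"

abbreviation act2 :: "endo fps fps \<Rightarrow> basis_space fps fps \<Rightarrow> basis_space fps fps"
  where "act2 \<equiv> fps_scale (fps_scale app)"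

lemmas is_rep_act1 = is_rep_fps_scale[OF is_rep_app]
lemmas is_rep_act2 = is_rep_fps_scale[OF is_rep_act1]

definition diag1 :: "(nat \<Rightarrow> complex fps) \<Rightarrow> endo fps"
  where "diag1 c = Abs_fps (\<lambda>i. diag (\<lambda>j. fps_nth (c j) i))"

definition diag2 :: "(nat \<Rightarrow> complex fps fps) \<Rightarrow> endo fps fps"
  where "diag2 c = Abs_fps (\<lambda>k. diag1 (\<lambda>j. fps_nth (c j) k))"

lemma comp1_act1:
  "comp1 j (act1 (diag1 c) v) = c j * comp1 j v"
  "comp1 j (act1 (fps_const up) v) = (if j = 0 then 0 else comp1 (j - 1) v)"
  "comp1 j (act1 (fps_const down) v) = comp1 (Suc j) v"
  "comp1 j (act1 (map_fps cst a) v) = a * comp1 j v"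
  "comp1 j (act1 (cst z) v) = cst z * comp1 j v"
proof -
  note c = fps_scale_const[of app, OF is_repD(5)[OF is_rep_app]]
  show "comp1 j (act1 (diag1 c) v) = c j * comp1 j v"
    "comp1 j (act1 (map_fps cst a) v) = a * comp1 j v"
    by (simp_all add: fps_eq_iff comp1_nth fps_scale_nth fps_mult_nth lookup_sum atMost_atLeast0 diag1_def app_cst)
  show "comp1 j (act1 (fps_const up) v) = (if j = 0 then 0 else comp1 (j - 1) v)"
    "comp1 j (act1 (fps_const down) v) = comp1 (Suc j) v"
    "comp1 j (act1 (cst z) v) = cst z * comp1 j v"
    by (simp_all add: fps_eq_iff comp1_nth c cst_fps_def app_cst)
qed

lemma comp2_act2:
  "comp2 j (act2 (diag2 c) v) = c j * comp2 j v"
  "comp2 j (act2 (fps_const (fps_const up)) v) = (if j = 0 then 0 else comp2 (j - 1) v)"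
  "comp2 j (act2 (fps_const (fps_const down)) v) = comp2 (Suc j) v"
  "comp2 j (act2 (map_fps (map_fps cst) a) v) = a * comp2 j v"
  "comp2 j (act2 (cst z) v) = cst z * comp2 j v"
proof -
  note c = fps_scale_const[of act1, OF is_repD(5)[OF is_rep_act1]]
  show "comp2 j (act2 (diag2 c) v) = c j * comp2 j v"
    "comp2 j (act2 (map_fps (map_fps cst) a) v) = a * comp2 j v"
    by (rule fps_ext; simp add: comp2_nth fps_scale_nth fps_mult_nth comp1_sum atMost_atLeast0 diag2_def comp1_act1)+
  show "comp2 j (act2 (fps_const (fps_const up)) v) = (if j = 0 then 0 else comp2 (j - 1) v)"
    "comp2 j (act2 (fps_const (fps_const down)) v) = comp2 (Suc j) v"
    "comp2 j (act2 (cst z) v) = cst z * comp2 j v"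
    by (rule fps_ext; simp add: comp2_nth c comp1_act1 cst_fps_def[where 'a="endo fps"]
        cst_fps_def[where 'a="complex fps"])+
qed

lemma act1_const: "fps_nth (act1 e (fps_const x)) n = app (fps_nth e n) x"
proof -
  have "(\<Sum>i\<le>n. app (fps_nth e i) (fps_nth (fps_const x) (n - i))) = (\<Sum>i\<le>n. if i = n then app (fps_nth e n) x else 0)"
    by (intro sum.cong) (auto simp: is_repD[OF is_rep_app])
  then show ?thesis by (simp add: fps_scale_nth)
qed

lemma act2_const: "fps_nth (act2 e (fps_const x)) n = act1 (fps_nth e n) x"
proof -
  have "(\<Sum>i\<le>n. act1 (fps_nth e i) (fps_nth (fps_const x) (n - i))) = (\<Sum>i\<le>n. if i = n then act1 (fps_nth e n) x else 0)"
    by (intro sum.cong) (auto simp: is_repD[OF is_rep_act1])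
  then show ?thesis by (simp add: fps_scale_nth)
qed

text \<open>Relations between operators thus follow from relations between coordinates.\<close>

lemma act1_faithful:
  assumes "\<And>j v. comp1 j (act1 e v) = comp1 j (act1 f v)" shows "e = f"
proof (intro fps_ext endo_eqI)
  fix n x
  have "act1 e (fps_const x) = act1 f (fps_const x)" by (rule comp1_eqI) (rule assms)
  then show "app (fps_nth e n) x = app (fps_nth f n) x" by (metis act1_const)
qed

lemma act2_faithful:
  assumes "\<And>j v. comp2 j (act2 e v) = comp2 j (act2 f v)" shows "e = f"
proof (rule fps_ext, rule act1_faithful)
  fix n j v
  have "act2 e (fps_const v) = act2 f (fps_const v)" by (rule comp2_eqI) (rule assms)
  then show "comp1 j (act1 (fps_nth e n) v) = comp1 j (act1 (fps_nth f n) v)" by (metis act2_const)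
qed

section \<open>Exponential series, Taylor expansion and quotients of hyperbolic sines\<close>

lemma cst_fps_nth: "fps_nth (cst c) n = (if n = 0 then cst c else 0)"
  by (simp add: cst_fps_def)

lemma cst_mult_fps_nth [simp]: "fps_nth (cst c * f) n = cst c * fps_nth f n"
  by (simp add: cst_fps_def)

lemma fexp_nth: "fps_nth (fexp x) k = cst (1 / fact k) * x ^ k"
  by (simp add: fexp_def)

lemma cst_inverse: "c \<noteq> 0 \<Longrightarrow> cst (inverse c) * cst c = (1 :: 'a::complex_alg)"
  "c \<noteq> 0 \<Longrightarrow> cst c * cst (inverse c) = (1 :: 'a::complex_alg)"
  by (simp_all flip: cst_mult)

lemma cst_inj: "cst c = (0 :: 'a::complex_alg) \<longleftrightarrow> c = 0"
proof
  assume "cst c = (0 :: 'a)"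
  then show "c = 0" using cst_inverse(1)[of c, where 'a='a] by (cases "c = 0") auto
qed simp

lemma fexp_zero [simp]: "fexp 0 = 1"
  by (auto simp: fps_eq_iff fexp_nth power_0_left)

lemma fexp_add:
  fixes x y :: "'a::{comm_ring_1,complex_alg}"
  shows "fexp (x + y) = fexp x * fexp y"
proof (rule fps_ext)
  fix n
  have c: "cst (1 / fact n) * of_nat (n choose k) = (cst (1 / fact k) * cst (1 / fact (n - k)) :: 'a)"
    if "k \<le> n" for k
    using that unfolding cst_of_nat[where 'a="'a", symmetric] cst_mult[where 'a="'a", symmetric]
    by (simp add: binomial_fact field_simps)
  have "fps_nth (fexp (x + y)) n = (\<Sum>k\<le>n. cst (1 / fact n) * of_nat (n choose k) * x ^ k * y ^ (n - k))"
    by (simp add: fexp_nth binomial_ring sum_distrib_left mult.assoc)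
  also have "\<dots> = (\<Sum>k\<le>n. cst (1 / fact k) * x ^ k * (cst (1 / fact (n - k)) * y ^ (n - k)))"
    by (intro sum.cong refl) (subst c, simp_all add: ac_simps)
  also have "\<dots> = fps_nth (fexp x * fexp y) n"
    by (simp add: fexp_nth fps_mult_nth atMost_atLeast0)
  finally show "fps_nth (fexp (x + y)) n = fps_nth (fexp x * fexp y) n" .
qed

lemma fexp_minus:
  fixes x :: "'a::{comm_ring_1,complex_alg}"
  shows "fexp x * fexp (- x) = 1"
  using fexp_add[of x "- x"] by simp

lemma map_fexp: "ahom \<theta> \<Longrightarrow> map_fps \<theta> (fexp x) = fexp (\<theta> x)"
  by (simp add: fps_eq_iff fexp_nth ahomD)

lemma fps_deriv_fexp:
  fixes x :: "'a::{comm_ring_1,complex_alg}"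
  shows "fps_deriv (fexp x) = fps_const x * fexp x"
proof (rule fps_ext)
  fix n
  have "of_nat (Suc n) * cst (1 / fact (Suc n)) = (cst (1 / fact n) :: 'a)"
    unfolding cst_of_nat[where 'a="'a", symmetric] cst_mult[where 'a="'a", symmetric]
    by (simp add: field_simps del: of_nat_Suc)
  then have "of_nat (Suc n) * (cst (1 / fact (Suc n)) * x ^ Suc n) = cst (1 / fact n) * x ^ Suc n"
    by (simp only: mult.assoc[symmetric])
  then show "fps_nth (fps_deriv (fexp x)) n = fps_nth (fps_const x * fexp x) n"
    by (simp add: fexp_nth mult.left_commute del: of_nat_Suc fact_Suc)
qed

text \<open>The divided powers of the derivation \<open>d/dt\<close>.\<close>

definition dderiv :: "nat \<Rightarrow> 'a::{comm_ring_1,complex_alg} fps \<Rightarrow> 'a fps"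
  where "dderiv k f = cst (1 / fact k) * (fps_deriv ^^ k) f"

lemma dderiv_0 [simp]: "dderiv 0 f = f"
  by (simp add: dderiv_def)

lemma dderiv_Suc: "dderiv (Suc k) f = cst (1 / of_nat (Suc k)) * fps_deriv (dderiv k f)"
proof -
  have "fps_deriv (cst c * f) = cst c * fps_deriv f" for c and f :: "'a fps"
    by (simp add: cst_fps_def)
  then show ?thesis
    by (simp add: dderiv_def mult.assoc[symmetric] cst_mult[symmetric] field_simps del: of_nat_Suc)
qed

lemma deriv_dderiv: "fps_deriv (dderiv k f) = of_nat (Suc k) * dderiv (Suc k) f"
proof -
  have "of_nat (Suc k) * cst (1 / of_nat (Suc k)) = (1 :: 'a fps)"
    unfolding cst_of_nat[where 'a="'a fps", symmetric] cst_mult[where 'a="'a fps", symmetric] by (simp del: of_nat_Suc)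
  then show ?thesis by (simp add: dderiv_Suc mult.assoc[symmetric] del: of_nat_Suc)
qed

lemma dderiv_add: "dderiv k (f + g) = dderiv k f + dderiv k g"
  by (induction k) (auto simp: dderiv_Suc algebra_simps)

lemma dderiv_cst: "dderiv (Suc k) (cst c) = 0"
  by (induction k) (auto simp: dderiv_Suc cst_fps_def)

lemma fps_deriv_sum: "fps_deriv (sum f S) = (\<Sum>i\<in>S. fps_deriv (f i :: 'a::comm_ring_1 fps))"
  by (induction S rule: infinite_finite_induct) auto

lemma dderiv_mult: "dderiv n (f * g) = (\<Sum>k\<le>n. dderiv k f * dderiv (n - k) g)"
proof (induction n)
  case (Suc n)
  let ?a = "\<lambda>k. dderiv k f" and ?b = "\<lambda>k. dderiv k g"
  have "fps_deriv (dderiv n (f * g)) =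
      (\<Sum>k\<le>n. of_nat (Suc k) * ?a (Suc k) * ?b (n - k) + of_nat (Suc n - k) * (?a k * ?b (Suc n - k)))"
    unfolding Suc.IH fps_deriv_sum
    by (intro sum.cong refl) (simp add: deriv_dderiv Suc_diff_le algebra_simps del: of_nat_Suc)
  also have "\<dots> = (\<Sum>k\<le>n. of_nat (Suc k) * ?a (Suc k) * ?b (n - k)) + (\<Sum>k\<le>Suc n. of_nat (Suc n - k) * (?a k * ?b (Suc n - k)))"
    by (simp add: sum.distrib del: of_nat_Suc)
  also have "(\<Sum>k\<le>n. of_nat (Suc k) * ?a (Suc k) * ?b (n - k)) = (\<Sum>k\<le>Suc n. of_nat k * (?a k * ?b (Suc n - k)))"
    unfolding sum.atMost_Suc_shift by (simp add: mult.assoc del: of_nat_Suc)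
  also have "\<dots> + (\<Sum>k\<le>Suc n. of_nat (Suc n - k) * (?a k * ?b (Suc n - k))) =
      of_nat (Suc n) * (\<Sum>k\<le>Suc n. ?a k * ?b (Suc n - k))"
    unfolding sum.distrib[symmetric] distrib_right[symmetric] sum_distrib_left
    by (intro sum.cong refl) (simp flip: of_nat_add)
  finally have "fps_deriv (dderiv n (f * g)) = of_nat (Suc n) * (\<Sum>k\<le>Suc n. ?a k * ?b (Suc n - k))" .
  moreover have "cst (1 / of_nat (Suc n)) * of_nat (Suc n) = (1 :: 'a fps)"
    unfolding cst_of_nat[where 'a="'a fps", symmetric] cst_mult[where 'a="'a fps", symmetric] by (simp del: of_nat_Suc)
  ultimately show ?case
    by (simp add: dderiv_Suc mult.assoc[symmetric] del: of_nat_Suc sum.atMost_Suc)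
qed simp

text \<open>Substitution of \<open>h + h' x\<close> for the variable, by Taylor's formula.\<close>

definition taylor :: "'a::{comm_ring_1,complex_alg} fps \<Rightarrow> 'a fps \<Rightarrow> 'a fps fps"
  where "taylor x f = Abs_fps (\<lambda>k. x ^ k * dderiv k f)"

lemma taylor_nth: "fps_nth (taylor x f) k = x ^ k * dderiv k f"
  by (simp add: taylor_def)

lemma ahom_taylor: "ahom (taylor x)"
proof -
  have "taylor x (cst c) = cst c" for c
  proof (rule fps_ext)
    fix n show "fps_nth (taylor x (cst c)) n = fps_nth (cst c) n"
      by (cases n) (simp_all add: taylor_nth dderiv_cst cst_fps_nth)
  qed
  moreover have "taylor x (f * g) = taylor x f * taylor x g" for f g
  proof (rule fps_ext)
    fix n
    have "x ^ n * (\<Sum>k\<le>n. dderiv k f * dderiv (n - k) g) =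
        (\<Sum>k\<le>n. x ^ k * dderiv k f * (x ^ (n - k) * dderiv (n - k) g))"
      unfolding sum_distrib_left
    proof (intro sum.cong refl)
      fix k assume "k \<in> {..n}"
      then have "x ^ n = x ^ k * x ^ (n - k)" by (simp flip: power_add)
      then show "x ^ n * (dderiv k f * dderiv (n - k) g) = x ^ k * dderiv k f * (x ^ (n - k) * dderiv (n - k) g)"
        by (simp add: ac_simps)
    qed
    then show "fps_nth (taylor x (f * g)) n = fps_nth (taylor x f * taylor x g) n"
      by (simp add: taylor_nth dderiv_mult fps_mult_nth atMost_atLeast0)
  qed
  ultimately show ?thesis
    by (auto simp: ahom_def fps_eq_iff taylor_nth dderiv_add distrib_left)
qed

lemma dderiv_fexp: "dderiv k (fexp y) = cst (1 / fact k) * fps_const y ^ k * fexp y"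
proof (induction k)
  case (Suc k)
  have "fps_deriv (cst c * fps_const y ^ k * f) = cst c * fps_const y ^ k * fps_deriv f" for c f
    by (simp add: cst_fps_def fps_const_power)
  then have "dderiv (Suc k) (fexp y) =
      cst (1 / of_nat (Suc k)) * (cst (1 / fact k) * fps_const y ^ k * (fps_const y * fexp y))"
    by (simp add: dderiv_Suc Suc fps_deriv_fexp)
  also have "\<dots> = (cst (1 / of_nat (Suc k)) * cst (1 / fact k)) * fps_const y ^ Suc k * fexp y"
    by (simp add: ac_simps del: fps_const_power)
  also have "cst (1 / of_nat (Suc k)) * cst (1 / fact k) = (cst (1 / fact (Suc k)) :: 'a fps)"
    unfolding cst_mult[symmetric] by simp
  finally show ?case .
qed simp

lemma taylor_fexp: "taylor x (fexp y) = fps_const (fexp y) * fexp (x * fps_const y)"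
  by (simp add: fps_eq_iff taylor_nth dderiv_fexp fexp_nth power_mult_distrib ac_simps)

lemma taylor_0 [simp]: "fps_nth (taylor x f) 0 = f"
  by (simp add: taylor_nth)

lemma taylor_X: "taylor x fps_X = fps_const fps_X + fps_X * fps_const x"
proof (rule fps_ext)
  fix n
  have 1: "dderiv (Suc 0) (fps_X :: 'a fps) = 1" by (simp add: dderiv_Suc)
  have "dderiv (Suc (Suc k)) (fps_X :: 'a fps) = 0" for k
    by (induction k) (simp_all add: dderiv_Suc)
  then show "fps_nth (taylor x fps_X) n = fps_nth (fps_const fps_X + fps_X * fps_const x) n"
    using 1 by (cases n; cases "n - 1") (auto simp: taylor_nth)
qed

lemma map_dderiv: "ahom \<theta> \<Longrightarrow> map_fps \<theta> (dderiv k f) = dderiv k (map_fps \<theta> f)"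
proof (induction k)
  case (Suc k)
  have "map_fps \<theta> (fps_deriv f) = fps_deriv (map_fps \<theta> f)" for f
    by (simp add: fps_eq_iff ahomD[OF Suc.prems])
  then show ?case
    using Suc by (simp add: dderiv_Suc ahomD[OF ahom_map_fps[OF Suc.prems]])
qed simp

lemma map_taylor:
  assumes "ahom \<theta>"
  shows "map_fps (map_fps \<theta>) (taylor x f) = taylor (map_fps \<theta> x) (map_fps \<theta> f)"
  by (rule fps_ext) (simp add: taylor_nth ahomD[OF ahom_map_fps[OF assms]] map_dderiv[OF assms])

text \<open>\<open>(exp(ty) - exp(-ty)) / t\<close>. Dividing by \<open>t\<close> first makes the denominator invertible in the quotient of
  hyperbolic sines, over any coefficient ring.\<close>

definition bser :: "'a::{comm_ring_1,complex_alg} \<Rightarrow> 'a fps"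
  where "bser y = Abs_fps (\<lambda>k. cst (1 / fact (Suc k)) * (y ^ Suc k - (- y) ^ Suc k))"

lemma bser_eq: "fps_X * bser y = fexp y - fexp (- y)"
proof (rule fps_ext)
  fix n show "fps_nth (fps_X * bser y) n = fps_nth (fexp y - fexp (- y)) n"
    by (cases n) (simp_all add: bser_def fexp_nth algebra_simps del: fact_Suc)
qed

lemma bser_0: "fps_nth (bser y) 0 = cst 2 * y"
  using cst_numeral[of "num.Bit0 num.One", where 'a='a] by (simp add: bser_def)

lemma map_bser: "ahom \<theta> \<Longrightarrow> map_fps \<theta> (bser y) = bser (\<theta> y)"
  by (simp add: fps_eq_iff bser_def ahomD del: fact_Suc power_Suc)

definition binv :: "complex \<Rightarrow> 'a::{comm_ring_1,complex_alg} fps"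
  where "binv d = fps_right_inverse (bser (cst d)) (cst (inverse (2 * d)))"

lemma binv: "d \<noteq> 0 \<Longrightarrow> bser (cst d) * binv d = (1 :: 'a::{comm_ring_1,complex_alg} fps)"
  unfolding binv_def by (rule fps_right_inverse) (simp add: bser_0 flip: cst_mult)

text \<open>\<open>sinh(dty) / sinh(dt)\<close>\<close>

definition qnum :: "complex \<Rightarrow> 'a::{comm_ring_1,complex_alg} \<Rightarrow> 'a fps"
  where "qnum d y = bser (cst d * y) * binv d"

lemma qnum_bser: "d \<noteq> 0 \<Longrightarrow> qnum d y * bser (cst d) = bser (cst d * y)"
  using binv[of d, where 'a='a] by (simp add: qnum_def mult.assoc mult.commute[of "binv d"])

lemma qnum_eq:
  assumes "d \<noteq> 0"
  shows "qnum d y * (fexp (cst d) - fexp (- cst d)) = fexp (cst d * y) - fexp (- (cst d * y))"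
proof -
  have "qnum d y * (fps_X * bser (cst d)) = fps_X * bser (cst d * y)"
    by (metis assms mult.left_commute qnum_bser)
  then show ?thesis by (simp add: bser_eq)
qed

lemma qnum_0: 
  assumes "d \<noteq> 0" shows "fps_nth (qnum d y) 0 = y"
proof -
  have "fps_nth (qnum d y * bser (cst d)) 0 = fps_nth (bser (cst d * y)) 0"
    by (simp only: qnum_bser[OF assms])
  then have "(cst (2 * d)) * fps_nth (qnum d y) 0 = cst (2 * d) * y"
    by (simp add: bser_0 cst_mult ac_simps)
  then have "cst (inverse (2 * d)) * cst (2 * d) * fps_nth (qnum d y) 0 = cst (inverse (2 * d)) * cst (2 * d) * y"
    by (simp only: mult.assoc)
  then show ?thesis using cst_inverse(1)[of "2 * d", where 'a='a] assms by simp
qed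

lemma bser_minus: "bser (- y) = - bser y"
  by (simp add: fps_eq_iff bser_def algebra_simps del: power_Suc)

lemma qnum_minus: "qnum d (- y) = - qnum d y"
  by (simp add: qnum_def bser_minus)

lemma qnum_unique: "d \<noteq> 0 \<Longrightarrow> z * bser (cst d) = bser (cst d * y) \<Longrightarrow> z = qnum d y"
  using binv[of d, where 'a='a] by (metis mult.assoc mult.right_neutral qnum_def)

lemma map_qnum:
  fixes \<theta> :: "'a::{comm_ring_1,complex_alg} \<Rightarrow> 'b::{comm_ring_1,complex_alg}"
  assumes \<theta>: "ahom \<theta>" and d: "d \<noteq> 0" shows "map_fps \<theta> (qnum d y) = qnum d (\<theta> y)"
proof (rule qnum_unique[OF d])
  have "map_fps \<theta> (qnum d y * bser (cst d)) = map_fps \<theta> (bser (cst d * y))"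
    by (simp only: qnum_bser[OF d])
  then show "map_fps \<theta> (qnum d y) * bser (cst d) = bser (cst d * \<theta> y)"
    by (simp add: ahomD[OF ahom_map_fps[OF \<theta>]] map_bser[OF \<theta>] ahomD[OF \<theta>])
qed

lemma exact_quot_mult: "b \<noteq> 0 \<Longrightarrow> exact_quot (c * b) b = c"
  unfolding exact_quot_def by (rule the_equality) auto

lemma fexp_diff_nonzero: "d \<noteq> 0 \<Longrightarrow> fexp (cst d) - fexp (- cst d) \<noteq> (0 :: 'a::{idom,complex_alg} fps)"
proof
  assume d: "d \<noteq> 0" and "fexp (cst d) - fexp (- cst d) = (0 :: 'a fps)"
  then have "fps_nth (fexp (cst d) - fexp (- cst d) :: 'a fps) 1 = 0" by simp
  then have "cst d + cst d = (0 :: 'a)" by (simp add: fexp_nth)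
  then have "cst (d + d) = (0 :: 'a)" by (simp only: cst_add)
  then show False using d by (simp only: cst_inj) simp
qed

section \<open>The function \<open>P\<close> and the deformed quantum numbers\<close>

lemma root_eps_cis: "root_eps g = cis (pi / g)"
  by (simp add: root_eps_def cis_conv_exp)

lemma root_eps_nz [simp]: "root_eps g \<noteq> 0"
  by (simp add: root_eps_cis)

lemma root_eps_power: "g \<ge> 1 \<Longrightarrow> root_eps g ^ g = - 1"
  by (simp add: root_eps_cis DeMoivre)

lemma root_eps_powi: "root_eps g powi m = cis (m * pi / g)"
proof (cases "m \<ge> 0")
  case True
  then obtain k where "m = int k" using nonneg_int_cases by blast
  then show ?thesis by (simp add: root_eps_cis DeMoivre)
next
  case False
  then obtain k where "m = - int k" by (metis neg_int_cases linorder_not_le)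
  then show ?thesis by (simp add: root_eps_cis DeMoivre power_int_minus flip: cis_inverse)
qed

lemma root_eps_powi_eq_1:
  assumes "g \<ge> 1" shows "root_eps g powi (2 * m) = 1 \<longleftrightarrow> int g dvd m"
proof
  assume "root_eps g powi (2 * m) = 1"
  then have "cos (real_of_int (2 * m) * pi / g) = 1"
    by (auto simp: root_eps_powi complex_eq_iff)
  then obtain k :: int where "real_of_int (2 * m) * pi / g = k * 2 * pi"
    by (auto simp: cos_one_2pi_int)
  then have "real_of_int m = real_of_int (k * int g)" using assms by (simp add: field_simps)
  then show "int g dvd m" by (metis dvd_triv_right of_int_eq_iff)
next
  assume "int g dvd m"
  then obtain k where "m = int g * k" by auto
  then have "root_eps g powi (2 * m) = ((root_eps g ^ g) ^ 2) powi k"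
    by (simp add: power_int_mult power_int_of_nat flip: power_mult) (simp add: mult.commute)
  then show "root_eps g powi (2 * m) = 1" using assms by (simp add: root_eps_power)
qed

lemma root_eps_diff:
  assumes "g \<ge> 1"
  shows "root_eps g powi m = root_eps g powi (- m) \<longleftrightarrow> int g dvd m"
proof -
  have "root_eps g powi m = root_eps g powi (- m) \<longleftrightarrow> root_eps g powi (2 * m) = 1"
  proof -
    have "root_eps g powi (2 * m) = root_eps g powi m * root_eps g powi m"
      by (metis mult_2 power_int_add root_eps_nz)
    then show ?thesis by (simp add: power_int_minus field_simps)
  qed
  then show ?thesis using root_eps_powi_eq_1[OF assms] by simp
qed

text \<open>\<open>P(1/u) = P(u)\<close>, because \<open>\<epsilon>\<^bsup>g-k\<^esup> = - \<epsilon>\<^bsup>-k\<^esup>\<close> exchanges the factors \<open>k\<close> and \<open>g - k\<close>.\<close>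

lemma P_fun_swap:
  assumes "g \<ge> 1" shows "P_fun g v u = P_fun g u v"
proof -
  let ?\<epsilon> = "root_eps g"
  let ?F = "\<lambda>u v k. cst (inverse (?\<epsilon> ^ k - inverse ?\<epsilon> ^ k)) * (cst (?\<epsilon> ^ k) * u - cst (inverse ?\<epsilon> ^ k) * v)"
  have F: "?F v u (g - k) = ?F u v k" if "k \<in> {1..g - 1}" for k
  proof -
    have "?\<epsilon> ^ (g - k) * ?\<epsilon> ^ k = - 1"
    proof -
      have "k \<le> g" using that by auto
      then show ?thesis using root_eps_power[OF assms] by (simp flip: power_add)
    qed
    then have 1: "?\<epsilon> ^ (g - k) = - (inverse ?\<epsilon> ^ k)"
      by (simp add: field_simps eq_neg_iff_add_eq_0)
    then have 2: "inverse ?\<epsilon> ^ (g - k) = - (?\<epsilon> ^ k)"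
      by (metis inverse_inverse_eq inverse_minus_eq power_inverse)
    show ?thesis unfolding 1 2 by (simp add: cst_minus algebra_simps)
  qed
  have "(\<Prod>k=1..g - 1. ?F v u k) = (\<Prod>k=1..g - 1. ?F v u (g - 1 + 1 - k))"
    by (rule prod.atLeastAtMost_rev)
  also have "\<dots> = (\<Prod>k=1..g - 1. ?F u v k)"
    by (rule prod.cong) (use F assms in auto)
  finally show ?thesis unfolding P_fun_def Let_def by (simp add: add.commute)
qed

lemma map_P_fun: "ahom \<theta> \<Longrightarrow> \<theta> (P_fun g u v) = P_fun g (\<theta> u) (\<theta> v)"
  by (simp add: P_fun_def ahomD ahom_prod Let_def)

text \<open>For \<open>a\<close> not divisible by \<open>g\<close> one of the factors of \<open>P\<close> vanishes at \<open>\<epsilon>\<^sup>a\<close>. This is the origin of the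
  duality: it makes most deformed numbers independent of \<open>T\<close> at \<open>Q = \<epsilon>\<close>.\<close>

lemma P_fun_root:
  assumes g: "g \<ge> 1"
  shows "P_fun g (root_eps g powi a) (root_eps g powi (- a)) = (if int g dvd a then 1 else 0)"
proof -
  let ?\<epsilon> = "root_eps g"
  let ?F = "\<lambda>k. inverse (?\<epsilon> ^ k - inverse ?\<epsilon> ^ k) * (?\<epsilon> ^ k * ?\<epsilon> powi a - inverse ?\<epsilon> ^ k * ?\<epsilon> powi (- a))"
  have P: "P_fun g (?\<epsilon> powi a) (?\<epsilon> powi (- a)) =
      1 / 2 * ((?\<epsilon> powi a) ^ (g - 1) + (?\<epsilon> powi (- a)) ^ (g - 1)) * (\<Prod>k=1..g - 1. ?F k)"
    by (simp add: P_fun_def Let_def)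
  have F: "?F k = inverse (?\<epsilon> powi int k - ?\<epsilon> powi (- int k)) * (?\<epsilon> powi (int k + a) - ?\<epsilon> powi (- (int k + a)))" for k
  proof -
    have 1: "?\<epsilon> ^ k * ?\<epsilon> powi a = ?\<epsilon> powi (int k + a)" by (simp add: power_int_add)
    have 2: "inverse ?\<epsilon> ^ k * ?\<epsilon> powi (- a) = ?\<epsilon> powi (- (int k + a))"
      unfolding power_int_minus 1[symmetric] by (simp add: power_inverse)
    have 3: "inverse ?\<epsilon> ^ k = ?\<epsilon> powi (- int k)" by (simp add: power_int_minus power_inverse)
    show ?thesis unfolding 1 2 by (simp add: 3)
  qed
  have nz: "?\<epsilon> powi int k - ?\<epsilon> powi (- int k) \<noteq> 0" if "k \<in> {1..g - 1}" for k
    using that g root_eps_diff[OF g, of "int k"] by (auto dest: dvd_imp_le)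
  show ?thesis
  proof (cases "int g dvd a")
    case True
    then obtain b where a: "a = int g * b" by auto
    have e: "?\<epsilon> powi a = (- 1) powi b"
      using root_eps_power[OF g] by (simp add: a power_int_mult)
    have e': "?\<epsilon> powi (- a) = (- 1) powi b"
      using e by (simp add: power_int_minus_left power_int_minus)
    have "?F k = (- 1) powi b" if "k \<in> {1..g - 1}" for k
      using nz[OF that] unfolding e e' by (simp add: power_int_minus power_inverse field_simps)
    then have "(\<Prod>k=1..g - 1. ?F k) = ((- 1) powi b) ^ (g - 1)" by simp
    moreover have "((- 1 :: complex) powi b) ^ (g - 1) * ((- 1) powi b) ^ (g - 1) = 1"
      by (simp add: power_int_minus_left flip: power_add mult_2)
    ultimately show ?thesis using True unfolding P unfolding e e' by simp
  next
    case False
    obtain r where r: "r = (- a) mod int g" "0 \<le> r" "r < int g" "r \<noteq> 0"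
      using g False pos_mod_bound[of "int g" "- a"] pos_mod_sign[of "int g" "- a"]
      by (simp add: mod_eq_0_iff_dvd)
    define k where "k = nat r"
    have k: "k \<in> {1..g - 1}" "int k = (- a) mod int g"
      using r by (auto simp: k_def)
    have "int k + a = - (int g * ((- a) div int g))"
      using k(2) minus_mult_div_eq_mod[of "- a" "int g"] by linarith
    then have "int g dvd int k + a" by simp
    then have "?\<epsilon> powi (int k + a) = ?\<epsilon> powi (- (int k + a))" using root_eps_diff[OF g] by blast
    then have "?F k = 0" unfolding F by simp
    then have "(\<Prod>k=1..g - 1. ?F k) = 0" using k(1) by (intro prod_zero) auto
    then show ?thesis using False unfolding P by simp
  qed
qed

section \<open>The series in the relations of the two-parameter algebra\<close>

text \<open>\<open>[a]\<close> at \<open>QT\<^bsup>{a}\<^esup>\<close>, the value of \<open>QT_number\<close> at a complex number\<close>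

definition num :: "nat \<Rightarrow> complex \<Rightarrow> complex fps fps"
  where "num g a = taylor (P_fun g (fexp a) (fexp (- a))) (qnum 1 a)"

text \<open>Substituting \<open>h + h'{y}\<close> for \<open>h\<close> in \<open>sinh(hy)/sinh(h)\<close> gives the deformed number. Taylor's formula
  expresses its coefficients by derivatives of a series in \<open>h\<close> and powers of \<open>{y}\<close>, which is
  what makes the limit \<open>h' \<rightarrow> 0\<close> and the values at \<open>Q = \<epsilon>\<close> accessible.\<close>

lemma QT_number_eq: "QT_number g y = taylor (brace_Q g y) (qnum 1 y)"
proof -
  define x where "x = brace_Q g y"
  define w where "w = fps_const fps_X + fps_X * fps_const x"
  note T = ahomD[OF ahom_taylor[of x]]
  have w: "w = taylor x fps_X" by (simp add: w_def taylor_X)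
  have w0: "w \<noteq> 0"
  proof
    assume "w = 0"
    then have "fps_nth (taylor x fps_X) 0 = 0" using w by simp
    then show False by simp
  qed
  have pow: "QT_pow x z - QT_pow x (- z) = taylor x (bser z) * w" for z
  proof -
    have "QT_pow x z - QT_pow x (- z) = taylor x (fexp z - fexp (- z))"
      unfolding T QT_pow_def taylor_fexp ..
    then show ?thesis unfolding bser_eq[symmetric] T w by (simp add: mult.commute)
  qed
  have quot: "exact_quot (QT_pow x z - QT_pow x (- z)) w = taylor x (bser z)" for z
    unfolding pow by (rule exact_quot_mult[OF w0])
  have b0: "taylor x (bser 1) \<noteq> 0"
  proof
    assume "taylor x (bser 1) = 0"
    then have "fps_nth (fps_nth (taylor x (bser 1)) 0) 0 = 0" by simp
    then show False by (simp add: bser_0 cst_inj)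
  qed
  have "taylor x (bser y) = taylor x (qnum 1 y) * taylor x (bser 1)"
    using qnum_bser[of 1 y] by (simp flip: T)
  then have "exact_quot (taylor x (bser y)) (taylor x (bser 1)) = taylor x (qnum 1 y)"
    using exact_quot_mult[OF b0] by simp
  then show ?thesis
    unfolding QT_number_def Let_def x_def[symmetric] w_def[symmetric] quot by simp
qed

lemma QT_number_minus:
  assumes "g \<ge> 1" shows "QT_number g (- y) = - QT_number g y"
proof -
  have "brace_Q g (- y) = brace_Q g y"
    unfolding brace_Q_def using P_fun_swap[OF assms, of "fexp (- y)" "fexp y"] by simp
  then show ?thesis by (simp add: QT_number_eq qnum_minus ahomD[OF ahom_taylor])
qed

lemma map_QT_number: "ahom \<theta> \<Longrightarrow> map_fps (map_fps \<theta>) (QT_number g y) = num g (\<theta> y)"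
  by (simp add: QT_number_eq num_def map_taylor map_qnum brace_Q_def map_P_fun ahom_map_fps map_fexp ahomD)

lemma num_00: "fps_nth (fps_nth (num g a) 0) 0 = a"
  by (simp add: num_def qnum_0)

lemma num_0: "fps_nth (num g a) 0 = qnum 1 a"
  by (simp add: num_def)

lemma num_zero [simp]: "num g 0 = 0"
proof -
  have "qnum 1 0 = (0 :: complex fps)" using qnum_minus[of 1 "0 :: complex"] by (simp add: eq_neg_iff_add_eq_0)
  then show ?thesis by (simp add: num_def ahomD[OF ahom_taylor])
qed

subsection \<open>Symmetric functions of \<open>\<surd>C\<close>\<close>

abbreviation csq :: "HC \<Rightarrow> HC" where "csq p \<equiv> p \<circ>\<^sub>p [:0, 0, 1:]"

lemma inj_csq: "csq p = csq q \<Longrightarrow> p = q"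
  using pcompose_eq_0_iff[of "[:0, 0, 1:] :: HC" "p - q"] by (simp add: pcompose_diff)

lemma even_poly_csq:
  fixes p :: HC
  assumes "p \<circ>\<^sub>p [:0, - 1:] = p" shows "\<exists>q. p = csq q"
  using assms
proof (induction "Polynomial.degree p" arbitrary: p rule: less_induct)
  case less
  obtain a r where p: "p = pCons a r" by (cases p)
  obtain b s where r: "r = pCons b s" by (cases r)
  have "p \<circ>\<^sub>p [:0, - 1:] = pCons a (pCons (- b) (s \<circ>\<^sub>p [:0, - 1:]))"
    by (simp add: p r pcompose_pCons)
  then have e: "- b = b" "s \<circ>\<^sub>p [:0, - 1:] = s" using less.prems p r by auto
  then have b: "b = 0" by simp
  show ?case
  proof (cases "s = 0")
    case True
    then have "p = csq [:a:]" by (simp add: p r b)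
    then show ?thesis by blast
  next
    case False
    then have "Polynomial.degree s < Polynomial.degree p" by (simp add: p r b)
    then obtain t where "s = csq t" using less.hyps e by blast
    then have "p = csq (pCons a t)" by (simp add: p r b pcompose_pCons)
    then show ?thesis by blast
  qed
qed

lemma ahom_pcompose: "ahom (\<lambda>p. p \<circ>\<^sub>p (q :: HC))"
  by (simp add: ahom_def cst_poly_def pcompose_add pcompose_mult pcompose_const)

text \<open>The value at \<open>H = a\<close> and outer variable \<open>s\<close>\<close>

definition ev :: "complex \<Rightarrow> complex \<Rightarrow> HC \<Rightarrow> complex"
  where "ev a s p = poly (poly p [:s:]) a"

lemma ahom_ev: "ahom (ev a s)"
  by (simp add: ahom_def ev_def cst_poly_def)

lemma ev_csq: "ev a s (csq p) = ev a (s\<^sup>2) p"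
  by (simp add: ev_def poly_pcompose power2_eq_square)

lemma ev_H_half: "ev a s (H_half \<sigma> e) = (s + of_int e * a - of_int (\<sigma> * e)) / 2"
proof -
  have "ev a s (cst c) = c" for c using ahomD(1)[OF ahom_ev, of a s c] by simp
  then show ?thesis
    unfolding H_half_def by (simp add: ahomD[OF ahom_ev] del: of_int_mult) (simp add: ev_def)
qed

text \<open>Changing the sign of \<open>\<surd>C\<close> exchanges the two factors up to the sign of each argument, and the numbers are
  odd functions of it; so the product is a series in \<open>C\<close>.\<close>

lemma XX_series:
  assumes "g \<ge> 1"
  shows "map_fps (map_fps csq) (XX_series g \<sigma>) = (\<Prod>e\<in>{1, -1}. QT_number g (H_half \<sigma> e))"
proof -
  let ?\<Pi> = "\<Prod>e\<in>{1, -1}. QT_number g (H_half \<sigma> e)"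
  let ?f = "\<lambda>p :: HC. p \<circ>\<^sub>p [:0, - 1:]"
  have f: "ahom ?f" by (rule ahom_pcompose)
  have neg: "?f (H_half \<sigma> e) = - H_half \<sigma> (- e)" for e
  proof -
    define A B :: HC where "A = [:0, 1:]" and "B = [:[:0, 1:]:]"
    have "?f A = - A" "?f B = B" by (simp_all add: A_def B_def pcompose_pCons)
    then show ?thesis unfolding H_half_def A_def[symmetric] B_def[symmetric]
      by (simp add: ahomD[OF f] algebra_simps)
  qed
  have QT: "map_fps (map_fps ?f) (QT_number g (H_half \<sigma> e)) = - QT_number g (H_half \<sigma> (- e))" for e
  proof -
    have "map_fps (map_fps ?f) (QT_number g y) = QT_number g (?f y)" for y
      by (simp add: QT_number_eq map_taylor f map_qnum brace_Q_def map_P_fun[OF ahom_map_fps[OF f]]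
          map_fexp[OF f] ahomD[OF f])
    then show ?thesis by (simp only: neg QT_number_minus[OF assms])
  qed
  have inv: "map_fps (map_fps ?f) ?\<Pi> = ?\<Pi>"
    by (simp add: ahomD[OF ahom_map_fps[OF ahom_map_fps[OF f]]] QT mult.commute)
  have "\<exists>q. fps_nth (fps_nth ?\<Pi> k) i = csq q" for k i
  proof (rule even_poly_csq)
    have "fps_nth (fps_nth (map_fps (map_fps ?f) ?\<Pi>) k) i = fps_nth (fps_nth ?\<Pi> k) i" by (simp only: inv)
    then show "?f (fps_nth (fps_nth ?\<Pi> k) i) = fps_nth (fps_nth ?\<Pi> k) i" by (simp only: map_fps_nth)
  qed
  then obtain G where "\<And>k i. fps_nth (fps_nth ?\<Pi> k) i = csq (G k i)" by metis
  then have G: "map_fps (map_fps csq) (Abs_fps (\<lambda>k. Abs_fps (G k))) = ?\<Pi>"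
    by (simp add: fps_eq_iff)
  have "G1 = G2" if "map_fps (map_fps csq) G1 = map_fps (map_fps csq) G2" for G1 G2
    using that by (auto simp: fps_eq_iff intro: inj_csq)
  then show ?thesis
    unfolding XX_series_def by (rule theI2[where P="\<lambda>G. map_fps (map_fps csq) G = ?\<Pi>", OF G]) (use G in auto)
qed

lemma map_ev_XX_series:
  assumes "g \<ge> 1"
  shows "map_fps (map_fps (ev a (s\<^sup>2))) (XX_series g \<sigma>) =
    num g ((s + a - of_int \<sigma>) / 2) * num g ((s - a + of_int \<sigma>) / 2)"
proof -
  have "map_fps (map_fps (ev a s)) (map_fps (map_fps csq) (XX_series g \<sigma>)) =
      num g ((s + a - of_int \<sigma>) / 2) * num g ((s - a + of_int \<sigma>) / 2)"
    unfolding XX_series[OF assms]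
    by (simp add: ahomD[OF ahom_map_fps[OF ahom_map_fps[OF ahom_ev]]] map_QT_number[OF ahom_ev] ev_H_half)
  then show ?thesis by (simp add: fps_eq_iff ev_csq)
qed

definition evH :: "complex \<Rightarrow> HC \<Rightarrow> complex poly"
  where "evH a p = map_poly (\<lambda>q. poly q a) p"

lemma poly_evH: "poly (evH a p) z = ev a z p"
  unfolding evH_def ev_def by (induction p) (simp_all add: map_poly_pCons)

text \<open>At \<open>H = n\<close>, the series for \<open>X\<^sup>-X\<^sup>+\<close> is \<open>C - (n+1)\<^sup>2\<close> times a unit: its coefficients vanish at
  \<open>\<surd>C = n+1\<close> because \<open>[0] = 0\<close>, and its constant term is \<open>(C - (n+1)\<^sup>2)/4\<close>.\<close>

lemma XX_series_minus_unit:
  assumes "g \<ge> 1"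
  shows "\<exists>V. V * map_fps (map_fps (evH a)) (XX_series g (- 1)) = fps_const (fps_const [:- ((a + 1)\<^sup>2), 1:])"
proof -
  let ?G = "map_fps (map_fps (evH a)) (XX_series g (- 1))"
  let ?N = "[:- ((a + 1)\<^sup>2), 1:]"
  have ev: "poly (fps_nth (fps_nth ?G k) i) (s\<^sup>2) =
      fps_nth (fps_nth (num g ((s + a + 1) / 2) * num g ((s - a - 1) / 2)) k) i" for s k i
  proof -
    have "poly (fps_nth (fps_nth ?G k) i) (s\<^sup>2) =
        fps_nth (fps_nth (map_fps (map_fps (ev a (s\<^sup>2))) (XX_series g (- 1))) k) i"
      by (simp add: poly_evH)
    then show ?thesis unfolding map_ev_XX_series[OF assms] by simp
  qed
  have "poly (fps_nth (fps_nth ?G k) i) ((a + 1)\<^sup>2) = 0" for k i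
    unfolding ev by simp
  then have "?N dvd fps_nth (fps_nth ?G k) i" for k i
    by (simp only: poly_eq_0_iff_dvd)
  then obtain U where U: "\<And>k i. fps_nth (fps_nth ?G k) i = ?N * U k i" unfolding dvd_def by metis
  let ?U = "Abs_fps (\<lambda>k. Abs_fps (U k))"
  have G: "?G = fps_const (fps_const ?N) * ?U"
    using U by (simp add: fps_eq_iff)
  have "?N * U 0 0 = Polynomial.smult (1 / 4) ?N"
  proof (rule poly_eq_poly_eq_iff[THEN iffD1], rule ext)
    fix z :: complex
    have z: "z = (csqrt z)\<^sup>2" by simp
    have "poly (fps_nth (fps_nth ?G 0) 0) z = (csqrt z + a + 1) / 2 * ((csqrt z - a - 1) / 2)"
      by (subst z, subst ev) (simp add: num_00)
    also have "\<dots> = ((csqrt z)\<^sup>2 - (a + 1)\<^sup>2) / 4"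
      by (simp add: power2_eq_square field_simps)
    also have "\<dots> = poly (Polynomial.smult (1 / 4) ?N) z" by simp
    finally show "poly (?N * U 0 0) z = poly (Polynomial.smult (1 / 4) ?N) z" by (simp only: U)
  qed
  then have "?N * U 0 0 = ?N * [:1 / 4:]" by simp
  then have U0: "U 0 0 * [:4:] = 1" by (simp only: mult_cancel_left) (simp add: one_pCons)
  obtain y where y: "fps_nth ?U 0 * y = 1"
    using fps_right_inverse[of "fps_nth ?U 0" "[:4:]"] U0 by auto
  obtain W where W: "?U * W = 1" using fps_right_inverse[of ?U y] y by blast
  have "W * ?G = fps_const (fps_const ?N) * (?U * W)" unfolding G by (simp only: ac_simps)
  then show ?thesis unfolding W by auto
qed

lemma sinh_quot_eq:
  assumes "d \<ge> 1" shows "sinh_quot d = map_fps subst_H (qnum (of_nat d) [:0, 1:])"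
proof -
  have d: "(of_nat d :: complex) \<noteq> 0" using assms by simp
  have "formal_sinh (of_nat d * [:0, 1:]) = qnum (of_nat d) [:0, 1:] * formal_sinh (of_nat d :: complex poly)"
    using qnum_eq[OF d, of "[:0, 1:] :: complex poly"]
    unfolding formal_sinh_def cst_of_nat by (metis mult.left_commute)
  moreover have "formal_sinh (of_nat d :: complex poly) \<noteq> 0"
    using fexp_diff_nonzero[OF d, where 'a="complex poly"]
    unfolding formal_sinh_def cst_of_nat by (simp add: cst_inj)
  ultimately show ?thesis unfolding sinh_quot_def by (simp add: exact_quot_mult)
qed

subsection \<open>Quantum integers\<close>

definition Epow :: "complex \<Rightarrow> int \<Rightarrow> complex fps"
  where "Epow d m = fexp (d * of_int m)"

lemma Epow_mult: "Epow d a * Epow d b = Epow d (a + b)"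
  by (simp add: Epow_def distrib_left flip: fexp_add)

lemma qnum_Epow:
  assumes "d \<noteq> 0" shows "qnum d (of_int a) * (Epow d 1 - Epow d (- 1)) = Epow d a - Epow d (- a)"
  using qnum_eq[OF assms, of "of_int a :: complex"] by (simp add: Epow_def)

lemma Epow_nz: "d \<noteq> 0 \<Longrightarrow> Epow d 1 - Epow d (- 1) \<noteq> 0"
  using fexp_diff_nonzero[of d, where 'a=complex] by (simp add: Epow_def)

text \<open>This is the relation for \<open>[X\<^sup>+, X\<^sup>-]\<close> at \<open>m\<^sub>j\<close>.\<close>

lemma quantum_identity:
  assumes d: "d \<noteq> 0"
  shows "qnum d (of_int (j + 1)) * qnum d (of_int (n - j)) - qnum d (of_int j) * qnum d (of_int (n - j + 1)) =
    (qnum d (of_int (n - 2 * j)) :: complex fps)"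
proof -
  define s where "s = Epow d 1 - Epow d (- 1)"
  have s: "qnum d (of_int a) * s = Epow d a - Epow d (- a)" for a
    unfolding s_def by (rule qnum_Epow[OF d])
  have "(qnum d (of_int (j + 1)) * qnum d (of_int (n - j)) - qnum d (of_int j) * qnum d (of_int (n - j + 1))) * (s * s) =
      (qnum d (of_int (j + 1)) * s) * (qnum d (of_int (n - j)) * s) - (qnum d (of_int j) * s) * (qnum d (of_int (n - j + 1)) * s)"
    by (simp add: algebra_simps)
  also have "\<dots> = (Epow d (n - 2 * j) - Epow d (- (n - 2 * j))) * s"
    unfolding s by (simp add: s_def left_diff_distrib right_diff_distrib Epow_mult algebra_simps)
  also have "\<dots> = qnum d (of_int (n - 2 * j)) * (s * s)" by (simp only: s[symmetric] mult.assoc)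
  finally show ?thesis using Epow_nz[OF d] by (simp add: s_def)
qed

section \<open>Verma modules from a representation of the free algebra\<close>

lemma ring_regular_module: "ring R \<Longrightarrow> left_module R (regular_module R)"
proof -
  assume "ring R"
  then interpret ring R .
  have "abelian_group (regular_module R)"
    by (rule abelian_groupI)
      (auto simp: regular_module_def a_assoc a_comm a_lcomm intro: l_neg)
  then show ?thesis
    by (intro left_module.intro left_module_axioms.intro)
      (auto simp: regular_module_def l_distr r_distr m_assoc ring_axioms)
qed

lemma quot_type_ring:
  fixes I :: "'f::ring_1 set"
  assumes "ideal I type_ring"
  shows "ring (type_ring Quot I)"
    "carrier (type_ring Quot I) = range (\<lambda>f. I +>\<^bsub>type_ring\<^esub> f)"
    "(I +>\<^bsub>type_ring\<^esub> f) \<oplus>\<^bsub>type_ring Quot I\<^esub> (I +>\<^bsub>type_ring\<^esub> g) = I +>\<^bsub>type_ring\<^esub> (f + g)"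
    "(I +>\<^bsub>type_ring\<^esub> f) \<otimes>\<^bsub>type_ring Quot I\<^esub> (I +>\<^bsub>type_ring\<^esub> g) = I +>\<^bsub>type_ring\<^esub> (f * g)"
    "\<one>\<^bsub>type_ring Quot I\<^esub> = I +>\<^bsub>type_ring\<^esub> 1"
    "(I +>\<^bsub>type_ring\<^esub> f) [^]\<^bsub>type_ring Quot I\<^esub> (N::nat) = I +>\<^bsub>type_ring\<^esub> (f ^ N)"
    "i \<in> I \<Longrightarrow> I +>\<^bsub>type_ring\<^esub> (i + f) = I +>\<^bsub>type_ring\<^esub> f"
proof -
  interpret ideal I "type_ring :: 'f ring" by fact
  show r: "ring (type_ring Quot I)" by (rule quotient_is_ring)
  show "carrier (type_ring Quot I) = range (\<lambda>f. I +>\<^bsub>type_ring\<^esub> f)"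
    by (auto simp: FactRing_def A_RCOSETS_def')
  note h = rcos_ring_hom
  show "(I +>\<^bsub>type_ring\<^esub> f) \<oplus>\<^bsub>type_ring Quot I\<^esub> (I +>\<^bsub>type_ring\<^esub> g) = I +>\<^bsub>type_ring\<^esub> (f + g)" for f g
    using ring_hom_add[OF h, of f g] by simp
  show m: "(I +>\<^bsub>type_ring\<^esub> f) \<otimes>\<^bsub>type_ring Quot I\<^esub> (I +>\<^bsub>type_ring\<^esub> g) = I +>\<^bsub>type_ring\<^esub> (f * g)" for f g
    using ring_hom_mult[OF h, of f g] by simp
  show o: "\<one>\<^bsub>type_ring Quot I\<^esub> = I +>\<^bsub>type_ring\<^esub> 1"
    using ring_hom_one[OF h] by simp
  interpret Q: ring "type_ring Quot I" by (rule r)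
  show "(I +>\<^bsub>type_ring\<^esub> f) [^]\<^bsub>type_ring Quot I\<^esub> (N::nat) = I +>\<^bsub>type_ring\<^esub> (f ^ N)"
    by (induction N) (simp_all add: m o power_commutes)
  show "i \<in> I \<Longrightarrow> I +>\<^bsub>type_ring\<^esub> (i + f) = I +>\<^bsub>type_ring\<^esub> f"
    using assms unfolding type_ring_coset ideal_type_ring_iff
    by (auto simp: add.assoc[symmetric]) (metis add.assoc diff_add_cancel mult_minus1 uminus_add_conv_diff)
qed

text \<open>Independent of the chosen representative when the ideal acts by zero (\<open>cact_coset\<close>).\<close>

definition cact :: "('f \<Rightarrow> 'w \<Rightarrow> 'w) \<Rightarrow> 'f set \<Rightarrow> 'w \<Rightarrow> 'w"
  where "cact A u w = A (SOME f. f \<in> u) w"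

lemma cact_coset:
  assumes "ideal I (type_ring :: 'f::ring_1 ring)" "is_rep A" "\<And>i w. i \<in> I \<Longrightarrow> A i w = 0"
  shows "cact A (I +>\<^bsub>type_ring\<^esub> f) w = A f w"
proof -
  have "0 + f \<in> I +>\<^bsub>type_ring\<^esub> f" using assms(1) unfolding ideal_type_ring_iff type_ring_coset by blast
  then have "(SOME f'. f' \<in> I +>\<^bsub>type_ring\<^esub> f) \<in> I +>\<^bsub>type_ring\<^esub> f" by (rule someI)
  then obtain i where "i \<in> I" "(SOME f'. f' \<in> I +>\<^bsub>type_ring\<^esub> f) = i + f" by (auto simp: type_ring_coset)
  then show ?thesis by (simp add: cact_def is_repD[OF assms(2)] assms(3))
qed

text \<open>A representation with a vector \<open>v\<^sub>0\<close> killed by \<open>X\<close> and \<open>Y\<close> receives a map from the Verma module. If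
  moreover every vector \<open>w\<close> is reached from \<open>v\<^sub>0\<close> by an element \<open>lift w\<close>, and these elements represent
  everything modulo the left ideal, then the map is bijective: an element of its kernel is congruent
  to \<open>lift w\<close> with \<open>w = 0\<close>.\<close>

lemma verma_models:
  fixes A :: "'f::ring_1 \<Rightarrow> 'w::ab_group_add \<Rightarrow> 'w"
  assumes I: "ideal I (type_ring :: 'f ring)" and A: "is_rep A" and kill: "\<And>i w. i \<in> I \<Longrightarrow> A i w = 0"
    and XY: "A X v0 = 0" "A Y v0 = 0"
    and lift: "lift 0 = 0" "\<And>w. A (lift w) v0 = w"
    and span: "\<And>f. \<exists>w u v i. i \<in> I \<and> f = lift w + u * X + v * Y + i"
  defines "R \<equiv> type_ring Quot I"
  defines "M \<equiv> verma R (I +>\<^bsub>type_ring\<^esub> X) (I +>\<^bsub>type_ring\<^esub> Y)"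
  shows "models R M (coset_map (\<lambda>u. cact A u v0)) UNIV (cact A)"
    and "coset_map (\<lambda>u. cact A u v0) (\<zero>\<^bsub>M\<^esub> +>\<^bsub>R\<^esub> (I +>\<^bsub>type_ring\<^esub> f)) = A f v0"
    and "carrier M = range (\<lambda>f. \<zero>\<^bsub>M\<^esub> +>\<^bsub>R\<^esub> (I +>\<^bsub>type_ring\<^esub> f))"
proof -
  note q = quot_type_ring[OF I, folded R_def]
  note c = cact_coset[OF I A kill]
  define N where "N = {u \<otimes>\<^bsub>R\<^esub> (I +>\<^bsub>type_ring\<^esub> X) \<oplus>\<^bsub>R\<^esub> v \<otimes>\<^bsub>R\<^esub> (I +>\<^bsub>type_ring\<^esub> Y) | u v. u \<in> carrier R \<and> v \<in> carrier R}"
  have M: "M = quot_module (regular_module R) N" unfolding M_def verma_def N_def ..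
  have N: "N = {x \<in> carrier (regular_module R). cact A x v0 = 0}"
  proof (rule Set.set_eqI)
    fix x
    show "x \<in> N \<longleftrightarrow> x \<in> {x \<in> carrier (regular_module R). cact A x v0 = 0}"
    proof
      assume "x \<in> N"
      then obtain u v where "x = I +>\<^bsub>type_ring\<^esub> (u * X + v * Y)" unfolding N_def by (auto simp: q)
      then show "x \<in> {x \<in> carrier (regular_module R). cact A x v0 = 0}"
        by (simp add: regular_module_def q c is_repD[OF A] XY)
    next
      assume x: "x \<in> {x \<in> carrier (regular_module R). cact A x v0 = 0}"
      then obtain f where f: "x = I +>\<^bsub>type_ring\<^esub> f" by (auto simp: regular_module_def q)
      obtain w u v i where s: "i \<in> I" "f = lift w + u * X + v * Y + i" using span by blast
      have "w = 0" using x by (simp add: f c s is_repD[OF A] XY lift kill)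
      then have "x = I +>\<^bsub>type_ring\<^esub> (i + (u * X + v * Y))" by (simp add: f s lift algebra_simps)
      also have "\<dots> = I +>\<^bsub>type_ring\<^esub> (u * X + v * Y)" by (rule q(7)[OF s(1)])
      finally have "x = (I +>\<^bsub>type_ring\<^esub> u) \<otimes>\<^bsub>R\<^esub> (I +>\<^bsub>type_ring\<^esub> X) \<oplus>\<^bsub>R\<^esub> (I +>\<^bsub>type_ring\<^esub> v) \<otimes>\<^bsub>R\<^esub> (I +>\<^bsub>type_ring\<^esub> Y)"
        by (simp add: q)
      moreover have "I +>\<^bsub>type_ring\<^esub> f \<in> carrier R" for f by (simp add: q(2))
      ultimately show "x \<in> N" unfolding N_def by blast
    qed
  qed
  have ad: "cact A (x \<oplus>\<^bsub>regular_module R\<^esub> y) v0 = cact A x v0 + cact A y v0"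
    if "x \<in> carrier (regular_module R)" "y \<in> carrier (regular_module R)" for x y
    using that by (auto simp: regular_module_def q c is_repD[OF A])
  have ac: "cact A (x \<odot>\<^bsub>regular_module R\<^esub> y) v0 = cact A x (cact A y v0)"
    if "x \<in> carrier R" "y \<in> carrier (regular_module R)" for x y
    using that by (auto simp: regular_module_def q c is_repD[OF A])
  note mq = models_quot[where \<tau>="\<lambda>u. cact A u v0" and act="cact A", OF ring_regular_module[OF q(1)] ad ac N]
  have "(\<lambda>u. cact A u v0) ` carrier (regular_module R) = UNIV"
    using surjI[of "\<lambda>f. A f v0" lift] lift(2) by (simp add: regular_module_def q image_image c)
  then show "models R M (coset_map (\<lambda>u. cact A u v0)) UNIV (cact A)" using mq(1) by (simp add: M)
  have z: "\<zero>\<^bsub>M\<^esub> +>\<^bsub>R\<^esub> x = N +>\<^bsub>regular_module R\<^esub> x" for x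
    by (simp add: M quot_module_def a_r_coset_def' regular_module_def)
  show "coset_map (\<lambda>u. cact A u v0) (\<zero>\<^bsub>M\<^esub> +>\<^bsub>R\<^esub> (I +>\<^bsub>type_ring\<^esub> f)) = A f v0"
    unfolding z using mq(2)[of "I +>\<^bsub>type_ring\<^esub> f"] by (simp add: regular_module_def q c)
  show "carrier M = range (\<lambda>f. \<zero>\<^bsub>M\<^esub> +>\<^bsub>R\<^esub> (I +>\<^bsub>type_ring\<^esub> f))"
  proof -
    have 1: "carrier M = (\<lambda>x. N +>\<^bsub>regular_module R\<^esub> x) ` carrier (regular_module R)" using mq(3) by (simp only: M)
    have 2: "carrier (regular_module R) = range (\<lambda>f. I +>\<^bsub>type_ring\<^esub> f)" using q(2) by (simp add: regular_module_def)
    show ?thesis unfolding z 1 2 image_image ..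
  qed
qed

subsection \<open>Polynomials in a non-commutative variable\<close>

definition poly_lift :: "'a::complex_alg \<Rightarrow> complex poly \<Rightarrow> 'a"
  where "poly_lift c p = (\<Sum>i\<le>Polynomial.degree p. cst (Polynomial.coeff p i) * c ^ i)"

lemma poly_lift_ge:
  "Polynomial.degree p \<le> n \<Longrightarrow> poly_lift c p = (\<Sum>i\<le>n. cst (Polynomial.coeff p i) * c ^ i)"
  unfolding poly_lift_def by (rule sum.mono_neutral_left) (auto simp: coeff_eq_0)

lemma poly_lift_0 [simp]: "poly_lift c 0 = 0"
  by (simp add: poly_lift_def)

lemma poly_lift_pCons: "poly_lift c (pCons a p) = cst a + c * poly_lift c p"
proof -
  have m: "cst b * (c * x) = c * (cst b * x)" for b x
    by (metis cst_central mult.assoc)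
  have "poly_lift c (pCons a p) = (\<Sum>i\<le>Suc (Polynomial.degree p). cst (Polynomial.coeff (pCons a p) i) * c ^ i)"
    by (rule poly_lift_ge) (simp add: degree_pCons_le)
  also have "\<dots> = cst a + (\<Sum>i\<le>Polynomial.degree p. c * (cst (Polynomial.coeff p i) * c ^ i))"
    unfolding sum.atMost_Suc_shift by (simp add: m)
  finally show ?thesis by (simp add: poly_lift_def sum_distrib_left)
qed

lemma poly_lift_add: "poly_lift c (p + q) = poly_lift c p + poly_lift c q"
  using degree_add_le[of p "max (Polynomial.degree p) (Polynomial.degree q)" q]
  by (simp add: poly_lift_ge[of _ "max (Polynomial.degree p) (Polynomial.degree q)"] cst_add distrib_right sum.distrib)

lemma poly_lift_smult: "poly_lift c (Polynomial.smult a q) = cst a * poly_lift c q"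
  by (simp add: poly_lift_ge[of _ "Polynomial.degree q"] poly_lift_ge[of q "Polynomial.degree q"]
      cst_mult mult.assoc sum_distrib_left)

lemma ahom_poly_lift: "ahom (poly_lift c)"
proof -
  have "poly_lift c (p * q) = poly_lift c p * poly_lift c q" for p q
  proof (induction p)
    case (pCons a p)
    have "poly_lift c (pCons a p * q) = cst a * poly_lift c q + c * (poly_lift c p * poly_lift c q)"
      by (simp add: poly_lift_add poly_lift_smult poly_lift_pCons pCons.IH)
    then show ?case by (simp add: poly_lift_pCons algebra_simps)
  qed simp
  then show ?thesis by (auto simp: ahom_def poly_lift_add cst_poly_def poly_lift_pCons)
qed

lemma ahom_poly_lift_comm: "ahom \<theta> \<Longrightarrow> \<theta> (poly_lift c p) = poly_lift (\<theta> c) p"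
  by (induction p) (simp_all add: poly_lift_pCons ahomD)

lemma subst_H_eq: "subst_H = poly_lift (gen Hg)"
  by (simp add: fun_eq_iff subst_H_def poly_lift_def)

lemma subst_HC_0 [simp]: "subst_HC 0 = 0"
  by (simp add: subst_HC_def)

lemma subst_HC_pCons: "subst_HC (pCons q p) = poly_lift (gen (Sl2 Hg)) q + gen Cas * subst_HC p"
proof -
  let ?f = "\<lambda>p j. \<Sum>i\<le>Polynomial.degree (Polynomial.coeff p j).
    cst (Polynomial.coeff (Polynomial.coeff p j) i) * gen Cas ^ j * gen (Sl2 Hg) ^ i"
  have ge: "subst_HC p = (\<Sum>j\<le>n. ?f p j)" if "Polynomial.degree p \<le> n" for n p
    unfolding subst_HC_def using that by (intro sum.mono_neutral_left) (auto simp: coeff_eq_0)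
  have m: "cst b * (gen Cas * x) = gen Cas * (cst b * x)" for b x
    by (metis cst_central mult.assoc)
  have "subst_HC (pCons q p) = (\<Sum>j\<le>Suc (Polynomial.degree p). ?f (pCons q p) j)"
    by (rule ge) (simp add: degree_pCons_le)
  also have "\<dots> = poly_lift (gen (Sl2 Hg)) q + (\<Sum>j\<le>Polynomial.degree p. gen Cas * ?f p j)"
    unfolding sum.atMost_Suc_shift by (simp add: poly_lift_def sum_distrib_left m mult.assoc)
  finally show ?thesis by (simp add: ge[OF order_refl] sum_distrib_left)
qed

text \<open>Modulo the left ideal generated by \<open>H - a\<close>, \<open>H\<close> may be replaced by \<open>a\<close>.\<close>

lemma subst_HC_evH: "\<exists>u. subst_HC p = poly_lift (gen Cas) (evH a p) + u * (gen (Sl2 Hg) - cst a)"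
proof (induction p)
  case 0
  then show ?case by (auto simp: evH_def intro: exI[of _ 0])
next
  case (pCons q p)
  let ?H = "gen (Sl2 Hg)"
  have "\<exists>v. poly_lift ?H q = cst (poly q a) + v * (?H - cst a)"
  proof (induction q)
    case (pCons b q)
    then obtain v where v: "poly_lift ?H q = cst (poly q a) + v * (?H - cst a)" by blast
    have "poly_lift ?H (pCons b q) = cst (poly (pCons b q) a) + (?H * v + cst (poly q a)) * (?H - cst a)"
      unfolding poly_lift_pCons v
      by (simp add: algebra_simps cst_add cst_mult cst_central[of "poly q a"])
    then show ?case by blast
  qed (auto intro: exI[of _ 0])
  then obtain v where v: "poly_lift ?H q = cst (poly q a) + v * (?H - cst a)" by blast
  obtain u where u: "subst_HC p = poly_lift (gen Cas) (evH a p) + u * (?H - cst a)" using pCons.IH by blast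
  have "evH a (pCons q p) = pCons (poly q a) (evH a p)" by (simp add: evH_def map_poly_pCons)
  then have "subst_HC (pCons q p) = poly_lift (gen Cas) (evH a (pCons q p)) + (v + gen Cas * u) * (?H - cst a)"
    unfolding subst_HC_pCons v u by (simp add: poly_lift_pCons algebra_simps)
  then show ?case by blast
qed

lemma poly_lift_diag: "poly_lift (diag l) q = diag (\<lambda>j. poly q (l j))"
proof (induction q)
  case 0
  show ?case by (auto intro!: endo_eqI poly_mapping_eqI simp: zero_endo.rep_eq)
next
  case (pCons a q)
  then show ?case
    by (auto intro!: endo_eqI poly_mapping_eqI
        simp: poly_lift_pCons plus_endo.rep_eq times_endo.rep_eq app_cst lookup_add algebra_simps)
qed

subsection \<open>The spanning set \<open>(X\<^sup>-)\<^sup>j\<close>\<close>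

text \<open>The element \<open>\<Sum> c\<^sub>j (X\<^sup>-)\<^sup>j\<close>, which takes the highest weight vector to \<open>\<Sum> c\<^sub>j m\<^sub>j\<close>.\<close>

definition lv :: "'x \<Rightarrow> basis_space \<Rightarrow> 'x free"
  where "lv xm = mono_lift (\<lambda>j. gen xm ^ j)"

text \<open>The set of series \<open>\<Sum> c\<^sub>j (X\<^sup>-)\<^sup>j + u X + v Y + i\<close>, in which \<open>c\<^sub>j\<close> are scalars, \<open>i\<close> is in the closed
  ideal of relations. It is everything as soon as generators map the \<open>(X\<^sup>-)\<^sup>j\<close> into it, because
  it contains \<open>1\<close> and all its convergent sums.\<close>

locale verma_span = series_ring con mon coef ser deg
  for con :: "'x free \<Rightarrow> 'f::complex_alg" and mon :: "'i::comm_monoid_add \<Rightarrow> 'f" and coef ser deg +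
  fixes I0 :: "'f set" and X Y :: 'f and xm :: 'x
  assumes ideal_I0: "ideal I0 (type_ring :: 'f ring)"
begin

definition low :: "'f set"
  where "low = {a. \<forall>n. coef a n \<in> range (lv xm)}"

definition L :: "'f set"
  where "L = {u * X + v * Y + i |u v i. i \<in> clos I0}"

definition T :: "'f set"
  where "T = {a + l |a l. a \<in> low \<and> l \<in> L}"

lemma lv_add: "lv xm v + lv xm w = lv xm (v + w)"
  by (simp add: lv_def mono_lift_add)

lemma lv_0: "lv xm 0 = 0"
  by (simp add: lv_def)

lemma lv_range: "a \<in> range (lv xm) \<Longrightarrow> b \<in> range (lv xm) \<Longrightarrow> a + b \<in> range (lv xm)" "0 \<in> range (lv xm)"
  using lv_0 by (auto simp: lv_add)

lemma lv_range_sum: "(\<And>s. s \<in> S \<Longrightarrow> F s \<in> range (lv xm)) \<Longrightarrow> sum F S \<in> range (lv xm)"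
  by (induction S rule: infinite_finite_induct) (simp_all add: lv_range)

lemma low_mon: "a \<in> low \<Longrightarrow> mon i * a \<in> low"
proof -
  assume a: "a \<in> low"
  have "coef (mon i * a) n \<in> range (lv xm)" for n
  proof -
    let ?N = "Suc (deg n)"
    have "eqv ?N (mon i * a) (mon i * (\<Sum>j | deg j < ?N. mon j * con (coef a j)))"
      by (intro eqv_mult eqv_refl eqv_expand)
    then have "coef (mon i * a) n = (\<Sum>j | deg j < ?N. coef (mon (i + j) * con (coef a j)) n)"
      by (simp add: eqv_def sum_distrib_left coef_sum mon_add mult.assoc)
    also have "\<dots> \<in> range (lv xm)"
      using a by (intro lv_range_sum) (auto simp: coef_mon_con low_def lv_range)
    finally show ?thesis .
  qed
  then show ?thesis by (simp add: low_def)
qed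

lemma low_join: "(\<And>i. b i \<in> low) \<Longrightarrow> join b \<in> low"
  unfolding join_def low_def coef_ser mem_Collect_eq coef_sum
  by (intro allI lv_range_sum) (use low_mon in \<open>auto simp: low_def\<close>)

lemma clos_I0:
  "0 \<in> clos I0" "x \<in> clos I0 \<Longrightarrow> y \<in> clos I0 \<Longrightarrow> x + y \<in> clos I0"
  "x \<in> clos I0 \<Longrightarrow> a * x \<in> clos I0" "x \<in> clos I0 \<Longrightarrow> x * a \<in> clos I0"
  using ideal_clos[OF ideal_I0] unfolding ideal_type_ring_iff by blast+

lemma L_join: "(\<And>i. b i \<in> L) \<Longrightarrow> join b \<in> L"
proof -
  assume "\<And>i. b i \<in> L"
  then have "\<forall>i. \<exists>u v z. z \<in> clos I0 \<and> b i = u * X + v * Y + z" unfolding L_def by blast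
  then obtain u v z where *: "\<And>i. z i \<in> clos I0" "\<And>i. b i = u i * X + v i * Y + z i" by metis
  have "b = (\<lambda>i. u i * X + v i * Y + z i)" using *(2) by blast
  then have "join b = join u * X + join v * Y + join z"
    by (simp add: join_mult_right join_add)
  moreover have "join z \<in> clos I0" by (rule join_clos[OF ideal_I0]) (rule *)
  ultimately show ?thesis unfolding L_def by blast
qed

lemma L_add: "x \<in> L \<Longrightarrow> y \<in> L \<Longrightarrow> x + y \<in> L"
proof -
  assume "x \<in> L" "y \<in> L"
  then obtain u v i u' v' i' where "x = u * X + v * Y + i" "y = u' * X + v' * Y + i'" "i \<in> clos I0" "i' \<in> clos I0"
    unfolding L_def by blast
  then have "x + y = (u + u') * X + (v + v') * Y + (i + i')" "i + i' \<in> clos I0"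
    by (auto simp: algebra_simps clos_I0)
  then show ?thesis unfolding L_def by blast
qed

lemma L_mult: "x \<in> L \<Longrightarrow> a * x \<in> L"
proof -
  assume "x \<in> L"
  then obtain u v i where "x = u * X + v * Y + i" "i \<in> clos I0" unfolding L_def by blast
  then have "a * x = (a * u) * X + (a * v) * Y + a * i" "a * i \<in> clos I0"
    by (auto simp: algebra_simps clos_I0)
  then show ?thesis unfolding L_def by blast
qed

lemma L_I: "x \<in> clos I0 \<Longrightarrow> x \<in> L" and L_X: "X \<in> L" and L_Y: "Y \<in> L"
proof -
  have *: "u * X + v * Y + i \<in> L" if "i \<in> clos I0" for u v i using that unfolding L_def by blast
  show "x \<in> clos I0 \<Longrightarrow> x \<in> L" using *[of x 0 0] by simp
  show "X \<in> L" "Y \<in> L" using *[OF clos_I0(1), of 1 0] *[OF clos_I0(1), of 0 1] by simp_all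
qed

lemma L_diff: "x \<in> L \<Longrightarrow> y \<in> L \<Longrightarrow> x - y \<in> L"
  using L_add[of x "- 1 * y"] L_mult[of y "- 1"] by simp

lemma low_add: "a \<in> low \<Longrightarrow> b \<in> low \<Longrightarrow> a + b \<in> low"
  unfolding low_def coef_add mem_Collect_eq using lv_range(1) by blast

lemma low_con: "con (lv xm v) \<in> low"
  using coef_mon_con[of 0 "lv xm v"] lv_0 by (auto simp: low_def mon_zero lv_range)

lemma low_zero: "0 \<in> low"
  using low_con[of 0] ahomD(4)[OF ahom_con] by (simp add: lv_0)

lemma T_L: "l \<in> L \<Longrightarrow> l \<in> T" and T_low: "a \<in> low \<Longrightarrow> a \<in> T"
proof -
  have *: "a + l \<in> T" if "a \<in> low" "l \<in> L" for a l using that unfolding T_def by blast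
  show "l \<in> L \<Longrightarrow> l \<in> T" using *[OF low_zero, of l] by simp
  show "a \<in> low \<Longrightarrow> a \<in> T" using *[OF _ L_mult[OF L_X, of 0], of a] by simp
qed

lemma T_add: "x \<in> T \<Longrightarrow> y \<in> T \<Longrightarrow> x + y \<in> T"
proof -
  assume "x \<in> T" "y \<in> T"
  then obtain a l b m where "x = a + l" "y = b + m" "a \<in> low" "b \<in> low" "l \<in> L" "m \<in> L" unfolding T_def by blast
  then have "x + y = (a + b) + (l + m)" "a + b \<in> low" "l + m \<in> L" by (auto simp: algebra_simps low_add L_add)
  then show ?thesis unfolding T_def by blast
qed

lemma T_join: "(\<And>i. b i \<in> T) \<Longrightarrow> join b \<in> T"
proof -
  assume "\<And>i. b i \<in> T"
  then have "\<forall>i. \<exists>a l. a \<in> low \<and> l \<in> L \<and> b i = a + l" unfolding T_def by blast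
  then obtain a l where *: "\<And>i. a i \<in> low" "\<And>i. l i \<in> L" "\<And>i. b i = a i + l i" by metis
  have "b = (\<lambda>i. a i + l i)" using *(3) by blast
  then have "join b = join a + join l" by (simp add: join_add)
  then show ?thesis using low_join[of a, OF *(1)] L_join[of l, OF *(2)] unfolding T_def by blast
qed

lemma T_pow: "con (gen xm ^ j) \<in> T"
  using low_con[of "Poly_Mapping.single j 1"] T_low by (simp add: lv_def)

lemma T_cst: "x \<in> T \<Longrightarrow> cst c * x \<in> T"
proof -
  assume "x \<in> T"
  then obtain a l where x: "x = a + l" "a \<in> low" "l \<in> L" unfolding T_def by blast
  have lv: "cst c * lv xm v \<in> range (lv xm)" for v
  proof -
    have "cst c * lv xm v = lv xm (cst c * v)" unfolding lv_def
      by (subst ahomD(3)[OF ahom_mono_lift], auto simp: power_add ahomD(1)[OF ahom_mono_lift])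
    then show ?thesis by blast
  qed
  have "cst c * a = join (\<lambda>n. con (cst c * coef a n))"
    by (subst join_coef[of a]) (simp add: join_mult_left ahomD[OF ahom_con])
  then have "coef (cst c * a) n \<in> range (lv xm)" for n
    proof -
    obtain v where "coef a n = lv xm v" using x(2) unfolding low_def by blast
    then show ?thesis using \<open>cst c * a = _\<close> lv[of v] by (simp add: join_con)
  qed
  then have "cst c * a \<in> low" by (simp add: low_def)
  then show ?thesis using L_mult[OF x(3), of "cst c"] unfolding T_def x(1) distrib_left by blast
qed

text \<open>Scalars and parameters are central and \<open>L\<close> is a left ideal, so only the sums of \<open>(X\<^sup>-)\<^sup>j\<close> matter, and
  these converge.\<close>

lemma T_stable:
  assumes "\<And>j. con s * con (gen xm ^ j) \<in> T" "x \<in> T"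
  shows "con s * x \<in> T"
proof -
  obtain a l where x: "x = a + l" "a \<in> low" "l \<in> L" using assms(2) unfolding T_def by blast
  have lv: "con s * con (lv xm v) \<in> T" for v
  proof (induction v rule: poly_mapping_single_induct)
    case zero
    then show ?case using low_zero T_low by (simp add: lv_0 ahomD[OF ahom_con])
  next
    case (single j c)
    have "con s * con (lv xm (Poly_Mapping.single j c)) = cst c * (con s * con (gen xm ^ j))"
      by (simp add: lv_def ahomD(1,3)[OF ahom_con]) (metis cst_central mult.assoc)
    then show ?case using T_cst[OF assms(1)] by simp
  next
    case (add v w)
    then show ?case using T_add by (simp add: lv_add[symmetric] ahomD[OF ahom_con] distrib_left)
  qed
  have "\<forall>n. \<exists>v. coef a n = lv xm v" using x(2) unfolding low_def by blast
  then obtain v where v: "\<And>n. coef a n = lv xm (v n)" by metis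
  have "con s * a = join (\<lambda>n. con s * con (lv xm (v n)))"
    by (subst join_coef[of a]) (simp add: join_mult_left v)
  then have "con s * a \<in> T" using T_join lv by simp
  then show ?thesis using T_add T_L[OF L_mult[OF x(3), of "con s"]] by (simp add: x(1) distrib_left)
qed

lemma T_UNIV:
  assumes "\<And>x j. con (gen x) * con (gen xm ^ j) \<in> T"
  shows "f \<in> T"
proof -
  have "con p \<in> T" for p
  proof (induction p rule: free_left_induct)
    case (cst c)
    show ?case using T_cst[OF T_pow[of 0], of c] by (simp add: ahomD[OF ahom_con])
  qed (use T_stable assms T_add in \<open>simp_all add: ahomD[OF ahom_con]\<close>)
  then have "join (\<lambda>i. con (coef f i)) \<in> T" by (intro T_join)
  then show ?thesis using join_coef[of f] by simp
qed

text \<open>By the relation, moving \<open>H\<close> to the right past \<open>(X\<^sup>-)\<^sup>j\<close> costs a multiple of \<open>(X\<^sup>-)\<^sup>j\<close>, and at the right end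
  \<open>H\<close> may be replaced by \<open>a\<close>.\<close>

lemma weight_T:
  assumes rel: "h * con (gen xm) - con (gen xm) * h + cst s * con (gen xm) \<in> clos I0" and a: "h - cst a \<in> L"
  shows "h * con (gen xm ^ j) \<in> T"
proof -
  let ?x = "con (gen xm)"
  have cl: "h * ?x ^ j - ?x ^ j * (h - cst (of_nat j * s)) \<in> clos I0" for j
  proof (induction j)
    case 0
    then show ?case using clos_I0(1) by simp
  next
    case (Suc j)
    have c: "cst s * y = y * cst s" "cst (s * of_nat j) * y = y * cst (s * of_nat j)" for y :: 'f
      by (rule cst_central)+
    have "h * ?x ^ Suc j - ?x ^ Suc j * (h - cst (of_nat (Suc j) * s)) =
        (h * ?x ^ j - ?x ^ j * (h - cst (of_nat j * s))) * ?x + ?x ^ j * (h * ?x - ?x * h + cst s * ?x)"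
      unfolding power_Suc2 of_nat_Suc by (simp add: algebra_simps cst_add c)
    then show ?case using Suc rel clos_I0 by simp
  qed
  have p: "con (gen xm ^ j) = ?x ^ j" by (simp add: ahomD[OF ahom_con])
  have eq: "h * ?x ^ j = cst (a - of_nat j * s) * ?x ^ j +
      (?x ^ j * (h - cst a) + (h * ?x ^ j - ?x ^ j * (h - cst (of_nat j * s))))"
    by (simp add: algebra_simps cst_diff cst_central[of _ "?x ^ j"])
  have "cst (a - of_nat j * s) * ?x ^ j \<in> T"
    using T_cst[OF T_pow, of "a - of_nat j * s" j] p by simp
  then show ?thesis
    unfolding p by (subst eq) (rule T_add[OF _ T_L[OF L_add[OF L_mult[OF a] L_I[OF cl]]]])
qed

lemma T_cong: "x - y \<in> clos I0 \<Longrightarrow> y \<in> T \<Longrightarrow> x \<in> T"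
  using T_add[OF T_L[OF L_I, of "x - y"], of y] by simp

lemma T_xm: "con (gen xm) * con (gen xm ^ j) \<in> T"
  using T_pow[of "Suc j"] by (simp add: ahomD[OF ahom_con])

lemma con_join_stable:
  assumes "\<And>i x. x \<in> T \<Longrightarrow> con (p i) * x \<in> T" "x \<in> T"
  shows "ser p * x \<in> T"
proof -
  have "ser p * x = join (\<lambda>i. con (p i) * x)" using join_mult_right[of "\<lambda>i. con (p i)" x] by (simp add: join_con)
  then show ?thesis using T_join[of "\<lambda>i. con (p i) * x"] assms by simp
qed

end

section \<open>The Verma modules\<close>

interpretation e1: series_ext fps_const "\<lambda>n. fps_X ^ n" fps_nth Abs_fps fps_const "\<lambda>n. fps_X ^ n" fps_nth Abs_fps
    "\<lambda>n. n" "free_lift a" for a :: "'x \<Rightarrow> 'b::complex_alg fps"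
  by unfold_locales (rule ahom_free_lift)

interpretation e2: series_ext "\<lambda>p. fps_const (fps_const p)" "\<lambda>(k, i). fps_X ^ k * fps_const (fps_X ^ i)"
    "\<lambda>f (k, i). fps_nth (fps_nth f k) i" "\<lambda>c. Abs_fps (\<lambda>k. Abs_fps (\<lambda>i. c (k, i)))"
    "\<lambda>p. fps_const (fps_const p)" "\<lambda>(k, i). fps_X ^ k * fps_const (fps_X ^ i)"
    "\<lambda>f (k, i). fps_nth (fps_nth f k) i" "\<lambda>c. Abs_fps (\<lambda>k. Abs_fps (\<lambda>i. c (k, i)))"
    "\<lambda>(k, i). k + i" "free_lift a" for a :: "'x \<Rightarrow> 'b::complex_alg fps fps"
  by unfold_locales (rule ahom_free_lift)

lemma Idl_type_ring:
  fixes S :: "'f::ring_1 set"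
  shows "ideal (Idl\<^bsub>type_ring\<^esub> S) type_ring" "S \<subseteq> Idl\<^bsub>type_ring\<^esub> S"
    "ideal J type_ring \<Longrightarrow> S \<subseteq> J \<Longrightarrow> Idl\<^bsub>type_ring\<^esub> S \<subseteq> J"
proof -
  interpret ring "type_ring :: 'f ring" by (rule ring_type_ring)
  show "ideal (Idl\<^bsub>type_ring\<^esub> S) type_ring" by (rule genideal_ideal) simp
  show "S \<subseteq> Idl\<^bsub>type_ring\<^esub> S" by (rule genideal_self) simp
  show "ideal J type_ring \<Longrightarrow> S \<subseteq> J \<Longrightarrow> Idl\<^bsub>type_ring\<^esub> S \<subseteq> J" by (rule genideal_minimal)
qed

lemma ahom_ideal: "ahom \<theta> \<Longrightarrow> ideal {f. \<theta> f = 0} (type_ring :: 'f::complex_alg ring)"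
  unfolding ideal_type_ring_iff by (simp add: ahomD)

lemma fps1_eqv_iff: "fps1.eqv N x y \<longleftrightarrow> (\<exists>z. x = y + fps_X ^ N * z)"
proof
  assume "fps1.eqv N x y"
  then have "x = y + fps_X ^ N * fps_shift N (x - y)"
    by (auto simp: fps1.eqv_def fps_eq_iff fps_X_power_mult_nth)
  then show "\<exists>z. x = y + fps_X ^ N * z" by blast
qed (auto simp: fps1.eqv_def fps_X_power_mult_nth)

text \<open>Both sides are continuous and agree on polynomials.\<close>

lemma ext1_unique:
  assumes \<kappa>: "ahom \<kappa>" and X: "\<kappa> fps_X = fps_X" and c: "\<And>p. \<kappa> (fps_const p) = free_lift a p"
  shows "\<kappa> f = e1.ext a f"
proof (rule fps1.eqv_all)
  fix N
  let ?t = "\<Sum>i | i < N. fps_X ^ i * fps_const (fps_nth f i)"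
  obtain z where z: "f = ?t + fps_X ^ N * z" using fps1.eqv_expand[of N f] unfolding fps1_eqv_iff by blast
  have "\<kappa> f = \<kappa> (?t + fps_X ^ N * z)" using z by (rule arg_cong)
  then have "\<kappa> f = \<kappa> ?t + fps_X ^ N * \<kappa> z" by (simp only: ahomD(2,3,8)[OF \<kappa>] X)
  then have "fps1.eqv N (\<kappa> f) (\<kappa> ?t)" unfolding fps1_eqv_iff by blast
  moreover have "\<kappa> ?t = e1.ext a ?t"
    by (simp only: ahomD(3,8,9)[OF \<kappa>] X c e1.ext_sum e1.ext_mon_con)
  moreover have "fps1.eqv N (e1.ext a ?t) (e1.ext a f)"
    by (rule e1.ext_eqv[OF fps1.eqv_sym[OF fps1.eqv_expand]])
  ultimately show "fps1.eqv N (\<kappa> f) (e1.ext a f)" by (simp only: fps1.eqv_trans)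
qed

lemma cact_laws:
  assumes I: "ideal I (type_ring :: 'f::ring_1 ring)" and A: "is_rep A" and kill: "\<And>i w. i \<in> I \<Longrightarrow> A i w = 0"
  shows "u \<in> carrier (type_ring Quot I) \<Longrightarrow> v \<in> carrier (type_ring Quot I) \<Longrightarrow>
      cact A (u \<oplus>\<^bsub>type_ring Quot I\<^esub> v) w = cact A u w + cact A v w"
    "u \<in> carrier (type_ring Quot I) \<Longrightarrow> cact A u (w + w') = cact A u w + cact A u w'"
    "u \<in> carrier (type_ring Quot I) \<Longrightarrow> v \<in> carrier (type_ring Quot I) \<Longrightarrow>
      cact A (u \<otimes>\<^bsub>type_ring Quot I\<^esub> v) w = cact A u (cact A v w)"
    "cact A \<one>\<^bsub>type_ring Quot I\<^esub> w = w"
  by (auto simp: quot_type_ring[OF I] cact_coset[OF I A kill] is_repD[OF A])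

subsection \<open>One parameter\<close>

definition gimg1 :: "complex \<Rightarrow> int \<Rightarrow> sl2_gen \<Rightarrow> endo fps"
  where "gimg1 d n x = (case x of
      Xp \<Rightarrow> fps_const down * diag1 (\<lambda>j. qnum d (of_int (int j)) * qnum d (of_int (n - int j + 1)))
    | Xm \<Rightarrow> fps_const up
    | Hg \<Rightarrow> diag1 (\<lambda>j. of_int (n - 2 * int j)))"

definition rep1 :: "complex \<Rightarrow> int \<Rightarrow> sl2_gen free fps \<Rightarrow> basis_space fps \<Rightarrow> basis_space fps"
  where "rep1 d n f = act1 (e1.ext (gimg1 d n) f)"

definition m0 :: basis_space where "m0 = Poly_Mapping.single 0 1"

lemma comp1_m0: "comp1 j (fps_const m0) = (if j = 0 then 1 else 0)"
  by (auto simp: fps_eq_iff comp1_nth m0_def lookup_single when_def simp del: single_one)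

definition phi1 :: "nat \<Rightarrow> int \<Rightarrow> sl2_gen free fps set set \<Rightarrow> basis_space fps"
  where "phi1 d n = coset_map (\<lambda>u. cact (rep1 (of_nat d) n) u (fps_const m0))"

lemma is_rep_rep1: "is_rep (rep1 d n)"
  using is_rep_act1 ahomD[OF e1.ahom_ext, of "gimg1 d n"] by (simp add: is_rep_def rep1_def)

lemma rep1_gen:
  "comp1 j (rep1 d n (gen1 Xm) v) = (if j = 0 then 0 else comp1 (j - 1) v)"
  "comp1 j (rep1 d n (gen1 Hg) v) = of_int (n - 2 * int j) * comp1 j v"
  "comp1 j (rep1 d n (gen1 Xp) v) = qnum d (of_int (int j + 1)) * qnum d (of_int (n - int j)) * comp1 (Suc j) v"
  "comp1 j (rep1 d n (map_fps cst a) v) = a * comp1 j v"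
proof -
  show "comp1 j (rep1 d n (gen1 Xm) v) = (if j = 0 then 0 else comp1 (j - 1) v)"
    "comp1 j (rep1 d n (gen1 Hg) v) = of_int (n - 2 * int j) * comp1 j v"
    "comp1 j (rep1 d n (gen1 Xp) v) = qnum d (of_int (int j + 1)) * qnum d (of_int (n - int j)) * comp1 (Suc j) v"
    unfolding rep1_def gen1_def e1.ext_con free_lift_gen gimg1_def sl2_gen.case is_repD(3)[OF is_rep_act1] comp1_act1
    by (simp_all add: add.commute)
  have "e1.ext (gimg1 d n) (map_fps cst a) = Abs_fps (\<lambda>i. cst (fps_nth a i))"
    by (rule e1.ext_ser) (simp only: map_fps_nth ahomD(1)[OF ahom_free_lift] cst_fps_def)
  also have "\<dots> = map_fps cst a" by (simp add: fps_eq_iff)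
  finally show "comp1 j (rep1 d n (map_fps cst a) v) = a * comp1 j v"
    by (simp add: rep1_def comp1_act1)
qed

lemma diag1_const: "diag1 (\<lambda>j. fps_const (l j)) = fps_const (diag l)"
proof -
  have "diag (\<lambda>j. 0) = 0" by (auto intro!: endo_eqI poly_mapping_eqI simp: zero_endo.rep_eq)
  then show ?thesis by (auto simp: fps_eq_iff diag1_def)
qed

lemma ext1_sinh_quot:
  assumes "d \<ge> 1"
  shows "e1.ext (gimg1 (of_nat d) n) (sinh_quot d) = diag1 (\<lambda>j. qnum (of_nat d) (of_int (n - 2 * int j)))"
proof -
  let ?l = "\<lambda>j. of_int (n - 2 * int j) :: complex"
  have H: "diag1 (\<lambda>j. of_int (n - 2 * int j)) = fps_const (diag ?l)"
    unfolding diag1_const[symmetric] by (simp only: fps_of_int)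
  have "e1.ext (gimg1 (of_nat d) n) (sinh_quot d) =
      Abs_fps (\<lambda>i. diag (\<lambda>j. poly (fps_nth (qnum (of_nat d) [:0, 1:]) i) (?l j)))"
  proof (rule e1.ext_ser)
    fix i
    have "free_lift (gimg1 (of_nat d) n) (poly_lift (gen Hg) q) = fps_const (poly_lift (diag ?l) q)" for q
      by (simp only: ahom_poly_lift_comm[OF ahom_free_lift] free_lift_gen gimg1_def sl2_gen.case H
          ahom_poly_lift_comm[OF ahom_fps_const])
    then show "free_lift (gimg1 (of_nat d) n) (fps_nth (sinh_quot d) i) =
        fps_const (diag (\<lambda>j. poly (fps_nth (qnum (of_nat d) [:0, 1:]) i) (?l j)))"
      by (simp add: sinh_quot_eq[OF assms] subst_H_eq poly_lift_diag)
  qed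
  also have "\<dots> = diag1 (\<lambda>j. map_fps (\<lambda>p. poly p (?l j)) (qnum (of_nat d) [:0, 1:]))"
    by (simp add: diag1_def)
  also have "\<dots> = diag1 (\<lambda>j. qnum (of_nat d) (?l j))"
  proof -
    have "ahom (\<lambda>p. poly p x)" for x :: complex by (simp add: ahom_def cst_poly_def)
    then show ?thesis using assms by (simp add: map_qnum)
  qed
  finally show ?thesis by simp
qed

lemma qnum_zero [simp]: "qnum d 0 = (0 :: complex fps)"
  using qnum_minus[of d "0 :: complex"] by (simp add: eq_neg_iff_add_eq_0)

lemma rep1_rels:
  assumes "d \<ge> 1" "f \<in> Uq_rels d" shows "e1.ext (gimg1 (of_nat d) n) f = 0"
proof (rule act1_faithful)
  fix j v
  note R = is_repD[OF is_rep_rep1]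
  have d: "(of_nat d :: complex) \<noteq> 0" using assms(1) by simp
  have sinh: "comp1 j (rep1 (of_nat d) n (sinh_quot d) v) = qnum (of_nat d) (of_int (n - 2 * int j)) * comp1 j v"
    by (simp add: rep1_def ext1_sinh_quot[OF assms(1)] comp1_act1)
  have two: "2 * x = x + x" for x :: "sl2_gen free fps" by (rule mult_2)
  have "comp1 j (rep1 (of_nat d) n f v) = 0"
    using assms(2) unfolding Uq_rels_def
  proof (elim insertE emptyE)
    assume f: "f = gen1 Xp * gen1 Xm - gen1 Xm * gen1 Xp - sinh_quot d"
    have e: "comp1 j (rep1 (of_nat d) n (gen1 Xm) (rep1 (of_nat d) n (gen1 Xp) v)) =
        qnum (of_nat d) (of_int (int j)) * qnum (of_nat d) (of_int (n - int j + 1)) * comp1 j v"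
      by (cases j) (simp_all add: rep1_gen algebra_simps)
    show ?thesis
      unfolding f R comp1_simps e sinh quantum_identity[OF d, of "int j" n, symmetric] rep1_gen
      by (simp add: algebra_simps)
  next
    assume f: "f = gen1 Hg * gen1 Xp - gen1 Xp * gen1 Hg - 2 * gen1 Xp"
    show ?thesis unfolding f two R comp1_simps rep1_gen by (simp add: algebra_simps)
  next
    assume f: "f = gen1 Hg * gen1 Xm - gen1 Xm * gen1 Hg + 2 * gen1 Xm"
    show ?thesis unfolding f two R comp1_simps rep1_gen by (cases j) (simp_all add: algebra_simps)
  qed
  then show "comp1 j (act1 (e1.ext (gimg1 (of_nat d) n) f) v) = comp1 j (act1 0 v)"
    by (simp add: rep1_def is_repD[OF is_rep_act1] comp1_simps)
qed

lemma Uq_ideal_clos: "Uq_ideal d = fps1.clos (Idl\<^bsub>type_ring\<^esub> (Uq_rels d))"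
  by (auto simp: Uq_ideal_def adic_closure_def fps1.clos_def fps1_eqv_iff regular_module_def)

lemma ideal_Uq: "ideal (Uq_ideal d) type_ring"
  unfolding Uq_ideal_clos by (rule fps1.ideal_clos[OF Idl_type_ring(1)])

lemma rep1_kill:
  assumes "d \<ge> 1" "f \<in> Uq_ideal d" shows "rep1 (of_nat d) n f v = 0"
proof -
  have "Idl\<^bsub>type_ring\<^esub> (Uq_rels d) \<subseteq> {f. e1.ext (gimg1 (of_nat d) n) f = 0}"
    by (rule Idl_type_ring(3)[OF ahom_ideal[OF e1.ahom_ext]]) (use rep1_rels[OF assms(1)] in auto)
  then have "e1.ext (gimg1 (of_nat d) n) f = 0"
    using e1.ext_clos assms(2) unfolding Uq_ideal_clos by blast
  then show ?thesis by (simp add: rep1_def is_repD[OF is_rep_act1])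
qed

lemma app_lv: "app (mono_lift (\<lambda>j. up ^ j) x) m0 = x"
proof (induction x rule: poly_mapping_single_induct)
  case (single j c)
  have "app (up ^ j) m0 = Poly_Mapping.single j 1"
  proof (induction j)
    case (Suc j)
    then show ?case
      by (auto simp: times_endo.rep_eq lookup_single when_def intro!: poly_mapping_eqI)
  qed (simp add: one_endo.rep_eq m0_def)
  then show ?case
    by (auto simp: times_endo.rep_eq app_cst lookup_single when_def intro!: poly_mapping_eqI)
qed (simp_all add: mono_lift_add plus_endo.rep_eq zero_endo.rep_eq)

lemma free_lift_lv: "ahom \<kappa> \<Longrightarrow> a x = \<kappa> up \<Longrightarrow> free_lift a (lv x v) = \<kappa> (mono_lift (\<lambda>j. up ^ j) v)"
  unfolding lv_def
  by (induction v rule: poly_mapping_single_induct)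
    (simp_all add: mono_lift_add ahomD ahomD[OF ahom_free_lift])

lemma rep1_lift: "rep1 d n (map_fps (lv Xm) w) (fps_const m0) = w"
proof -
  have "e1.ext (gimg1 d n) (map_fps (lv Xm) w) = Abs_fps (\<lambda>i. mono_lift (\<lambda>j. up ^ j) (fps_nth w i))"
    by (rule e1.ext_ser) (simp add: free_lift_lv[OF ahom_fps_const] gimg1_def)
  then show ?thesis by (simp add: fps_eq_iff rep1_def act1_const app_lv)
qed

text \<open>It suffices to bring \<open>x (X\<^sup>-)\<^sup>j\<close> into the required form for the generators \<open>x\<close>. For \<open>x = X\<^sup>+\<close> this is
  an induction on \<open>j\<close>: the commutator with \<open>X\<^sup>-\<close> is a series in \<open>H\<close>, which acts on \<open>(X\<^sup>-)\<^sup>j\<close> by a scalar.\<close>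

lemma span1:
  "\<exists>w u v i. i \<in> Uq_ideal d \<and> f = map_fps (lv Xm) w + u * gen1 Xp + v * (gen1 Hg - of_int n) + i"
proof -
  interpret V: verma_span fps_const "\<lambda>n. fps_X ^ n" fps_nth Abs_fps "\<lambda>n. n" "Idl\<^bsub>type_ring\<^esub> (Uq_rels d)"
      "gen1 Xp" "gen1 Hg - of_int n" Xm
    by (intro verma_span.intro verma_span_axioms.intro fps1.series_ring_axioms Idl_type_ring(1))
  note I = Uq_ideal_clos[symmetric]
  have rels: "f \<in> Uq_ideal d" if "f \<in> Uq_rels d" for f
    unfolding Uq_ideal_clos using that Idl_type_ring(2) fps1.subset_clos by blast
  have xm: "fps_const (gen Xm) * fps_const (gen Xm ^ j) \<in> V.T" for j by (rule V.T_xm)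
  have h: "fps_const (gen Hg) * fps_const (gen Xm ^ j) \<in> V.T" for j
  proof (rule V.weight_T[where s=2 and a="of_int n"])
    have "gen1 Hg * gen1 Xm - gen1 Xm * gen1 Hg + 2 * gen1 Xm \<in> Uq_ideal d"
      by (rule rels) (simp add: Uq_rels_def)
    then show "fps_const (gen Hg) * fps_const (gen Xm) - fps_const (gen Xm) * fps_const (gen Hg) +
        cst 2 * fps_const (gen Xm) \<in> fps1.clos (Idl\<^bsub>type_ring\<^esub> (Uq_rels d))"
      by (simp only: I gen1_def cst_numeral)
    show "fps_const (gen Hg) - cst (of_int n) \<in> V.L"
      using V.L_Y by (simp add: gen1_def cst_of_int)
  qed
  have q: "fps_const (subst_H p) * x \<in> V.T" if x: "x \<in> V.T" for p x
  proof (induction p)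
    case 0
    show ?case using V.T_cst[OF x, of 0] by (simp add: subst_H_eq)
  next
    case (pCons a p)
    have "fps_const (subst_H (pCons a p)) * x = cst a * x + fps_const (gen Hg) * (fps_const (subst_H p) * x)"
      unfolding subst_H_eq poly_lift_pCons ahomD(2)[OF ahom_fps_const, symmetric] ahomD(3)[OF ahom_fps_const, symmetric] cst_fps_def
      by (simp only: ahomD[OF ahom_fps_const] distrib_right mult.assoc)
    then show ?case using V.T_add[OF V.T_cst[OF x] V.T_stable[OF h pCons.IH]] by simp
  qed
  have xp: "fps_const (gen Xp) * fps_const (gen Xm ^ j) \<in> V.T" for j
  proof (induction j)
    case 0
    show ?case using V.T_L[OF V.L_X] by (simp add: gen1_def)
  next
    case (Suc j)
    let ?R = "fps_const (gen Xm ^ j) :: sl2_gen free fps"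
    have "gen1 Xp * gen1 Xm - gen1 Xm * gen1 Xp - sinh_quot d \<in> Uq_ideal d"
      by (rule rels) (simp add: Uq_rels_def)
    then have "(gen1 Xp * gen1 Xm - gen1 Xm * gen1 Xp - sinh_quot d) * ?R \<in> fps1.clos (Idl\<^bsub>type_ring\<^esub> (Uq_rels d))"
      using V.clos_I0(4) by (simp only: I)
    moreover have "fps_const (gen Xp) * fps_const (gen Xm ^ Suc j) - (gen1 Xm * (gen1 Xp * ?R) + sinh_quot d * ?R) =
        (gen1 Xp * gen1 Xm - gen1 Xm * gen1 Xp - sinh_quot d) * ?R"
      unfolding power_Suc ahomD(3)[OF ahom_fps_const] gen1_def by (simp only: left_diff_distrib distrib_right mult.assoc diff_diff_add)
    moreover have "gen1 Xm * (gen1 Xp * ?R) \<in> V.T"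
      using V.T_stable[OF xm Suc] by (simp only: gen1_def)
    moreover have "sinh_quot d * ?R \<in> V.T"
      using V.con_join_stable[of "fps_nth (sinh_quot d)" ?R, OF _ V.T_pow] q
      by (simp add: sinh_quot_def fps_nth_inverse)
    ultimately show ?case using V.T_cong V.T_add by metis
  qed
  have "f \<in> V.T"
  proof (rule V.T_UNIV)
    fix x j show "fps_const (gen x) * fps_const (gen Xm ^ j) \<in> V.T"
      using xm h xp by (cases x) auto
  qed
  then obtain a u v i where f: "f = a + (u * gen1 Xp + v * (gen1 Hg - of_int n) + i)" "a \<in> V.low" "i \<in> Uq_ideal d"
    unfolding V.T_def V.L_def I by blast
  then have "\<forall>k. \<exists>w. fps_nth a k = lv Xm w" unfolding V.low_def by blast
  then obtain w where "\<And>k. fps_nth a k = lv Xm (w k)" by metis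
  then have "a = map_fps (lv Xm) (Abs_fps w)" by (simp add: fps_eq_iff)
  then have "f = map_fps (lv Xm) (Abs_fps w) + u * gen1 Xp + v * (gen1 Hg - of_int n) + i"
    using f(1) by (simp add: add.assoc)
  then show ?thesis using f(3) by blast
qed

theorem Mq_models:
  assumes "d \<ge> 1"
  shows "models (Uq d) (Mq d n) (phi1 d n) UNIV (cact (rep1 (of_nat d) n))"
  unfolding Uq_def Mq_def Uq_cls_def phi1_def
proof (rule verma_models(1)[where lift="map_fps (lv Xm)", OF ideal_Uq is_rep_rep1 rep1_kill[OF assms] _ _ _ rep1_lift span1])
  show "rep1 (of_nat d) n (gen1 Xp) (fps_const m0) = 0"
    by (rule comp1_eqI) (simp add: rep1_gen comp1_m0 comp1_simps)
  have i: "of_int n = (map_fps cst (of_int n) :: sl2_gen free fps)"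
    by (rule ahomD(10)[OF ahom_map_fps[OF ahom_cst], symmetric])
  show "rep1 (of_nat d) n (gen1 Hg - of_int n) (fps_const m0) = 0"
    unfolding i by (rule comp1_eqI) (simp add: rep1_gen comp1_m0 comp1_simps is_repD[OF is_rep_rep1])
  show "map_fps (lv Xm) 0 = 0" by (simp add: fps_eq_iff lv_def)
qed

lemma cact_rep1: "d \<ge> 1 \<Longrightarrow> cact (rep1 (of_nat d) n) (Uq_cls d f) w = rep1 (of_nat d) n f w"
  unfolding Uq_cls_def by (rule cact_coset[OF ideal_Uq is_rep_rep1 rep1_kill])

lemma Uq_carrier: "carrier (Uq d) = range (Uq_cls d)"
  unfolding Uq_def Uq_cls_def by (rule quot_type_ring(2)[OF ideal_Uq])

lemma models_rep_on_Uq: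
  assumes d: "d \<ge> 1" and M: "models (Uq d) M \<phi> UNIV (cact (rep1 (of_nat d) n))"
  shows "rep_on (Uq d) (Uq_scal d) (fps_scale scale_sum) M"
proof -
  have "\<phi> (Uq_scal d c \<odot>\<^bsub>M\<^esub> x) = fps_scale scale_sum c (\<phi> x)" if "x \<in> carrier M" for c x
    using modelsD(7)[OF M _ that, of "Uq_scal d c"]
    by (auto simp: Uq_scal_def Uq_carrier cact_rep1[OF d] rep1_gen comp1_scale intro: comp1_eqI)
  then show ?thesis unfolding rep_on_def using modelsD[OF M] by blast
qed

subsection \<open>Two parameters\<close>

definition gimg2 :: "nat \<Rightarrow> int \<Rightarrow> int_gen \<Rightarrow> endo fps fps"
  where "gimg2 g n x = (case x of
      Sl2 y \<Rightarrow> (case y of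
          Xp \<Rightarrow> fps_const (fps_const down) * diag2 (\<lambda>j. num g (of_int (int j)) * num g (of_int (n - int j + 1)))
        | Xm \<Rightarrow> fps_const (fps_const up)
        | Hg \<Rightarrow> diag2 (\<lambda>j. fps_const (fps_const (of_int (n - 2 * int j)))))
    | Cas \<Rightarrow> cst ((of_int (n + 1))\<^sup>2))"

definition rep2 :: "nat \<Rightarrow> int \<Rightarrow> int_gen free fps fps \<Rightarrow> basis_space fps fps \<Rightarrow> basis_space fps fps"
  where "rep2 g n f = act2 (e2.ext (gimg2 g n) f)"

definition phi2 :: "nat \<Rightarrow> int \<Rightarrow> int_gen free fps fps set set \<Rightarrow> basis_space fps fps"
  where "phi2 g n = coset_map (\<lambda>u. cact (rep2 g n) u (fps_const (fps_const m0)))"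

lemma is_rep_rep2: "is_rep (rep2 g n)"
  using is_rep_act2 ahomD[OF e2.ahom_ext, of "gimg2 g n"] by (simp add: is_rep_def rep2_def)

lemma diag2_const: "diag2 (\<lambda>j. fps_const (c j)) = fps_const (diag1 c)"
proof -
  have "diag (\<lambda>j. 0) = 0" by (auto intro!: endo_eqI poly_mapping_eqI simp: zero_endo.rep_eq)
  then have "diag1 (\<lambda>j. 0) = 0" by (simp add: diag1_def fps_eq_iff)
  then show ?thesis by (auto simp: fps_eq_iff diag2_def)
qed

lemma ahom_const2: "ahom (\<lambda>p. fps_const (fps_const p))"
  by (rule ahom_compose[OF ahom_fps_const ahom_fps_const])

lemma gimg2_poly:
  "free_lift (gimg2 g n) (poly_lift (gen (Sl2 Hg)) q) = fps_const (fps_const (diag (\<lambda>j. poly q (of_int (n - 2 * int j)))))"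
  by (simp only: ahom_poly_lift_comm[OF ahom_free_lift] free_lift_gen gimg2_def int_gen.case sl2_gen.case
      diag2_const diag1_const ahom_poly_lift_comm[OF ahom_const2, symmetric] poly_lift_diag)

lemma gimg2_subst_HC:
  "free_lift (gimg2 g n) (subst_HC p) =
    fps_const (fps_const (diag (\<lambda>j. ev (of_int (n - 2 * int j)) ((of_int (n + 1))\<^sup>2) p)))"
proof (induction p)
  case 0
  have "diag (\<lambda>j. 0) = 0" by (auto intro!: endo_eqI poly_mapping_eqI simp: zero_endo.rep_eq)
  then show ?case by (simp add: ahomD[OF ahom_free_lift] ev_def)
next
  case (pCons q p)
  let ?l = "\<lambda>j. of_int (n - 2 * int j) :: complex" and ?N = "(of_int (n + 1) :: complex)\<^sup>2"
  have "diag (\<lambda>j. poly q (?l j)) + cst ?N * diag (\<lambda>j. ev (?l j) ?N p) = diag (\<lambda>j. ev (?l j) ?N (pCons q p))"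
    by (auto intro!: endo_eqI poly_mapping_eqI
        simp: ev_def plus_endo.rep_eq times_endo.rep_eq app_cst lookup_add algebra_simps)
  moreover have "free_lift (gimg2 g n) (gen Cas) = fps_const (fps_const (cst ?N))"
    by (simp add: gimg2_def cst_fps_def)
  ultimately show ?case
    unfolding subst_HC_pCons ahomD(2,3)[OF ahom_free_lift] gimg2_poly pCons.IH
    by (simp only: ahomD(2,3)[OF ahom_const2, symmetric])
qed

lemma ext2_subst_HC:
  "e2.ext (gimg2 g n) (map_fps (map_fps subst_HC) G) =
    diag2 (\<lambda>j. map_fps (map_fps (ev (of_int (n - 2 * int j)) ((of_int (n + 1))\<^sup>2))) G)"
proof -
  let ?e = "\<lambda>(k, i). diag (\<lambda>j. ev (of_int (n - 2 * int j)) ((of_int (n + 1))\<^sup>2) (fps_nth (fps_nth G k) i))"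
  have "e2.ext (gimg2 g n) (map_fps (map_fps subst_HC) G) = Abs_fps (\<lambda>k. Abs_fps (\<lambda>i. ?e (k, i)))"
    by (rule e2.ext_ser) (simp only: map_fps_nth split_beta gimg2_subst_HC)
  then show ?thesis by (simp add: diag2_def diag1_def)
qed

lemma rep2_gen:
  "comp2 j (rep2 g n (gen2 (Sl2 Xm)) v) = (if j = 0 then 0 else comp2 (j - 1) v)"
  "comp2 j (rep2 g n (gen2 (Sl2 Hg)) v) = of_int (n - 2 * int j) * comp2 j v"
  "comp2 j (rep2 g n (gen2 (Sl2 Xp)) v) = num g (of_int (int j + 1)) * num g (of_int (n - int j)) * comp2 (Suc j) v"
  "comp2 j (rep2 g n (gen2 Cas) v) = cst ((of_int (n + 1))\<^sup>2) * comp2 j v"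
  unfolding rep2_def gen2_def e2.ext_con free_lift_gen gimg2_def sl2_gen.case int_gen.case
    is_repD(3)[OF is_rep_act2] comp2_act2
  by (simp_all add: add.commute fps_of_int del: of_int_diff)

lemma rep2_scalar: "comp2 j (rep2 g n (map_fps (map_fps cst) a) v) = a * comp2 j v"
proof -
  have "e2.ext (gimg2 g n) (map_fps (map_fps cst) a) = Abs_fps (\<lambda>k. Abs_fps (\<lambda>i. case (k, i) of (k, i) \<Rightarrow> cst (fps_nth (fps_nth a k) i)))"
    by (rule e2.ext_ser) (simp only: map_fps_nth split_beta ahomD(1)[OF ahom_free_lift] cst_fps_def)
  also have "\<dots> = map_fps (map_fps cst) a" by (simp add: fps_eq_iff)
  finally show ?thesis by (simp add: rep2_def comp2_act2)
qed

lemma rep2_Q_H: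
  "comp2 j (rep2 g n (Q_H e) v) = fps_const (fexp (of_int (e * (n - 2 * int j)))) * comp2 j v"
proof -
  let ?l = "\<lambda>j. of_int (n - 2 * int j) :: complex"
  let ?p = "\<lambda>i. cst (1 / fact i) * (of_int e * [:0, 1:]) ^ i :: complex poly"
  have H: "poly_lift h [:0, 1:] = h" for h :: "int_gen free" by (simp add: poly_lift_pCons)
  have p: "cst (1 / fact i) * (of_int e * gen (Sl2 Hg)) ^ i = poly_lift (gen (Sl2 Hg)) (?p i)" for i
    by (simp only: ahomD[OF ahom_poly_lift] H)
  have "e2.ext (gimg2 g n) (Q_H e) =
      Abs_fps (\<lambda>k. Abs_fps (\<lambda>i. case (k, i) of (k, i) \<Rightarrow> if k = 0 then diag (\<lambda>j. poly (?p i) (?l j)) else 0))"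
  proof (rule e2.ext_ser)
    fix i :: "nat \<times> nat"
    show "free_lift (gimg2 g n) (case i of (k, i) \<Rightarrow> fps_nth (fps_nth (Q_H e) k) i) =
        fps_const (fps_const (case i of (k, i) \<Rightarrow> if k = 0 then diag (\<lambda>j. poly (?p i) (?l j)) else 0))"
    proof (cases i)
      case (Pair a b)
      have "free_lift (gimg2 g n) (cst (1 / fact b) * (of_int e * gen (Sl2 Hg)) ^ b) =
          fps_const (fps_const (diag (\<lambda>j. poly (?p b) (?l j))))"
        unfolding p by (rule gimg2_poly)
      then show ?thesis
        by (cases "a = 0")
          (simp_all only: Pair Q_H_def fps_nth_fps_const prod.case fexp_nth fps_zero_nth ahomD(4)[OF ahom_free_lift]
            fps_const_0_eq_0 if_True if_False simp_thms)
    qed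
  qed
  also have "\<dots> = fps_const (diag1 (\<lambda>j. fexp (of_int e * ?l j)))"
  proof -
    have "poly (?p i) (?l j) = fps_nth (fexp (of_int e * ?l j)) i" for i j
      by (simp add: fexp_nth cst_poly_def mult.commute)
    then show ?thesis by (auto simp: fps_eq_iff diag1_def)
  qed
  also have "\<dots> = diag2 (\<lambda>j. fps_const (fexp (of_int e * ?l j)))" by (simp only: diag2_const)
  finally show ?thesis by (simp add: rep2_def comp2_act2)
qed

lemma rep2_Q_sqrtC:
  "comp2 j (rep2 g n Q_sqrtC v) = fps_const (fexp (of_int (n + 1)) + fexp (of_int (- (n + 1)))) * comp2 j v"
proof -
  define A :: "complex fps" where "A = fexp (of_int (n + 1)) + fexp (of_int (- (n + 1)))"
  obtain N :: complex where N: "of_int (n + 1) = N" "of_int (- (n + 1)) = - N" by (metis of_int_minus)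
  have A: "fps_nth A b = (if even b then 2 / fact b * (N\<^sup>2) ^ (b div 2) else 0)" for b
  proof -
    have "(- x) ^ b = (if even b then x ^ b else - (x ^ b))" for x :: complex by simp
    moreover have "even b \<Longrightarrow> (x\<^sup>2) ^ (b div 2) = x ^ b" for x :: complex by (simp flip: power_mult)
    ultimately show ?thesis unfolding A_def N by (simp add: fexp_nth field_simps)
  qed
  have "e2.ext (gimg2 g n) Q_sqrtC =
      Abs_fps (\<lambda>k. Abs_fps (\<lambda>i. case (k, i) of (k, i) \<Rightarrow> cst (fps_nth (fps_nth (fps_const A) k) i)))"
  proof (rule e2.ext_ser)
    fix i :: "nat \<times> nat"
    show "free_lift (gimg2 g n) (case i of (k, i) \<Rightarrow> fps_nth (fps_nth Q_sqrtC k) i) =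
        fps_const (fps_const (case i of (k, i) \<Rightarrow> cst (fps_nth (fps_nth (fps_const A) k) i)))"
    proof (cases i)
      case (Pair k b)
      have "free_lift (gimg2 g n) (cst (2 / fact b) * gen Cas ^ (b div 2)) = cst (2 / fact b * (N\<^sup>2) ^ (b div 2))"
        by (simp only: ahomD[OF ahom_free_lift] free_lift_gen gimg2_def int_gen.case cst_mult cst_power N)
      also have "\<dots> = fps_const (fps_const (cst (2 / fact b * (N\<^sup>2) ^ (b div 2))))"
        by (simp only: cst_fps_def)
      finally show ?thesis
        by (cases "k = 0"; cases "even b")
          (simp_all only: Pair Q_sqrtC_def A prod.case fps_nth_fps_const fps_nth_Abs_fps ahomD(4)[OF ahom_free_lift]
            if_True if_False simp_thms fps_const_0_eq_0 fps_zero_nth cst_zero)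
    qed
  qed
  also have "\<dots> = map_fps (map_fps cst) (fps_const A)" by (simp add: fps_eq_iff)
  finally show ?thesis by (simp add: rep2_def comp2_act2 A_def del: of_int_add)
qed

text \<open>At \<open>\<surd>C = n + 1\<close> and \<open>H = n - 2j\<close>, \<open>H\<^sub>e\<^sup>+\<close> takes the values \<open>n - j\<close> and \<open>j + 1\<close>, and \<open>H\<^sub>e\<^sup>-\<close> the values
  \<open>n - j + 1\<close> and \<open>j\<close>.\<close>

lemma XX_series_value:
  assumes "g \<ge> 1"
  shows "map_fps (map_fps (ev (of_int (n - 2 * int j)) ((of_int (n + 1))\<^sup>2))) (XX_series g 1) =
      num g (of_int (int j + 1)) * num g (of_int (n - int j))"
    "map_fps (map_fps (ev (of_int (n - 2 * int j)) ((of_int (n + 1))\<^sup>2))) (XX_series g (- 1)) =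
      num g (of_int (int j)) * num g (of_int (n - int j + 1))"
  unfolding map_ev_XX_series[OF assms]
  by (auto simp: field_simps intro!: arg_cong2[where f="(*)"] arg_cong[where f="num g"])

lemma rep2_rels:
  assumes "g \<ge> 1" "f \<in> Uhh_rels g" shows "e2.ext (gimg2 g n) f = 0"
proof (rule act2_faithful)
  fix j v
  note R = is_repD[OF is_rep_rep2]
  have two: "2 * x = x + x" for x :: "int_gen free fps fps" by (rule mult_2)
  have XX: "comp2 j (rep2 g n (map_fps (map_fps subst_HC) G) v) =
      map_fps (map_fps (ev (of_int (n - 2 * int j)) ((of_int (n + 1))\<^sup>2))) G * comp2 j v" for G
    by (simp add: rep2_def ext2_subst_HC comp2_act2)
  have "comp2 j (rep2 g n f v) = 0"
    using assms(2) unfolding Uhh_rels_def Let_def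
  proof (elim insertE emptyE)
    assume f: "f = gen2 Cas * gen2 (Sl2 Xp) - gen2 (Sl2 Xp) * gen2 Cas"
    show ?thesis unfolding f R comp2_simps rep2_gen by simp
  next
    assume f: "f = gen2 Cas * gen2 (Sl2 Xm) - gen2 (Sl2 Xm) * gen2 Cas"
    show ?thesis unfolding f R comp2_simps rep2_gen by simp
  next
    assume f: "f = gen2 Cas * gen2 (Sl2 Hg) - gen2 (Sl2 Hg) * gen2 Cas"
    show ?thesis unfolding f R comp2_simps rep2_gen by simp
  next
    assume f: "f = gen2 (Sl2 Hg) * gen2 (Sl2 Xp) - gen2 (Sl2 Xp) * gen2 (Sl2 Hg) - 2 * gen2 (Sl2 Xp)"
    show ?thesis unfolding f two R comp2_simps rep2_gen by (simp add: algebra_simps)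
  next
    assume f: "f = gen2 (Sl2 Hg) * gen2 (Sl2 Xm) - gen2 (Sl2 Xm) * gen2 (Sl2 Hg) + 2 * gen2 (Sl2 Xm)"
    show ?thesis unfolding f two R comp2_simps rep2_gen by (cases j) (simp_all add: algebra_simps)
  next
    assume f: "f = gen2 (Sl2 Xp) * gen2 (Sl2 Xm) - map_fps (map_fps subst_HC) (XX_series g 1)"
    show ?thesis unfolding f R comp2_simps XX XX_series_value[OF assms(1)] rep2_gen by simp
  next
    assume f: "f = gen2 (Sl2 Xm) * gen2 (Sl2 Xp) - map_fps (map_fps subst_HC) (XX_series g (- 1))"
    have e: "comp2 j (rep2 g n (gen2 (Sl2 Xm)) (rep2 g n (gen2 (Sl2 Xp)) v)) =
        num g (of_int (int j)) * num g (of_int (n - int j + 1)) * comp2 j v"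
      by (cases j) (simp_all add: rep2_gen algebra_simps)
    show ?thesis unfolding f R comp2_simps XX XX_series_value[OF assms(1)] e by simp
  qed
  then show "comp2 j (act2 (e2.ext (gimg2 g n) f) v) = comp2 j (act2 0 v)"
    by (simp add: rep2_def is_repD[OF is_rep_act2] comp2_simps)
qed

lemma Uhh_ideal_clos: "Uhh_ideal g = fps2.clos (Idl\<^bsub>type_ring\<^esub> (Uhh_rels g))"
proof -
  have "fps2.eqv N x s \<longleftrightarrow> (\<forall>i k. i + k < N \<longrightarrow> fps_nth (fps_nth x k) i = fps_nth (fps_nth s k) i)"
    for N and x s :: "int_gen free fps fps"
    unfolding fps2.eqv_def by (auto simp: add.commute)
  then show ?thesis by (simp only: Uhh_ideal_def closure_hh_def fps2.clos_def)
qed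

lemma ideal_Uhh: "ideal (Uhh_ideal g) type_ring"
  unfolding Uhh_ideal_clos by (rule fps2.ideal_clos[OF Idl_type_ring(1)])

lemma rep2_kill:
  assumes "g \<ge> 1" "f \<in> Uhh_ideal g" shows "rep2 g n f v = 0"
proof -
  have "Idl\<^bsub>type_ring\<^esub> (Uhh_rels g) \<subseteq> {f. e2.ext (gimg2 g n) f = 0}"
    by (rule Idl_type_ring(3)[OF ahom_ideal[OF e2.ahom_ext]]) (use rep2_rels[OF assms(1)] in auto)
  then have "e2.ext (gimg2 g n) f = 0"
    using e2.ext_clos assms(2) unfolding Uhh_ideal_clos by blast
  then show ?thesis by (simp add: rep2_def is_repD[OF is_rep_act2])
qed

lemma rep2_lift: "rep2 g n (map_fps (map_fps (lv (Sl2 Xm))) w) (fps_const (fps_const m0)) = w"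
proof -
  have "e2.ext (gimg2 g n) (map_fps (map_fps (lv (Sl2 Xm))) w) =
      Abs_fps (\<lambda>k. Abs_fps (\<lambda>i. case (k, i) of (k, i) \<Rightarrow> mono_lift (\<lambda>j. up ^ j) (fps_nth (fps_nth w k) i)))"
    by (rule e2.ext_ser) (simp add: free_lift_lv[OF ahom_const2] gimg2_def split_beta)
  then show ?thesis by (simp add: fps_eq_iff rep2_def act2_const act1_const app_lv)
qed

lemma span2:
  assumes g: "g \<ge> 1"
  shows "\<exists>w u v i. i \<in> Uhh_ideal g \<and>
    f = map_fps (map_fps (lv (Sl2 Xm))) w + u * gen2 (Sl2 Xp) + v * (gen2 (Sl2 Hg) - of_int n) + i"
proof -
  interpret V: verma_span "\<lambda>p. fps_const (fps_const p)" "\<lambda>(k, i). fps_X ^ k * fps_const (fps_X ^ i)"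
      "\<lambda>f (k, i). fps_nth (fps_nth f k) i" "\<lambda>c. Abs_fps (\<lambda>k. Abs_fps (\<lambda>i. c (k, i)))" "\<lambda>(k, i). k + i"
      "Idl\<^bsub>type_ring\<^esub> (Uhh_rels g)" "gen2 (Sl2 Xp)" "gen2 (Sl2 Hg) - of_int n" "Sl2 Xm"
    by (intro verma_span.intro verma_span_axioms.intro fps2.series_ring_axioms Idl_type_ring(1))
  let ?c = "\<lambda>p. fps_const (fps_const p) :: int_gen free fps fps"
  note I = Uhh_ideal_clos[symmetric]
  have rels: "f \<in> fps2.clos (Idl\<^bsub>type_ring\<^esub> (Uhh_rels g))" if "f \<in> Uhh_rels g" for f
    using that Idl_type_ring(2) fps2.subset_clos by blast
  have xm: "?c (gen (Sl2 Xm)) * ?c (gen (Sl2 Xm) ^ j) \<in> V.T" for j by (rule V.T_xm)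
  have h: "?c (gen (Sl2 Hg)) * ?c (gen (Sl2 Xm) ^ j) \<in> V.T" for j
  proof (rule V.weight_T[where s=2 and a="of_int n"])
    have "gen2 (Sl2 Hg) * gen2 (Sl2 Xm) - gen2 (Sl2 Xm) * gen2 (Sl2 Hg) + 2 * gen2 (Sl2 Xm)
        \<in> fps2.clos (Idl\<^bsub>type_ring\<^esub> (Uhh_rels g))"
      by (rule rels) (simp add: Uhh_rels_def Let_def)
    then show "?c (gen (Sl2 Hg)) * ?c (gen (Sl2 Xm)) - ?c (gen (Sl2 Xm)) * ?c (gen (Sl2 Hg)) +
        cst 2 * ?c (gen (Sl2 Xm)) \<in> fps2.clos (Idl\<^bsub>type_ring\<^esub> (Uhh_rels g))"
      by (simp only: gen2_def cst_numeral)
    show "?c (gen (Sl2 Hg)) - cst (of_int n) \<in> V.L"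
      using V.L_Y by (simp only: gen2_def cst_of_int)
  qed
  \<comment> \<open>\<open>X\<^sup>-X\<^sup>+\<close> lies in the left ideal; dividing its expression in \<open>C\<close> by the unit shows that \<open>C - (n+1)\<^sup>2\<close> does.\<close>
  have cas: "?c (gen Cas) - cst ((of_int n + 1)\<^sup>2) \<in> V.L"
  proof -
    let ?G = "XX_series g (- 1)" and ?n = "of_int n :: complex"
    let ?\<kappa> = "map_fps (map_fps (poly_lift (gen Cas))) :: complex poly fps fps \<Rightarrow> int_gen free fps fps"
    have \<kappa>: "ahom ?\<kappa>" by (intro ahom_map_fps ahom_poly_lift)
    let ?S = "map_fps (map_fps subst_HC) ?G" and ?E = "map_fps (map_fps (evH ?n)) ?G"
    have "gen2 (Sl2 Xm) * gen2 (Sl2 Xp) - ?S \<in> V.L"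
      by (rule V.L_I, rule rels) (simp add: Uhh_rels_def Let_def)
    then have "gen2 (Sl2 Xm) * gen2 (Sl2 Xp) - (gen2 (Sl2 Xm) * gen2 (Sl2 Xp) - ?S) \<in> V.L"
      by (rule V.L_diff[OF V.L_mult[OF V.L_X]])
    then have S: "?S \<in> V.L" by simp
    have "?S - ?\<kappa> ?E = fps2.join (\<lambda>(k, i). ?c (subst_HC (fps_nth (fps_nth ?G k) i) -
        poly_lift (gen Cas) (evH ?n (fps_nth (fps_nth ?G k) i))))"
      using fps2.join_con[of "\<lambda>(k, i). subst_HC (fps_nth (fps_nth ?G k) i) -
        poly_lift (gen Cas) (evH ?n (fps_nth (fps_nth ?G k) i))"]
      by (simp add: case_prod_unfold fps_eq_iff)
    also have "\<dots> \<in> V.L"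
    proof (rule V.L_join)
      fix i :: "nat \<times> nat"
      obtain u where "subst_HC (fps_nth (fps_nth ?G (fst i)) (snd i)) -
          poly_lift (gen Cas) (evH ?n (fps_nth (fps_nth ?G (fst i)) (snd i))) = u * (gen (Sl2 Hg) - cst ?n)"
        using subst_HC_evH[of "fps_nth (fps_nth ?G (fst i)) (snd i)" ?n] by auto
      moreover have "?c (u * (gen (Sl2 Hg) - cst ?n)) = ?c u * (gen2 (Sl2 Hg) - of_int n)"
        by (simp only: ahomD[OF ahom_const2] cst_of_int gen2_def)
      ultimately show "(case i of (k, i) \<Rightarrow> ?c (subst_HC (fps_nth (fps_nth ?G k) i) -
        poly_lift (gen Cas) (evH ?n (fps_nth (fps_nth ?G k) i)))) \<in> V.L"
        using V.L_mult[OF V.L_Y, of "?c u"] by (simp add: split_beta)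
    qed
    finally have "?S - (?S - ?\<kappa> ?E) \<in> V.L" by (rule V.L_diff[OF S])
    then have E: "?\<kappa> ?E \<in> V.L" by simp
    obtain W where W: "W * ?E = fps_const (fps_const [:- ((?n + 1)\<^sup>2), 1:])"
      using XX_series_minus_unit[OF g] by blast
    have "poly_lift (gen Cas) [:- a, 1:] = gen Cas - cst a" for a
      by (simp add: poly_lift_pCons cst_minus)
    moreover have "?\<kappa> (fps_const (fps_const p)) = ?c (poly_lift (gen Cas) p)" for p
      by (simp add: fps_eq_iff)
    ultimately have "?\<kappa> (W * ?E) = ?c (gen Cas) - cst ((?n + 1)\<^sup>2)"
      unfolding W by (simp only: ahomD[OF ahom_const2])
    then show ?thesis using V.L_mult[OF E, of "?\<kappa> W"] by (simp only: ahomD(3)[OF \<kappa>])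
  qed
  have c: "?c (gen Cas) * ?c (gen (Sl2 Xm) ^ j) \<in> V.T" for j
  proof (rule V.weight_T[OF _ cas, where s=0])
    have "gen2 Cas * gen2 (Sl2 Xm) - gen2 (Sl2 Xm) * gen2 Cas \<in> fps2.clos (Idl\<^bsub>type_ring\<^esub> (Uhh_rels g))"
      by (rule rels) (simp add: Uhh_rels_def Let_def)
    then show "?c (gen Cas) * ?c (gen (Sl2 Xm)) - ?c (gen (Sl2 Xm)) * ?c (gen Cas) + cst 0 * ?c (gen (Sl2 Xm))
        \<in> fps2.clos (Idl\<^bsub>type_ring\<^esub> (Uhh_rels g))"
      by (simp only: gen2_def cst_zero mult_zero_left add_0_right)
  qed
  have pl: "?c (poly_lift (gen (Sl2 Hg)) p) * x \<in> V.T" if x: "x \<in> V.T" for p x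
  proof (induction p)
    case 0
    show ?case using V.T_cst[OF x, of 0] by simp
  next
    case (pCons a p)
    have "?c (poly_lift (gen (Sl2 Hg)) (pCons a p)) * x = cst a * x + ?c (gen (Sl2 Hg)) * (?c (poly_lift (gen (Sl2 Hg)) p) * x)"
      unfolding poly_lift_pCons by (simp only: ahomD[OF ahom_const2] distrib_right mult.assoc)
    then show ?case using V.T_add[OF V.T_cst[OF x] V.T_stable[OF h pCons.IH]] by simp
  qed
  have q: "?c (subst_HC p) * x \<in> V.T" if x: "x \<in> V.T" for p x
  proof (induction p)
    case 0
    show ?case using V.T_cst[OF x, of 0] by simp
  next
    case (pCons a p)
    have "?c (subst_HC (pCons a p)) * x = ?c (poly_lift (gen (Sl2 Hg)) a) * x + ?c (gen Cas) * (?c (subst_HC p) * x)"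
      unfolding subst_HC_pCons by (simp only: ahomD[OF ahom_const2] distrib_right mult.assoc)
    then show ?case using V.T_add[OF pl[OF x] V.T_stable[OF c pCons.IH]] by simp
  qed
  have xp: "?c (gen (Sl2 Xp)) * ?c (gen (Sl2 Xm) ^ j) \<in> V.T" for j
  proof (cases j)
    case 0
    then show ?thesis using V.T_L[OF V.L_X] by (simp add: gen2_def)
  next
    case (Suc j)
    let ?R = "?c (gen (Sl2 Xm) ^ j)" and ?S = "map_fps (map_fps subst_HC) (XX_series g 1)"
    have "gen2 (Sl2 Xp) * gen2 (Sl2 Xm) - ?S \<in> fps2.clos (Idl\<^bsub>type_ring\<^esub> (Uhh_rels g))"
      by (rule rels) (simp add: Uhh_rels_def Let_def)
    then have "(gen2 (Sl2 Xp) * gen2 (Sl2 Xm) - ?S) * ?R \<in> fps2.clos (Idl\<^bsub>type_ring\<^esub> (Uhh_rels g))"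
      by (rule V.clos_I0(4))
    moreover have "?c (gen (Sl2 Xp)) * ?c (gen (Sl2 Xm) ^ Suc j) - ?S * ?R = (gen2 (Sl2 Xp) * gen2 (Sl2 Xm) - ?S) * ?R"
      unfolding power_Suc ahomD(3)[OF ahom_const2] gen2_def by (simp only: left_diff_distrib mult.assoc)
    moreover have "?S * ?R \<in> V.T"
      using V.con_join_stable[of "\<lambda>(k, i). subst_HC (fps_nth (fps_nth (XX_series g 1) k) i)" ?R, OF _ V.T_pow] q
      by (simp add: split_beta map_fps_def)
    ultimately show ?thesis unfolding Suc using V.T_cong by metis
  qed
  have "f \<in> V.T"
  proof (rule V.T_UNIV)
    fix x j show "?c (gen x) * ?c (gen (Sl2 Xm) ^ j) \<in> V.T"
    proof (cases x)
      case (Sl2 y)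
      then show ?thesis using xm[of j] h[of j] xp[of j] by (cases y) simp_all
    next
      case Cas
      then show ?thesis using c[of j] by simp
    qed
  qed
  then obtain a u v i where f: "f = a + (u * gen2 (Sl2 Xp) + v * (gen2 (Sl2 Hg) - of_int n) + i)" "a \<in> V.low" "i \<in> Uhh_ideal g"
    unfolding V.T_def V.L_def I by blast
  then have "\<forall>k l. \<exists>w. fps_nth (fps_nth a k) l = lv (Sl2 Xm) w" unfolding V.low_def by auto
  then obtain w where "\<And>k l. fps_nth (fps_nth a k) l = lv (Sl2 Xm) (w k l)" by metis
  then have "a = map_fps (map_fps (lv (Sl2 Xm))) (Abs_fps (\<lambda>k. Abs_fps (w k)))" by (simp add: fps_eq_iff)
  then have "f = map_fps (map_fps (lv (Sl2 Xm))) (Abs_fps (\<lambda>k. Abs_fps (w k))) + u * gen2 (Sl2 Xp) + v * (gen2 (Sl2 Hg) - of_int n) + i"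
    using f(1) by (simp add: add.assoc)
  then show ?thesis using f(3) by blast
qed

lemma verma2_hyps:
  "rep2 g n (gen2 (Sl2 Xp)) (fps_const (fps_const m0)) = 0"
  "rep2 g n (gen2 (Sl2 Hg) - of_int n) (fps_const (fps_const m0)) = 0"
  "map_fps (map_fps (lv (Sl2 Xm))) 0 = 0"
proof -
  have c: "comp2 j (fps_const (fps_const m0)) = (if j = 0 then 1 else 0)" for j
    by (rule fps_ext) (simp add: comp2_nth comp1_m0 comp1_simps)
  show "rep2 g n (gen2 (Sl2 Xp)) (fps_const (fps_const m0)) = 0"
    by (rule comp2_eqI) (simp add: rep2_gen c comp2_simps)
  have i: "of_int n = (map_fps (map_fps cst) (of_int n) :: int_gen free fps fps)"
    by (rule ahomD(10)[OF ahom_map_fps[OF ahom_map_fps[OF ahom_cst]], symmetric])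
  show "rep2 g n (gen2 (Sl2 Hg) - of_int n) (fps_const (fps_const m0)) = 0"
    unfolding i by (rule comp2_eqI) (simp add: rep2_gen rep2_scalar c comp2_simps is_repD[OF is_rep_rep2])
  show "map_fps (map_fps (lv (Sl2 Xm))) 0 = 0" by (simp add: fps_eq_iff lv_def)
qed

lemma Mhh_models:
  assumes "g \<ge> 1"
  shows "models (Uhh g) (Mhh g n) (phi2 g n) UNIV (cact (rep2 g n))"
    "phi2 g n (Mhh_cls g n f) = rep2 g n f (fps_const (fps_const m0))"
    "carrier (Mhh g n) = range (Mhh_cls g n)"
  using verma_models[where lift="map_fps (map_fps (lv (Sl2 Xm)))", OF ideal_Uhh is_rep_rep2 rep2_kill[OF assms]
      verma2_hyps rep2_lift span2[OF assms]]
  unfolding Mhh_cls_def Uhh_def Mhh_def Uhh_cls_def phi2_def by blast+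

lemma cact_rep2: "g \<ge> 1 \<Longrightarrow> cact (rep2 g n) (Uhh_cls g f) w = rep2 g n f w"
  unfolding Uhh_cls_def by (rule cact_coset[OF ideal_Uhh is_rep_rep2 rep2_kill])

lemma Uhh_carrier: "carrier (Uhh g) = range (Uhh_cls g)"
  unfolding Uhh_def Uhh_cls_def by (rule quot_type_ring(2)[OF ideal_Uhh])

section \<open>The limit \<open>h' \<rightarrow> 0\<close>\<close>

lemma models_surj: "models R M \<phi> T act \<Longrightarrow> t \<in> T \<Longrightarrow> \<exists>y. y \<in> carrier M \<and> \<phi> y = t"
  by (auto simp: models_def bij_betw_def)

lemma Mhh_scal:
  assumes "g \<ge> 1" "x \<in> carrier (Mhh g n)"
  shows "comp2 j (phi2 g n (Uhh_scal g c \<odot>\<^bsub>Mhh g n\<^esub> x)) = c * comp2 j (phi2 g n x)"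
  using modelsD(7)[OF Mhh_models(1)[OF assms(1)] _ assms(2), of "Uhh_scal g c"]
  by (auto simp: Uhh_scal_def Uhh_carrier cact_rep2[OF assms(1)] rep2_scalar)

lemma Mhh_rep_on:
  assumes "g \<ge> 1"
  shows "rep_on (Uhh g) (Uhh_scal g) (fps_scale (fps_scale scale_sum)) (Mhh g n)"
proof -
  have "phi2 g n (Uhh_scal g c \<odot>\<^bsub>Mhh g n\<^esub> x) = fps_scale (fps_scale scale_sum) c (phi2 g n x)"
    if "x \<in> carrier (Mhh g n)" for c x
    by (rule comp2_eqI) (simp add: Mhh_scal[OF assms that] comp2_scale)
  then show ?thesis unfolding rep_on_def using modelsD[OF Mhh_models(1)[OF assms]] by blast
qed

lemma ahom_nth_0: "ahom (\<lambda>f :: 'a::complex_alg fps. fps_nth f 0)"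
  by (simp add: ahom_def cst_fps_def fps_mult_nth_0)

lemma embed_free_eq: "embed_free = mono_lift (\<lambda>w. Poly_Mapping.single (map Sl2 w) 1)"
proof
  fix p
  have "cst c * Poly_Mapping.single w 1 = (Poly_Mapping.single w c :: int_gen free)" for c w
    by (simp add: cst_poly_mapping_def mult_single zero_list_def plus_list_def)
  then show "embed_free p = mono_lift (\<lambda>w. Poly_Mapping.single (map Sl2 w) 1) p"
    by (simp add: embed_free_def mono_lift_def)
qed

lemma ahom_embed_free: "ahom embed_free"
  unfolding embed_free_eq
proof (rule ahom_mono_lift)
  show "Poly_Mapping.single (map Sl2 0) 1 = (1 :: int_gen free)"
    using single_one[where 'a="int_gen list" and 'b=complex] by (simp add: zero_list_def)
  show "Poly_Mapping.single (map Sl2 (k + l)) 1 =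
      (Poly_Mapping.single (map Sl2 k) 1 * Poly_Mapping.single (map Sl2 l) 1 :: int_gen free)" for k l
    by (simp add: mult_single plus_list_def)
qed

lemma embed_free_gen: "embed_free (gen x) = gen (Sl2 x)"
  by (simp add: embed_free_eq gen_def)

text \<open>At \<open>h' = 0\<close> the deformed numbers are the quantum numbers for \<open>Q\<close>, so the generators act by the
  one-parameter operators.\<close>

lemma ext2_embed:
  "fps_nth (e2.ext (gimg2 g n) (fps_const (map_fps embed_free f))) 0 = e1.ext (gimg1 1 n) f"
proof (rule ext1_unique)
  let ?\<kappa> = "\<lambda>f. fps_nth (e2.ext (gimg2 g n) (fps_const (map_fps embed_free f))) 0"
  show \<kappa>: "ahom ?\<kappa>"
    by (rule ahom_compose[OF ahom_nth_0 ahom_compose[OF e2.ahom_ext ahom_compose[OF ahom_fps_const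
        ahom_map_fps[OF ahom_embed_free]]]])
  have "map_fps embed_free fps_X = fps_X"
    by (simp add: fps_eq_iff fps_X_def ahomD[OF ahom_embed_free])
  then show "?\<kappa> fps_X = fps_X"
    using e2.ext_mon_con[of "gimg2 g n" "(0, 1)" 1] by (simp add: ahomD[OF ahom_free_lift])
  have "?\<kappa> (fps_const (gen x)) = gimg1 1 n x" for x
  proof -
    have "?\<kappa> (fps_const (gen x)) = fps_nth (gimg2 g n (Sl2 x)) 0"
    proof -
      have "map_fps embed_free (fps_const (gen x)) = fps_const (gen (Sl2 x))"
        by (simp add: fps_eq_iff embed_free_gen ahomD[OF ahom_embed_free])
      then show ?thesis using e2.ext_con[of "gimg2 g n" "gen (Sl2 x)"] by simp
    qed
    also have "\<dots> = gimg1 1 n x"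
      by (cases x) (simp_all add: gimg2_def gimg1_def diag2_def num_0 fps_of_int flip: of_int_diff)
    finally show ?thesis .
  qed
  then show "?\<kappa> (fps_const p) = free_lift (gimg1 1 n) p" for p
    using ahom_free_eqI[OF ahom_compose[OF \<kappa> ahom_fps_const] ahom_free_lift[of "gimg1 1 n"]] by simp
qed

lemma rep2_nth_0: "fps_nth (rep2 g n f w) 0 = act1 (fps_nth (e2.ext (gimg2 g n) f) 0) (fps_nth w 0)"
  by (simp add: rep2_def fps_scale_nth)

text \<open>The quotient by \<open>h'\<close> keeps the constant coefficients, on which the one-parameter algebra acts by
  \<open>rep1\<close>.\<close>

lemma limit_models:
  assumes g: "g \<ge> 1"
  shows "\<exists>\<phi>. models (Uq 1) (limit_h' g (Mhh g n)) \<phi> UNIV (cact (rep1 1 n))"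
proof -
  let ?M = "Mhh g n" and ?\<phi> = "phi2 g n"
  note M = Mhh_models(1)[OF g, of n]
  note M' = modelsD[OF M]
  define \<tau> where "\<tau> x = fps_nth (?\<phi> x) 0" for x
  define act0 where "act0 a t = fps_nth (cact (rep2 g n) a (fps_const t)) 0" for a t
  define N where "N = (\<lambda>x. Uhh_scal g fps_X \<odot>\<^bsub>?M\<^esub> x) ` carrier ?M"
  have clsc: "Uhh_cls g f \<in> carrier (Uhh g)" for f by (simp add: Uhh_carrier)
  have N: "N = {x \<in> carrier ?M. \<tau> x = 0}"
  proof (rule Set.set_eqI)
    fix x
    show "x \<in> N \<longleftrightarrow> x \<in> {x \<in> carrier ?M. \<tau> x = 0}"
    proof
      assume "x \<in> N"
      then obtain y where y: "y \<in> carrier ?M" "x = Uhh_scal g fps_X \<odot>\<^bsub>?M\<^esub> y" by (auto simp: N_def)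
      have "comp1 j (\<tau> x) = 0" for j
        using Mhh_scal[OF g y(1), of j fps_X] by (simp add: \<tau>_def y(2) flip: comp2_nth)
      then have "\<tau> x = 0" by (intro comp1_eqI) (simp add: comp1_simps)
      then show "x \<in> {x \<in> carrier ?M. \<tau> x = 0}"
        using y left_module_closed(2)[OF M'(1) clsc y(1)] by (simp add: Uhh_scal_def)
    next
      assume x: "x \<in> {x \<in> carrier ?M. \<tau> x = 0}"
      obtain y where y: "y \<in> carrier ?M" "?\<phi> y = fps_shift 1 (?\<phi> x)"
        using models_surj[OF M UNIV_I] by blast
      have "?\<phi> (Uhh_scal g fps_X \<odot>\<^bsub>?M\<^esub> y) = ?\<phi> x"
      proof (rule comp2_eqI, rule fps_ext)
        fix j k
        show "fps_nth (comp2 j (?\<phi> (Uhh_scal g fps_X \<odot>\<^bsub>?M\<^esub> y))) k = fps_nth (comp2 j (?\<phi> x)) k"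
          using x by (cases k) (simp_all add: Mhh_scal[OF g y(1)] y(2) comp2_nth \<tau>_def comp1_simps)
      qed
      then have "x = Uhh_scal g fps_X \<odot>\<^bsub>?M\<^esub> y"
        using M'(3) x left_module_closed(2)[OF M'(1) clsc y(1)] by (auto simp: inj_on_def Uhh_scal_def)
      then show "x \<in> N" using y(1) by (simp add: N_def)
    qed
  qed
  have add: "\<tau> (x \<oplus>\<^bsub>?M\<^esub> y) = \<tau> x + \<tau> y" if "x \<in> carrier ?M" "y \<in> carrier ?M" for x y
    using M'(6)[OF that] by (simp add: \<tau>_def)
  have act: "\<tau> (a \<odot>\<^bsub>?M\<^esub> x) = act0 a (\<tau> x)" if "a \<in> carrier (Uhh g)" "x \<in> carrier ?M" for a x
    using M'(7)[OF that] that by (auto simp: \<tau>_def act0_def Uhh_carrier cact_rep2[OF g] rep2_nth_0)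
  define M0 where "M0 = quot_module ?M N"
  note Q = models_quot[where \<tau>=\<tau> and act=act0, OF M'(1) add act N, folded M0_def]
  have "\<tau> ` carrier ?M = UNIV"
  proof -
    have "t \<in> \<tau> ` carrier ?M" for t
    proof -
      obtain y where "y \<in> carrier ?M" "?\<phi> y = fps_const t"
        using models_surj[OF M UNIV_I] by blast
      then show ?thesis by (auto simp: \<tau>_def intro!: rev_image_eqI)
    qed
    then show ?thesis by blast
  qed
  then have Q1: "models (Uhh g) M0 (coset_map \<tau>) UNIV act0" using Q(1) by simp
  note Q' = modelsD[OF Q1]
  define sm where "sm u x = (\<Union>f\<in>u. Uhh_cls g (fps_const (map_fps embed_free f)) \<odot>\<^bsub>M0\<^esub> x)" for u x
  have sm: "sm u x \<in> carrier M0 \<and> coset_map \<tau> (sm u x) = cact (rep1 1 n) u (coset_map \<tau> x)"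
    if u: "u \<in> carrier (Uq 1)" and x: "x \<in> carrier M0" for u x
  proof -
    obtain f0 where f0: "u = Uq_cls 1 f0" using u by (auto simp: Uq_carrier)
    let ?y = "\<lambda>f. Uhh_cls g (fps_const (map_fps embed_free f)) \<odot>\<^bsub>M0\<^esub> x"
    have y: "?y f \<in> carrier M0" for f by (rule left_module_closed(2)[OF Q'(1) clsc x])
    have \<phi>y: "coset_map \<tau> (?y f) = rep1 1 n f (coset_map \<tau> x)" for f
      using Q'(7)[OF clsc x] by (simp add: act0_def cact_rep2[OF g] rep2_nth_0 ext2_embed rep1_def)
    have f: "?y f = ?y f0" if fu: "f \<in> u" for f
    proof -
      obtain i where "i \<in> Uq_ideal 1" "f = i + f0" using fu by (auto simp: f0 Uq_cls_def type_ring_coset)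
      then have "coset_map \<tau> (?y f) = coset_map \<tau> (?y f0)"
        using rep1_kill[of 1 i n] by (simp add: \<phi>y is_repD[OF is_rep_rep1])
      then show ?thesis using Q'(3) y by (auto simp: inj_on_def)
    qed
    have "0 + f0 \<in> u" using ideal_Uq[of 1] unfolding f0 Uq_cls_def type_ring_coset ideal_type_ring_iff by blast
    then have "u \<noteq> {}" by blast
    then have "sm u x = ?y f0" unfolding sm_def using f by auto
    then show ?thesis using y[of f0] \<phi>y[of f0] cact_rep1[of 1 n f0] by (simp add: f0)
  qed
  have "models (Uq 1) (with_smult sm M0) (coset_map \<tau>) UNIV (cact (rep1 1 n))"
  proof (rule models_with_smult[OF Q1])
    show "ring (Uq 1)" unfolding Uq_def by (rule quot_type_ring(1)[OF ideal_Uq])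
  qed (use sm cact_laws[OF ideal_Uq is_rep_rep1 rep1_kill[of 1], folded Uq_def] in auto)
  moreover have "limit_h' g ?M = with_smult sm M0"
    by (simp add: limit_h'_def Let_def M0_def N_def sm_def[abs_def])
  ultimately show ?thesis by metis
qed

theorem Mhh_deformation:
  assumes "g \<ge> 1" shows "deformation_along_h' scale_sum g (Mhh g n) (Mq 1 n)"
proof -
  obtain \<phi> where L: "models (Uq 1) (limit_h' g (Mhh g n)) \<phi> UNIV (cact (rep1 1 n))"
    using limit_models[OF assms] by blast
  have M: "models (Uq 1) (Mq 1 n) (phi1 1 n) UNIV (cact (rep1 1 n))"
    using Mq_models[of 1 n] by simp
  have "rep_on (Uq 1) (Uq_scal 1) (fps_scale scale_sum) (limit_h' g (Mhh g n))"
    "rep_on (Uq 1) (Uq_scal 1) (fps_scale scale_sum) (Mq 1 n)"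
    by (rule models_rep_on_Uq; use L M in simp)+
  then show ?thesis
    unfolding deformation_along_h'_def using Mhh_rep_on[OF assms] models_iso[OF L M] by blast
qed

section \<open>The ring \<open>\<A>\<close> and its evaluation at \<open>Q = z\<close>\<close>

definition AL :: "(int \<Rightarrow>\<^sub>0 complex) \<Rightarrow> complex fps"
  where "AL = mono_lift (\<lambda>i. fexp (of_int i))"

lemma ahom_AL: "ahom AL"
  unfolding AL_def by (rule ahom_mono_lift) (simp_all flip: fexp_add)

lemma AL_single: "AL (Poly_Mapping.single i c) = cst c * fexp (of_int i)"
  by (simp add: AL_def)

lemma ring_A_AL: "ring_A = range AL"
proof (intro equalityI subsetI)
  fix a assume "a \<in> ring_A"
  then obtain I c where "a = (\<Sum>i\<in>I. cst (c i) * fexp (of_int i))" unfolding ring_A_def by blast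
  then have "a = AL (\<Sum>i\<in>I. Poly_Mapping.single i (c i))" by (simp only: ahomD[OF ahom_AL] AL_single)
  then show "a \<in> range AL" by blast
next
  fix a assume "a \<in> range AL"
  then obtain p where "a = AL p" by blast
  then have "a = (\<Sum>i\<in>Poly_Mapping.keys p. cst (Poly_Mapping.lookup p i) * fexp (of_int i))"
    by (simp only: AL_def mono_lift_def)
  then show "a \<in> ring_A" unfolding ring_A_def using finite_keys[of p] by (intro CollectI exI conjI)
qed

text \<open>The powers \<open>Q\<^sup>i\<close> are linearly independent: a relation gives \<open>\<Sum> c\<^sub>i f(i) = 0\<close> for all polynomials \<open>f\<close>,
  in particular for one that vanishes at all but one of the exponents.\<close>

lemma inj_AL: "AL p = 0 \<Longrightarrow> p = 0"
proof (rule ccontr)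
  assume "AL p = 0" "p \<noteq> 0"
  let ?K = "Poly_Mapping.keys p" and ?c = "Poly_Mapping.lookup p"
  have "(\<Sum>i\<in>?K. ?c i * of_int i ^ k) = 0" for k
  proof -
    have "0 = fps_nth (AL p) k" by (simp add: \<open>AL p = 0\<close>)
    also have "\<dots> = (1 / fact k) * (\<Sum>i\<in>?K. ?c i * of_int i ^ k)"
      by (simp add: AL_def mono_lift_def fps_sum_nth fexp_nth sum_distrib_left sum_divide_distrib)
    finally show ?thesis by simp
  qed
  then have *: "(\<Sum>i\<in>?K. ?c i * poly f (of_int i)) = 0" for f :: "complex poly"
  proof -
    have "(\<Sum>i\<in>?K. ?c i * poly f (of_int i)) = (\<Sum>i\<in>?K. \<Sum>k\<le>Polynomial.degree f. Polynomial.coeff f k * (?c i * of_int i ^ k))"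
      by (simp add: poly_altdef sum_distrib_left ac_simps)
    also have "\<dots> = (\<Sum>k\<le>Polynomial.degree f. Polynomial.coeff f k * (\<Sum>i\<in>?K. ?c i * of_int i ^ k))"
      by (subst sum.swap) (simp add: sum_distrib_left)
    finally show ?thesis using \<open>\<And>k. (\<Sum>i\<in>?K. ?c i * of_int i ^ k) = 0\<close> by simp
  qed
  obtain i0 where i0: "i0 \<in> ?K" using \<open>p \<noteq> 0\<close> by (metis all_not_in_conv keys_eq_empty)
  define f :: "complex poly" where "f = (\<Prod>l\<in>?K - {i0}. [:- of_int l, 1:])"
  have "(\<Sum>i\<in>?K. ?c i * poly f (of_int i)) = (\<Sum>i\<in>{i0}. ?c i * poly f (of_int i))"
    by (rule sum.mono_neutral_right) (use i0 in \<open>auto simp: f_def poly_prod\<close>)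
  then have "?c i0 * poly f (of_int i0) = 0" using * by simp
  moreover have "poly f (of_int i0) \<noteq> 0" by (auto simp: f_def poly_prod)
  ultimately show False using i0 by (simp add: in_keys_iff)
qed

text \<open>Evaluation at \<open>Q = z\<close>; the preimage is unique by \<open>inj_AL\<close>.\<close>

definition evA :: "complex \<Rightarrow> complex fps \<Rightarrow> complex"
  where "evA z a = mono_lift (\<lambda>i. z powi i) (SOME p. AL p = a)"

lemma evA_AL: "evA z (AL p) = mono_lift (\<lambda>i. z powi i) p"
proof -
  have "AL (SOME q. AL q = AL p) = AL p" by (rule someI) simp
  then have "AL ((SOME q. AL q = AL p) - p) = 0" by (simp add: ahomD[OF ahom_AL])
  then have "(SOME q. AL q = AL p) = p" using inj_AL by fastforce
  then show ?thesis by (simp add: evA_def)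
qed

lemma ring_A_closed:
  "cst c \<in> ring_A" "fexp (of_int i) \<in> ring_A"
  "a \<in> ring_A \<Longrightarrow> b \<in> ring_A \<Longrightarrow> a + b \<in> ring_A" "a \<in> ring_A \<Longrightarrow> b \<in> ring_A \<Longrightarrow> a * b \<in> ring_A"
  "a \<in> ring_A \<Longrightarrow> - a \<in> ring_A" "a \<in> ring_A \<Longrightarrow> b \<in> ring_A \<Longrightarrow> a - b \<in> ring_A" "0 \<in> ring_A" "1 \<in> ring_A"
proof -
  show "cst c \<in> ring_A" for c unfolding ring_A_AL by (metis ahomD(1)[OF ahom_AL] rangeI)
  then show "0 \<in> ring_A" "1 \<in> ring_A" by (metis cst_zero, metis cst_one')
  have "fexp (of_int i) = AL (Poly_Mapping.single i 1)" by (simp add: AL_single del: cst_id)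
  then show "fexp (of_int i) \<in> ring_A" unfolding ring_A_AL by blast
  show "a \<in> ring_A \<Longrightarrow> b \<in> ring_A \<Longrightarrow> a + b \<in> ring_A" "a \<in> ring_A \<Longrightarrow> b \<in> ring_A \<Longrightarrow> a * b \<in> ring_A"
    "a \<in> ring_A \<Longrightarrow> - a \<in> ring_A" "a \<in> ring_A \<Longrightarrow> b \<in> ring_A \<Longrightarrow> a - b \<in> ring_A"
    unfolding ring_A_AL by (auto simp flip: ahomD[OF ahom_AL])
qed

lemma ring_A_sum: "(\<And>i. i \<in> S \<Longrightarrow> f i \<in> ring_A) \<Longrightarrow> sum f S \<in> ring_A"
  by (induction S rule: infinite_finite_induct) (auto simp: ring_A_closed)

lemma ring_A_prod: "(\<And>i. i \<in> S \<Longrightarrow> f i \<in> ring_A) \<Longrightarrow> prod f S \<in> ring_A"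
  by (induction S rule: infinite_finite_induct) (auto simp: ring_A_closed)

lemma ring_A_power: "a \<in> ring_A \<Longrightarrow> a ^ k \<in> ring_A"
  by (induction k) (auto simp: ring_A_closed)

lemma evA_simps:
  assumes z: "z \<noteq> 0"
  shows "evA z (cst c) = c" "evA z (fexp (of_int i)) = z powi i"
    "a \<in> ring_A \<Longrightarrow> b \<in> ring_A \<Longrightarrow> evA z (a + b) = evA z a + evA z b"
    "a \<in> ring_A \<Longrightarrow> b \<in> ring_A \<Longrightarrow> evA z (a * b) = evA z a * evA z b"
    "a \<in> ring_A \<Longrightarrow> evA z (- a) = - evA z a"
    "a \<in> ring_A \<Longrightarrow> b \<in> ring_A \<Longrightarrow> evA z (a - b) = evA z a - evA z b" "evA z 0 = 0" "evA z 1 = 1"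
proof -
  have h: "ahom (mono_lift (\<lambda>i. z powi i))" by (rule ahom_mono_lift) (auto simp: power_int_add z)
  note e = evA_AL[of z]
  show c: "evA z (cst c) = c" for c
    using e[of "cst c"] by (simp only: ahomD(1)[OF ahom_AL] ahomD(1)[OF h] cst_id)
  show "evA z 0 = 0" "evA z 1 = 1" using c[of 0] c[of 1] by (simp_all only: cst_zero cst_one')
  have "fexp (of_int i) = AL (Poly_Mapping.single i 1)" by (simp add: AL_single del: cst_id)
  then show "evA z (fexp (of_int i)) = z powi i" by (simp add: e)
  show "a \<in> ring_A \<Longrightarrow> b \<in> ring_A \<Longrightarrow> evA z (a + b) = evA z a + evA z b"
    "a \<in> ring_A \<Longrightarrow> b \<in> ring_A \<Longrightarrow> evA z (a * b) = evA z a * evA z b"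
    "a \<in> ring_A \<Longrightarrow> evA z (- a) = - evA z a"
    "a \<in> ring_A \<Longrightarrow> b \<in> ring_A \<Longrightarrow> evA z (a - b) = evA z a - evA z b"
    unfolding ring_A_AL by (auto simp: e ahomD[OF h] simp flip: ahomD[OF ahom_AL])
qed

lemma evA_sum: "z \<noteq> 0 \<Longrightarrow> (\<And>i. i \<in> S \<Longrightarrow> f i \<in> ring_A) \<Longrightarrow> evA z (sum f S) = (\<Sum>i\<in>S. evA z (f i))"
  by (induction S rule: infinite_finite_induct) (auto simp: evA_simps ring_A_sum)

lemma evA_prod: "z \<noteq> 0 \<Longrightarrow> (\<And>i. i \<in> S \<Longrightarrow> f i \<in> ring_A) \<Longrightarrow> evA z (prod f S) = (\<Prod>i\<in>S. evA z (f i))"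
  by (induction S rule: infinite_finite_induct) (auto simp: evA_simps ring_A_prod)

lemma evA_power: "z \<noteq> 0 \<Longrightarrow> a \<in> ring_A \<Longrightarrow> evA z (a ^ k) = evA z a ^ k"
  by (induction k) (auto simp: evA_simps ring_A_power)

text \<open>Modulo \<open>Q - z\<close> every \<open>Q\<^sup>i\<close>, also for negative \<open>i\<close>, is congruent to the constant \<open>z\<^sup>i\<close>, so every
  element is congruent to its value.\<close>

lemma evA_kernel:
  assumes z: "z \<noteq> 0" and a: "a \<in> ring_A" "evA z a = 0"
  shows "\<exists>b\<in>ring_A. a = (fexp 1 - cst z) * b"
proof -
  let ?u = "fexp 1 - cst z :: complex fps"
  define K where "K = {?u * b |b. b \<in> ring_A}"
  have K_add: "x + y \<in> K" if xy: "x \<in> K" "y \<in> K" for x y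
  proof -
    obtain b c where "x = ?u * b" "y = ?u * c" "b \<in> ring_A" "c \<in> ring_A"
      using xy unfolding K_def by blast
    then have "x + y = ?u * (b + c)" "b + c \<in> ring_A" by (auto simp: distrib_left ring_A_closed)
    then show ?thesis unfolding K_def by blast
  qed
  have K_mult: "c * x \<in> K" if xc: "x \<in> K" "c \<in> ring_A" for c x
  proof -
    obtain b where "x = ?u * b" "b \<in> ring_A" using xc unfolding K_def by blast
    then have "c * x = ?u * (c * b)" "c * b \<in> ring_A" using xc by (auto simp: ring_A_closed)
    then show ?thesis unfolding K_def by blast
  qed
  have u: "?u \<in> K" unfolding K_def using ring_A_closed(8) by force
  have zK: "0 \<in> K" using K_mult[OF u ring_A_closed(7)] by simp
  have D: "fexp (of_int i) - cst (z powi i) \<in> K" for i :: int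
  proof (induction i rule: int_induct[of _ 0])
    case base
    then show ?case using zK by simp
  next
    case (step1 i)
    have "fexp (of_int (i + 1)) = (fexp 1 * fexp (of_int i) :: complex fps)" by (simp add: add.commute flip: fexp_add)
    moreover have "cst (z powi (i + 1)) = (cst z * cst (z powi i) :: complex fps)"
      using z by (simp add: power_int_add mult.commute flip: cst_mult)
    ultimately have "fexp (of_int (i + 1)) - cst (z powi (i + 1)) =
        fexp 1 * (fexp (of_int i) - cst (z powi i)) + cst (z powi i) * ?u"
      by (simp add: algebra_simps)
    then show ?case using K_add[OF K_mult[OF step1(2)] K_mult[OF u]] ring_A_closed(1) ring_A_closed(2)[of 1] by simp
  next
    case (step2 i)
    have 1: "fexp (of_int (i - 1)) = (fexp (- 1) * fexp (of_int i) :: complex fps)" by (simp flip: fexp_add)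
    have 2: "cst (z powi (i - 1)) = (cst (inverse z) * cst (z powi i) :: complex fps)"
      using z by (simp add: power_int_diff field_simps flip: cst_mult)
    have 3: "fexp (- 1) * fexp 1 = (1 :: complex fps)" using fexp_minus[of "1 :: complex"] by (simp add: mult.commute)
    have 4: "cst (inverse z) * cst z = (1 :: complex fps)" using cst_inverse(1)[OF z] .
    have "fexp (of_int (i - 1)) - cst (z powi (i - 1)) =
        ((fexp (- 1) * (cst (inverse z) * cst z)) * fexp (of_int i) - cst (inverse z) * cst (z powi i) * (fexp (- 1) * fexp 1) :: complex fps)"
      by (simp only: 1 2 3 4 mult_1_right)
    also have "\<dots> = fexp (- 1) * (fexp (of_int i) - cst (z powi i)) + (- (fexp (- 1) * cst (inverse z) * cst (z powi i))) * ?u"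
      using 4 by (simp add: algebra_simps)
    finally have eq: "fexp (of_int (i - 1)) - cst (z powi (i - 1)) = fexp (- 1) * (fexp (of_int i) - cst (z powi i)) +
        (- (fexp (- 1) * cst (inverse z) * cst (z powi i))) * ?u" .
    have A1: "fexp (- 1) \<in> ring_A" using ring_A_closed(2)[of "- 1"] by simp
    have "- (fexp (- 1) * cst (inverse z) * cst (z powi i)) \<in> ring_A" by (intro ring_A_closed A1)
    then show ?case unfolding eq using K_add[OF K_mult[OF step2(2) A1] K_mult[OF u]] by blast
  qed
  obtain p where p: "a = AL p" using a(1) unfolding ring_A_AL by blast
  have "AL p - cst (mono_lift (\<lambda>i. z powi i) p) \<in> K"
  proof (induction p rule: poly_mapping_single_induct)
    case zero
    then show ?case using zK by (simp add: ahomD[OF ahom_AL])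
  next
    case (single i c)
    have "AL (Poly_Mapping.single i c) - cst (mono_lift (\<lambda>i. z powi i) (Poly_Mapping.single i c)) =
        cst c * (fexp (of_int i) - cst (z powi i))"
      by (simp add: AL_single right_diff_distrib cst_mult)
    then show ?case using K_mult[OF D ring_A_closed(1)] by simp
  next
    case (add p q)
    then show ?case using K_add[OF add] by (simp add: ahomD[OF ahom_AL] mono_lift_add cst_add algebra_simps)
  qed
  then have "a \<in> K" using a(2) by (simp add: p evA_AL)
  then show ?thesis unfolding K_def by blast
qed

lemma ring_A_dderiv: "a \<in> ring_A \<Longrightarrow> dderiv k a \<in> ring_A"
proof (induction k)
  case (Suc k)
  have "fps_deriv a \<in> ring_A" if a: "a \<in> ring_A" for a
  proof -
    obtain p where "a = AL p" using a unfolding ring_A_AL by blast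
    moreover have "fps_deriv (AL p) \<in> ring_A"
    proof (induction p rule: poly_mapping_single_induct)
      case (single i c)
      have "fps_deriv (AL (Poly_Mapping.single i c)) = cst c * (cst (of_int i) * fexp (of_int i))"
        by (simp add: AL_single cst_fps_def fps_deriv_fexp)
      then show ?case using ring_A_closed by simp
    qed (simp_all add: ahomD[OF ahom_AL] ring_A_closed)
    ultimately show ?thesis by simp
  qed
  then show ?case using Suc by (simp only: dderiv_Suc ring_A_closed)
qed simp

lemma qnum_ring_A: "qnum 1 (of_int a :: complex) \<in> ring_A"
proof -
  have E: "Epow 1 1 - Epow 1 (- 1) \<noteq> 0" by (rule Epow_nz) simp
  have nat: "qnum 1 (of_int (int k) :: complex) \<in> ring_A" for k
  proof (induction k)
    case 0
    then show ?case using ring_A_closed(7) by simp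
  next
    case (Suc k)
    let ?s = "\<lambda>a. qnum 1 (of_int a :: complex)"
    have "(Epow 1 1 * ?s (int k) + Epow 1 (- int k)) * (Epow 1 1 - Epow 1 (- 1)) =
        Epow 1 1 * (?s (int k) * (Epow 1 1 - Epow 1 (- 1))) + Epow 1 (- int k) * (Epow 1 1 - Epow 1 (- 1))"
      by (simp add: algebra_simps)
    also have "\<dots> = ?s (int (Suc k)) * (Epow 1 1 - Epow 1 (- 1))"
      unfolding qnum_Epow[OF one_neq_zero] by (simp add: right_diff_distrib Epow_mult algebra_simps)
    finally have "?s (int (Suc k)) = Epow 1 1 * ?s (int k) + Epow 1 (- int k)" using E by simp
    moreover have "Epow 1 i \<in> ring_A" for i using ring_A_closed(2) by (simp add: Epow_def)
    ultimately show ?case using Suc ring_A_closed by simp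
  qed
  show ?thesis
  proof (cases a rule: int_cases2)
    case (nonneg k)
    then show ?thesis using nat[of k] by simp
  next
    case (nonpos k)
    then have "qnum 1 (of_int a :: complex) = - qnum 1 (of_int (int k))" by (simp add: qnum_minus)
    then show ?thesis using nat[of k] ring_A_closed(5) by simp
  qed
qed

lemma P_fun_ring_A:
  "P_fun g (fexp (of_int a)) (fexp (- of_int a)) \<in> ring_A"
  "z \<noteq> 0 \<Longrightarrow> evA z (P_fun g (fexp (of_int a)) (fexp (- of_int a))) = P_fun g (z powi a) (z powi (- a))"
proof -
  have m: "- (of_int a :: complex) = of_int (- a)" by simp
  have A: "fexp (of_int i) \<in> ring_A" for i by (rule ring_A_closed)
  show "P_fun g (fexp (of_int a)) (fexp (- of_int a)) \<in> ring_A"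
    unfolding P_fun_def Let_def m by (intro ring_A_closed ring_A_prod ring_A_power)
  assume z: "z \<noteq> 0"
  show "evA z (P_fun g (fexp (of_int a)) (fexp (- of_int a))) = P_fun g (z powi a) (z powi (- a))"
    unfolding P_fun_def Let_def m
    by (simp only: evA_simps[OF z] evA_prod[OF z] evA_power[OF z] ring_A_closed ring_A_prod ring_A_power cst_id)
qed

lemma taylor_ring_A: "x \<in> ring_A \<Longrightarrow> f \<in> ring_A \<Longrightarrow> fps_nth (taylor x f) k \<in> ring_A"
  by (simp add: taylor_nth ring_A_closed ring_A_power ring_A_dderiv)

text \<open>For an integer \<open>a\<close>, \<open>[a]\<^sub>Q\<close> and \<open>{a}\<close> are Laurent polynomials in \<open>Q\<close>, and \<open>d/dh\<close> preserves them.\<close>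

lemma num_ring_A: "fps_nth (num g (of_int a)) k \<in> ring_A"
  unfolding num_def by (intro taylor_ring_A P_fun_ring_A qnum_ring_A)

lemma map_evA_mult:
  assumes "z \<noteq> 0" "\<And>k. fps_nth f k \<in> ring_A" "\<And>k. fps_nth g k \<in> ring_A"
  shows "map_fps (evA z) (f * g) = map_fps (evA z) f * map_fps (evA z) g"
  by (rule fps_ext) (simp add: fps_mult_nth evA_sum[OF assms(1)] evA_simps[OF assms(1)] ring_A_closed assms)

definition numE :: "nat \<Rightarrow> int \<Rightarrow> complex fps"
  where "numE g a = map_fps (evA (root_eps g)) (num g (of_int a))"

text \<open>Substituting \<open>h + h'{a}\<close> for \<open>h\<close> in \<open>[a]\<^sub>Q (Q - Q\<^sup>-\<^sup>1) = Q\<^sup>a - Q\<^sup>-\<^sup>a\<close> and evaluating at \<open>Q = \<epsilon>\<close>, where \<open>{a}\<close>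
  becomes \<open>x\<close>.\<close>

lemma numE_eq:
  fixes a :: int
  assumes g: "g \<ge> 1"
  defines "x \<equiv> if int g dvd a then 1 else (0 :: complex)"
  shows "numE g a * (cst (root_eps g) * fexp x - cst (inverse (root_eps g)) * fexp (- x)) =
    cst (root_eps g powi a) * fexp (x * of_int a) - cst (root_eps g powi (- a)) * fexp (- (x * of_int a))"
proof -
  let ?z = "root_eps g" and ?P = "P_fun g (fexp (of_int a)) (fexp (- of_int a)) :: complex fps"
  have z: "?z \<noteq> 0" by simp
  have P: "?P \<in> ring_A" "evA ?z ?P = x"
    using P_fun_ring_A(1)[of g a] P_fun_ring_A(2)[OF z, of g a] P_fun_root[OF g, of a] by (simp_all add: x_def)
  have tE: "map_fps (evA ?z) (taylor ?P (fexp (of_int i))) = cst (?z powi i) * fexp (x * of_int i)" for i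
  proof (rule fps_ext)
    fix k
    have "fps_nth (taylor ?P (fexp (of_int i))) k = fexp (of_int i) * (cst (1 / fact k) * (?P * cst (of_int i)) ^ k)"
      unfolding taylor_fexp by (simp add: fexp_nth cst_fps_def)
    moreover have "evA ?z \<dots> = ?z powi i * (1 / fact k * (x * of_int i) ^ k)"
      using P by (simp only: evA_simps[OF z] evA_power[OF z] ring_A_closed ring_A_power)
    ultimately show "fps_nth (map_fps (evA ?z) (taylor ?P (fexp (of_int i)))) k = fps_nth (cst (?z powi i) * fexp (x * of_int i)) k"
      by (simp add: fexp_nth)
  qed
  have E: "fexp (of_int i) \<in> ring_A" for i by (rule ring_A_closed)
  have tD: "map_fps (evA ?z) (taylor ?P (fexp (of_int i) - fexp (of_int (- i)))) =
      cst (?z powi i) * fexp (x * of_int i) - cst (?z powi (- i)) * fexp (x * of_int (- i))" for i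
  proof -
    have "map_fps (evA ?z) (taylor ?P (fexp (of_int i) - fexp (of_int (- i)))) =
        map_fps (evA ?z) (taylor ?P (fexp (of_int i))) - map_fps (evA ?z) (taylor ?P (fexp (of_int (- i))))"
      by (rule fps_ext) (simp only: map_fps_nth fps_sub_nth ahomD[OF ahom_taylor] evA_simps[OF z] taylor_ring_A[OF P(1) E])
    then show ?thesis by (simp only: tE)
  qed
  have "num g (of_int a) * taylor ?P (fexp (of_int 1) - fexp (of_int (- 1))) = taylor ?P (fexp (of_int a) - fexp (of_int (- a)))"
    using qnum_eq[of 1 "of_int a :: complex"] unfolding num_def by (simp flip: ahomD(3)[OF ahom_taylor])
  then have "map_fps (evA ?z) (num g (of_int a)) * map_fps (evA ?z) (taylor ?P (fexp (of_int 1) - fexp (of_int (- 1)))) =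
      map_fps (evA ?z) (taylor ?P (fexp (of_int a) - fexp (of_int (- a))))"
    by (subst map_evA_mult[OF z, symmetric]) (auto intro!: num_ring_A taylor_ring_A P ring_A_closed E simp del: of_int_minus of_int_1)
  then show ?thesis unfolding tD by (simp add: numE_def power_int_minus)
qed

section \<open>Specialization at \<open>Q = \<epsilon>\<close>\<close>

lemma models_laws:
  assumes M: "models R M \<phi> T act" and a: "a \<in> carrier R"
  shows "b \<in> carrier R \<Longrightarrow> t \<in> T \<Longrightarrow> act (a \<oplus>\<^bsub>R\<^esub> b) t = act a t + act b t"
    "s \<in> T \<Longrightarrow> t \<in> T \<Longrightarrow> act a (s + t) = act a s + act a t"
    "b \<in> carrier R \<Longrightarrow> t \<in> T \<Longrightarrow> act (a \<otimes>\<^bsub>R\<^esub> b) t = act a (act b t)"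
    "t \<in> T \<Longrightarrow> act \<one>\<^bsub>R\<^esub> t = t"
proof -
  note M' = modelsD[OF M]
  interpret left_module R M by (rule M'(1))
  note clo = left_module_closed[OF M'(1)]
  have s: "\<exists>x\<in>carrier M. \<phi> x = t" if "t \<in> T" for t using models_surj[OF M that] by blast
  show "act (a \<oplus>\<^bsub>R\<^esub> b) t = act a t + act b t" if b: "b \<in> carrier R" and t: "t \<in> T"
  proof -
    obtain x where x: "x \<in> carrier M" "\<phi> x = t" using s[OF t] by blast
    show ?thesis using M'(7)[of "a \<oplus>\<^bsub>R\<^esub> b" x] M'(7)[of a x] M'(7)[of b x] a b x
      by (simp add: smult_l_distr M'(6) clo)
  qed
  show "act (a \<otimes>\<^bsub>R\<^esub> b) t = act a (act b t)" if b: "b \<in> carrier R" and t: "t \<in> T"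
  proof -
    obtain x where x: "x \<in> carrier M" "\<phi> x = t" using s[OF t] by blast
    show ?thesis using M'(7)[of "a \<otimes>\<^bsub>R\<^esub> b" x] M'(7)[of a "b \<odot>\<^bsub>M\<^esub> x"] M'(7)[of b x] a b x
      by (simp add: smult_assoc clo)
  qed
  show "act a (s + t) = act a s + act a t" if st: "s \<in> T" "t \<in> T"
  proof -
    obtain x y where x: "x \<in> carrier M" "\<phi> x = s" "y \<in> carrier M" "\<phi> y = t" using s st by metis
    show ?thesis using M'(7)[of a "x \<oplus>\<^bsub>M\<^esub> y"] M'(7)[of a x] M'(7)[of a y] a x
      by (simp add: smult_r_distr M'(6) clo)
  qed
  show "act \<one>\<^bsub>R\<^esub> t = t" if t: "t \<in> T"
  proof -
    obtain x where x: "x \<in> carrier M" "\<phi> x = t" using s[OF t] by blast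
    show ?thesis using M'(7)[of "\<one>\<^bsub>R\<^esub>" x] x by (simp add: smult_one)
  qed
qed

subsection \<open>Adic closures of subrings and ideals\<close>

context ring
begin

lemma central_pow:
  assumes "t \<in> carrier R" "\<And>x. x \<in> carrier R \<Longrightarrow> t \<otimes> x = x \<otimes> t" "x \<in> carrier R"
  shows "(t [^] (N::nat)) \<otimes> x = x \<otimes> (t [^] N)"
proof (induction N)
  case (Suc N)
  have "(t [^] N \<otimes> t) \<otimes> x = t [^] N \<otimes> (x \<otimes> t)" using assms by (simp add: m_assoc)
  also have "\<dots> = (t [^] N \<otimes> x) \<otimes> t" using assms by (simp add: m_assoc)
  also have "\<dots> = x \<otimes> (t [^] N \<otimes> t)" using assms Suc by (simp add: m_assoc)
  finally show ?case by simp
qed (use assms in simp)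

lemma adic_closureI:
  assumes "x \<in> carrier R" "\<And>N::nat. \<exists>s y. s \<in> S \<and> y \<in> carrier R \<and> x = s \<oplus> (t [^] N) \<otimes> y"
  shows "x \<in> adic_closure R t (regular_module R) S"
proof -
  have "\<forall>N::nat. \<exists>s\<in>S. \<exists>y\<in>carrier R. x = s \<oplus> (t [^] N) \<otimes> y" using assms(2) by blast
  then show ?thesis using assms(1) by (simp add: adic_closure_def regular_module_def)
qed

lemma adic_closureD:
  assumes "x \<in> adic_closure R t (regular_module R) S"
  shows "x \<in> carrier R" "\<And>N::nat. \<exists>s y. s \<in> S \<and> y \<in> carrier R \<and> x = s \<oplus> (t [^] N) \<otimes> y"
proof -
  show "x \<in> carrier R" using assms by (simp add: adic_closure_def regular_module_def)
  fix N :: nat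
  have "\<exists>s\<in>S. \<exists>y\<in>carrier R. x = s \<oplus> (t [^] N) \<otimes> y"
    using assms by (simp add: adic_closure_def regular_module_def)
  then show "\<exists>s y. s \<in> S \<and> y \<in> carrier R \<and> x = s \<oplus> (t [^] N) \<otimes> y" by blast
qed

lemma subset_adic_closure:
  assumes "t \<in> carrier R" "S \<subseteq> carrier R" shows "S \<subseteq> adic_closure R t (regular_module R) S"
proof
  fix x assume x: "x \<in> S"
  then have "x \<in> carrier R" using assms by blast
  then have "x = x \<oplus> (t [^] N) \<otimes> \<zero>" for N :: nat using assms by simp
  then show "x \<in> adic_closure R t (regular_module R) S"
    using x \<open>x \<in> carrier R\<close> by (intro adic_closureI) blast+
qed

context
  fixes t
  assumes t: "t \<in> carrier R" "\<And>x. x \<in> carrier R \<Longrightarrow> t \<otimes> x = x \<otimes> t"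
begin

lemma adic_closure_add:
  assumes S: "S \<subseteq> carrier R" "\<And>a b. a \<in> S \<Longrightarrow> b \<in> S \<Longrightarrow> a \<oplus> b \<in> S"
    and x: "x \<in> adic_closure R t (regular_module R) S" and x': "x' \<in> adic_closure R t (regular_module R) S"
  shows "x \<oplus> x' \<in> adic_closure R t (regular_module R) S"
proof (rule adic_closureI)
  fix N :: nat
  obtain s y s' y' where "s \<in> S" "y \<in> carrier R" "x = s \<oplus> (t [^] N) \<otimes> y"
    "s' \<in> S" "y' \<in> carrier R" "x' = s' \<oplus> (t [^] N) \<otimes> y'"
    using adic_closureD(2)[OF x, of N] adic_closureD(2)[OF x', of N] by auto
  moreover from this have "s \<in> carrier R" "s' \<in> carrier R" using S(1) by auto
  ultimately have "x \<oplus> x' = (s \<oplus> s') \<oplus> (t [^] N) \<otimes> (y \<oplus> y')" using t by (simp add: r_distr a_ac)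
  then show "\<exists>s y. s \<in> S \<and> y \<in> carrier R \<and> x \<oplus> x' = s \<oplus> (t [^] N) \<otimes> y"
    using S(2) \<open>s \<in> S\<close> \<open>s' \<in> S\<close> \<open>y \<in> carrier R\<close> \<open>y' \<in> carrier R\<close> by blast
qed (use adic_closureD[OF x] adic_closureD[OF x'] in simp)

lemma adic_closure_mult:
  assumes S: "S \<subseteq> carrier R" "S' \<subseteq> carrier R" "\<And>a b. a \<in> S \<Longrightarrow> b \<in> S' \<Longrightarrow> a \<otimes> b \<in> S''"
    and x: "x \<in> adic_closure R t (regular_module R) S" and x': "x' \<in> adic_closure R t (regular_module R) S'"
  shows "x \<otimes> x' \<in> adic_closure R t (regular_module R) S''"
proof (rule adic_closureI)
  fix N :: nat
  obtain s y s' y' where *: "s \<in> S" "y \<in> carrier R" "x = s \<oplus> (t [^] N) \<otimes> y"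
    "s' \<in> S'" "y' \<in> carrier R" "x' = s' \<oplus> (t [^] N) \<otimes> y'"
    using adic_closureD(2)[OF x, of N] adic_closureD(2)[OF x', of N] by auto
  define T where "T = t [^] N"
  have T: "T \<in> carrier R" using t by (simp add: T_def)
  have s: "s \<in> carrier R" "s' \<in> carrier R" using S * by auto
  have x'c: "x' \<in> carrier R" using adic_closureD(1)[OF x'] .
  have "x \<otimes> x' = s \<otimes> x' \<oplus> T \<otimes> (y \<otimes> x')"
    using * s T x'c by (simp add: T_def[symmetric] l_distr m_assoc)
  also have "s \<otimes> x' = s \<otimes> s' \<oplus> (s \<otimes> T) \<otimes> y'"
    using * s T by (simp add: T_def[symmetric] r_distr m_assoc)
  also have "s \<otimes> T = T \<otimes> s" using central_pow[OF t s(1), of N] by (simp add: T_def)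
  finally have "x \<otimes> x' = s \<otimes> s' \<oplus> T \<otimes> (s \<otimes> y' \<oplus> y \<otimes> x')"
    using * s T x'c by (simp add: r_distr m_assoc a_assoc)
  moreover have "s \<otimes> y' \<oplus> y \<otimes> x' \<in> carrier R" using * s x'c by simp
  ultimately show "\<exists>s y. s \<in> S'' \<and> y \<in> carrier R \<and> x \<otimes> x' = s \<oplus> (t [^] N) \<otimes> y"
    using S(3)[OF *(1,4)] unfolding T_def by blast
qed (use adic_closureD[OF x] adic_closureD[OF x'] in simp)

lemma subring_adic_closure:
  assumes S: "subring S R" shows "subring (adic_closure R t (regular_module R) S) R"
proof (rule subringI)
  note S' = subringE[OF S]
  note sub = subset_adic_closure[OF t(1) S'(1)]
  let ?C = "adic_closure R t (regular_module R) S"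
  show "?C \<subseteq> carrier R" using adic_closureD(1) by blast
  show "\<one> \<in> ?C" using sub S'(3) by blast
  show "x \<otimes> y \<in> ?C" "x \<oplus> y \<in> ?C" if "x \<in> ?C" "y \<in> ?C" for x y
    using adic_closure_mult[OF S'(1,1,6)] adic_closure_add[OF S'(1,7)] that by blast+
  show "\<ominus> x \<in> ?C" if x: "x \<in> ?C" for x
  proof -
    have "\<ominus> \<one> \<otimes> x \<in> ?C" using adic_closure_mult[OF S'(1,1,6) _ x] sub S'(5)[OF S'(3)] by blast
    then show ?thesis using adic_closureD(1)[OF x] by (simp add: l_minus)
  qed
qed

lemma ideal_adic_closure:
  assumes I: "ideal I R" shows "ideal (adic_closure R t (regular_module R) I) R"
proof -
  interpret I: ideal I R by (rule I)
  let ?C = "adic_closure R t (regular_module R) I"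
  have sub: "I \<subseteq> carrier R" by (rule I.a_subset)
  have car: "carrier R \<subseteq> adic_closure R t (regular_module R) (carrier R)" by (rule subset_adic_closure[OF t(1)]) simp
  have C: "?C \<subseteq> carrier R" using adic_closureD(1) by blast
  have l: "a \<otimes> x \<in> ?C" if "a \<in> carrier R" "x \<in> ?C" for a x
    using adic_closure_mult[OF _ sub, of "carrier R" I] I.I_l_closed car that by blast
  have r: "x \<otimes> a \<in> ?C" if "a \<in> carrier R" "x \<in> ?C" for a x
    using adic_closure_mult[OF sub, of "carrier R" I] I.I_r_closed car that by blast
  show ?thesis
  proof (rule idealI[OF ring_axioms])
    show "subgroup ?C (add_monoid R)"
    proof (rule add.subgroupI)
      show "?C \<subseteq> carrier R" by (rule C)
      show "?C \<noteq> {}" using subset_adic_closure[OF t(1) sub] I.zero_closed by blast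
      show "x \<oplus> y \<in> ?C" if "x \<in> ?C" "y \<in> ?C" for x y
        using adic_closure_add[OF sub _ that] I.a_closed by blast
      show "\<ominus> x \<in> ?C" if "x \<in> ?C" for x
        using l[of "\<ominus> \<one>" x] that C by (auto simp: l_minus)
    qed
  qed (use l r in auto)
qed

end
end

subsection \<open>The lattice over \<open>\<A>[[h']]\<close>\<close>

lemma scalar_central: "map_fps (map_fps cst) c * f = f * map_fps (map_fps cst) (c :: complex fps fps)"
proof -
  let ?c = "\<lambda>(k, i). cst (fps_nth (fps_nth c k) i)"
  have "map_fps (map_fps cst) c = Abs_fps (\<lambda>k. Abs_fps (\<lambda>i. ?c (k, i)))" by (simp add: fps_eq_iff)
  also have "\<dots> = fps2.join (\<lambda>i. fps_const (fps_const (?c i)))" by (rule fps2.join_con[symmetric])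
  finally have s: "map_fps (map_fps cst) c = fps2.join (\<lambda>i. fps_const (fps_const (?c i)))" .
  have "fps_const (fps_const (cst z)) * f = f * fps_const (fps_const (cst z))" for z
    using cst_central[of z f] by (simp add: cst_fps_def)
  then show ?thesis unfolding s fps2.join_mult_left fps2.join_mult_right by (simp add: case_prod_unfold)
qed

text \<open>The lattice \<open>(\<Oplus>\<^sub>j \<A> m\<^sub>j)[[h']]\<close>: the number of nonzero coordinates is bounded in each degree in \<open>h'\<close>,
  uniformly in \<open>h\<close>. Without this bound the specialization would not be a space of series in \<open>h'\<close>
  with coefficients in \<open>\<Oplus> \<complex> m\<^sub>j\<close>.\<close>

definition WA :: "basis_space fps fps set"
  where "WA = {v. (\<forall>k. \<exists>B. \<forall>j\<ge>B. fps_nth (comp2 j v) k = 0) \<and> (\<forall>j k. fps_nth (comp2 j v) k \<in> ring_A)}"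

lemma WA_bound: "v \<in> WA \<Longrightarrow> \<exists>B. \<forall>j\<ge>B. \<forall>l\<le>k. fps_nth (comp2 j v) l = 0"
proof (induction k)
  case 0
  then show ?case by (auto simp: WA_def)
next
  case (Suc k)
  then obtain B B' where "\<forall>j\<ge>B. \<forall>l\<le>k. fps_nth (comp2 j v) l = 0" "\<forall>j\<ge>B'. fps_nth (comp2 j v) (Suc k) = 0"
    unfolding WA_def by blast
  then have "\<forall>j\<ge>max B B'. \<forall>l\<le>Suc k. fps_nth (comp2 j v) l = 0" by (auto simp: le_Suc_eq)
  then show ?case by blast
qed

lemma WA_I:
  assumes v: "v \<in> WA" and w: "\<And>j. comp2 j w = a j * comp2 (i j) v" and i: "\<And>j. j \<le> Suc (i j)"
    and a: "\<And>j k. fps_nth (a j) k \<in> ring_A"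
  shows "w \<in> WA"
  unfolding WA_def
proof (intro CollectI conjI allI)
  fix k
  obtain B where B: "\<forall>j\<ge>B. \<forall>l\<le>k. fps_nth (comp2 j v) l = 0" using WA_bound[OF v] by blast
  have "fps_nth (comp2 j w) k = 0" if "j \<ge> Suc B" for j
  proof -
    have "B \<le> i j" using that i[of j] by linarith
    then show ?thesis using B by (simp add: w fps_mult_nth)
  qed
  then show "\<exists>B. \<forall>j\<ge>B. fps_nth (comp2 j w) k = 0" by blast
next
  fix j k show "fps_nth (comp2 j w) k \<in> ring_A"
    unfolding w fps_mult_nth by (intro ring_A_sum ring_A_closed a) (use v in \<open>auto simp: WA_def\<close>)
qed

lemma WA_add: "v \<in> WA \<Longrightarrow> w \<in> WA \<Longrightarrow> v + w \<in> WA"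
  unfolding WA_def
proof (intro CollectI conjI allI; elim CollectE conjE)
  fix k assume "\<forall>k. \<exists>B. \<forall>j\<ge>B. fps_nth (comp2 j v) k = 0" "\<forall>k. \<exists>B. \<forall>j\<ge>B. fps_nth (comp2 j w) k = 0"
  then obtain B B' where "\<forall>j\<ge>B. fps_nth (comp2 j v) k = 0" "\<forall>j\<ge>B'. fps_nth (comp2 j w) k = 0" by meson
  then have "\<forall>j\<ge>max B B'. fps_nth (comp2 j (v + w)) k = 0" by (simp add: comp2_simps)
  then show "\<exists>B. \<forall>j\<ge>B. fps_nth (comp2 j (v + w)) k = 0" by blast
qed (auto simp: comp2_simps ring_A_closed)

lemma WA_neg: "v \<in> WA \<Longrightarrow> - v \<in> WA"
  by (auto simp: WA_def comp2_simps ring_A_closed)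

lemma WA_zero: "0 \<in> WA"
  by (auto simp: WA_def comp2_simps ring_A_closed)

lemma WA_finite: "v \<in> WA \<Longrightarrow> finite {j. fps_nth (comp2 j v) k \<noteq> 0}"
proof -
  assume "v \<in> WA"
  then obtain B where "\<forall>j\<ge>B. fps_nth (comp2 j v) k = 0" unfolding WA_def by blast
  then have "{j. fps_nth (comp2 j v) k \<noteq> 0} \<subseteq> {..<B}" by (auto simp: not_le[symmetric])
  then show ?thesis by (rule finite_subset) simp
qed

lemma WA_cong:
  assumes "\<And>N. \<exists>v\<in>WA. \<forall>j k. k < N \<longrightarrow> fps_nth (comp2 j w) k = fps_nth (comp2 j v) k" shows "w \<in> WA"
  unfolding WA_def
proof (intro CollectI conjI allI)
  fix k
  obtain v where v: "v \<in> WA" "\<And>j. fps_nth (comp2 j w) k = fps_nth (comp2 j v) k" using assms[of "Suc k"] by auto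
  then show "\<exists>B. \<forall>j\<ge>B. fps_nth (comp2 j w) k = 0" "\<And>j. fps_nth (comp2 j w) k \<in> ring_A" by (auto simp: WA_def)
qed

locale specialization =
  fixes g :: nat and n :: int
  assumes g: "g \<ge> 1"
begin

abbreviation "gens_A \<equiv> Uhh_cls g ` (range gen2 \<union> {Q_H 1, Q_H (- 1), Q_sqrtC}) \<union>
         Uhh_scal g ` {c. \<forall>k. fps_nth c k \<in> ring_A}"

abbreviation "tt \<equiv> Uhh_scal g fps_X"

lemmas qU = quot_type_ring[OF ideal_Uhh[of g], folded Uhh_def Uhh_cls_def]
lemmas cU = cact_rep2[OF g, of n]
lemmas R2 = is_repD[OF is_rep_rep2[of g n]]

lemma scal_carrier: "Uhh_scal g c \<in> carrier (Uhh g)"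
  by (simp add: Uhh_scal_def Uhh_carrier)

lemma gens_carrier: "gens_A \<subseteq> carrier (Uhh g)"
  by (auto simp: Uhh_scal_def Uhh_carrier)

lemma scal_comm: "u \<in> carrier (Uhh g) \<Longrightarrow> Uhh_scal g c \<otimes>\<^bsub>Uhh g\<^esub> u = u \<otimes>\<^bsub>Uhh g\<^esub> Uhh_scal g c"
  by (auto simp: qU(2) Uhh_scal_def qU(4) scalar_central)

lemma cact_scal: "comp2 j (cact (rep2 g n) (Uhh_scal g c) w) = c * comp2 j w"
  by (simp add: Uhh_scal_def cU rep2_scalar)

lemma tt_pow: "tt [^]\<^bsub>Uhh g\<^esub> (N::nat) = Uhh_scal g (fps_X ^ N)"
  unfolding Uhh_scal_def qU(6) by (simp only: ahomD[OF ahom_map_fps[OF ahom_map_fps[OF ahom_cst]]])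

lemma cact_tt_pow:
  "u \<in> carrier (Uhh g) \<Longrightarrow> comp2 j (cact (rep2 g n) (tt [^]\<^bsub>Uhh g\<^esub> N \<otimes>\<^bsub>Uhh g\<^esub> u) w) = fps_X ^ N * comp2 j (cact (rep2 g n) u w)"
  unfolding tt_pow by (auto simp: qU(2) Uhh_scal_def qU(4) cU R2 rep2_scalar)

lemma carrier_UA: "carrier (UA g) = adic_closure (Uhh g) tt (regular_module (Uhh g)) (generate_ring (Uhh g) gens_A)"
  by (simp add: UA_def)

lemma subring_UA: "subring (carrier (UA g)) (Uhh g)"
proof -
  interpret ring "Uhh g" by (rule qU(1))
  show ?thesis unfolding carrier_UA
    by (intro subring_adic_closure scal_carrier scal_comm generate_ring_is_subring gens_carrier)
qed

lemma ring_UA: "ring (UA g)"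
proof -
  interpret ring "Uhh g" by (rule qU(1))
  have "ring ((Uhh g)\<lparr>carrier := carrier (UA g)\<rparr>)" by (rule subring_is_ring[OF subring_UA])
  then show ?thesis by (simp add: UA_def)
qed

lemma UA_ops:
  "x \<oplus>\<^bsub>UA g\<^esub> y = x \<oplus>\<^bsub>Uhh g\<^esub> y" "x \<otimes>\<^bsub>UA g\<^esub> y = x \<otimes>\<^bsub>Uhh g\<^esub> y" "\<one>\<^bsub>UA g\<^esub> = \<one>\<^bsub>Uhh g\<^esub>"
  "x [^]\<^bsub>UA g\<^esub> (N::nat) = x [^]\<^bsub>Uhh g\<^esub> N"
  by (simp_all add: UA_def nat_pow_def)

lemma UA_subset: "u \<in> carrier (UA g) \<Longrightarrow> u \<in> carrier (Uhh g)"
  using subringE(1)[OF subring_UA] by blast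

lemma gens_UA: "u \<in> gens_A \<Longrightarrow> u \<in> carrier (UA g)"
proof -
  interpret ring "Uhh g" by (rule qU(1))
  assume "u \<in> gens_A"
  then have "u \<in> generate_ring (Uhh g) gens_A" by (rule generate_ring.incl)
  then show "u \<in> carrier (UA g)"
    unfolding carrier_UA using subset_adic_closure[OF scal_carrier[of fps_X] generate_ring_incl[OF gens_carrier]] by blast
qed

lemma scal_UA: "(\<And>k. fps_nth c k \<in> ring_A) \<Longrightarrow> Uhh_scal g c \<in> carrier (UA g)"
  by (intro gens_UA) blast

lemma tt_UA: "tt \<in> carrier (UA g)"
  by (rule scal_UA) (simp add: fps_X_def ring_A_closed)

lemma Qme_UA: "Q_minus_eps g \<in> carrier (UA g)"
proof -
  have "fexp 1 \<in> ring_A" using ring_A_closed(2)[of 1] by simp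
  then show ?thesis unfolding Q_minus_eps_def by (intro scal_UA) (simp add: ring_A_closed)
qed

lemma WA_gens:
  assumes w: "w \<in> WA" and u: "u \<in> gens_A" shows "cact (rep2 g n) u w \<in> WA"
proof -
  have const: "fps_nth (fps_const a) k \<in> ring_A" if "a \<in> ring_A" for a k using that by (simp add: ring_A_closed)
  have int: "fps_nth (of_int m) k \<in> ring_A" for m k
    using const[of "of_int m" k] ring_A_closed(1)[of "of_int m"] by (simp add: cst_of_int fps_of_int)
  have gen: "rep2 g n (gen2 x) w \<in> WA" for x
  proof (cases x)
    case (Sl2 y)
    show ?thesis
    proof (cases y)
      case Xp
      show ?thesis
        by (rule WA_I[OF w, where a="\<lambda>j. num g (of_int (int j + 1)) * num g (of_int (n - int j))" and i=Suc])
          (auto simp only: Sl2 Xp rep2_gen fps_mult_nth intro!: ring_A_sum ring_A_closed num_ring_A)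
    next
      case Xm
      show ?thesis
        by (rule WA_I[OF w, where a="\<lambda>j. if j = 0 then 0 else 1" and i="\<lambda>j. j - 1"])
          (auto simp: Sl2 Xm rep2_gen ring_A_closed)
    next
      case Hg
      show ?thesis
        by (rule WA_I[OF w, where a="\<lambda>j. of_int (n - 2 * int j)" and i="\<lambda>j. j"])
          (auto simp only: Sl2 Hg rep2_gen int)
    qed
  next
    case Cas
    show ?thesis
      by (rule WA_I[OF w, where a="\<lambda>j. cst ((of_int (n + 1))\<^sup>2)" and i="\<lambda>j. j"])
        (auto simp: Cas rep2_gen cst_fps_nth ring_A_closed)
  qed
  have QH: "rep2 g n (Q_H e) w \<in> WA" for e
    by (rule WA_I[OF w, where a="\<lambda>j. fps_const (fexp (of_int (e * (n - 2 * int j))))" and i="\<lambda>j. j"])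
      (auto simp only: rep2_Q_H intro!: const ring_A_closed)
  have QC: "rep2 g n Q_sqrtC w \<in> WA"
    by (rule WA_I[OF w, where a="\<lambda>j. fps_const (fexp (of_int (n + 1)) + fexp (of_int (- (n + 1))))" and i="\<lambda>j. j"])
      (auto simp only: rep2_Q_sqrtC intro!: const ring_A_closed)
  have sc: "cact (rep2 g n) (Uhh_scal g c) w \<in> WA" if "\<And>k. fps_nth c k \<in> ring_A" for c
    by (rule WA_I[OF w, where a="\<lambda>j. c" and i="\<lambda>j. j"]) (auto simp: cact_scal that)
  show ?thesis using u gen QH QC sc by (auto simp: cU)
qed

text \<open>Generators preserve the lattice, and elements of the closure agree with polynomials in generators
  modulo powers of \<open>h'\<close>, which is all that membership depends on.\<close>

lemma WA_UA:
  assumes u: "u \<in> carrier (UA g)" and w: "w \<in> WA" shows "cact (rep2 g n) u w \<in> WA"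
proof -
  interpret ring "Uhh g" by (rule qU(1))
  define K where "K = {u \<in> carrier (Uhh g). \<forall>w\<in>WA. cact (rep2 g n) u w \<in> WA}"
  note laws = cact_laws[OF ideal_Uhh is_rep_rep2 rep2_kill[OF g], folded Uhh_def]
  have one: "cact (rep2 g n) \<one>\<^bsub>Uhh g\<^esub> w = w" for w by (rule laws(4))
  have neg: "cact (rep2 g n) (\<ominus>\<^bsub>Uhh g\<^esub> x) w = - cact (rep2 g n) x w" if "x \<in> carrier (Uhh g)" for x w
    by (rule additive_zero_neg(2)[OF abelian_group_axioms, where \<tau>="\<lambda>u. cact (rep2 g n) u w"]) (use laws(1) that in auto)
  have "subring K (Uhh g)"
    by (rule subringI) (auto simp: K_def one neg laws(1,3) WA_add WA_neg)
  then have "generate_ring (Uhh g) gens_A \<subseteq> K"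
    by (rule generate_ring_min_subring1[OF gens_carrier]) (use WA_gens gens_carrier in \<open>auto simp: K_def\<close>)
  show ?thesis
  proof (rule WA_cong)
    fix N :: nat
    obtain s y where s: "s \<in> generate_ring (Uhh g) gens_A" "y \<in> carrier (Uhh g)" "u = s \<oplus>\<^bsub>Uhh g\<^esub> (tt [^]\<^bsub>Uhh g\<^esub> N) \<otimes>\<^bsub>Uhh g\<^esub> y"
      using adic_closureD(2)[OF u[unfolded carrier_UA], of N] by blast
    have sK: "s \<in> K" using s \<open>_ \<subseteq> K\<close> by blast
    have "cact (rep2 g n) u w = cact (rep2 g n) s w + cact (rep2 g n) ((tt [^]\<^bsub>Uhh g\<^esub> N) \<otimes>\<^bsub>Uhh g\<^esub> y) w"
      unfolding s(3) using sK s(2) scal_carrier by (intro laws(1)) (auto simp: K_def)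
    then have "fps_nth (comp2 j (cact (rep2 g n) u w)) k = fps_nth (comp2 j (cact (rep2 g n) s w)) k" if "k < N" for j k
      using that by (simp add: comp2_simps cact_tt_pow[OF s(2)] fps_X_power_mult_nth)
    then show "\<exists>v\<in>WA. \<forall>j k. k < N \<longrightarrow> fps_nth (comp2 j (cact (rep2 g n) u w)) k = fps_nth (comp2 j v) k"
      using sK w by (auto simp: K_def)
  qed
qed

end

context specialization
begin

lemma MA_ops: "x \<oplus>\<^bsub>MA g n\<^esub> y = x \<oplus>\<^bsub>Mhh g n\<^esub> y" "a \<odot>\<^bsub>MA g n\<^esub> x = a \<odot>\<^bsub>Mhh g n\<^esub> x" "\<zero>\<^bsub>MA g n\<^esub> = \<zero>\<^bsub>Mhh g n\<^esub>"
  "carrier (MA g n) = MA_carrier g n"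
  by (simp_all add: MA_def)

lemmas MM = modelsD[OF Mhh_models(1)[OF g, of n]]

definition MA_rep :: "(nat \<Rightarrow> nat \<Rightarrow>\<^sub>0 complex fps) \<Rightarrow> int_gen free fps fps"
  where "MA_rep a = Abs_fps (\<lambda>k. \<Sum>j\<in>Poly_Mapping.keys (a k).
        map_fps cst (Poly_Mapping.lookup (a k) j) * fps_const (gen (Sl2 Xm) ^ j))"

lemma phi2_MA_rep:
  "comp2 j (phi2 g n (Mhh_cls g n (MA_rep a))) = Abs_fps (\<lambda>k. Poly_Mapping.lookup (a k) j)"
proof -
  let ?w = "assemble2 (\<lambda>j. Abs_fps (\<lambda>k. Poly_Mapping.lookup (a k) j))"
  have fin: "finite {j. fps_nth (Poly_Mapping.lookup (a k) j) i \<noteq> 0}" for k i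
    by (rule finite_subset[OF _ finite_keys[of "a k"]]) (auto simp: in_keys_iff)
  have w: "comp2 j ?w = Abs_fps (\<lambda>k. Poly_Mapping.lookup (a k) j)" for j
    by (rule comp2_assemble2) (simp add: fin)
  have l: "Poly_Mapping.lookup (fps_nth (fps_nth ?w k) i) j = fps_nth (Poly_Mapping.lookup (a k) j) i" for k i j
    using w[of j] by (metis comp1_nth comp2_nth fps_nth_Abs_fps)
  have "fps_nth (fps_nth (MA_rep a) k) i = lv (Sl2 Xm) (fps_nth (fps_nth ?w k) i)" for k i
  proof -
    have "lv (Sl2 Xm) (fps_nth (fps_nth ?w k) i) =
        (\<Sum>j\<in>Poly_Mapping.keys (a k). cst (fps_nth (Poly_Mapping.lookup (a k) j) i) * gen (Sl2 Xm) ^ j)"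
      unfolding lv_def l[symmetric] by (rule mono_lift_superset) (auto simp: in_keys_iff l)
    then show ?thesis by (simp add: MA_rep_def fps_sum_nth)
  qed
  then have "MA_rep a = map_fps (map_fps (lv (Sl2 Xm))) ?w" by (simp add: fps_eq_iff)
  then show ?thesis by (simp add: Mhh_models(2)[OF g] rep2_lift w)
qed

lemma MA_carrier_eq: "MA_carrier g n = {x \<in> carrier (Mhh g n). phi2 g n x \<in> WA}"
proof (intro equalityI subsetI)
  fix x assume "x \<in> MA_carrier g n"
  then obtain a where a: "x = Mhh_cls g n (MA_rep a)" "\<And>k j. Poly_Mapping.lookup (a k) j \<in> ring_A"
    unfolding MA_carrier_def MA_rep_def by blast
  have "\<exists>B. \<forall>j\<ge>B. Poly_Mapping.lookup (a k) j = 0" for k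
  proof -
    obtain B where "\<forall>j\<in>Poly_Mapping.keys (a k). j < B"
      using finite_keys[of "a k"] finite_nat_set_iff_bounded by blast
    then show ?thesis by (meson in_keys_iff not_le)
  qed
  then have "phi2 g n x \<in> WA" by (simp add: WA_def a phi2_MA_rep)
  then show "x \<in> {x \<in> carrier (Mhh g n). phi2 g n x \<in> WA}" by (simp add: a(1) Mhh_models(3)[OF g])
next
  fix x assume x: "x \<in> {x \<in> carrier (Mhh g n). phi2 g n x \<in> WA}"
  define a where "a k = Abs_poly_mapping (\<lambda>j. fps_nth (comp2 j (phi2 g n x)) k)" for k
  have a: "Poly_Mapping.lookup (a k) j = fps_nth (comp2 j (phi2 g n x)) k" for k j
    using x WA_finite by (simp add: a_def)
  have "phi2 g n (Mhh_cls g n (MA_rep a)) = phi2 g n x"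
    by (rule comp2_eqI) (simp add: phi2_MA_rep a fps_eq_iff)
  moreover have "Mhh_cls g n (MA_rep a) \<in> carrier (Mhh g n)" by (simp add: Mhh_models(3)[OF g])
  ultimately have "x = Mhh_cls g n (MA_rep a)" using MM(3) x by (auto simp: inj_on_def)
  moreover have "Poly_Mapping.lookup (a k) j \<in> ring_A" for k j using x by (simp add: a WA_def)
  ultimately show "x \<in> MA_carrier g n" unfolding MA_carrier_def MA_rep_def by blast
qed

lemma MA_models: "models (UA g) (MA g n) (phi2 g n) WA (cact (rep2 g n))"
proof -
  note clo = left_module_closed[OF MM(1)]
  have c: "carrier (MA g n) = {x \<in> carrier (Mhh g n). phi2 g n x \<in> WA}" by (simp add: MA_ops MA_carrier_eq)
  have bij: "bij_betw (phi2 g n) (carrier (MA g n)) WA"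
  proof (rule bij_betw_imageI)
    show "inj_on (phi2 g n) (carrier (MA g n))" using MM(3) by (auto simp: c inj_on_def)
    show "phi2 g n ` carrier (MA g n) = WA"
    proof (intro equalityI subsetI)
      fix w assume "w \<in> WA"
      then show "w \<in> phi2 g n ` carrier (MA g n)" using models_surj[OF Mhh_models(1)[OF g] UNIV_I, of n w] by (auto simp: c)
    qed (auto simp: c)
  qed
  have z: "phi2 g n \<zero>\<^bsub>Mhh g n\<^esub> = 0" by (rule additive_zero_neg(1)[OF clo(6) MM(6)])
  have ab: "abelian_group (MA g n)"
    by (rule abelian_group_model[OF bij]) (auto simp: c WA_neg WA_zero z WA_add MA_ops(1-3) MM(6) clo)
  note laws = models_laws[OF Mhh_models(1)[OF g, of n]]
  note one = laws(4)[OF scal_carrier[of 0] UNIV_I]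
  show ?thesis
  proof (rule models_intro[OF ring_UA ab bij])
    fix a x assume a: "a \<in> carrier (UA g)" and x: "x \<in> carrier (MA g n)"
    note a' = UA_subset[OF a]
    show "phi2 g n (a \<odot>\<^bsub>MA g n\<^esub> x) = cact (rep2 g n) a (phi2 g n x)"
      using MM(7)[OF a'] x by (simp add: MA_ops(1-3) c)
    then show "a \<odot>\<^bsub>MA g n\<^esub> x \<in> carrier (MA g n)"
      using WA_UA[OF a, of "phi2 g n x"] x clo(2)[OF a', of x] by (simp add: MA_ops(1-3) c)
  qed (use laws(1-3) one UA_subset in \<open>auto simp: c MA_ops(1-3) MM(6) UA_ops\<close>)
qed

lemmas AM = modelsD[OF MA_models]

definition evW :: "basis_space fps fps \<Rightarrow> basis_space fps"
  where "evW v = assemble1 (\<lambda>j. map_fps (evA (root_eps g)) (comp2 j v))"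

text \<open>Constant coefficients give a section of the evaluation.\<close>

definition liftW :: "basis_space fps \<Rightarrow> basis_space fps fps"
  where "liftW t = assemble2 (\<lambda>j. map_fps cst (comp1 j t))"

lemmas evs = evA_simps[OF root_eps_nz[of g]]

lemma comp1_evW: "v \<in> WA \<Longrightarrow> comp1 j (evW v) = map_fps (evA (root_eps g)) (comp2 j v)"
  unfolding evW_def
proof (rule comp1_assemble1)
  fix k assume "v \<in> WA"
  then show "finite {j. fps_nth (map_fps (evA (root_eps g)) (comp2 j v)) k \<noteq> 0}"
    by (rule finite_subset[rotated, OF WA_finite[of v k]]) (auto simp: evs)
qed

lemma comp2_liftW: "comp2 j (liftW t) = map_fps cst (comp1 j t)"
  unfolding liftW_def
proof (rule comp2_assemble2)
  fix k i
  show "finite {j. fps_nth (fps_nth (map_fps cst (comp1 j t) :: complex fps fps) k) i \<noteq> 0}"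
    by (rule finite_subset[OF _ finite_comp1[of t k]]) (auto simp: cst_fps_nth)
qed

lemma liftW_WA: "liftW t \<in> WA"
  unfolding WA_def
proof (intro CollectI conjI allI)
  fix k
  obtain B where "\<forall>j\<in>{j. fps_nth (comp1 j t) k \<noteq> 0}. j < B"
    using finite_comp1[of t k] finite_nat_set_iff_bounded by blast
  then have "fps_nth (comp1 j t) k = 0" if "j \<ge> B" for j using that by (meson leD mem_Collect_eq)
  then have "\<forall>j\<ge>B. fps_nth (comp2 j (liftW t)) k = 0" by (simp add: comp2_liftW)
  then show "\<exists>B. \<forall>j\<ge>B. fps_nth (comp2 j (liftW t)) k = 0" by blast
qed (simp add: comp2_liftW ring_A_closed)

lemma evW_liftW: "evW (liftW t) = t"
  by (rule comp1_eqI) (simp add: comp1_evW liftW_WA comp2_liftW fps_eq_iff evs del: cst_id)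

lemma WA_A: "v \<in> WA \<Longrightarrow> fps_nth (comp2 j v) k \<in> ring_A"
  by (simp add: WA_def)

lemma evW_add: "v \<in> WA \<Longrightarrow> w \<in> WA \<Longrightarrow> evW (v + w) = evW v + evW w"
  by (rule comp1_eqI) (simp add: comp1_evW WA_add comp2_simps comp1_simps fps_eq_iff evs WA_A)

lemma evW_neg: "v \<in> WA \<Longrightarrow> evW (- v) = - evW v"
  by (rule comp1_eqI) (simp add: comp1_evW WA_neg comp2_simps comp1_simps fps_eq_iff evs WA_A)

text \<open>Each coefficient of a vector of the kernel is divisible by \<open>Q - \<epsilon>\<close>, and division does not create new
  nonzero coordinates.\<close>

lemma evW_kernel:
  assumes v: "v \<in> WA" and e: "evW v = 0"
  shows "\<exists>w\<in>WA. v = cact (rep2 g n) (Q_minus_eps g) w"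
proof -
  let ?q = "fexp 1 - cst (root_eps g) :: complex fps"
  have q: "?q \<noteq> 0"
  proof
    assume "?q = 0"
    then have "fps_nth ?q 1 = 0" by simp
    then show False by (simp add: fexp_nth cst_fps_nth)
  qed
  have "evA (root_eps g) (fps_nth (comp2 j v) k) = 0" for j k
    using arg_cong[OF e, of "comp1 j"] by (simp add: comp1_evW[OF v] comp1_simps fps_eq_iff)
  then have "\<forall>j k. \<exists>b. b \<in> ring_A \<and> fps_nth (comp2 j v) k = ?q * b"
    using evA_kernel[OF root_eps_nz WA_A[OF v]] by blast
  then obtain b where b: "\<And>j k. b j k \<in> ring_A" "\<And>j k. fps_nth (comp2 j v) k = ?q * b j k" by metis
  have b0: "fps_nth (comp2 j v) k = 0 \<longleftrightarrow> b j k = 0" for j k using b(2)[of j k] q by simp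
  define w where "w = assemble2 (\<lambda>j. Abs_fps (b j))"
  have w: "comp2 j w = Abs_fps (b j)" for j unfolding w_def
  proof (rule comp2_assemble2)
    fix k i show "finite {j. fps_nth (fps_nth (Abs_fps (b j)) k) i \<noteq> 0}"
      by (rule finite_subset[OF _ WA_finite[OF v, of k]]) (auto simp: b0)
  qed
  have "\<forall>k. \<exists>B. \<forall>j\<ge>B. b j k = 0" using v unfolding WA_def mem_Collect_eq b0 by blast
  then have "w \<in> WA" by (simp add: WA_def w b(1))
  moreover have "v = cact (rep2 g n) (Q_minus_eps g) w"
    by (rule comp2_eqI) (simp add: Q_minus_eps_def cact_scal w b(2) fps_eq_iff[of "comp2 _ v"])
  ultimately show ?thesis by blast
qed

lemma evW_Qme:
  assumes w: "w \<in> WA" shows "evW (cact (rep2 g n) (Q_minus_eps g) w) = 0"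
proof (rule comp1_eqI, rule fps_ext)
  fix j k
  have "fexp 1 - cst (root_eps g) \<in> ring_A" "evA (root_eps g) (fexp 1 - cst (root_eps g)) = 0"
    using ring_A_closed(2)[of 1] evs(2)[of 1] evs(6)[OF ring_A_closed(2)[of 1] ring_A_closed(1)[of "root_eps g"]]
    by (simp_all add: ring_A_closed(6) ring_A_closed(1) evs(1) del: cst_id)
  then show "fps_nth (comp1 j (evW (cact (rep2 g n) (Q_minus_eps g) w))) k = fps_nth (comp1 j 0) k"
    using comp1_evW[OF WA_UA[OF Qme_UA w], of j] WA_A[OF w, of j k]
    by (simp add: Q_minus_eps_def cact_scal evs(4) comp1_simps)
qed

lemma evW_tt:
  assumes u: "u \<in> carrier (UA g)" and w: "w \<in> WA" and k: "k < N"
  shows "fps_nth (evW (cact (rep2 g n) (tt [^]\<^bsub>UA g\<^esub> (N::nat) \<otimes>\<^bsub>UA g\<^esub> u) w)) k = 0"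
proof -
  interpret ring "UA g" by (rule ring_UA)
  have W: "cact (rep2 g n) (tt [^]\<^bsub>UA g\<^esub> N \<otimes>\<^bsub>UA g\<^esub> u) w \<in> WA"
    using u tt_UA by (intro WA_UA w) simp
  have "fps_nth (comp1 j (evW (cact (rep2 g n) (tt [^]\<^bsub>UA g\<^esub> N \<otimes>\<^bsub>UA g\<^esub> u) w))) k = 0" for j
    unfolding comp1_evW[OF W] unfolding UA_ops using k by (simp add: cact_tt_pow[OF UA_subset[OF u]] fps_X_power_mult_nth evs)
  then show ?thesis by (auto simp: comp1_nth intro: poly_mapping_eqI)
qed

definition actA :: "int_gen free fps fps set \<Rightarrow> basis_space fps \<Rightarrow> basis_space fps"
  where "actA u t = evW (cact (rep2 g n) u (liftW t))"

lemmas laws_UA = models_laws[OF MA_models]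

lemma actA:
  assumes u: "u \<in> carrier (UA g)" and w: "w \<in> WA"
  shows "evW (cact (rep2 g n) u w) = actA u (evW w)"
proof -
  define v where "v = w - liftW (evW w)"
  have v: "v \<in> WA" using WA_add[OF w WA_neg[OF liftW_WA]] by (simp add: v_def)
  have "evW v = evW w + evW (- liftW (evW w))" using evW_add[OF w WA_neg[OF liftW_WA]] by (simp add: v_def)
  then have "evW v = 0" by (simp add: evW_neg liftW_WA evW_liftW)
  then obtain x where x: "x \<in> WA" "v = cact (rep2 g n) (Q_minus_eps g) x" using evW_kernel[OF v] by blast
  have "cact (rep2 g n) u v = cact (rep2 g n) (u \<otimes>\<^bsub>UA g\<^esub> Q_minus_eps g) x"
    unfolding x(2) by (rule laws_UA(3)[OF u Qme_UA x(1), symmetric])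
  also have "\<dots> = cact (rep2 g n) (Q_minus_eps g \<otimes>\<^bsub>UA g\<^esub> u) x"
    unfolding UA_ops Q_minus_eps_def by (simp only: scal_comm[OF UA_subset[OF u]])
  also have "\<dots> = cact (rep2 g n) (Q_minus_eps g) (cact (rep2 g n) u x)" by (rule laws_UA(3)[OF Qme_UA u x(1)])
  finally have "evW (cact (rep2 g n) u v) = 0" using evW_Qme[OF WA_UA[OF u x(1)]] by simp
  moreover have "w = liftW (evW w) + v" by (simp add: v_def)
  then have "cact (rep2 g n) u w = cact (rep2 g n) u (liftW (evW w)) + cact (rep2 g n) u v"
    using laws_UA(2)[OF u liftW_WA v] by metis
  ultimately show ?thesis by (simp add: evW_add WA_UA[OF u] liftW_WA v actA_def)
qed

definition tau :: "int_gen free fps fps set set \<Rightarrow> basis_space fps"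
  where "tau x = evW (phi2 g n x)"

lemma tau_add: "x \<in> carrier (MA g n) \<Longrightarrow> y \<in> carrier (MA g n) \<Longrightarrow> tau (x \<oplus>\<^bsub>MA g n\<^esub> y) = tau x + tau y"
  by (simp add: tau_def AM(6) evW_add AM(5))

lemma tau_act: "u \<in> carrier (UA g) \<Longrightarrow> x \<in> carrier (MA g n) \<Longrightarrow> tau (u \<odot>\<^bsub>MA g n\<^esub> x) = actA u (tau x)"
  by (simp add: tau_def AM(7) AM(5) actA)

text \<open>The image of \<open>Q - \<epsilon>\<close> is already the whole kernel, hence closed.\<close>

lemma kernel_tau:
  "adic_closure (UA g) tt (MA g n) ((\<lambda>x. Q_minus_eps g \<odot>\<^bsub>MA g n\<^esub> x) ` carrier (MA g n)) =
    {x \<in> carrier (MA g n). tau x = 0}"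
proof (intro equalityI subsetI)
  note clo = left_module_closed[OF AM(1)]
  interpret R: ring "UA g" by (rule ring_UA)
  interpret left_module "UA g" "MA g n" by (rule AM(1))
  {
    fix x assume x: "x \<in> adic_closure (UA g) tt (MA g n) ((\<lambda>x. Q_minus_eps g \<odot>\<^bsub>MA g n\<^esub> x) ` carrier (MA g n))"
    then have xc: "x \<in> carrier (MA g n)" by (simp add: adic_closure_def)
    have "fps_nth (tau x) k = 0" for k
    proof -
      obtain s y where s: "s \<in> carrier (MA g n)" "y \<in> carrier (MA g n)"
        "x = Q_minus_eps g \<odot>\<^bsub>MA g n\<^esub> s \<oplus>\<^bsub>MA g n\<^esub> (tt [^]\<^bsub>UA g\<^esub> Suc k) \<odot>\<^bsub>MA g n\<^esub> y"
        using x unfolding adic_closure_def by blast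
      have t: "tt [^]\<^bsub>UA g\<^esub> Suc k \<in> carrier (UA g)" using tt_UA by (rule R.nat_pow_closed)
      have "tau (Q_minus_eps g \<odot>\<^bsub>MA g n\<^esub> s) = 0"
        using AM(7)[OF Qme_UA s(1)] AM(5)[OF s(1)] by (simp add: tau_def evW_Qme)
      moreover have "(tt [^]\<^bsub>UA g\<^esub> Suc k) \<odot>\<^bsub>MA g n\<^esub> y = (tt [^]\<^bsub>UA g\<^esub> Suc k \<otimes>\<^bsub>UA g\<^esub> \<one>\<^bsub>UA g\<^esub>) \<odot>\<^bsub>MA g n\<^esub> y"
        using t by simp
      then have "fps_nth (tau ((tt [^]\<^bsub>UA g\<^esub> Suc k) \<odot>\<^bsub>MA g n\<^esub> y)) k = 0"
        using evW_tt[OF R.one_closed AM(5)[OF s(2)], of k "Suc k"] AM(7)[OF _ s(2), of "tt [^]\<^bsub>UA g\<^esub> Suc k \<otimes>\<^bsub>UA g\<^esub> \<one>\<^bsub>UA g\<^esub>"] t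
        by (simp only: tau_def R.m_closed R.one_closed lessI)
      ultimately show ?thesis unfolding s(3) using s clo(2)[OF Qme_UA s(1)] clo(2)[OF t s(2)] by (simp add: tau_add)
    qed
    then have "tau x = 0" by (simp add: fps_eq_iff)
    then show "x \<in> {x \<in> carrier (MA g n). tau x = 0}" using xc by simp
  next
    fix x assume x: "x \<in> {x \<in> carrier (MA g n). tau x = 0}"
    then obtain w where w: "w \<in> WA" "phi2 g n x = cact (rep2 g n) (Q_minus_eps g) w"
      using evW_kernel[of "phi2 g n x"] AM(5)[of x] by (auto simp: tau_def)
    obtain s where s: "s \<in> carrier (MA g n)" "phi2 g n s = w" using models_surj[OF MA_models w(1)] by blast
    have "phi2 g n (Q_minus_eps g \<odot>\<^bsub>MA g n\<^esub> s) = phi2 g n x" using AM(7)[OF Qme_UA s(1)] s(2) w(2) by simp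
    then have xs: "x = Q_minus_eps g \<odot>\<^bsub>MA g n\<^esub> s"
      using inj_onD[OF AM(3), of "Q_minus_eps g \<odot>\<^bsub>MA g n\<^esub> s" x] x clo(2)[OF Qme_UA s(1)] by simp
    have "(tt [^]\<^bsub>UA g\<^esub> N) \<odot>\<^bsub>MA g n\<^esub> \<zero>\<^bsub>MA g n\<^esub> = \<zero>\<^bsub>MA g n\<^esub>" for N :: nat
    proof -
      have t: "tt [^]\<^bsub>UA g\<^esub> N \<in> carrier (UA g)" using tt_UA by (rule R.nat_pow_closed)
      have z: "phi2 g n \<zero>\<^bsub>MA g n\<^esub> = 0" by (rule additive_zero_neg(1)[OF clo(6) AM(6)])
      have "cact (rep2 g n) (tt [^]\<^bsub>UA g\<^esub> N) 0 = 0" using laws_UA(2)[OF t WA_zero WA_zero] by simp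
      then show ?thesis
        using inj_onD[OF AM(3), of "(tt [^]\<^bsub>UA g\<^esub> N) \<odot>\<^bsub>MA g n\<^esub> \<zero>\<^bsub>MA g n\<^esub>" "\<zero>\<^bsub>MA g n\<^esub>"] AM(7)[OF t clo(3)] clo(2)[OF t clo(3)] clo(3) z
        by simp
    qed
    then have "x = Q_minus_eps g \<odot>\<^bsub>MA g n\<^esub> s \<oplus>\<^bsub>MA g n\<^esub> (tt [^]\<^bsub>UA g\<^esub> N) \<odot>\<^bsub>MA g n\<^esub> \<zero>\<^bsub>MA g n\<^esub>" for N :: nat
      using x xs by simp
    then show "x \<in> adic_closure (UA g) tt (MA g n) ((\<lambda>x. Q_minus_eps g \<odot>\<^bsub>MA g n\<^esub> x) ` carrier (MA g n))"
      unfolding adic_closure_def using x s(1) clo(3) by blast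
  }
qed

definition M0 :: "(int_gen free fps fps set, int_gen free fps fps set set set) module"
  where "M0 = quot_module (MA g n) {x \<in> carrier (MA g n). tau x = 0}"

lemma M0_models: "models (UA g) M0 (coset_map tau) UNIV actA"
proof -
  have "t \<in> tau ` carrier (MA g n)" for t
    using models_surj[OF MA_models liftW_WA[of t]] by (auto simp: tau_def evW_liftW intro!: rev_image_eqI)
  then have "tau ` carrier (MA g n) = UNIV" by blast
  then show ?thesis
    using models_quot(1)[where \<tau>=tau and act=actA, OF AM(1) tau_add tau_act refl] by (simp add: M0_def)
qed

end

context specialization
begin

abbreviation "JE \<equiv> Ueps_ideal g"

lemma tt_comm: "u \<in> carrier (UA g) \<Longrightarrow> tt \<otimes>\<^bsub>UA g\<^esub> u = u \<otimes>\<^bsub>UA g\<^esub> tt"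
  unfolding UA_ops by (rule scal_comm[OF UA_subset])

lemma ideal_JE: "ideal JE (UA g)"
proof -
  interpret ring "UA g" by (rule ring_UA)
  show ?thesis unfolding Ueps_ideal_def
    by (rule ideal_adic_closure[OF tt_UA tt_comm genideal_ideal]) (use Qme_UA in auto)
qed

lemmas laws_A = models_laws[OF M0_models]

text \<open>The generator of the ideal acts by zero, and an element of the closure acts by a multiple of
  every power of \<open>h'\<close>.\<close>

lemma JE_kill:
  assumes u: "u \<in> JE" shows "actA u t = 0"
proof -
  interpret ring "UA g" by (rule ring_UA)
  define K where "K = {u \<in> carrier (UA g). \<forall>t. actA u t = 0}"
  have zero: "actA \<zero>\<^bsub>UA g\<^esub> t = 0" for t
    using laws_A(1)[of "\<zero>\<^bsub>UA g\<^esub>" "\<zero>\<^bsub>UA g\<^esub>" t] by simp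
  have actA0: "a \<in> carrier (UA g) \<Longrightarrow> actA a 0 = 0" for a using laws_A(2)[of a 0 0] by simp
  have neg: "actA (\<ominus>\<^bsub>UA g\<^esub> x) t = - actA x t" if "x \<in> carrier (UA g)" for x t
    by (rule additive_zero_neg(2)[OF abelian_group_axioms, where \<tau>="\<lambda>u. actA u t"]) (use laws_A(1) that in auto)
  have "ideal K (UA g)"
  proof (rule idealI[OF ring_axioms])
    show "subgroup K (add_monoid (UA g))"
      by (rule add.subgroupI) (auto simp: K_def zero neg laws_A(1))
  qed (auto simp: K_def laws_A(3) actA0)
  moreover have "{Q_minus_eps g} \<subseteq> K"
    using Qme_UA evW_Qme[OF liftW_WA] by (auto simp: K_def actA_def)
  ultimately have I: "Idl\<^bsub>UA g\<^esub> {Q_minus_eps g} \<subseteq> K" by (rule genideal_minimal)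
  have "fps_nth (actA u t) k = 0" for k
  proof -
    obtain s y where s: "s \<in> Idl\<^bsub>UA g\<^esub> {Q_minus_eps g}" "y \<in> carrier (UA g)" "u = s \<oplus>\<^bsub>UA g\<^esub> (tt [^]\<^bsub>UA g\<^esub> Suc k) \<otimes>\<^bsub>UA g\<^esub> y"
      using adic_closureD(2)[OF u[unfolded Ueps_ideal_def], of "Suc k"] by blast
    have "s \<in> carrier (UA g)" "actA s t = 0" using s(1) I by (auto simp: K_def)
    moreover have "tt [^]\<^bsub>UA g\<^esub> Suc k \<otimes>\<^bsub>UA g\<^esub> y \<in> carrier (UA g)" using s(2) tt_UA nat_pow_closed by blast
    ultimately have "actA u t = actA (tt [^]\<^bsub>UA g\<^esub> Suc k \<otimes>\<^bsub>UA g\<^esub> y) t"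
      unfolding s(3) using laws_A(1)[OF _ _ UNIV_I] by simp
    then show ?thesis unfolding actA_def using evW_tt[OF s(2) liftW_WA[of t], of k "Suc k"] by (simp del: nat_pow_Suc)
  qed
  then show ?thesis by (simp add: fps_eq_iff)
qed

definition actE :: "int_gen free fps fps set set \<Rightarrow> basis_space fps \<Rightarrow> basis_space fps"
  where "actE Y t = actA (SOME u. u \<in> Y) t"

lemma JE_coset: "u \<in> carrier (UA g) \<Longrightarrow> v \<in> JE +>\<^bsub>UA g\<^esub> u \<Longrightarrow> v \<in> carrier (UA g) \<and> actA v t = actA u t"
proof -
  interpret ideal JE "UA g" by (rule ideal_JE)
  assume u: "u \<in> carrier (UA g)" and "v \<in> JE +>\<^bsub>UA g\<^esub> u"
  then obtain i where i: "i \<in> JE" "v = i \<oplus>\<^bsub>UA g\<^esub> u" by (auto simp: a_r_coset_def')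
  then have "i \<in> carrier (UA g)" using a_subset by blast
  then show ?thesis using u i laws_A(1)[of i u t] JE_kill[OF i(1)] by simp
qed

lemma JE_self: "u \<in> carrier (UA g) \<Longrightarrow> u \<in> JE +>\<^bsub>UA g\<^esub> u"
proof -
  interpret ideal JE "UA g" by (rule ideal_JE)
  show "u \<in> carrier (UA g) \<Longrightarrow> u \<in> JE +>\<^bsub>UA g\<^esub> u" by (rule a_rcos_self)
qed

lemma actE: "u \<in> carrier (UA g) \<Longrightarrow> actE (JE +>\<^bsub>UA g\<^esub> u) t = actA u t"
  unfolding actE_def using JE_coset someI[of "\<lambda>v. v \<in> JE +>\<^bsub>UA g\<^esub> u", OF JE_self] by blast

lemma Ueps_carrier: "Y \<in> carrier (Ueps g) \<longleftrightarrow> (\<exists>u\<in>carrier (UA g). Y = JE +>\<^bsub>UA g\<^esub> u)"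
  by (auto simp: Ueps_def FactRing_def A_RCOSETS_def')

definition phiE :: "int_gen free fps fps set set set \<Rightarrow> basis_space fps"
  where "phiE = coset_map tau"

lemma Meps_models: "models (Ueps g) (Meps g n) phiE UNIV actE"
proof -
  interpret J: ideal JE "UA g" by (rule ideal_JE)
  note h = J.rcos_ring_hom[folded Ueps_def]
  note Q = modelsD[OF M0_models]
  have ne: "x \<in> A \<Longrightarrow> A \<noteq> {}" for x and A :: "'z set" by blast
  define sm where "sm Y X = (\<Union>u\<in>Y. u \<odot>\<^bsub>M0\<^esub> X)" for Y X
  have sm: "sm Y X \<in> carrier M0 \<and> coset_map tau (sm Y X) = actE Y (coset_map tau X)"
    if Y: "Y \<in> carrier (Ueps g)" and X: "X \<in> carrier M0" for Y X
  proof -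
    obtain u where u: "u \<in> carrier (UA g)" "Y = JE +>\<^bsub>UA g\<^esub> u" using Y Ueps_carrier by blast
    have eq: "v \<odot>\<^bsub>M0\<^esub> X = u \<odot>\<^bsub>M0\<^esub> X" if v: "v \<in> Y" for v
    proof (rule inj_onD[OF Q(3)])
      have v': "v \<in> carrier (UA g)" "actA v (coset_map tau X) = actA u (coset_map tau X)"
        using JE_coset[OF u(1), of v] v u(2) by auto
      show "coset_map tau (v \<odot>\<^bsub>M0\<^esub> X) = coset_map tau (u \<odot>\<^bsub>M0\<^esub> X)" using Q(7)[OF _ X] v' u(1) by simp
      show "v \<odot>\<^bsub>M0\<^esub> X \<in> carrier M0" "u \<odot>\<^bsub>M0\<^esub> X \<in> carrier M0"
        using left_module_closed(2)[OF Q(1) _ X] v' u(1) by auto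
    qed
    have "Y \<noteq> {}" using JE_self[OF u(1)] unfolding u(2) by (rule ne)
    moreover have "sm Y X = (\<Union>v\<in>Y. u \<odot>\<^bsub>M0\<^esub> X)" unfolding sm_def by (rule SUP_cong[OF refl eq])
    ultimately have s: "sm Y X = u \<odot>\<^bsub>M0\<^esub> X" by (simp only: UN_constant if_False)
    show ?thesis unfolding s unfolding u(2) actE[OF u(1)] using Q(7)[OF u(1) X] left_module_closed(2)[OF Q(1) u(1) X] by (rule conjI[rotated])
  qed
  have "models (Ueps g) (with_smult sm M0) (coset_map tau) UNIV actE"
  proof (rule models_with_smult[OF M0_models])
    show "ring (Ueps g)" unfolding Ueps_def by (rule J.quotient_is_ring)
    show "actE (a \<oplus>\<^bsub>Ueps g\<^esub> b) t = actE a t + actE b t" "actE (a \<otimes>\<^bsub>Ueps g\<^esub> b) t = actE a (actE b t)"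
      if ab: "a \<in> carrier (Ueps g)" "b \<in> carrier (Ueps g)" for a b t
    proof -
      obtain u v where uv: "u \<in> carrier (UA g)" "v \<in> carrier (UA g)" "a = JE +>\<^bsub>UA g\<^esub> u" "b = JE +>\<^bsub>UA g\<^esub> v"
        using ab[unfolded Ueps_carrier] by (elim bexE) (rule that)
      show "actE (a \<oplus>\<^bsub>Ueps g\<^esub> b) t = actE a t + actE b t"
        unfolding uv ring_hom_add[OF h uv(1,2), symmetric] actE[OF J.a_closed[OF uv(1,2)]] actE[OF uv(1)] actE[OF uv(2)]
        by (rule laws_A(1)[OF uv(1,2) UNIV_I])
      show "actE (a \<otimes>\<^bsub>Ueps g\<^esub> b) t = actE a (actE b t)"
        unfolding uv ring_hom_mult[OF h uv(1,2), symmetric] actE[OF J.m_closed[OF uv(1,2)]] actE[OF uv(1)] actE[OF uv(2)]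
        by (rule laws_A(3)[OF uv(1,2) UNIV_I])
    qed
    show "actE \<one>\<^bsub>Ueps g\<^esub> t = t" for t
      unfolding ring_hom_one[OF h, symmetric] actE[OF J.one_closed] by (rule laws_A(4)[OF J.one_closed UNIV_I])
    show "actE a (s + t) = actE a s + actE a t" if a: "a \<in> carrier (Ueps g)" for a s t
    proof -
      obtain u where u: "u \<in> carrier (UA g)" "a = JE +>\<^bsub>UA g\<^esub> u"
        using a[unfolded Ueps_carrier] by (elim bexE) (rule that)
      show ?thesis unfolding u(2) actE[OF u(1)] by (rule laws_A(2)[OF u(1) UNIV_I UNIV_I])
    qed
  qed (use sm in auto)
  moreover have "Meps g n = with_smult sm M0"
    unfolding Meps_def Let_def kernel_tau M0_def[symmetric] sm_def[abs_def] ..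
  ultimately show ?thesis by (simp add: phiE_def)
qed

lemmas EM = modelsD[OF Meps_models]
lemmas Eclo = left_module_closed[OF EM(1)]

lemma Ueps_cls_carrier: "Uhh_cls g f \<in> carrier (UA g) \<Longrightarrow> Ueps_cls g f \<in> carrier (Ueps g)"
  unfolding Ueps_cls_def Ueps_carrier by blast

lemma phiE_cls:
  assumes f: "Uhh_cls g f \<in> carrier (UA g)" and x: "x \<in> carrier (Meps g n)"
  shows "comp1 j (phiE (Ueps_cls g f \<odot>\<^bsub>Meps g n\<^esub> x)) =
    map_fps (evA (root_eps g)) (comp2 j (rep2 g n f (liftW (phiE x))))"
proof -
  have "phiE (Ueps_cls g f \<odot>\<^bsub>Meps g n\<^esub> x) = evW (rep2 g n f (liftW (phiE x)))"
    using EM(7)[OF Ueps_cls_carrier[OF f] x] by (simp add: Ueps_cls_def actE[OF f] actA_def cU)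
  then show ?thesis using comp1_evW[of "rep2 g n f (liftW (phiE x))" j] WA_UA[OF f liftW_WA[of "phiE x"]] by (simp add: cU)
qed

lemma gen2_UA: "Uhh_cls g (gen2 x) \<in> carrier (UA g)"
  by (intro gens_UA) blast

abbreviation "xpE \<equiv> Ueps_cls g (gen2 (Sl2 Xp))"
abbreviation "xmE \<equiv> Ueps_cls g (gen2 (Sl2 Xm))"
abbreviation "hE \<equiv> Ueps_cls g (gen2 (Sl2 Hg))"

lemma gens_Ueps: "Ueps_cls g (gen2 x) \<in> carrier (Ueps g)"
  by (rule Ueps_cls_carrier[OF gen2_UA])

lemma ev_cst: "map_fps (evA (root_eps g)) (map_fps cst a) = a"
  by (simp add: fps_eq_iff evs del: cst_id)

lemma phiE_gens:
  assumes x: "x \<in> carrier (Meps g n)"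
  shows "comp1 j (phiE (xmE \<odot>\<^bsub>Meps g n\<^esub> x)) = (if j = 0 then 0 else comp1 (j - 1) (phiE x))"
    "comp1 j (phiE (hE \<odot>\<^bsub>Meps g n\<^esub> x)) = of_int (n - 2 * int j) * comp1 j (phiE x)"
    "comp1 j (phiE (xpE \<odot>\<^bsub>Meps g n\<^esub> x)) = numE g (int j + 1) * numE g (n - int j) * comp1 (Suc j) (phiE x)"
proof -
  note p = phiE_cls[OF gen2_UA x] and hom = ahomD[OF ahom_map_fps[OF ahom_cst]]
  have w: "of_int m * map_fps cst a = map_fps cst (of_int m * a)" for m and a :: "complex fps" by (simp only: hom(3) hom(10))
  show "comp1 j (phiE (xmE \<odot>\<^bsub>Meps g n\<^esub> x)) = (if j = 0 then 0 else comp1 (j - 1) (phiE x))"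
    unfolding p rep2_gen comp2_liftW by (simp add: ev_cst) (simp add: fps_eq_iff evs)
  show "comp1 j (phiE (hE \<odot>\<^bsub>Meps g n\<^esub> x)) = of_int (n - 2 * int j) * comp1 j (phiE x)"
    unfolding p rep2_gen comp2_liftW w by (rule ev_cst)
  have A: "fps_nth (map_fps cst a) k \<in> ring_A" for a k by (simp only: map_fps_nth ring_A_closed)
  have N: "fps_nth (num g (of_int a) * num g (of_int b)) k \<in> ring_A" for a b k
    unfolding fps_mult_nth by (intro ring_A_sum ring_A_closed num_ring_A)
  show "comp1 j (phiE (xpE \<odot>\<^bsub>Meps g n\<^esub> x)) = numE g (int j + 1) * numE g (n - int j) * comp1 (Suc j) (phiE x)"
    unfolding p rep2_gen comp2_liftW map_evA_mult[OF root_eps_nz N A] map_evA_mult[OF root_eps_nz num_ring_A num_ring_A]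
      numE_def[symmetric] ev_cst ..
qed

lemma Ueps_scal_carrier: "Ueps_scal g a \<in> carrier (Ueps g)"
  and phiE_scal: "x \<in> carrier (Meps g n) \<Longrightarrow> comp1 j (phiE (Ueps_scal g a \<odot>\<^bsub>Meps g n\<^esub> x)) = a * comp1 j (phiE x)"
proof -
  have e: "(map_fps cst a :: int_gen free fps fps) = map_fps (map_fps cst) (map_fps cst a :: complex fps fps)" for a
    by (simp add: fps_eq_iff cst_fps_nth)
  have c: "Uhh_cls g (map_fps cst a) \<in> carrier (UA g)"
  proof -
    have "Uhh_cls g (map_fps cst a) = Uhh_scal g (map_fps cst a)" unfolding Uhh_scal_def e[of a] ..
    then show ?thesis using scal_UA[of "map_fps cst a"] by (simp only: map_fps_nth ring_A_closed)
  qed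
  then show "Ueps_scal g a \<in> carrier (Ueps g)" unfolding Ueps_scal_def by (rule Ueps_cls_carrier)
  assume x: "x \<in> carrier (Meps g n)"
  show "comp1 j (phiE (Ueps_scal g a \<odot>\<^bsub>Meps g n\<^esub> x)) = a * comp1 j (phiE x)"
    unfolding Ueps_scal_def phiE_cls[OF c x] unfolding e rep2_scalar comp2_liftW
      ahomD(3)[OF ahom_map_fps[OF ahom_cst], symmetric] by (rule ev_cst)
qed

lemma phiE_pow:
  assumes u: "u \<in> carrier (Ueps g)" and x: "x \<in> carrier (Meps g n)"
  shows "u [^]\<^bsub>Ueps g\<^esub> (N::nat) \<in> carrier (Ueps g)"
    "(u [^]\<^bsub>Ueps g\<^esub> Suc N) \<odot>\<^bsub>Meps g n\<^esub> x = (u [^]\<^bsub>Ueps g\<^esub> N) \<odot>\<^bsub>Meps g n\<^esub> (u \<odot>\<^bsub>Meps g n\<^esub> x)"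
    "(u [^]\<^bsub>Ueps g\<^esub> (0::nat)) \<odot>\<^bsub>Meps g n\<^esub> x = x"
proof -
  interpret left_module "Ueps g" "Meps g n" by (rule EM(1))
  interpret R: ring "Ueps g" by (rule Eclo(5))
  show c: "u [^]\<^bsub>Ueps g\<^esub> (N::nat) \<in> carrier (Ueps g)" using u by (rule R.nat_pow_closed)
  show "(u [^]\<^bsub>Ueps g\<^esub> Suc N) \<odot>\<^bsub>Meps g n\<^esub> x = (u [^]\<^bsub>Ueps g\<^esub> N) \<odot>\<^bsub>Meps g n\<^esub> (u \<odot>\<^bsub>Meps g n\<^esub> x)"
    using smult_assoc[OF c u x] by simp
  show "(u [^]\<^bsub>Ueps g\<^esub> (0::nat)) \<odot>\<^bsub>Meps g n\<^esub> x = x" using smult_one[OF x] by simp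
qed

lemma phiE_xm_pow:
  "x \<in> carrier (Meps g n) \<Longrightarrow>
    comp1 j (phiE ((xmE [^]\<^bsub>Ueps g\<^esub> N) \<odot>\<^bsub>Meps g n\<^esub> x)) = (if j < N then 0 else comp1 (j - N) (phiE x))"
proof (induction N arbitrary: x)
  case (Suc N)
  note s = Eclo(2)[OF gens_Ueps Suc.prems, of "Sl2 Xm"]
  show ?case unfolding phiE_pow(2)[OF gens_Ueps Suc.prems] Suc.IH[OF s] phiE_gens(1)[OF Suc.prems] by auto
qed (simp only: phiE_pow(3)[OF gens_Ueps] not_less0 if_False diff_zero)

lemma phiE_xp_pow:
  "x \<in> carrier (Meps g n) \<Longrightarrow>
    comp1 j (phiE ((xpE [^]\<^bsub>Ueps g\<^esub> N) \<odot>\<^bsub>Meps g n\<^esub> x)) =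
      (\<Prod>i<N. numE g (int (j + i) + 1) * numE g (n - int (j + i))) * comp1 (j + N) (phiE x)"
proof (induction N arbitrary: x)
  case (Suc N)
  note s = Eclo(2)[OF gens_Ueps Suc.prems, of "Sl2 Xp"]
  show ?case unfolding phiE_pow(2)[OF gens_Ueps Suc.prems] Suc.IH[OF s] phiE_gens(3)[OF Suc.prems] by (simp add: mult.assoc)
qed (simp only: phiE_pow(3)[OF gens_Ueps] lessThan_0 prod.empty mult_1 add_0_right)

lemma phiE_scal_pow:
  "x \<in> carrier (Meps g n) \<Longrightarrow>
    comp1 j (phiE ((Ueps_scal g a [^]\<^bsub>Ueps g\<^esub> N) \<odot>\<^bsub>Meps g n\<^esub> x)) = a ^ N * comp1 j (phiE x)"
proof (induction N arbitrary: x)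
  case (Suc N)
  note s = Eclo(2)[OF Ueps_scal_carrier Suc.prems, of a]
  show ?case unfolding phiE_pow(2)[OF Ueps_scal_carrier Suc.prems] Suc.IH[OF s] phiE_scal[OF Suc.prems] by simp
qed (simp only: phiE_pow(3)[OF Ueps_scal_carrier] power_0 mult_1)

end

context specialization
begin

subsection \<open>Weights\<close>

abbreviation "tE \<equiv> Ueps_scal g fps_X"
abbreviation "M \<equiv> Meps g n"

definition psi :: "basis_space fps \<Rightarrow> int_gen free fps fps set set set"
  where "psi = inv_into (carrier M) phiE"

lemma psi: "psi v \<in> carrier M" "phiE (psi v) = v"
  using EM(4) unfolding psi_def by (auto intro: inv_into_into f_inv_into_f)

lemma phiE_inj: "x \<in> carrier M \<Longrightarrow> y \<in> carrier M \<Longrightarrow> phiE x = phiE y \<Longrightarrow> x = y"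
  using EM(3) by (auto simp: inj_on_def)

lemma phiE_zero: "phiE \<zero>\<^bsub>M\<^esub> = 0"
  by (rule additive_zero_neg(1)[OF Eclo(6) EM(6)])

text \<open>The \<open>h'\<close>-adic topology of the module is the one of coefficients, so convergence can be read off the
  coordinates.\<close>

lemma tE_image:
  assumes x: "x \<in> carrier M"
  shows "x \<in> (\<lambda>y. (tE [^]\<^bsub>Ueps g\<^esub> (N::nat)) \<odot>\<^bsub>M\<^esub> y) ` carrier M \<longleftrightarrow> (\<forall>k<N. fps_nth (phiE x) k = 0)"
proof
  assume "x \<in> (\<lambda>y. (tE [^]\<^bsub>Ueps g\<^esub> N) \<odot>\<^bsub>M\<^esub> y) ` carrier M"
  then obtain y where y: "y \<in> carrier M" "x = (tE [^]\<^bsub>Ueps g\<^esub> N) \<odot>\<^bsub>M\<^esub> y" by blast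
  have "fps_nth (comp1 j (phiE x)) k = 0" if "k < N" for j k
    unfolding y(2) phiE_scal_pow[OF y(1)] using that by (simp add: fps_X_power_mult_nth)
  then show "\<forall>k<N. fps_nth (phiE x) k = 0" by (auto simp: comp1_nth intro: poly_mapping_eqI)
next
  assume k: "\<forall>k<N. fps_nth (phiE x) k = 0"
  let ?y = "psi (fps_shift N (phiE x))"
  note c = phiE_pow(1)[OF Ueps_scal_carrier psi(1)]
  have "phiE ((tE [^]\<^bsub>Ueps g\<^esub> N) \<odot>\<^bsub>M\<^esub> ?y) = phiE x"
  proof (rule comp1_eqI, rule fps_ext)
    fix j l
    show "fps_nth (comp1 j (phiE ((tE [^]\<^bsub>Ueps g\<^esub> N) \<odot>\<^bsub>M\<^esub> ?y))) l = fps_nth (comp1 j (phiE x)) l"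
      unfolding phiE_scal_pow[OF psi(1)] psi(2) using k by (simp add: fps_X_power_mult_nth comp1_nth)
  qed
  then have "x = (tE [^]\<^bsub>Ueps g\<^esub> N) \<odot>\<^bsub>M\<^esub> ?y"
    using phiE_inj[OF x Eclo(2)[OF c psi(1)]] by simp
  then show "x \<in> (\<lambda>y. (tE [^]\<^bsub>Ueps g\<^esub> N) \<odot>\<^bsub>M\<^esub> y) ` carrier M" using psi(1) by blast
qed

lemma weight_space_iff:
  "x \<in> weight_space hE M m \<longleftrightarrow> x \<in> carrier M \<and> (\<forall>j. n - 2 * int j \<noteq> m \<longrightarrow> comp1 j (phiE x) = 0)"
proof (cases "x \<in> carrier M")
  case True
  interpret abelian_group M by (rule Eclo(6))
  have m: "comp1 j (phiE ([m] \<cdot>\<^bsub>M\<^esub> x)) = of_int m * comp1 j (phiE x)" for j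
    by (rule additive_int_pow[OF Eclo(6) True]) (simp add: EM(6) comp1_simps)
  have c: "[m] \<cdot>\<^bsub>M\<^esub> x \<in> carrier M" using True by (rule add.int_pow_closed)
  have "hE \<odot>\<^bsub>M\<^esub> x = [m] \<cdot>\<^bsub>M\<^esub> x \<longleftrightarrow> phiE (hE \<odot>\<^bsub>M\<^esub> x) = phiE ([m] \<cdot>\<^bsub>M\<^esub> x)"
    using phiE_inj[OF Eclo(2)[OF gens_Ueps True] c] by auto
  also have "\<dots> \<longleftrightarrow> (\<forall>j. comp1 j (phiE (hE \<odot>\<^bsub>M\<^esub> x)) = comp1 j (phiE ([m] \<cdot>\<^bsub>M\<^esub> x)))"
    by (auto intro: comp1_eqI)
  finally have *: "hE \<odot>\<^bsub>M\<^esub> x = [m] \<cdot>\<^bsub>M\<^esub> x \<longleftrightarrow> (\<forall>j. comp1 j (phiE (hE \<odot>\<^bsub>M\<^esub> x)) = comp1 j (phiE ([m] \<cdot>\<^bsub>M\<^esub> x)))" .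
  have i: "fps_const (of_int a :: complex) = fps_const (of_int b) \<longleftrightarrow> a = b" for a b
    by (metis fps_nth_fps_const of_int_eq_iff)
  have "(\<forall>j. comp1 j (phiE (hE \<odot>\<^bsub>M\<^esub> x)) = comp1 j (phiE ([m] \<cdot>\<^bsub>M\<^esub> x))) \<longleftrightarrow> (\<forall>j. n - 2 * int j \<noteq> m \<longrightarrow> comp1 j (phiE x) = 0)"
  proof (rule iff_allI)
    fix j
    show "(comp1 j (phiE (hE \<odot>\<^bsub>M\<^esub> x)) = comp1 j (phiE ([m] \<cdot>\<^bsub>M\<^esub> x))) = (n - 2 * int j \<noteq> m \<longrightarrow> comp1 j (phiE x) = 0)"
      unfolding phiE_gens(2)[OF True, of j] m[of j] mult_cancel_right fps_of_int[symmetric] i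
      by (simp only: disj_commute imp_conv_disj not_not)
  qed
  then show ?thesis using True * by (simp add: weight_space_def)
qed (simp add: weight_space_def)

lemma adic_null_iff:
  assumes "\<And>m. f m \<in> carrier M"
  shows "adic_null (Ueps g) tE M f \<longleftrightarrow> (\<forall>N. finite {m. \<exists>k<N. fps_nth (phiE (f m)) k \<noteq> 0})"
  unfolding adic_null_def tE_image[OF assms] by simp

lemma adic_sums_iff:
  assumes f: "\<And>m. f m \<in> carrier M" and x: "x \<in> carrier M"
  shows "adic_sums (Ueps g) tE M f x \<longleftrightarrow>
    (\<forall>N. \<exists>F. finite F \<and> (\<forall>F'. finite F' \<and> F \<subseteq> F' \<longrightarrow>
      (\<forall>k<N. fps_nth (phiE x) k = fps_nth (\<Sum>m\<in>F'. phiE (f m)) k)))"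
proof -
  interpret abelian_group M by (rule Eclo(6))
  have "(\<exists>y\<in>carrier M. x = finsum M f F' \<oplus>\<^bsub>M\<^esub> (tE [^]\<^bsub>Ueps g\<^esub> N) \<odot>\<^bsub>M\<^esub> y) \<longleftrightarrow>
      (\<forall>k<N. fps_nth (phiE x) k = fps_nth (\<Sum>m\<in>F'. phiE (f m)) k)" if F': "finite F'" for N :: nat and F'
  proof -
    have s: "finsum M f F' \<in> carrier M" using f by (auto intro: finsum_closed)
    let ?d = "x \<oplus>\<^bsub>M\<^esub> (\<ominus>\<^bsub>M\<^esub> finsum M f F')"
    have d: "?d \<in> carrier M" using s x by simp
    have pd: "phiE ?d = phiE x - (\<Sum>m\<in>F'. phiE (f m))"
      using s x additive_zero_neg(2)[OF Eclo(6) EM(6) s] additive_finsum[OF Eclo(6) F' f EM(6)] by (simp add: EM(6))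
    have c: "tE [^]\<^bsub>Ueps g\<^esub> N \<in> carrier (Ueps g)" by (rule phiE_pow(1)[OF Ueps_scal_carrier x])
    have "x = finsum M f F' \<oplus>\<^bsub>M\<^esub> z \<longleftrightarrow> ?d = z" if z: "z \<in> carrier M" for z
    proof -
      have "x = finsum M f F' \<oplus>\<^bsub>M\<^esub> ?d" using s x by (simp add: a_lcomm[of "finsum M f F'"] r_neg)
      moreover have "?d = z" if e: "x = finsum M f F' \<oplus>\<^bsub>M\<^esub> z"
        unfolding e using s z r_neg1[OF s z] by (simp add: a_comm)
      ultimately show ?thesis by auto
    qed
    then have "(\<exists>y\<in>carrier M. x = finsum M f F' \<oplus>\<^bsub>M\<^esub> (tE [^]\<^bsub>Ueps g\<^esub> N) \<odot>\<^bsub>M\<^esub> y) \<longleftrightarrow>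
        ?d \<in> (\<lambda>y. (tE [^]\<^bsub>Ueps g\<^esub> N) \<odot>\<^bsub>M\<^esub> y) ` carrier M"
      using Eclo(2)[OF c] by auto
    then show ?thesis unfolding tE_image[OF d] pd by simp
  qed
  then show ?thesis unfolding adic_sums_def by meson
qed

lemma comp1_weight_sum:
  assumes f: "\<And>m j. n - 2 * int j \<noteq> m \<Longrightarrow> comp1 j (phiE (f m)) = 0" and F: "finite F"
  shows "comp1 j (\<Sum>m\<in>F. phiE (f m)) = (if n - 2 * int j \<in> F then comp1 j (phiE (f (n - 2 * int j))) else 0)"
proof -
  have "comp1 j (\<Sum>m\<in>F. phiE (f m)) = (\<Sum>m\<in>F. if m = n - 2 * int j then comp1 j (phiE (f (n - 2 * int j))) else 0)"
    unfolding comp1_sum by (intro sum.cong refl) (auto intro: f)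
  then show ?thesis using F by simp
qed

lemma sums_comp:
  assumes c: "\<And>m. f m \<in> carrier M" and x: "x \<in> carrier M" and f: "\<And>m j. n - 2 * int j \<noteq> m \<Longrightarrow> comp1 j (phiE (f m)) = 0"
    and s: "adic_sums (Ueps g) tE M f x"
  shows "comp1 j (phiE x) = comp1 j (phiE (f (n - 2 * int j)))"
proof (rule fps_ext)
  fix k
  obtain F where F: "finite F" "\<And>F'. finite F' \<Longrightarrow> F \<subseteq> F' \<Longrightarrow> \<forall>l<Suc k. fps_nth (phiE x) l = fps_nth (\<Sum>m\<in>F'. phiE (f m)) l"
    using s unfolding adic_sums_iff[OF c x] by meson
  have "fps_nth (phiE x) k = fps_nth (\<Sum>m\<in>insert (n - 2 * int j) F. phiE (f m)) k"
    using F(2)[of "insert (n - 2 * int j) F"] F(1) by blast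
  then have "fps_nth (comp1 j (phiE x)) k = fps_nth (comp1 j (\<Sum>m\<in>insert (n - 2 * int j) F. phiE (f m))) k"
    by (simp only: comp1_nth)
  then show "fps_nth (comp1 j (phiE x)) k = fps_nth (comp1 j (phiE (f (n - 2 * int j)))) k"
    using comp1_weight_sum[where f=f and F="insert (n - 2 * int j) F" and j=j, OF f] F(1) by simp
qed

lemma comp_sums:
  assumes c: "\<And>m. f m \<in> carrier M" and x: "x \<in> carrier M" and f: "\<And>m j. n - 2 * int j \<noteq> m \<Longrightarrow> comp1 j (phiE (f m)) = 0"
    and null: "adic_null (Ueps g) tE M f" and e: "\<And>j. comp1 j (phiE x) = comp1 j (phiE (f (n - 2 * int j)))"
  shows "adic_sums (Ueps g) tE M f x"
  unfolding adic_sums_iff[OF c x]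
proof (intro allI exI conjI impI; (elim conjE)?)
  fix N
  show "finite {m. \<exists>k<N. fps_nth (phiE (f m)) k \<noteq> 0}" using null unfolding adic_null_iff[OF c] by blast
  fix F' k assume F': "finite F'" "{m. \<exists>k<N. fps_nth (phiE (f m)) k \<noteq> 0} \<subseteq> F'" and k: "k < N"
  have "fps_nth (comp1 j (phiE x)) k = fps_nth (comp1 j (\<Sum>m\<in>F'. phiE (f m))) k" for j
  proof (cases "n - 2 * int j \<in> F'")
    case False
    then have "fps_nth (phiE (f (n - 2 * int j))) k = 0" using F'(2) k by blast
    then have "fps_nth (comp1 j (phiE x)) k = 0" unfolding e by (simp add: comp1_nth)
    then show ?thesis using False comp1_weight_sum[where f=f and j=j and F=F'] f F'(1) by simp
  qed (simp add: comp1_weight_sum[where f=f, OF f F'(1)] e)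
  then show "fps_nth (phiE x) k = fps_nth (\<Sum>m\<in>F'. phiE (f m)) k" by (auto simp: comp1_nth intro: poly_mapping_eqI)
qed

text \<open>The decomposition into weight vectors: weight spaces are coordinate axes, because the weights
  \<open>n - 2j\<close> are distinct.\<close>

definition fam :: "int_gen free fps fps set set set \<Rightarrow> int \<Rightarrow> int_gen free fps fps set set set"
  where "fam x m = psi (assemble1 (\<lambda>j. if n - 2 * int j = m then comp1 j (phiE x) else 0))"

lemma fam: "fam x m \<in> carrier M" "comp1 j (phiE (fam x m)) = (if n - 2 * int j = m then comp1 j (phiE x) else 0)"
proof -
  show "fam x m \<in> carrier M" by (simp add: fam_def psi)
  show "comp1 j (phiE (fam x m)) = (if n - 2 * int j = m then comp1 j (phiE x) else 0)"
    unfolding fam_def psi(2)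
  proof (rule comp1_assemble1)
    fix k show "finite {j. fps_nth (if n - 2 * int j = m then comp1 j (phiE x) else 0) k \<noteq> 0}"
      by (rule finite_subset[OF _ finite_comp1[of "phiE x" k]]) auto
  qed
qed

lemma fam_null: "adic_null (Ueps g) tE M (fam x)"
  unfolding adic_null_iff[of "fam x", OF fam(1)]
proof
  fix N
  have "{m. \<exists>k<N. fps_nth (phiE (fam x m)) k \<noteq> 0} \<subseteq>
      (\<Union>k<N. (\<lambda>j. n - 2 * int j) ` {j. fps_nth (comp1 j (phiE x)) k \<noteq> 0})"
  proof
    fix m assume "m \<in> {m. \<exists>k<N. fps_nth (phiE (fam x m)) k \<noteq> 0}"
    then obtain k where k: "k < N" "fps_nth (phiE (fam x m)) k \<noteq> 0" by blast
    then obtain j where "Poly_Mapping.lookup (fps_nth (phiE (fam x m)) k) j \<noteq> 0"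
      by (metis lookup_zero poly_mapping_eqI)
    then have "fps_nth (comp1 j (phiE (fam x m))) k \<noteq> 0" by (simp add: comp1_nth)
    then have "m = n - 2 * int j" "fps_nth (comp1 j (phiE x)) k \<noteq> 0" by (auto simp: fam split: if_splits)
    then show "m \<in> (\<Union>k<N. (\<lambda>j. n - 2 * int j) ` {j. fps_nth (comp1 j (phiE x)) k \<noteq> 0})" using k(1) by blast
  qed
  then show "finite {m. \<exists>k<N. fps_nth (phiE (fam x m)) k \<noteq> 0}"
    by (rule finite_subset) (auto intro: finite_comp1)
qed

lemma fam_sums: "x \<in> carrier M \<Longrightarrow> adic_sums (Ueps g) tE M (fam x) x"
  by (rule comp_sums) (simp_all add: fam fam_null)

theorem Meps_weight_module: "weight_module (Ueps g) tE hE M"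
  unfolding weight_module_def
proof (intro conjI ballI allI impI)
  show "left_module (Ueps g) M" by (rule EM(1))
next
  fix x assume x: "x \<in> carrier M"
  show "\<exists>!f. (\<forall>m. f m \<in> weight_space hE M m) \<and> adic_null (Ueps g) tE M f \<and> adic_sums (Ueps g) tE M f x"
  proof (rule ex1I[of _ "fam x"])
    show "(\<forall>m. fam x m \<in> weight_space hE M m) \<and> adic_null (Ueps g) tE M (fam x) \<and> adic_sums (Ueps g) tE M (fam x) x"
      by (auto simp: weight_space_iff fam fam_null fam_sums[OF x])
    fix f assume f: "(\<forall>m. f m \<in> weight_space hE M m) \<and> adic_null (Ueps g) tE M f \<and> adic_sums (Ueps g) tE M f x"
    then have f': "f m \<in> carrier M" "n - 2 * int j \<noteq> m \<Longrightarrow> comp1 j (phiE (f m)) = 0" for m j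
      by (auto simp: weight_space_iff)
    show "f = fam x"
    proof
      fix m
      have "comp1 j (phiE (f m)) = comp1 j (phiE (fam x m))" for j
        using sums_comp[where f=f and j=j, OF f'(1) x] f f'(2) by (auto simp: fam)
      then show "f m = fam x m" using phiE_inj[OF f'(1) fam(1)] comp1_eqI by blast
    qed
  qed
next
  fix f assume f: "(\<forall>m. f m \<in> weight_space hE M m) \<and> adic_null (Ueps g) tE M f"
  then have f': "f m \<in> carrier M" "n - 2 * int j \<noteq> m \<Longrightarrow> comp1 j (phiE (f m)) = 0" for m j
    by (auto simp: weight_space_iff)
  define x where "x = psi (assemble1 (\<lambda>j. comp1 j (phiE (f (n - 2 * int j)))))"
  have x: "comp1 j (phiE x) = comp1 j (phiE (f (n - 2 * int j)))" for j
    unfolding x_def psi(2)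
  proof (rule comp1_assemble1)
    fix k
    have "finite {m. \<exists>l<Suc k. fps_nth (phiE (f m)) l \<noteq> 0}" using f unfolding adic_null_iff[of f, OF f'(1)] by blast
    then have "finite ((\<lambda>j. n - 2 * int j) -` {m. \<exists>l<Suc k. fps_nth (phiE (f m)) l \<noteq> 0})"
      by (rule finite_vimageI) (simp add: inj_on_def)
    then show "finite {j. fps_nth (comp1 j (phiE (f (n - 2 * int j)))) k \<noteq> 0}"
      by (rule finite_subset[rotated]) (auto simp: comp1_nth intro!: exI[of _ k])
  qed
  have xc: "x \<in> carrier M" by (simp add: x_def psi)
  show "\<exists>!x. x \<in> carrier M \<and> adic_sums (Ueps g) tE M f x"
  proof (rule ex1I[of _ x])
    show "x \<in> carrier M \<and> adic_sums (Ueps g) tE M f x"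
      using comp_sums[where f=f, OF f'(1) xc] f f' x xc by blast
    fix y assume y: "y \<in> carrier M \<and> adic_sums (Ueps g) tE M f y"
    then have "comp1 j (phiE y) = comp1 j (phiE x)" for j
      using sums_comp[where f=f and x=y and j=j, OF f'(1)] f'(2) by (simp add: x)
    then show "y = x" using phiE_inj[OF _ xc] y comp1_eqI by blast
  qed
qed

lemma weight_sum_iff:
  "x \<in> weight_sum (Ueps g) tE hE M I \<longleftrightarrow> x \<in> carrier M \<and> (\<forall>j. n - 2 * int j \<notin> I \<longrightarrow> comp1 j (phiE x) = 0)"
proof
  assume "x \<in> weight_sum (Ueps g) tE hE M I"
  then obtain f where x: "x \<in> carrier M" and f: "\<forall>m\<in>I. f m \<in> weight_space hE M m" "\<forall>m. m \<notin> I \<longrightarrow> f m = \<zero>\<^bsub>M\<^esub>"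
    "adic_sums (Ueps g) tE M f x" unfolding weight_sum_def by blast
  have f': "f m \<in> carrier M" "n - 2 * int j \<noteq> m \<Longrightarrow> comp1 j (phiE (f m)) = 0" for m j
    using f by (cases "m \<in> I"; auto simp: weight_space_iff Eclo(3) phiE_zero comp1_simps)+
  show "x \<in> carrier M \<and> (\<forall>j. n - 2 * int j \<notin> I \<longrightarrow> comp1 j (phiE x) = 0)"
    using x sums_comp[where f=f, OF f'(1) x _ f(3)] f' f(2) by (simp add: phiE_zero comp1_simps)
next
  assume x: "x \<in> carrier M \<and> (\<forall>j. n - 2 * int j \<notin> I \<longrightarrow> comp1 j (phiE x) = 0)"
  have "fam x m = \<zero>\<^bsub>M\<^esub>" if "m \<notin> I" for m
    by (rule phiE_inj[OF fam(1) Eclo(3)], rule comp1_eqI) (use x that in \<open>auto simp: fam phiE_zero comp1_simps\<close>)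
  moreover have "fam x m \<in> weight_space hE M m" for m by (auto simp: weight_space_iff fam)
  ultimately show "x \<in> weight_sum (Ueps g) tE hE M I"
    unfolding weight_sum_def using x fam_null fam_sums by blast
qed

end

section \<open>Products over a full period of quantum numbers at the root of unity\<close>

context
  fixes g :: nat
  assumes g: "g \<ge> 1"
begin

lemma root_eps_add_period: "root_eps g powi (a + int g * q) = (- 1) powi q * root_eps g powi a"
proof -
  have "root_eps g powi (int g * q) = (- 1) powi q"
    unfolding power_int_mult by (simp add: root_eps_power[OF g])
  then show ?thesis by (simp add: power_int_add)
qed

lemma root_eps_multiple: "root_eps g powi (int g * b) = (- 1) powi b"
  using root_eps_add_period[of 0 b] by simp

lemma minus_one_powi_minus: "(- 1 :: complex) powi (- b) = (- 1) powi b"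
  by (simp add: power_int_minus_one_minus)

text \<open>Away from the multiples of \<open>g\<close> the number is the constant \<open>[a]\<^sub>\<epsilon>\<close>, because there \<open>P\<close> vanishes
  and with it the dependence on \<open>T\<close>; shifting \<open>a\<close> by \<open>g\<close> changes the sign, as \<open>\<epsilon>\<^sup>g = -1\<close>.\<close>

lemma numE_const:
  assumes a: "\<not> int g dvd a"
  shows "numE g a = fps_const ((root_eps g powi a - root_eps g powi (- a)) / (root_eps g - inverse (root_eps g)))"
proof -
  let ?z = "root_eps g"
  have "\<not> int g dvd 1" using a by auto
  then have d: "?z - inverse ?z \<noteq> 0" using root_eps_diff[OF g, of 1] by (simp add: power_int_minus)
  have "numE g a * (cst ?z - cst (inverse ?z)) = cst (?z powi a) - cst (?z powi (- a))"
    using numE_eq[OF g, of a] a by simp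
  then have "numE g a * fps_const (?z - inverse ?z) = fps_const (?z powi a - ?z powi (- a))"
    by (simp add: cst_fps_def flip: fps_const_sub)
  then have "numE g a * fps_const (?z - inverse ?z) * fps_const (inverse (?z - inverse ?z)) =
      fps_const ((?z powi a - ?z powi (- a)) / (?z - inverse ?z))"
    by (simp add: divide_inverse)
  then show ?thesis using d by (simp add: mult.assoc)
qed

lemma numE_shift:
  assumes a: "\<not> int g dvd a"
  shows "numE g (a + int g * q) = fps_const ((- 1) powi q) * numE g a"
proof -
  have a': "\<not> int g dvd (a + int g * q)" using a by (simp add: dvd_add_left_iff)
  have e: "- (a + int g * q) = - a + int g * (- q)" by simp
  show ?thesis
    unfolding numE_const[OF a] numE_const[OF a'] e root_eps_add_period minus_one_powi_minus
    by (simp add: right_diff_distrib)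
qed

abbreviation "TE \<equiv> cst (root_eps g) * fexp 1 - cst (inverse (root_eps g)) * fexp (- 1) :: complex fps"
abbreviation "TG \<equiv> fexp (of_nat g) - fexp (- of_nat g) :: complex fps"

lemma numE_multiple: "numE g (int g * b) * TE = fps_const ((- 1) powi b) * qnum (of_nat g) (of_int b) * TG"
proof -
  have s: "qnum (of_nat g) (of_int b) * TG = fexp (of_int (int g * b)) - fexp (- of_int (int g * b))"
    using qnum_eq[of "of_nat g" "of_int b :: complex"] g by simp
  have "numE g (int g * b) * TE =
      cst ((- 1) powi b) * fexp (of_int (int g * b)) - cst ((- 1) powi b) * fexp (- of_int (int g * b))"
    using numE_eq[OF g, of "int g * b"] root_eps_multiple[of b] root_eps_multiple[of "- b"]
    by (simp add: minus_one_powi_minus)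
  then show ?thesis unfolding mult.assoc s by (simp only: cst_fps_def cst_id right_diff_distrib)
qed

text \<open>A window of \<open>g\<close> consecutive integers meets every residue once: its \<open>g - 1\<close> constants make up
  \<open>[g - 1]\<^sub>\<epsilon>!\<close> up to sign, and its multiple of \<open>g\<close> leaves a quantum number for \<open>T\<^sup>g\<close>.\<close>

lemma numE_window:
  "(\<Prod>i<g. numE g (a + 1 + int i)) * TE =
    fps_const ((- 1) powi (a + 1) * eps_fact g) * qnum (of_nat g) (of_int (a div int g + 1)) * TG"
proof -
  define F where "F a = (\<Prod>i<g. numE g (a + 1 + int i))" for a
  let ?C = "\<lambda>a q. fps_const ((- 1) powi (a + 1) * eps_fact g) * qnum (of_nat g) (of_int (q + 1)) * TG"
  have "F (int g * q + int r) * TE = ?C (int g * q + int r) q" if "r < g" for q r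
    using that
  proof (induction r)
    case 0
    have nd: "\<not> int g dvd int k" if "k \<in> {1..g - 1}" for k using that g by (auto dest!: dvd_imp_le)
    have t: "numE g (int g * q + 1 + int i) = fps_const ((- 1) powi q *
        ((root_eps g ^ Suc i - inverse (root_eps g) ^ Suc i) / (root_eps g - inverse (root_eps g))))" if i: "i < g - 1" for i
    proof -
      have "int g * q + 1 + int i = int (Suc i) + int g * q" by simp
      then show ?thesis
        using numE_shift[OF nd[of "Suc i"], of q] numE_const[OF nd[of "Suc i"]] i
        by (simp only: power_int_minus power_int_of_nat power_inverse fps_const_mult) auto
    qed
    have "(\<Prod>i<g - 1. numE g (int g * q + 1 + int i)) = fps_const (((- 1) powi q) ^ (g - 1) * eps_fact g)"
    proof -
      have "eps_fact g = (\<Prod>i<g - 1. (root_eps g ^ Suc i - inverse (root_eps g) ^ Suc i) / (root_eps g - inverse (root_eps g)))"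
        unfolding eps_fact_def Let_def One_nat_def by (rule prod.atLeast1_atMost_eq)
      moreover have c: "(\<Prod>i<g - 1. fps_const (c * f i)) = fps_const (c ^ (g - 1) * (\<Prod>i<g - 1. f i))" for c :: complex and f
      proof -
        have "(\<Prod>i<N. fps_const (c * f i)) = fps_const (c ^ N * (\<Prod>i<N. f i))" for N :: nat
          by (induction N) (simp_all add: mult_ac)
        then show ?thesis .
      qed
      moreover have "(\<Prod>i<g - 1. numE g (int g * q + 1 + int i)) = (\<Prod>i<g - 1. fps_const ((- 1) powi q *
          ((root_eps g ^ Suc i - inverse (root_eps g) ^ Suc i) / (root_eps g - inverse (root_eps g)))))"
        by (intro prod.cong refl t) (simp only: lessThan_iff)
      ultimately show ?thesis by (simp only: c)
    qed
    moreover have "F (int g * q) = (\<Prod>i<g - 1. numE g (int g * q + 1 + int i)) * numE g (int g * (q + 1))"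
      using g unfolding F_def by (cases g) (simp_all add: algebra_simps)
    ultimately have "F (int g * q) * TE = fps_const (((- 1) powi q) ^ (g - 1) * eps_fact g) *
        (fps_const ((- 1) powi (q + 1)) * qnum (of_nat g) (of_int (q + 1)) * TG)"
      by (simp only: mult.assoc numE_multiple)
    moreover have "((- 1) powi q) ^ (g - 1) * (- 1) powi (q + 1) = ((- 1) powi (int g * q + 1) :: complex)"
    proof -
      have "((- 1) powi q) ^ (g - 1) = ((- 1 :: complex) powi (q * int (g - 1)))"
        by (simp only: power_int_mult power_int_of_nat)
      then have "((- 1) powi q) ^ (g - 1) * (- 1) powi (q + 1) = ((- 1 :: complex) powi (q * int (g - 1) + (q + 1)))"
        by (simp add: power_int_add)
      also have "q * int (g - 1) + (q + 1) = int g * q + 1" using g by (simp add: of_nat_diff algebra_simps)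
      finally show ?thesis .
    qed
    ultimately show ?case by (simp add: mult_ac)
  next
    case (Suc r)
    let ?a = "int g * q + int r"
    have "\<not> int g dvd int (Suc r)" unfolding int_dvd_int_iff using Suc.prems by (auto dest!: dvd_imp_le)
    then have nd: "\<not> int g dvd ?a + 1" by (metis add.assoc dvd_add_right_iff dvd_triv_left of_nat_Suc add.commute)
    have n0: "numE g (?a + 1) \<noteq> 0"
    proof -
      have "\<not> int g dvd 1" using nd by auto
      then show ?thesis unfolding numE_const[OF nd] using root_eps_diff[OF g, of "?a + 1"] nd root_eps_diff[OF g, of 1]
        by (simp del: minus_add_distrib add: power_int_minus)
    qed
    obtain h where h: "g = Suc h" using g by (cases g) auto
    have "F ?a = numE g (?a + 1) * (\<Prod>i<h. numE g (?a + 2 + int i))"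
      unfolding F_def h prod.lessThan_Suc_shift by (simp add: algebra_simps)
    moreover have "F (?a + 1) = (\<Prod>i<h. numE g (?a + 2 + int i)) * numE g (?a + 1 + int g * 1)"
      unfolding F_def h by (simp add: algebra_simps)
    ultimately have "numE g (?a + 1) * F (?a + 1) = numE g (?a + 1) * - F ?a"
      unfolding numE_shift[OF nd] by (simp add: mult_ac flip: fps_const_neg)
    then have "F (?a + 1) = - F ?a" using n0 by (simp only: mult_cancel_left) simp
    then have "F (?a + 1) * TE = - (F ?a * TE)" by (simp only: minus_mult_left)
    also have "\<dots> = - ?C ?a q" unfolding Suc.IH[OF Suc_lessD[OF Suc.prems]] ..
    also have "\<dots> = ?C (?a + 1) q"
    proof -
      have "(- 1 :: complex) powi (?a + 1 + 1) = - ((- 1) powi (?a + 1))" by (subst power_int_add_1) auto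
      then show ?thesis by (simp only: mult_minus_left fps_const_neg[symmetric])
    qed
    finally show ?case unfolding of_nat_Suc add.commute[of 1] add.assoc[symmetric] .
  qed
  from this[of "nat (a mod int g)" "a div int g"] show ?thesis
    using g by (simp add: F_def nat_less_iff)
qed

lemma eps_fact_nz: "eps_fact g \<noteq> 0"
proof -
  have "root_eps g ^ k \<noteq> inverse (root_eps g) ^ k" if "k \<in> {1..g - 1}" for k
    using root_eps_diff[OF g, of "int k"] that g by (auto simp: power_int_minus power_inverse dest!: dvd_imp_le)
  moreover from this[of 1] have "root_eps g \<noteq> inverse (root_eps g)" if "g \<noteq> 1" using that g by auto
  ultimately show ?thesis unfolding eps_fact_def Let_def by (cases "g = 1") auto
qed

text \<open>The two windows of \<open>(X\<^sup>+)\<^sup>g\<close>: the scalar of \<open>\<^sup>LX\<^sup>+\<close> turns its coefficients into those of \<open>X\<^sup>+\<close> on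
  Verma modules over \<open>U\<^sub>g\<^sub>h\<^sub>'(sl\<^sub>2)\<close>. The signs of the windows multiply to \<open>(-1)\<^sup>n\<^sup>+\<^sup>g\<close>.\<close>

lemma LX_coeff_numE:
  "LX_coeff g n * fps_to_fls (\<Prod>i<g. numE g (int (j + i) + 1) * numE g (n - int (j + i))) =
    fps_to_fls (qnum (of_nat g) (of_int (int j div int g + 1)) * qnum (of_nat g) (of_int ((n - int j) div int g)))"
proof -
  let ?P = "\<Prod>i<g. numE g (int (j + i) + 1) * numE g (n - int (j + i))"
  let ?S = "qnum (of_nat g) (of_int (int j div int g + 1)) * qnum (of_nat g) (of_int ((n - int j) div int g)) :: complex fps"
  have P: "?P = (\<Prod>i<g. numE g (int j + 1 + int i)) * (\<Prod>i<g. numE g (n - int j - int g + 1 + int i))"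
  proof -
    have "(\<Prod>i<g. numE g (n - int (j + i))) = (\<Prod>i<g. numE g (n - int (j + (g - Suc i))))"
      by (rule prod.nat_diff_reindex[symmetric])
    also have "\<dots> = (\<Prod>i<g. numE g (n - int j - int g + 1 + int i))"
      by (intro prod.cong refl arg_cong[where f="numE g"]) (auto simp: of_nat_diff)
    finally show ?thesis unfolding prod.distrib by (simp add: add_ac)
  qed
  have d: "(n - int j - int g) div int g + 1 = (n - int j) div int g"
    using g div_add_self2[of "int g" "n - int j - int g"] by simp
  have s: "(- 1) powi (int j + 1) * (- 1) powi (n - int j - int g + 1) = ((- 1) powi (n + int g) :: complex)"
  proof -
    have "(- 1) powi (int j + 1) * (- 1) powi (n - int j - int g + 1) = (- 1 :: complex) powi (n + int g + 2 * (1 - int g))"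
      by (simp add: algebra_simps flip: power_int_add)
    then show ?thesis unfolding power_int_add[of "-1 :: complex" "n + int g", simplified] by (simp add: power_int_mult)
  qed
  have e: "?P * TE\<^sup>2 = fps_const ((- 1) powi (n + int g) * (eps_fact g)\<^sup>2) * ?S * TG\<^sup>2"
  proof -
    have "?P * TE\<^sup>2 = ((\<Prod>i<g. numE g (int j + 1 + int i)) * TE) * ((\<Prod>i<g. numE g (n - int j - int g + 1 + int i)) * TE)"
      unfolding P power2_eq_square by (simp only: mult_ac)
    then show ?thesis unfolding numE_window d s[symmetric] power2_eq_square
      by (simp add: mult_ac flip: fps_const_mult)
  qed
  have nz: "fls_const (eps_fact g) \<noteq> 0" "fps_to_fls TG \<noteq> 0"
    using eps_fact_nz fexp_diff_nonzero[of "of_nat g", where 'a=complex] g by auto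
  define s where "s = fls_const ((- 1 :: complex) powi (n + int g))"
  have ss: "s * s = 1" unfolding s_def by (simp flip: power_mult_distrib power_int_mult_distrib)
  have "fps_to_fls ?P * (fps_to_fls TE)\<^sup>2 = s * (fls_const (eps_fact g))\<^sup>2 * fps_to_fls ?S * (fps_to_fls TG)\<^sup>2"
    using arg_cong[OF e, of fps_to_fls]
    by (simp only: fls_times_fps_to_fls fps_to_fls_power s_def fps_const_to_fls fls_const_mult_const[symmetric] power2_eq_square)
  then have "LX_coeff g n * fps_to_fls ?P = s * inverse ((fls_const (eps_fact g))\<^sup>2) * inverse ((fps_to_fls TG)\<^sup>2) *
      (s * (fls_const (eps_fact g))\<^sup>2 * fps_to_fls ?S * (fps_to_fls TG)\<^sup>2)"
    unfolding LX_coeff_def Let_def s_def[symmetric] power_inverse by (simp only: mult_ac)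
  also have "\<dots> = s * s * fps_to_fls ?S" using nz by (simp add: field_simps)
  finally show ?thesis unfolding ss by simp
qed

end


section \<open>The Langlands dual\<close>

lemma fls_clear_denominator: "\<exists>k p. fls_X ^ k * a = fps_to_fls (p :: complex fps)"
proof (cases "a = 0")
  case True
  then show ?thesis by (intro exI[of _ 0]) simp
next
  case False
  define k where "k = nat (- fls_subdegree a)"
  have "fls_subdegree (fls_X ^ k * a) \<ge> 0"
    using False by (simp add: fls_subdegree_pow k_def)
  then have "fls_X ^ k * a = fps_to_fls (fls_regpart (fls_X ^ k * a))" by simp
  then show ?thesis by blast
qed

context specialization
begin

text \<open>Multiplication by \<open>h'\<close> is injective on coordinates, so equality in the localization is equality of
  Laurent series.\<close>

lemma loc_eq_iff:
  assumes x: "x \<in> carrier M" and y: "y \<in> carrier M"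
  shows "loc_eq (Ueps_scal g) M a x y \<longleftrightarrow>
    (\<forall>j. a * fps_to_fls (comp1 j (phiE x)) = fps_to_fls (comp1 j (phiE y)))"
proof
  assume "loc_eq (Ueps_scal g) M a x y"
  then obtain k N p where p: "fls_X ^ k * a = fps_to_fls p"
      and e: "Ueps_scal g (fps_X ^ N) \<odot>\<^bsub>M\<^esub> (Ueps_scal g p \<odot>\<^bsub>M\<^esub> x) = Ueps_scal g (fps_X ^ (N + k)) \<odot>\<^bsub>M\<^esub> y"
    unfolding loc_eq_def by blast
  show "\<forall>j. a * fps_to_fls (comp1 j (phiE x)) = fps_to_fls (comp1 j (phiE y))"
  proof
    fix j
    have "fps_X ^ N * (p * comp1 j (phiE x)) = fps_X ^ (N + k) * comp1 j (phiE y)"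
      using arg_cong[OF e, of "\<lambda>z. comp1 j (phiE z)"]
      unfolding phiE_scal[OF Eclo(2)[OF Ueps_scal_carrier x]] phiE_scal[OF x] phiE_scal[OF y] .
    then have "p * comp1 j (phiE x) = fps_X ^ k * comp1 j (phiE y)" by (simp add: power_add mult.assoc)
    then have "fps_to_fls p * fps_to_fls (comp1 j (phiE x)) = fls_X ^ k * fps_to_fls (comp1 j (phiE y))"
      by (metis fls_times_fps_to_fls fps_to_fls_power fps_X_to_fls)
    then show "a * fps_to_fls (comp1 j (phiE x)) = fps_to_fls (comp1 j (phiE y))"
      unfolding p[symmetric] by (simp add: mult.assoc)
  qed
next
  assume e: "\<forall>j. a * fps_to_fls (comp1 j (phiE x)) = fps_to_fls (comp1 j (phiE y))"
  obtain k p where p: "fls_X ^ k * a = fps_to_fls p" using fls_clear_denominator by blast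
  have "p * comp1 j (phiE x) = fps_X ^ k * comp1 j (phiE y)" for j
  proof -
    have "fps_to_fls (p * comp1 j (phiE x)) = fps_to_fls (fps_X ^ k * comp1 j (phiE y))"
      unfolding fls_times_fps_to_fls p[symmetric] mult.assoc e[rule_format] by (simp add: fps_to_fls_power)
    then show ?thesis by (simp only: fps_to_fls_eq_iff)
  qed
  then have "Ueps_scal g (fps_X ^ 0) \<odot>\<^bsub>M\<^esub> (Ueps_scal g p \<odot>\<^bsub>M\<^esub> x) = Ueps_scal g (fps_X ^ (0 + k)) \<odot>\<^bsub>M\<^esub> y"
    by (intro phiE_inj comp1_eqI Eclo(2) Ueps_scal_carrier x y)
      (simp only: phiE_scal x y Eclo(2)[OF Ueps_scal_carrier] power_0 mult_1 add_0)
  then show "loc_eq (Ueps_scal g) M a x y" unfolding loc_eq_def using p by blast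
qed

text \<open>The coordinates with index \<open>\<equiv> r\<close> modulo \<open>g\<close>, renumbered. Both \<open>(X\<^sup>\<plusminus>)\<^sup>g\<close> and \<open>H\<close> preserve these parts, and each
  part will carry one Verma module of \<open>U\<^sub>g\<^sub>h\<^sub>'(sl\<^sub>2)\<close>.\<close>

definition part :: "nat \<Rightarrow> basis_space fps \<Rightarrow> basis_space fps"
  where "part r v = assemble1 (\<lambda>q. comp1 (g * q + r) v)"

definition glue :: "(nat \<Rightarrow> basis_space fps) \<Rightarrow> basis_space fps"
  where "glue w = assemble1 (\<lambda>j. comp1 (j div g) (w (j mod g)))"

lemma comp1_part: "comp1 q (part r v) = comp1 (g * q + r) v"
  unfolding part_def
proof (rule comp1_assemble1)
  fix k
  have "finite ((\<lambda>q. g * q + r) -` {j. fps_nth (comp1 j v) k \<noteq> 0})"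
    by (rule finite_vimageI[OF finite_comp1]) (use g in \<open>auto simp: inj_on_def\<close>)
  then show "finite {q. fps_nth (comp1 (g * q + r) v) k \<noteq> 0}" by (simp add: vimage_def)
qed

lemma comp1_glue: "comp1 j (glue w) = comp1 (j div g) (w (j mod g))"
  unfolding glue_def
proof (rule comp1_assemble1)
  fix k
  have "{j. fps_nth (comp1 (j div g) (w (j mod g))) k \<noteq> 0} \<subseteq>
      (\<Union>r<g. (\<lambda>q. g * q + r) ` {q. fps_nth (comp1 q (w r)) k \<noteq> 0})"
  proof
    fix j assume "j \<in> {j. fps_nth (comp1 (j div g) (w (j mod g))) k \<noteq> 0}"
    then have "j \<in> (\<lambda>q. g * q + j mod g) ` {q. fps_nth (comp1 q (w (j mod g))) k \<noteq> 0}"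
      by (intro image_eqI[of _ _ "j div g"]) auto
    moreover have "j mod g < g" using g by simp
    ultimately show "j \<in> (\<Union>r<g. (\<lambda>q. g * q + r) ` {q. fps_nth (comp1 q (w r)) k \<noteq> 0})" by blast
  qed
  then show "finite {j. fps_nth (comp1 (j div g) (w (j mod g))) k \<noteq> 0}"
    by (rule finite_subset) (auto intro: finite_comp1)
qed

lemma part_glue: "r < g \<Longrightarrow> part r (glue w) = w r"
  by (rule comp1_eqI) (simp add: comp1_part comp1_glue)

lemma glue_part: "(\<And>r. r < g \<Longrightarrow> w r = part r v) \<Longrightarrow> glue w = v"
  using g by (intro comp1_eqI) (simp add: comp1_part comp1_glue)

lemma part_simps: "part r (v + w) = part r v + part r w" "part r 0 = 0"
  by (rule comp1_eqI; simp add: comp1_part comp1_simps)+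

text \<open>The highest weight of the part \<open>r\<close>. Its first vector \<open>m\<^sub>r\<close> has weight \<open>n - 2r\<close>, so \<open>\<^sup>LH\<close> has the value
  \<open>n/g\<close> for \<open>r = 0\<close> and \<open>n/g - 1\<close> for \<open>r = g/2\<close>, the only residues of weights divisible by \<open>g\<close>.\<close>

definition top :: "nat \<Rightarrow> int"
  where "top r = n div int g - (if r = 0 then 0 else 1)"

definition repL :: "sl2_gen free fps \<Rightarrow> basis_space fps \<Rightarrow> basis_space fps"
  where "repL f v = glue (\<lambda>r. rep1 (of_nat g) (top r) f (part r v))"

lemma comp1_repL: "comp1 j (repL f v) = comp1 (j div g) (rep1 (of_nat g) (top (j mod g)) f (part (j mod g) v))"
  by (simp add: repL_def comp1_glue)

lemma repL_glue: "repL f (glue w) = glue (\<lambda>r. rep1 (of_nat g) (top r) f (w r))"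
  using g by (intro comp1_eqI) (simp add: comp1_repL comp1_glue part_glue)

lemma is_rep_repL: "is_rep repL"
  unfolding is_rep_def
proof (intro conjI allI)
  note R = is_repD[OF is_rep_rep1]
  show "repL (e + f) v = repL e v + repL f v" "repL e (v + w) = repL e v + repL e w" for e f v w
    by (rule comp1_eqI, simp add: comp1_repL comp1_simps R part_simps)+
  show "repL (e * f) v = repL e (repL f v)" for e f v
    unfolding repL_def[of f] repL_glue by (simp add: repL_def R)
  show "repL 1 v = v" for v by (simp add: repL_def R glue_part)
qed

lemma repL_kill: "f \<in> Uq_ideal g \<Longrightarrow> repL f v = 0"
  by (rule comp1_eqI) (simp add: comp1_repL rep1_kill[OF g] comp1_simps)

lemma cact_repL: "cact repL (Uq_cls g f) v = repL f v"
  unfolding Uq_cls_def by (rule cact_coset[OF ideal_Uq is_rep_repL repL_kill])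

lemma repL_gen:
  "comp1 j (repL (gen1 Xm) v) = (if j < g then 0 else comp1 (j - g) v)"
  "comp1 j (repL (gen1 Hg) v) = of_int (top (j mod g) - 2 * int (j div g)) * comp1 j v"
  "comp1 j (repL (gen1 Xp) v) = qnum (of_nat g) (of_int (int (j div g) + 1)) *
    qnum (of_nat g) (of_int (top (j mod g) - int (j div g))) * comp1 (j + g) v"
  "comp1 j (repL (map_fps cst a) v) = a * comp1 j v"
proof -
  have "g * (j div g - 1) + j mod g = j - g" if "\<not> j < g"
  proof -
    have "g * (j div g - 1) + g = g * (j div g)" using that g by (cases "j div g") (auto simp: div_eq_0_iff)
    then show ?thesis using mult_div_mod_eq[of g j] by linarith
  qed
  moreover have "j div g = 0 \<longleftrightarrow> j < g" using g by (auto simp: div_eq_0_iff)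
  ultimately show "comp1 j (repL (gen1 Xm) v) = (if j < g then 0 else comp1 (j - g) v)"
    unfolding comp1_repL rep1_gen comp1_part by simp
  have s: "g * Suc (j div g) + j mod g = j + g" by simp
  show "comp1 j (repL (gen1 Hg) v) = of_int (top (j mod g) - 2 * int (j div g)) * comp1 j v"
    "comp1 j (repL (map_fps cst a) v) = a * comp1 j v"
    unfolding comp1_repL rep1_gen comp1_part mult_div_mod_eq by (rule refl)+
  show "comp1 j (repL (gen1 Xp) v) = qnum (of_nat g) (of_int (int (j div g) + 1)) *
    qnum (of_nat g) (of_int (top (j mod g) - int (j div g))) * comp1 (j + g) v"
    unfolding comp1_repL rep1_gen comp1_part s ..
qed

text \<open>The coordinates of the sum of the weight spaces in question: \<open>n\<close> is divisible by \<open>g\<close>, so \<open>n - 2j\<close> is if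
  and only if \<open>2j\<close> is.\<close>

definition W :: "basis_space fps set"
  where "W = {v. \<forall>j. \<not> g dvd 2 * j \<longrightarrow> comp1 j v = 0}"

lemma W_part: "v \<in> W \<longleftrightarrow> (\<forall>r<g. \<not> g dvd 2 * r \<longrightarrow> part r v = 0)"
proof
  have d: "g dvd 2 * (g * q + r) \<longleftrightarrow> g dvd 2 * r" for q r
    by (simp add: distrib_left dvd_add_right_iff)
  assume v: "v \<in> W"
  show "\<forall>r<g. \<not> g dvd 2 * r \<longrightarrow> part r v = 0"
  proof (intro allI impI)
    fix r assume "\<not> g dvd 2 * r"
    then have "comp1 (g * q + r) v = 0" for q using v d[of q r] unfolding W_def by blast
    then show "part r v = 0" by (intro comp1_eqI) (simp add: comp1_part comp1_simps)
  qed
next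
  have d: "g dvd 2 * (g * q + r) \<longleftrightarrow> g dvd 2 * r" for q r
    by (simp add: distrib_left dvd_add_right_iff)
  assume a: "\<forall>r<g. \<not> g dvd 2 * r \<longrightarrow> part r v = 0"
  show "v \<in> W" unfolding W_def
  proof (intro CollectI allI impI)
    fix j assume "\<not> g dvd 2 * j"
    then have "part (j mod g) v = 0" using a d[of "j div g" "j mod g"] g by simp
    then show "comp1 j v = 0" using comp1_part[of "j div g" "j mod g" v] by (simp add: comp1_simps)
  qed
qed

lemma repL_W: "v \<in> W \<Longrightarrow> repL f v \<in> W"
  unfolding W_part repL_def by (simp add: part_glue is_repD[OF is_rep_rep1])

lemma W_add: "v \<in> W \<Longrightarrow> w \<in> W \<Longrightarrow> v + w \<in> W" and W_neg: "v \<in> W \<Longrightarrow> - v \<in> W" and W_0: "0 \<in> W"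
  by (simp_all add: W_def comp1_simps)

end

locale langlands = specialization +
  assumes dvd: "int g dvd n"
begin

lemma top_eq: "top (j mod g) - int (j div g) = (n - int j) div int g"
proof -
  obtain m where m: "n = int g * m" using dvd by blast
  have nd: "n div int g = m" unfolding m using g by simp
  have "(n - int j) div int g = m + (- int j) div int g"
    unfolding m using g div_mult_self1[of "int g" "- int j" m] by (simp add: algebra_simps)
  also have "(- int j) div int g = - int (j div g) - (if j mod g = 0 then 0 else 1)"
    using g zdiv_zminus1_eq_if[of "int g" "int j"] by (auto simp: zdiv_int zmod_int[symmetric])
  finally show ?thesis using nd by (simp add: top_def)
qed

lemma top_weight:
  assumes j: "g dvd 2 * j"
  shows "int g * (top (j mod g) - 2 * int (j div g)) = n - 2 * int j"
proof -
  obtain m where m: "n = int g * m" using dvd by blast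
  have nd: "n div int g = m" unfolding m using g by simp
  have "g dvd 2 * (j mod g)" using j by (metis dvd_mod_iff mod_mult_right_eq dvd_refl)
  then obtain c where c: "2 * (j mod g) = g * c" by blast
  have "g * c < g * 2" unfolding c[symmetric] using g by simp
  then have "c < 2" by simp
  then have r: "2 * (j mod g) = (if j mod g = 0 then 0 else g)"
    using c g by (cases "c = 0") (auto simp: less_2_cases_iff)
  have "int j = int g * int (j div g) + int (j mod g)" by (metis mult_div_mod_eq of_nat_add of_nat_mult)
  moreover have "2 * int (j mod g) = (if j mod g = 0 then 0 else int g)" using r by (auto split: if_splits)
  ultimately show ?thesis unfolding top_def nd using m by (auto simp: algebra_simps split: if_splits)
qed

abbreviation "WS \<equiv> weight_sum (Ueps g) tE hE M {m. int g dvd m}"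

lemma WS_iff: "x \<in> WS \<longleftrightarrow> x \<in> carrier M \<and> phiE x \<in> W"
proof -
  have "int g dvd n - 2 * int j \<longleftrightarrow> g dvd 2 * j" for j
  proof -
    have "int g dvd n - 2 * int j \<longleftrightarrow> int g dvd int (2 * j)" using dvd by (simp add: dvd_diff_right_iff)
    then show ?thesis unfolding int_dvd_int_iff .
  qed
  then show ?thesis by (simp add: weight_sum_iff W_def)
qed

lemma bij_WS: "bij_betw phiE WS W"
  unfolding bij_betw_def
proof
  show "inj_on phiE WS" using phiE_inj by (auto simp: inj_on_def WS_iff)
  show "phiE ` WS = W"
  proof
    show "W \<subseteq> phiE ` WS" using psi by (auto simp: WS_iff intro!: image_eqI[of _ _ "psi _"])
  qed (auto simp: WS_iff)
qed

abbreviation "LXp x \<equiv> (xpE [^]\<^bsub>Ueps g\<^esub> g) \<odot>\<^bsub>M\<^esub> x"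
abbreviation "LXm x \<equiv> (xmE [^]\<^bsub>Ueps g\<^esub> g) \<odot>\<^bsub>M\<^esub> x"
abbreviation "LH x \<equiv> Ueps_scal g (cst (1 / of_nat g)) \<odot>\<^bsub>M\<^esub> (hE \<odot>\<^bsub>M\<^esub> x)"

lemma L_gens:
  assumes x: "x \<in> WS"
  shows "phiE (LXm x) = repL (gen1 Xm) (phiE x)" "phiE (LH x) = repL (gen1 Hg) (phiE x)"
    "phiE (Ueps_scal g a \<odot>\<^bsub>M\<^esub> x) = repL (map_fps cst a) (phiE x)"
    "y \<in> carrier M \<Longrightarrow> loc_eq (Ueps_scal g) M (LX_coeff g n) (LXp x) y \<longleftrightarrow> phiE y = repL (gen1 Xp) (phiE x)"
proof -
  have c: "x \<in> carrier M" "phiE x \<in> W" using x by (auto simp: WS_iff)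
  show "phiE (LXm x) = repL (gen1 Xm) (phiE x)"
    by (rule comp1_eqI) (simp only: phiE_xm_pow[OF c(1)] repL_gen)
  show "phiE (Ueps_scal g a \<odot>\<^bsub>M\<^esub> x) = repL (map_fps cst a) (phiE x)"
    by (rule comp1_eqI) (simp only: phiE_scal[OF c(1)] repL_gen)
  show "phiE (LH x) = repL (gen1 Hg) (phiE x)"
  proof (rule comp1_eqI)
    fix j
    show "comp1 j (phiE (LH x)) = comp1 j (repL (gen1 Hg) (phiE x))"
    proof (cases "g dvd 2 * j")
      case True
      have "cst (1 / of_nat g) * of_int (n - 2 * int j) = (of_int (top (j mod g) - 2 * int (j div g)) :: complex fps)"
      proof -
        have "(of_int (n - 2 * int j) :: complex) = of_nat g * of_int (top (j mod g) - 2 * int (j div g))"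
          unfolding top_weight[OF True, symmetric] of_int_mult of_int_of_nat_eq ..
        then show ?thesis unfolding fps_of_int[symmetric] cst_fps_def fps_const_mult using g by simp
      qed
      then show ?thesis
        unfolding phiE_scal[OF Eclo(2)[OF gens_Ueps c(1)]] phiE_gens(2)[OF c(1)] repL_gen mult.assoc[symmetric] by simp
    next
      case False
      then have "comp1 j (phiE x) = 0" using c(2) by (simp add: W_def)
      then show ?thesis
        unfolding phiE_scal[OF Eclo(2)[OF gens_Ueps c(1)]] phiE_gens(2)[OF c(1)] repL_gen by simp
    qed
  qed
  assume y: "y \<in> carrier M"
  have "LX_coeff g n * fps_to_fls (comp1 j (phiE (LXp x))) = fps_to_fls (comp1 j (repL (gen1 Xp) (phiE x)))" for j
    unfolding phiE_xp_pow[OF c(1)] repL_gen top_eq fls_times_fps_to_fls[of _ "comp1 _ _"] mult.assoc[symmetric]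
    unfolding LX_coeff_numE[OF g, of n j] zdiv_int ..
  then show "loc_eq (Ueps_scal g) M (LX_coeff g n) (LXp x) y \<longleftrightarrow> phiE y = repL (gen1 Xp) (phiE x)"
    unfolding loc_eq_iff[OF Eclo(2)[OF phiE_pow(1)[OF gens_Ueps c(1)] c(1)] y] fps_to_fls_eq_iff
    by (auto intro: comp1_eqI)
qed

end

lemma left_module_direct_sum:
  assumes M: "left_module R M" and N: "left_module R N"
  shows "left_module R (direct_sum_module M N)"
proof -
  interpret M: left_module R M by (rule M)
  interpret N: left_module R N by (rule N)
  have "abelian_group (direct_sum_module M N)"
  proof (rule abelian_groupI)
    fix x assume "x \<in> carrier (direct_sum_module M N)"
    then show "\<exists>y\<in>carrier (direct_sum_module M N). y \<oplus>\<^bsub>direct_sum_module M N\<^esub> x = \<zero>\<^bsub>direct_sum_module M N\<^esub>"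
      by (intro bexI[of _ "(\<ominus>\<^bsub>M\<^esub> fst x, \<ominus>\<^bsub>N\<^esub> snd x)"])
        (auto simp: direct_sum_module_def M.l_neg N.l_neg)
  qed (auto simp: direct_sum_module_def M.a_assoc N.a_assoc M.a_comm N.a_comm M.a_lcomm N.a_lcomm)
  then show ?thesis
    by (intro left_module.intro left_module_axioms.intro M.R.ring_axioms)
      (auto simp: direct_sum_module_def M.smult_closed N.smult_closed M.smult_l_distr N.smult_l_distr
        M.smult_r_distr N.smult_r_distr M.smult_assoc N.smult_assoc M.smult_one N.smult_one)
qed

lemma Uq_ops:
  "Uq_cls d (e + f) = Uq_cls d e \<oplus>\<^bsub>Uq d\<^esub> Uq_cls d f" "Uq_cls d (e * f) = Uq_cls d e \<otimes>\<^bsub>Uq d\<^esub> Uq_cls d f"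
  "Uq_cls d e \<in> carrier (Uq d)"
  unfolding Uq_def Uq_cls_def by (simp_all add: quot_type_ring[OF ideal_Uq])

context langlands
begin

lemmas laws_L = cact_laws[OF ideal_Uq is_rep_repL repL_kill, folded Uq_def]

subsection \<open>Existence\<close>

definition dualL :: "(sl2_gen free fps set, int_gen free fps fps set set set) module"
  where "dualL = \<lparr>carrier = WS, mult = mult M, one = one M, zero = zero M, add = add M,
    smult = (\<lambda>u x. psi (cact repL u (phiE x)))\<rparr>"

lemma cact_W: "u \<in> carrier (Uq g) \<Longrightarrow> v \<in> W \<Longrightarrow> cact repL u v \<in> W"
  unfolding Uq_carrier by (auto simp: cact_repL repL_W)

lemma dualL_models: "models (Uq g) dualL phiE W (cact repL)"
proof (rule models_intro)
  show "ring (Uq g)" unfolding Uq_def by (rule quot_type_ring(1)[OF ideal_Uq])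
  show b: "bij_betw phiE (carrier dualL) W" using bij_WS by (simp add: dualL_def)
  show add: "phiE (x \<oplus>\<^bsub>dualL\<^esub> y) = phiE x + phiE y" if "x \<in> carrier dualL" "y \<in> carrier dualL" for x y
    using that by (simp add: dualL_def WS_iff EM(6))
  show "abelian_group dualL"
  proof (rule abelian_group_model[OF b W_neg _ _ _ add])
    show "x \<oplus>\<^bsub>dualL\<^esub> y \<in> carrier dualL" if "x \<in> carrier dualL" "y \<in> carrier dualL" for x y
      using that by (simp add: dualL_def WS_iff EM(6) Eclo(1) W_add)
  qed (simp_all add: dualL_def WS_iff Eclo(3) phiE_zero W_0)
  show "a \<odot>\<^bsub>dualL\<^esub> x \<in> carrier dualL" "phiE (a \<odot>\<^bsub>dualL\<^esub> x) = cact repL a (phiE x)"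
    if "a \<in> carrier (Uq g)" "x \<in> carrier dualL" for a x
    using that by (simp_all add: dualL_def WS_iff psi cact_W)
qed (simp_all add: laws_L)

text \<open>The indices \<open>j\<close> with \<open>g dvd 2 * j\<close> are the multiples of \<open>g' = g/2\<close> or \<open>g' = g\<close>.\<close>

lemma W_reindex:
  obtains \<rho> where "bij_betw \<rho> W UNIV" "\<And>v w. \<rho> (v + w) = \<rho> v + \<rho> w"
    "\<And>c v. \<rho> (repL (map_fps cst c) v) = fps_scale scale_sum c (\<rho> v)"
proof
  define p where "p = (if even g then g div 2 else g)"
  have p: "p > 0" and d: "g dvd 2 * j \<longleftrightarrow> p dvd j" for j
  proof -
    show "p > 0" using g by (auto simp: p_def elim: evenE)
    show "g dvd 2 * j \<longleftrightarrow> p dvd j"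
    proof (cases "even g")
      case True
      then have "2 * p = g" by (simp add: p_def)
      then have "g dvd 2 * j \<longleftrightarrow> 2 * p dvd 2 * j" by simp
      then show ?thesis by simp
    next
      case False
      then have "coprime g 2" by simp
      then show ?thesis using False by (simp add: p_def coprime_dvd_mult_right_iff)
    qed
  qed
  define \<rho> where "\<rho> v = assemble1 (\<lambda>k. comp1 (p * k) v)" for v
  have \<rho>: "comp1 k (\<rho> v) = comp1 (p * k) v" for k v
    unfolding \<rho>_def
  proof (rule comp1_assemble1)
    fix i
    have "finite ((\<lambda>k. p * k) -` {j. fps_nth (comp1 j v) i \<noteq> 0})"
      by (rule finite_vimageI[OF finite_comp1]) (use p in \<open>auto simp: inj_on_def\<close>)
    then show "finite {k. fps_nth (comp1 (p * k) v) i \<noteq> 0}" by (simp add: vimage_def)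
  qed
  show "\<rho> (v + w) = \<rho> v + \<rho> w" for v w by (rule comp1_eqI) (simp add: \<rho> comp1_simps)
  show "\<rho> (repL (map_fps cst c) v) = fps_scale scale_sum c (\<rho> v)" for c v
    by (rule comp1_eqI) (simp add: \<rho> repL_gen comp1_scale)
  show "bij_betw \<rho> W UNIV"
  proof (rule bij_betwI')
    fix v w assume vw: "v \<in> W" "w \<in> W"
    have "v = w" if e: "\<rho> v = \<rho> w"
    proof (rule comp1_eqI)
      fix j
      show "comp1 j v = comp1 j w"
      proof (cases "p dvd j")
        case True
        then obtain k where "j = p * k" by blast
        then show ?thesis using arg_cong[OF e, of "comp1 k"] by (simp add: \<rho>)
      qed (use vw in \<open>auto simp: W_def d\<close>)
    qed
    then show "\<rho> v = \<rho> w \<longleftrightarrow> v = w" by blast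
  next
    fix w :: "basis_space fps"
    define v where "v = assemble1 (\<lambda>j. if p dvd j then comp1 (j div p) w else 0)"
    have v: "comp1 j v = (if p dvd j then comp1 (j div p) w else 0)" for j
      unfolding v_def
    proof (rule comp1_assemble1)
      fix i
      have "{j. fps_nth (if p dvd j then comp1 (j div p) w else 0) i \<noteq> 0} \<subseteq>
          (\<lambda>k. p * k) ` {k. fps_nth (comp1 k w) i \<noteq> 0}" using p by (auto elim!: dvdE)
      then show "finite {j. fps_nth (if p dvd j then comp1 (j div p) w else 0) i \<noteq> 0}"
        by (rule finite_subset) (intro finite_imageI finite_comp1)
    qed
    have "v \<in> W" by (simp add: W_def v d)
    moreover have "w = \<rho> v" by (rule comp1_eqI) (use p in \<open>simp add: \<rho> v\<close>)
    ultimately show "\<exists>v\<in>W. w = \<rho> v" by blast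
  qed simp
qed

lemma dualL_rep_on: "rep_on (Uq g) (Uq_scal g) (fps_scale scale_sum) dualL"
proof -
  note D = modelsD[OF dualL_models]
  obtain \<rho> where \<rho>: "bij_betw \<rho> W UNIV" "\<And>v w. \<rho> (v + w) = \<rho> v + \<rho> w"
    "\<And>c v. \<rho> (repL (map_fps cst c) v) = fps_scale scale_sum c (\<rho> v)" using W_reindex by blast
  have "bij_betw (\<lambda>x. \<rho> (phiE x)) (carrier dualL) UNIV"
    using bij_betw_trans[OF D(2) \<rho>(1)] by (simp add: comp_def)
  moreover have "\<rho> (phiE (Uq_scal g c \<odot>\<^bsub>dualL\<^esub> x)) = fps_scale scale_sum c (\<rho> (phiE x))"
    if "x \<in> carrier dualL" for c x
    unfolding Uq_scal_def D(7)[OF Uq_ops(3) that] cact_repL by (rule \<rho>(3))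
  ultimately show ?thesis
    unfolding rep_on_def using D(1) by (intro conjI exI[of _ "\<lambda>x. \<rho> (phiE x)"]) (auto simp: D(6) \<rho>(2))
qed

lemma dualL_langlands: "langlands_dual g n dualL"
proof -
  note D = modelsD[OF dualL_models]
  have c: "Uq_cls g f \<odot>\<^bsub>dualL\<^esub> x \<in> carrier M" "phiE (Uq_cls g f \<odot>\<^bsub>dualL\<^esub> x) = repL f (phiE x)" if "x \<in> WS" for f x
    using D(7)[OF Uq_ops(3), of x f] left_module_closed(2)[OF D(1) Uq_ops(3), of x f] that
    by (simp_all add: dualL_def cact_repL WS_iff)
  have m: "Ueps_scal g a \<odot>\<^bsub>M\<^esub> x \<in> carrier M" "LXm x \<in> carrier M" "LH x \<in> carrier M" if "x \<in> carrier M" for a x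
    using that by (auto intro!: Eclo(2) Ueps_scal_carrier gens_Ueps phiE_pow(1))
  have "Uq_scal g a \<odot>\<^bsub>dualL\<^esub> x = Ueps_scal g a \<odot>\<^bsub>M\<^esub> x" "Uq_cls g (gen1 Xm) \<odot>\<^bsub>dualL\<^esub> x = LXm x"
    "Uq_cls g (gen1 Hg) \<odot>\<^bsub>dualL\<^esub> x = LH x"
    "loc_eq (Ueps_scal g) M (LX_coeff g n) (LXp x) (Uq_cls g (gen1 Xp) \<odot>\<^bsub>dualL\<^esub> x)" if x: "x \<in> WS" for a x
  proof -
    have xM: "x \<in> carrier M" using x by (simp add: WS_iff)
    show "Uq_scal g a \<odot>\<^bsub>dualL\<^esub> x = Ueps_scal g a \<odot>\<^bsub>M\<^esub> x"
      unfolding Uq_scal_def by (rule phiE_inj[OF c(1)[OF x] m(1)[OF xM]]) (simp only: c(2)[OF x] L_gens(3)[OF x])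
    show "Uq_cls g (gen1 Xm) \<odot>\<^bsub>dualL\<^esub> x = LXm x"
      by (rule phiE_inj[OF c(1)[OF x] m(2)[OF xM]]) (simp only: c(2)[OF x] L_gens(1)[OF x])
    show "Uq_cls g (gen1 Hg) \<odot>\<^bsub>dualL\<^esub> x = LH x"
      by (rule phiE_inj[OF c(1)[OF x] m(3)[OF xM]]) (simp only: c(2)[OF x] L_gens(2)[OF x])
    show "loc_eq (Ueps_scal g) M (LX_coeff g n) (LXp x) (Uq_cls g (gen1 Xp) \<odot>\<^bsub>dualL\<^esub> x)"
      unfolding L_gens(4)[OF x c(1)[OF x]] by (rule c(2)[OF x])
  qed
  moreover have "carrier dualL = WS" "\<zero>\<^bsub>dualL\<^esub> = \<zero>\<^bsub>M\<^esub>" "x \<oplus>\<^bsub>dualL\<^esub> y = x \<oplus>\<^bsub>M\<^esub> y" for x y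
    by (simp_all add: dualL_def)
  ultimately show ?thesis
    unfolding langlands_dual_def Let_def using dualL_rep_on by (intro conjI ballI allI) (simp_all only:)
qed

subsection \<open>Uniqueness\<close>

text \<open>The conditions on the generators determine the action. Two actions that agree on generators and
  scalars agree on polynomials in the generators. For a series \<open>f\<close>, split off its constant coefficient:
  the rest is \<open>h'\<close> times a series, so the coefficient of degree \<open>k\<close> of \<open>f x\<close> only involves
  coefficients of degree less than \<open>k\<close> of such vectors, and induction on \<open>k\<close> applies.\<close>

lemma langlands_models:
  assumes L: "langlands_dual g n L"
  shows "models (Uq g) L phiE W (cact repL)"
proof -
  note L' = L[unfolded langlands_dual_def Let_def]
  have car: "carrier L = WS" and add: "\<And>x y. x \<in> WS \<Longrightarrow> y \<in> WS \<Longrightarrow> x \<oplus>\<^bsub>L\<^esub> y = x \<oplus>\<^bsub>M\<^esub> y"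
    and lm: "left_module (Uq g) L"
    and scal: "\<And>c x. x \<in> WS \<Longrightarrow> Uq_scal g c \<odot>\<^bsub>L\<^esub> x = Ueps_scal g c \<odot>\<^bsub>M\<^esub> x"
    and gens: "\<And>x. x \<in> WS \<Longrightarrow> Uq_cls g (gen1 Xm) \<odot>\<^bsub>L\<^esub> x = LXm x"
      "\<And>x. x \<in> WS \<Longrightarrow> Uq_cls g (gen1 Hg) \<odot>\<^bsub>L\<^esub> x = LH x"
      "\<And>x. x \<in> WS \<Longrightarrow> loc_eq (Ueps_scal g) M (LX_coeff g n) (LXp x) (Uq_cls g (gen1 Xp) \<odot>\<^bsub>L\<^esub> x)"
    using L' unfolding rep_on_def by auto
  interpret left_module "Uq g" L by (rule lm)
  define A where "A f x = phiE (Uq_cls g f \<odot>\<^bsub>L\<^esub> x)" for f x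
  have cl: "Uq_cls g f \<odot>\<^bsub>L\<^esub> x \<in> WS" if "x \<in> WS" for f x
    using smult_closed[OF Uq_ops(3), of x f] that by (simp add: car)
  have A_add: "A (e + f) x = A e x + A f x" if x: "x \<in> WS" for e f x
  proof -
    have "Uq_cls g (e + f) \<odot>\<^bsub>L\<^esub> x = (Uq_cls g e \<odot>\<^bsub>L\<^esub> x) \<oplus>\<^bsub>M\<^esub> (Uq_cls g f \<odot>\<^bsub>L\<^esub> x)"
      unfolding Uq_ops(1) using smult_l_distr[OF Uq_ops(3) Uq_ops(3), of x e f] x add[OF cl[OF x] cl[OF x]] by (simp add: car)
    then show ?thesis unfolding A_def using cl[OF x] by (simp add: EM(6) WS_iff)
  qed
  have A_mult: "A (e * f) x = A e (Uq_cls g f \<odot>\<^bsub>L\<^esub> x)" if x: "x \<in> WS" for e f x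
    unfolding A_def Uq_ops(2) using smult_assoc[OF Uq_ops(3) Uq_ops(3), of x e f] x by (simp add: car)
  have A_scal: "A (map_fps cst c) x = repL (map_fps cst c) (phiE x)" if x: "x \<in> WS" for c x
    unfolding A_def Uq_scal_def[symmetric] scal[OF x] by (rule L_gens(3)[OF x])
  have A_gen: "A (gen1 y) x = repL (gen1 y) (phiE x)" if x: "x \<in> WS" for y x
  proof (cases y)
    case Xp
    have "Uq_cls g (gen1 Xp) \<odot>\<^bsub>L\<^esub> x \<in> carrier M" using cl[OF x] by (simp add: WS_iff)
    then show ?thesis unfolding A_def Xp using L_gens(4)[OF x] gens(3)[OF x] by blast
  qed (simp_all only: A_def gens[OF x] L_gens[OF x])
  note R = is_repD[OF is_rep_repL]
  have A_con: "\<forall>x\<in>WS. A (fps_const p) x = repL (fps_const p) (phiE x)" for p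
  proof (induction p rule: free_left_induct)
    case (cst c)
    have "fps_const (cst c) = (map_fps cst (fps_const c) :: sl2_gen free fps)" by (simp add: fps_eq_iff)
    then show ?case using A_scal by simp
  next
    case (add f g)
    then show ?case by (simp add: A_add R flip: fps_const_add)
  next
    case (gen y f)
    have e: "fps_const (gen y * f) = gen1 y * fps_const f" by (simp add: gen1_def)
    show ?case
    proof
      fix x assume x: "x \<in> WS"
      have "A (fps_const (gen y * f)) x = repL (gen1 y) (A (fps_const f) x)"
        unfolding e A_mult[OF x] A_gen[OF cl[OF x]] unfolding A_def ..
      then show "A (fps_const (gen y * f)) x = repL (fps_const (gen y * f)) (phiE x)"
        using gen x unfolding e R(3) by simp
    qed
  qed
  have "A f x = repL f (phiE x)" if x: "x \<in> WS" for f x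
  proof -
    have f: "f = fps_const (fps_nth f 0) + map_fps cst fps_X * fps_shift 1 f" for f :: "sl2_gen free fps"
    proof -
      have X: "map_fps cst fps_X = (fps_X :: sl2_gen free fps)" by (simp add: fps_eq_iff)
      show ?thesis unfolding X by (rule fps_ext) simp
    qed
    have "\<forall>f. fps_nth (comp1 j (A f x)) k = fps_nth (comp1 j (repL f (phiE x))) k" for j k
    proof (induction k)
      case 0
      show ?case
      proof
        fix f
        show "fps_nth (comp1 j (A f x)) 0 = fps_nth (comp1 j (repL f (phiE x))) 0"
          by (subst (1 2) f[of f]) (simp add: A_add[OF x] A_mult[OF x] A_scal[OF cl[OF x]] R A_con x comp1_simps repL_gen)
      qed
    next
      case (Suc k)
      show ?case
      proof
        fix f
        have "A (map_fps cst fps_X * fps_shift 1 f) x = repL (map_fps cst fps_X) (A (fps_shift 1 f) x)"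
          unfolding A_mult[OF x] A_scal[OF cl[OF x]] unfolding A_def ..
        then show "fps_nth (comp1 j (A f x)) (Suc k) = fps_nth (comp1 j (repL f (phiE x))) (Suc k)"
          by (subst (1 2) f[of f]) (use Suc.IH in \<open>simp add: A_add[OF x] R A_con x comp1_simps repL_gen\<close>)
      qed
    qed
    then show ?thesis by (intro comp1_eqI fps_ext) blast
  qed
  then have "phiE (u \<odot>\<^bsub>L\<^esub> x) = cact repL u (phiE x)" if "u \<in> carrier (Uq g)" "x \<in> carrier L" for u x
    using that unfolding Uq_carrier car by (auto simp: A_def cact_repL)
  moreover have "phiE (x \<oplus>\<^bsub>L\<^esub> y) = phiE x + phiE y" if "x \<in> carrier L" "y \<in> carrier L" for x y
    using that by (simp add: car add EM(6) WS_iff)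
  ultimately show ?thesis unfolding models_def using lm bij_WS by (auto simp: car)
qed

subsection \<open>Decomposition into Verma modules\<close>

lemma W_glue: "glue w \<in> W \<longleftrightarrow> (\<forall>r<g. \<not> g dvd 2 * r \<longrightarrow> w r = 0)"
  by (auto simp: W_part part_glue)

lemma glue_add: "glue v + glue w = glue (\<lambda>r. v r + w r)"
  by (rule comp1_eqI) (simp add: comp1_simps comp1_glue)

text \<open>For odd \<open>g\<close> only the part \<open>r = 0\<close> is present.\<close>

lemma odd_models:
  assumes odd: "odd g"
  shows "models (Uq g) (Mq g (n div int g)) (\<lambda>x. glue (\<lambda>r. if r = 0 then phi1 g (n div int g) x else 0)) W (cact repL)"
proof -
  let ?N = "n div int g"
  note D = modelsD[OF Mq_models[OF g, of ?N]]
  have d: "g dvd 2 * r \<longleftrightarrow> r = 0" if "r < g" for r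
    using odd that coprime_dvd_mult_right_iff[of g 2 r] by (auto dest: dvd_imp_le)
  have "bij_betw (\<lambda>x. glue (\<lambda>r. if r = 0 then phi1 g ?N x else 0)) (carrier (Mq g ?N)) W"
  proof (rule bij_betwI')
    fix x y assume "x \<in> carrier (Mq g ?N)" "y \<in> carrier (Mq g ?N)"
    moreover have "phi1 g ?N x = phi1 g ?N y"
      if "glue (\<lambda>r. if r = 0 then phi1 g ?N x else 0) = glue (\<lambda>r. if r = 0 then phi1 g ?N y else 0)"
      using arg_cong[OF that, of "part 0"] g by (simp add: part_glue)
    ultimately show "glue (\<lambda>r. if r = 0 then phi1 g ?N x else 0) = glue (\<lambda>r. if r = 0 then phi1 g ?N y else 0) \<longleftrightarrow> x = y"
      using D(3) by (auto simp: inj_on_def)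
  next
    fix v assume v: "v \<in> W"
    obtain x where x: "x \<in> carrier (Mq g ?N)" "phi1 g ?N x = part 0 v"
      using models_surj[OF Mq_models[OF g, of ?N] UNIV_I[of "part 0 v"]] by blast
    have "glue (\<lambda>r. if r = 0 then phi1 g ?N x else 0) = v"
      by (rule glue_part) (use v d in \<open>auto simp: W_part x\<close>)
    then show "\<exists>x\<in>carrier (Mq g ?N). v = glue (\<lambda>r. if r = 0 then phi1 g ?N x else 0)" using x(1) by blast
  qed (simp add: W_glue d)
  moreover have "glue (\<lambda>r. if r = 0 then phi1 g ?N (u \<odot>\<^bsub>Mq g ?N\<^esub> x) else 0) =
      cact repL u (glue (\<lambda>r. if r = 0 then phi1 g ?N x else 0))" if "u \<in> carrier (Uq g)" "x \<in> carrier (Mq g ?N)" for u x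
  proof -
    obtain f where f: "u = Uq_cls g f" using \<open>u \<in> carrier (Uq g)\<close> unfolding Uq_carrier by blast
    show ?thesis unfolding D(7)[OF that] unfolding f cact_repL repL_glue cact_rep1[OF g]
      by (rule arg_cong[where f=glue]) (auto simp: top_def is_repD[OF is_rep_rep1])
  qed
  ultimately show ?thesis unfolding models_def using D(1) by (auto simp: D(6) glue_add intro!: arg_cong[where f=glue])
qed

text \<open>For even \<open>g\<close> the parts \<open>r = 0\<close> and \<open>r = g/2\<close> are present, with highest weights \<open>n/g\<close> and \<open>n/g - 1\<close>.\<close>

lemma even_models:
  assumes ev: "even g"
  defines "N \<equiv> n div int g"
  defines "\<phi> \<equiv> \<lambda>(x, y). glue (\<lambda>r. if r = 0 then phi1 g N x else if r = g div 2 then phi1 g (N - 1) y else 0)"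
  shows "models (Uq g) (direct_sum_module (Mq g N) (Mq g (N - 1))) \<phi> W (cact repL)"
proof -
  let ?S = "direct_sum_module (Mq g N) (Mq g (N - 1))"
  note D = modelsD[OF Mq_models[OF g, of N]] and E = modelsD[OF Mq_models[OF g, of "N - 1"]]
  have h: "g div 2 < g" "g div 2 \<noteq> 0" using g ev by (auto elim: evenE)
  have d: "g dvd 2 * r \<longleftrightarrow> r = 0 \<or> r = g div 2" if "r < g" for r
  proof -
    obtain h where h: "g = 2 * h" using ev by blast
    show ?thesis
    proof
      assume "g dvd 2 * r"
      then have "h dvd r" unfolding h by simp
      then obtain c where c: "r = h * c" by blast
      then have "c < 2" using that g unfolding h by simp
      then show "r = 0 \<or> r = g div 2" using c h by (auto simp: less_2_cases_iff)
    qed (auto simp: h)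
  qed
  have parts: "part 0 (\<phi> (x, y)) = phi1 g N x" "part (g div 2) (\<phi> (x, y)) = phi1 g (N - 1) y" for x y
    using g h by (simp_all add: \<phi>_def part_glue)
  have "bij_betw \<phi> (carrier ?S) W"
  proof (rule bij_betwI')
    fix z z' assume "z \<in> carrier ?S" "z' \<in> carrier ?S"
    then obtain x y x' y' where z: "z = (x, y)" "z' = (x', y')" "x \<in> carrier (Mq g N)" "x' \<in> carrier (Mq g N)"
        "y \<in> carrier (Mq g (N - 1))" "y' \<in> carrier (Mq g (N - 1))"
      by (auto simp: direct_sum_module_def)
    have "phi1 g N x = phi1 g N x'" "phi1 g (N - 1) y = phi1 g (N - 1) y'" if "\<phi> z = \<phi> z'"
      using arg_cong[OF that, of "part 0"] arg_cong[OF that, of "part (g div 2)"] by (simp_all add: z parts)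
    then show "\<phi> z = \<phi> z' \<longleftrightarrow> z = z'" using D(3) E(3) z by (auto simp: inj_on_def)
  next
    fix v assume v: "v \<in> W"
    obtain x where x: "x \<in> carrier (Mq g N)" "phi1 g N x = part 0 v"
      using models_surj[OF Mq_models[OF g, of N] UNIV_I[of "part 0 v"]] by blast
    obtain y where y: "y \<in> carrier (Mq g (N - 1))" "phi1 g (N - 1) y = part (g div 2) v"
      using models_surj[OF Mq_models[OF g, of "N - 1"] UNIV_I[of "part (g div 2) v"]] by blast
    have "\<phi> (x, y) = v" unfolding \<phi>_def prod.case
      by (rule glue_part) (use v d in \<open>auto simp: W_part x y\<close>)
    then show "\<exists>z\<in>carrier ?S. v = \<phi> z" using x(1) y(1) by (intro bexI[of _ "(x, y)"]) (auto simp: direct_sum_module_def)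
  qed (auto simp: \<phi>_def W_glue d)
  moreover have "\<phi> (u \<odot>\<^bsub>?S\<^esub> z) = cact repL u (\<phi> z)" if "u \<in> carrier (Uq g)" "z \<in> carrier ?S" for u z
  proof -
    obtain f where f: "u = Uq_cls g f" using \<open>u \<in> carrier (Uq g)\<close> unfolding Uq_carrier by blast
    obtain x y where z: "z = (x, y)" "x \<in> carrier (Mq g N)" "y \<in> carrier (Mq g (N - 1))"
      using \<open>z \<in> carrier ?S\<close> by (auto simp: direct_sum_module_def)
    have s: "u \<odot>\<^bsub>?S\<^esub> z = (u \<odot>\<^bsub>Mq g N\<^esub> x, u \<odot>\<^bsub>Mq g (N - 1)\<^esub> y)" by (simp add: z direct_sum_module_def)
    show ?thesis unfolding s unfolding z(1) \<phi>_def prod.case D(7)[OF that(1) z(2)] E(7)[OF that(1) z(3)]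
      unfolding f cact_repL repL_glue cact_rep1[OF g]
      by (rule arg_cong[where f=glue]) (auto simp: top_def N_def is_repD[OF is_rep_rep1])
  qed
  moreover have "\<phi> (z \<oplus>\<^bsub>?S\<^esub> z') = \<phi> z + \<phi> z'" if zz: "z \<in> carrier ?S" "z' \<in> carrier ?S" for z z'
  proof -
    obtain x y x' y' where z: "z = (x, y)" "z' = (x', y')" "x \<in> carrier (Mq g N)" "x' \<in> carrier (Mq g N)"
        "y \<in> carrier (Mq g (N - 1))" "y' \<in> carrier (Mq g (N - 1))"
      using zz by (auto simp: direct_sum_module_def)
    have s: "z \<oplus>\<^bsub>?S\<^esub> z' = (x \<oplus>\<^bsub>Mq g N\<^esub> x', y \<oplus>\<^bsub>Mq g (N - 1)\<^esub> y')" by (simp add: z direct_sum_module_def)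
    show ?thesis unfolding s unfolding z(1,2) \<phi>_def prod.case D(6)[OF z(3,4)] E(6)[OF z(5,6)] glue_add
      by (rule arg_cong[where f=glue]) auto
  qed
  ultimately show ?thesis unfolding models_def using left_module_direct_sum[OF D(1) E(1)] by blast
qed

end

section \<open>The theorem\<close>

theorem mainTheorem3:
  fixes g :: nat and n :: int
  assumes "g \<ge> 1" and "int g dvd n"
  shows "deformation_along_h' scale_sum g (Mhh g n) (Mq 1 n) \<and>
    weight_module (Ueps g) (Ueps_scal g fps_X) (Ueps_cls g (gen2 (Sl2 Hg))) (Meps g n) \<and>
    (\<exists>L. langlands_dual g n L) \<and>
    (even g \<longrightarrow> (\<forall>L. langlands_dual g n L \<longrightarrow>
       module_iso (Uq g) L (direct_sum_module (Mq g (n div int g)) (Mq g (n div int g - 1))))) \<and>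
    (odd g \<longrightarrow> (\<forall>L. langlands_dual g n L \<longrightarrow> module_iso (Uq g) L (Mq g (n div int g))))"
proof -
  interpret langlands g n by unfold_locales (use assms in auto)
  show ?thesis
    using Mhh_deformation[OF assms(1)] Meps_weight_module dualL_langlands
      models_iso[OF langlands_models even_models] models_iso[OF langlands_models odd_models] by blast
qed


end
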